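(* Consider a conservative Feller semi-group $(P_t)_{t\ge 0}$ on a Polish space $E$ and, for each $\nu\in\mathcal P(E)$, a jump rate $\lambda_\nu$ and a jump kernel $Q_\nu$ with representation $G_\nu$, as described in the context. Assume that there is $\lambda_*$ with $\lambda_\nu(x)\le\lambda_*$ for all $\nu\in\mathcal P(E)$, $x\in E$, and that there exist a measurable $\mathcal V:E\to[1,\infty)$, $\theta\ge0$, $\rho,t_0>0$, $\rho_*\in\mathbb R$, $\alpha\in[0,1]$, $\eta\in[0,1)$ and $M,\gamma_*\ge1$ such that: (i) for all $\mu\in\mathcal M(\mathbb R_+,\mathcal P(E))$, $x\in E$, $t\ge0$ and almost all $u\in[0,1]$, $$R^\mu_{0,t}\mathcal V(x)\le e^{-\rho t}\mathcal V(x)+\rho\int_0^te^{\rho(s-t)}\big(\eta\,\mu_s(\mathcal V)+M\big)ds,\qquad P_t\mathcal V(x)\le e^{\rho_*t}\mathcal V(x),\qquad \mathcal V(G_{\mu_t}(x,u))\le\gamma_*\mathcal V(x);$$ (ii) for all $\nu_1,\nu_2\in\mathcal P_{\mathcal V}(E)$, $$\sup_{\|f\|_\infty\le1}\|\lambda_{\nu_1}(Q_{\nu_1}f-f)-\lambda_{\nu_2}(Q_{\nu_2}f-f)\|_\infty\le\theta\|\nu_1-\nu_2\|_{\mathcal V};$$ (iii) for all $x,y\in E$ with $\mathcal V(x)+\mathcal V(y)\le8(1+M/(1-\eta))$, $\|\delta_xP_{t_0}-\delta_yP_{t_0}\|_{TV}\le2(1-\alpha)$. Suppose $\alpha>0$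 and denote $$\beta=\frac{2(1-e^{-\rho t_0})e^{\lambda_*t_0}}{\alpha}\Big(\frac M{1-\eta}+1\Big),$$ $$C_*=\theta\,\frac{2(1+\beta)\gamma_*\big(\frac M{1-\eta}+1\big)}{(\rho+\theta\gamma_* )\big(\frac M{1-\eta}+1\big)}\,e^{(\rho_*+\lambda_*(\gamma_*-1))t_0}\Big(e^{(\rho+\theta\gamma_* )\left(\frac M{1-\eta}+1\right)t_0}-1\Big),$$ $$\kappa=\max\Big(\frac{1+e^{-\rho t_0}}2,\ 1-\tfrac12\alpha e^{-\lambda_*t_0}\Big),\qquad \tilde\kappa=\max\big(e^{-\rho(1-\eta)t_0},\ \kappa+C_*\big).$$ Suppose that $\tilde\kappa<1$. Then the equation $$\partial_tm_t=L'm_t+Q'_{m_t}(\lambda_{m_t}m_t)-\lambda_{m_t}m_t$$ admits an equilibrium $\mu_\infty\in\mathcal P_{\mathcal V}(E)$, i.e. a constant solution $m_t=\mu_\infty$ for all $t\ge0$, which is unique in $\mathcal P_{\mathcal V}(E)$. Moreover $\mu_\infty(\mathcal V)\le M/(1-\eta)$ and, for all $m_0\in\mathcal P_{\mathcal V}(E)$ and all $t\ge0$, the solution $t\mapsto m_t$ with initial condition $m_0$ satisfies $$\|m_t-\mu_\infty\|_{\mathcal V}\le2\,\tilde\kappa^{\,t/t_0-1}\Big(\beta+1+\frac M{1-\eta}\Big)m_0(\mathcal V).$$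
   Context: $E$ is a Polish space, $\mathcal P(E)$ the set of Borel probability measures on $E$, $\mathcal D(E)$ the set of càdlàg functions $\mathbb R_+\to E$ with the Skorokhod topology, $\|\nu_1-\nu_2\|_{TV}=\sup_{\|f\|_\infty\le1}|(\nu_1-\nu_2)(f)|$ (supremum over measurable $f$). For measurable $\mathcal V:E\to[1,\infty)$, $\mathcal P_{\mathcal V}(E)=\{\nu\in\mathcal P(E):\nu(\mathcal V)<\infty\}$ and $\|\mu-\nu\|_{\mathcal V}=|\mu-\nu|(\mathcal V)$ for $\mu,\nu\in\mathcal P_{\mathcal V}(E)$. $(P_t)_{t\ge0}$ is a conservative Feller semi-group on $E$ with generator $L$; for each $x\in E$, $(Z^x_t)_{t\ge0}$ is an associated càdlàg strong Markov process with $Z_0^x=x$ and $P_tf(x)=\mathbb E f(Z^x_t)$. $A'$ denotes the dual on measures of an operator $A$ on functions. For each $\nu\in\mathcal P(E)$, $\lambda_\nu:E\to\mathbb R_+$ is measurable and $Q_\nu$ is a Markov kernel on $E$ (also viewed as the operator $Q_\nu f(x)=\int f\,dQ_\nu(x)$). $G_\nu:E\times[0,1]\to E$ is a representation of $Q_\nu$: if $U$ is uniform on $[0,1]$ then $G_\nu(x,U)\sim Q_\nu(x)$ for all $x$. Similarly $H:(x,u)\in E\times[0,1]\mapsto(H_t(x,u))_{t\ge0}\in\mathcal D(E)$ is a representation of $x\mapsto Law((Z^x_t)_{t\ge0})$. The maps $(\nu,x)\mapsto\lambda_\nu(x)$ and $(\nu,x,u)\mapsto G_\nu(x,u)$ are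 taken measurable so that the construction below makes sense. $\mathcal M(\mathbb R_+,\mathcal P(E))$ is the set of measurable functions $\mathbb R_+\to\mathcal P(E)$. Process $X^{\mu,x}$. Assume $\lambda_\nu(x)\le\lambda_*$ for all $\nu,x$. Let $\mu\in\mathcal M(\mathbb R_+,\mathcal P(E))$, $x\in E$, and let $(S_k,U_k,V_k,W_k)_{k\in\mathbb N}$ be i.i.d. with independent components, $S_k$ exponential of parameter 1 and $U_k,V_k,W_k$ uniform on $[0,1]$. Put $T_0=0$, $X_0^{\mu,x}=x$, $T_{n+1}=T_n+S_n/\lambda_*$. For $t\in(T_n,T_{n+1})$ put $X_t^{\mu,x}=H_{t-T_n}(X_{T_n}^{\mu,x},U_n)$. With $\tilde x=H_{S_n/\lambda_*}(X^{\mu,x}_{T_n},U_n)$: if $V_n\le\lambda_{\mu_{T_{n+1}}}(\tilde x)/\lambda_*$ put $X_{T_{n+1}}^{\mu,x}=G_{\mu_{T_{n+1}}}(\tilde x,W_n)$, otherwise put $X_{T_{n+1}}^{\mu,x}=\tilde x$. Set $R^\mu_{s,t}f(x)=\mathbb E f(X^{\sigma_s\mu,x}_{t-s})$ for $0\le s\le t$ and $f$ bounded or nonnegative measurable, where $(\sigma_s\mu)_t=\mu_{s+t}$. A solution with initial distribution $m_0$ is an $m\in\mathcal M(\mathbb R_+,\mathcal P(E))$ such that $m_0R^m_{0,t}=m_t$ for all $t\ge0$. Under the listed hypotheses (i)-(iii) and the bound on $\lambda_\nu$, for each $m_0\in\mathcal P_{\mathcal V}(E)$ there is exactly one solution. 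*)

theory Defs
  imports "HOL-Probability.Probability"
begin

text \<open>\<open>space (prob_algebra borel)\<close> is the set of Borel probability measures. Its \<open>\<sigma>\<close>-algebra is
  generated by the evaluations \<open>\<nu> \<mapsto> \<nu> A\<close>; on a Polish space it is the Borel \<open>\<sigma>\<close>-algebra of the weak
  topology.\<close>

abbreviation probs :: "'e::polish_space measure set" where
  "probs \<equiv> space (prob_algebra borel)"

definition probs_V :: "('e::polish_space \<Rightarrow> real) \<Rightarrow> 'e measure set" where
  "probs_V V = {\<nu> \<in> probs. (\<integral>\<^sup>+x. ennreal (V x) \<partial>\<nu>) < \<infinity>}"

text \<open>Measurable maps from \<open>[0,\<infinity>)\<close> to probability measures; the values at negative times are
  irrelevant.\<close>

abbreviation prob_flows :: "(real \<Rightarrow> 'e::polish_space measure) set" where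
  "prob_flows \<equiv> restrict_space borel {0..} \<rightarrow>\<^sub>M prob_algebra borel"

definition tv_norm :: "'e::polish_space measure \<Rightarrow> 'e measure \<Rightarrow> ennreal" where
  "tv_norm \<nu>\<^sub>1 \<nu>\<^sub>2 =
    (SUP f\<in>{f \<in> borel_measurable borel. \<forall>x. \<bar>f x\<bar> \<le> (1::real)}.
      ennreal \<bar>(\<integral>x. f x \<partial>\<nu>\<^sub>1) - (\<integral>x. f x \<partial>\<nu>\<^sub>2)\<bar>)"

text \<open>The positive part \<open>(\<mu> - \<nu>)\<^sup>+\<close> in the Jordan decomposition of \<open>\<mu> - \<nu>\<close>, as the upper variation
  \<open>A \<mapsto> sup {\<mu> B - \<nu> B | B \<subseteq> A}\<close>. The subtraction on \<^typ>\<open>ennreal\<close> is truncated at 0, which does not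
  change the supremum because of \<open>B = {}\<close>.\<close>

definition upper_variation :: "'e measure \<Rightarrow> 'e measure \<Rightarrow> 'e measure" where
  "upper_variation \<mu> \<nu> = measure_of (space \<mu>) (sets \<mu>)
    (\<lambda>A. SUP B\<in>{B \<in> sets \<mu>. B \<subseteq> A}. emeasure \<mu> B - emeasure \<nu> B)"

lemma emeasure_upper_variation:
  assumes "finite_measure \<mu>" "finite_measure \<nu>" and sets_eq [simp]: "sets \<nu> = sets \<mu>"
    and A: "A \<in> sets \<mu>"
  shows "emeasure (upper_variation \<mu> \<nu>) A =
    (SUP B\<in>{B \<in> sets \<mu>. B \<subseteq> A}. emeasure \<mu> B - emeasure \<nu> B)"
proof -
  interpret M: finite_measure \<mu> by fact
  interpret N: finite_measure \<nu> by fact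
  obtain Y where Y [measurable]: "Y \<in> sets \<mu>"
    and pos: "\<And>X. X \<in> sets \<mu> \<Longrightarrow> X \<subseteq> Y \<Longrightarrow> emeasure \<nu> X \<le> emeasure \<mu> X"
    and neg: "\<And>X. X \<in> sets \<mu> \<Longrightarrow> X \<inter> Y = {} \<Longrightarrow> emeasure \<mu> X \<le> emeasure \<nu> X"
    using finite_unsigned_Hahn_decomposition[OF assms(1,2) sets_eq] by blast
  have YN [measurable]: "Y \<in> sets \<nu>" by simp
  define M' where "M' = density \<mu> (indicator Y)"
  define N' where "N' = density \<nu> (indicator Y)"
  have M': "emeasure M' X = emeasure \<mu> (X \<inter> Y)" if "X \<in> sets \<mu>" for X
    using that by (simp add: M'_def emeasure_density nn_integral_indicator
        indicator_inter_arith[symmetric] Int_commute)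
  have N': "emeasure N' X = emeasure \<nu> (X \<inter> Y)" if "X \<in> sets \<mu>" for X
    using that by (simp add: N'_def emeasure_density nn_integral_indicator
        indicator_inter_arith[symmetric] Int_commute)
  have fin: "finite_measure M'" "finite_measure N'"
    by (auto intro!: finite_measureI simp: M' N' M'_def N'_def
        emeasure_density nn_integral_indicator sets_eq_imp_space_eq[OF sets_eq]
        indicator_inter_arith[symmetric] cong: nn_integral_cong_simp)
  have "emeasure (diff_measure M' N') X = emeasure M' X - emeasure N' X" if "X \<in> sets \<mu>" for X
  proof (rule emeasure_diff_measure)
    show "sets M' = sets N'" by (simp add: M'_def N'_def)
    then show "X \<in> sets M'" using that by (simp add: M'_def)
    show "emeasure N' A \<le> emeasure M' A" if "A \<in> sets M'" for A
      using that by (simp add: M' N' pos M'_def[THEN arg_cong[where f=sets]])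
  qed (fact fin)+
  then have diff: "emeasure (diff_measure M' N') X = emeasure \<mu> (X \<inter> Y) - emeasure \<nu> (X \<inter> Y)"
    if "X \<in> sets \<mu>" for X
    using that by (simp add: M' N')
  have sup: "(SUP B\<in>{B \<in> sets \<mu>. B \<subseteq> X}. emeasure \<mu> B - emeasure \<nu> B) =
      emeasure (diff_measure M' N') X" if X: "X \<in> sets \<mu>" for X
  proof (intro antisym SUP_least)
    fix B assume "B \<in> {B \<in> sets \<mu>. B \<subseteq> X}"
    then have B [measurable]: "B \<in> sets \<mu>" and BX: "B \<subseteq> X" by auto
    have [measurable]: "B \<in> sets \<nu>" by simp
    have sp: "emeasure \<mu> B = emeasure \<mu> (B \<inter> Y) + emeasure \<mu> (B - Y)"
      "emeasure \<nu> B = emeasure \<nu> (B \<inter> Y) + emeasure \<nu> (B - Y)"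
      by (subst plus_emeasure; auto intro!: arg_cong2[where f=emeasure])+
    have "emeasure \<mu> B - emeasure \<nu> B \<le> emeasure \<mu> (B \<inter> Y) - emeasure \<nu> (B \<inter> Y)"
    proof -
      have "emeasure \<mu> (B - Y) \<le> emeasure \<nu> (B - Y)" by (intro neg) auto
      then have "emeasure \<mu> B - emeasure \<nu> B
          \<le> (emeasure \<mu> (B \<inter> Y) + emeasure \<nu> (B - Y)) - (emeasure \<nu> (B \<inter> Y) + emeasure \<nu> (B - Y))"
        unfolding sp by (intro ennreal_minus_mono add_mono) auto
      also have "\<dots> = emeasure \<mu> (B \<inter> Y) - emeasure \<nu> (B \<inter> Y)"
        by (simp add: add.commute[of _ "emeasure \<nu> (B - Y)"] diff_add_eq_diff_diff_swap_ennreal)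
      finally show ?thesis .
    qed
    also have "\<dots> = emeasure (diff_measure M' N') B" by (simp add: diff)
    also have "\<dots> \<le> emeasure (diff_measure M' N') X"
      using X BX by (intro emeasure_mono) (auto simp: M'_def)
    finally show "emeasure \<mu> B - emeasure \<nu> B \<le> emeasure (diff_measure M' N') X" .
  next
    show "emeasure (diff_measure M' N') X \<le> (SUP B\<in>{B \<in> sets \<mu>. B \<subseteq> X}. emeasure \<mu> B - emeasure \<nu> B)"
      unfolding diff[OF X] using X by (intro SUP_upper2[of "X \<inter> Y"]) auto
  qed
  have "upper_variation \<mu> \<nu> = diff_measure M' N'"
  proof -
    have "diff_measure M' N' = measure_of (space \<mu>) (sets \<mu>) (emeasure (diff_measure M' N'))"
      using measure_of_of_measure[of "diff_measure M' N'"] by (simp add: M'_def)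
    also have "\<dots> = upper_variation \<mu> \<nu>"
      unfolding upper_variation_def
      by (intro measure_of_eq sets.space_closed) (auto simp: sup sets.sigma_sets_eq)
    finally show ?thesis ..
  qed
  then show ?thesis using sup[OF A] by simp
qed

text \<open>\<open>\<parallel>\<mu> - \<nu>\<parallel>\<^sub>V = \<bar>\<mu> - \<nu>\<bar>(V)\<close> with \<open>\<bar>\<mu> - \<nu>\<bar> = (\<mu> - \<nu>)\<^sup>+ + (\<mu> - \<nu>)\<^sup>-\<close> and \<open>(\<mu> - \<nu>)\<^sup>- = (\<nu> - \<mu>)\<^sup>+\<close>.\<close>

definition V_norm :: "('e::polish_space \<Rightarrow> real) \<Rightarrow> 'e measure \<Rightarrow> 'e measure \<Rightarrow> ennreal" where
  "V_norm V \<mu> \<nu> =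
    (\<integral>\<^sup>+x. ennreal (V x) \<partial>upper_variation \<mu> \<nu>) + (\<integral>\<^sup>+x. ennreal (V x) \<partial>upper_variation \<nu> \<mu>)"

definition cadlag_paths :: "(real \<Rightarrow> 'e::polish_space) set" where
  "cadlag_paths = {f \<in> extensional {0..}.
    (\<forall>t\<ge>0. (f \<longlongrightarrow> f t) (at_right t)) \<and> (\<forall>t>0. \<exists>l. (f \<longlongrightarrow> l) (at_left t))}"

definition time_changes :: "(real \<Rightarrow> real) set" where
  "time_changes = {\<tau>. strict_mono_on {0..} \<tau> \<and> \<tau> ` {0..} = {0..}}"

definition skorokhod_converges ::
    "(nat \<Rightarrow> real \<Rightarrow> 'e::polish_space) \<Rightarrow> (real \<Rightarrow> 'e) \<Rightarrow> bool" where
  "skorokhod_converges F f \<longleftrightarrow>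
    (\<exists>\<tau>. (\<forall>n. \<tau> n \<in> time_changes) \<and> uniform_limit {0..} \<tau> (\<lambda>t. t) sequentially \<and>
      (\<forall>a\<ge>0. uniform_limit {0..a} (\<lambda>n t. F n (\<tau> n t)) f sequentially))"

text \<open>The Skorokhod (J1) topology is metrizable, hence determined by its convergent sequences: a set
  is open iff it is sequentially open.\<close>

definition skorokhod_topology :: "(real \<Rightarrow> 'e::polish_space) topology" where
  "skorokhod_topology = topology (\<lambda>U. U \<subseteq> cadlag_paths \<and>
    (\<forall>f\<in>U. \<forall>F. (\<forall>n. F n \<in> cadlag_paths) \<and> skorokhod_converges F f \<longrightarrow>
      (\<forall>\<^sub>F n in sequentially. F n \<in> U)))"

lemma openin_skorokhod_topology:
  "openin skorokhod_topology U \<longleftrightarrow> U \<subseteq> cadlag_paths \<and>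
    (\<forall>f\<in>U. \<forall>F. (\<forall>n. F n \<in> cadlag_paths) \<and> skorokhod_converges F f \<longrightarrow>
      (\<forall>\<^sub>F n in sequentially. F n \<in> U))"
  unfolding skorokhod_topology_def
proof (subst topology_inverse')
  show "istopology (\<lambda>U. U \<subseteq> (cadlag_paths :: (real \<Rightarrow> 'e::polish_space) set) \<and>
    (\<forall>f\<in>U. \<forall>F. (\<forall>n. F n \<in> cadlag_paths) \<and> skorokhod_converges F f \<longrightarrow>
      (\<forall>\<^sub>F n in sequentially. F n \<in> U)))"
    unfolding istopology_def
  proof (intro conjI allI impI ballI)
    fix K :: "(real \<Rightarrow> 'e) set set" and f F
    assume K: "\<forall>U\<in>K. U \<subseteq> cadlag_paths \<and> (\<forall>f\<in>U. \<forall>F. (\<forall>n. F n \<in> cadlag_paths) \<and>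
        skorokhod_converges F f \<longrightarrow> (\<forall>\<^sub>F n in sequentially. F n \<in> U))"
      and "f \<in> \<Union>K" and F: "(\<forall>n. F n \<in> cadlag_paths) \<and> skorokhod_converges F f"
    then obtain U where "U \<in> K" "f \<in> U" by blast
    with K F have "\<forall>\<^sub>F n in sequentially. F n \<in> U" by blast
    then show "\<forall>\<^sub>F n in sequentially. F n \<in> \<Union>K"
      by eventually_elim (use \<open>U \<in> K\<close> in blast)
  qed (auto simp: eventually_conj_iff)
qed auto

definition skorokhod_borel :: "(real \<Rightarrow> 'e::polish_space) measure" where
  "skorokhod_borel = sigma cadlag_paths {U. openin skorokhod_topology U}"

text \<open>A semi-group is given by its transition kernels, \<open>P\<^sub>t f(x) = \<integral> f d(P t x)\<close>; it is conservative
  since the kernels are Markovian. On a Polish space the Feller property is preservation of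
  \<open>C\<^sub>b(E)\<close>, with continuity at time 0 in the pointwise sense.\<close>

definition feller_semigroup :: "(real \<Rightarrow> 'e::polish_space \<Rightarrow> 'e measure) \<Rightarrow> bool" where
  "feller_semigroup P \<longleftrightarrow>
    (\<forall>t\<ge>0. P t \<in> borel \<rightarrow>\<^sub>M prob_algebra borel) \<and>
    (\<forall>x. P 0 x = return borel x) \<and>
    (\<forall>s\<ge>0. \<forall>t\<ge>0. \<forall>x. P (s + t) x = P s x \<bind> P t) \<and>
    (\<forall>f::'e \<Rightarrow> real. continuous_on UNIV f \<and> bounded (range f) \<longrightarrow>
      (\<forall>t\<ge>0. continuous_on UNIV (\<lambda>x. \<integral>y. f y \<partial>P t x)) \<and>
      (\<forall>x. ((\<lambda>t. \<integral>y. f y \<partial>P t x) \<longlongrightarrow> f x) (at_right 0)))"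

definition natural_filtration ::
    "'w measure \<Rightarrow> ('w \<Rightarrow> real \<Rightarrow> 'e::polish_space) \<Rightarrow> real \<Rightarrow> 'w measure" where
  "natural_filtration N Z t =
    sigma (space N) {(\<lambda>\<omega>. Z \<omega> s) -` A \<inter> space N | s A. 0 \<le> s \<and> s \<le> t \<and> A \<in> sets borel}"

text \<open>\<open>Z\<close> is a random element of the Skorokhod space over the probability space \<open>N\<close> that starts at
  \<open>x\<close>, satisfies \<open>P\<^sub>t f(x) = E f(Z\<^sub>t)\<close> and has the strong Markov property
  \<open>E(f(Z\<^bsub>T+t\<^esub>) | F\<^sub>T) = P\<^sub>t f(Z\<^sub>T)\<close>. It is enough to consider finite stopping times \<open>T\<close>: a general one is
  reduced to \<open>min T n\<close>.\<close>

definition strong_markov_process ::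
    "(real \<Rightarrow> 'e::polish_space \<Rightarrow> 'e measure) \<Rightarrow> 'e \<Rightarrow> 'w measure \<Rightarrow> ('w \<Rightarrow> real \<Rightarrow> 'e) \<Rightarrow> bool" where
  "strong_markov_process P x N Z \<longleftrightarrow>
    prob_space N \<and> Z \<in> N \<rightarrow>\<^sub>M skorokhod_borel \<and>
    (AE \<omega> in N. Z \<omega> 0 = x) \<and>
    (\<forall>t\<ge>0. distr N borel (\<lambda>\<omega>. Z \<omega> t) = P t x) \<and>
    (\<forall>T. stopping_time (natural_filtration N Z) T \<and> (\<forall>\<omega>\<in>space N. 0 \<le> T \<omega>) \<longrightarrow>
      (\<forall>t\<ge>0. \<forall>f::'e \<Rightarrow> real. f \<in> borel_measurable borel \<and> bounded (range f) \<longrightarrow>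
        (AE \<omega> in N.
          real_cond_exp N (filtration.pre_sigma (space N) (natural_filtration N Z) T)
            (\<lambda>\<omega>'. f (Z \<omega>' (T \<omega>' + t))) \<omega>
          = (\<integral>y. f y \<partial>P t (Z \<omega> (T \<omega>))))))"

text \<open>The uniform law on \<open>[0,1]\<close> and the exponential law of parameter 1, carried by \<open>[0,1]\<close> and
  \<open>(0,\<infinity>)\<close> themselves, so that the data need not be measurable outside of their domains.\<close>

definition unif01 :: "real measure" where
  "unif01 = restrict_space lborel {0..1}"

definition exp1 :: "real measure" where
  "exp1 = restrict_space (density lborel (exponential_density 1)) {0<..}"

text \<open>The canonical space of the i.i.d. sequence \<open>(S\<^sub>k, U\<^sub>k, V\<^sub>k, W\<^sub>k)\<close>: waiting time (before
  division by \<open>lmax\<close>), randomness of \<open>H\<close>, acceptance of the jump, randomness of \<open>G\<close>.\<close>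

definition noise :: "(nat \<Rightarrow> real \<times> real \<times> real \<times> real) measure" where
  "noise = (\<Pi>\<^sub>M k\<in>UNIV. exp1 \<Otimes>\<^sub>M unif01 \<Otimes>\<^sub>M unif01 \<Otimes>\<^sub>M unif01)"

lemma prob_space_unif01: "prob_space unif01"
  by (auto intro!: prob_spaceI simp: unif01_def space_restrict_space emeasure_restrict_space)

lemma prob_space_exp1: "prob_space exp1"
proof -
  interpret E: prob_space "density lborel (exponential_density 1)"
    by (rule prob_space_exponential_density) simp
  have "AE x in density lborel (exponential_density 1). x \<in> {0<..}"
    using AE_lborel_singleton[of "0::real"]
    by (subst AE_density) (auto simp: exponential_density_def elim!: eventually_mono)
  then have "emeasure (density lborel (exponential_density 1)) {0<..} = 1"
    by (intro E.emeasure_eq_1_AE) auto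
  then show ?thesis
    by (auto intro!: prob_spaceI simp: exp1_def space_restrict_space emeasure_restrict_space)
qed

primrec jump_time :: "real \<Rightarrow> (nat \<Rightarrow> real \<times> real \<times> real \<times> real) \<Rightarrow> nat \<Rightarrow> real" where
  "jump_time lmax \<omega> 0 = 0"
| "jump_time lmax \<omega> (Suc n) = jump_time lmax \<omega> n + fst (\<omega> n) / lmax"

primrec jump_state :: "real \<Rightarrow> ('e::polish_space measure \<Rightarrow> 'e \<Rightarrow> real) \<Rightarrow>
    ('e measure \<Rightarrow> 'e \<Rightarrow> real \<Rightarrow> 'e) \<Rightarrow> ('e \<Rightarrow> real \<Rightarrow> real \<Rightarrow> 'e) \<Rightarrow> (real \<Rightarrow> 'e measure) \<Rightarrow> 'e \<Rightarrow>
    (nat \<Rightarrow> real \<times> real \<times> real \<times> real) \<Rightarrow> nat \<Rightarrow> 'e" where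
  "jump_state lmax lam G H \<mu> x \<omega> 0 = x"
| "jump_state lmax lam G H \<mu> x \<omega> (Suc n) =
    (case \<omega> n of (s, u, v, w) \<Rightarrow>
      let y = H (jump_state lmax lam G H \<mu> x \<omega> n) u (s / lmax);
          \<nu> = \<mu> (jump_time lmax \<omega> (Suc n))
      in if v \<le> lam \<nu> y / lmax then G \<nu> y w else y)"

text \<open>The value \<open>x\<close> is only taken on the null event that all \<open>T\<^sub>n\<close> are at most \<open>t\<close>. At
  \<open>t = T\<^sub>n\<close> the value is the post-jump state and not \<open>H\<^sub>0\<close> of it: they agree only almost surely.\<close>

definition jump_process :: "real \<Rightarrow> ('e::polish_space measure \<Rightarrow> 'e \<Rightarrow> real) \<Rightarrow>
    ('e measure \<Rightarrow> 'e \<Rightarrow> real \<Rightarrow> 'e) \<Rightarrow> ('e \<Rightarrow> real \<Rightarrow> real \<Rightarrow> 'e) \<Rightarrow> (real \<Rightarrow> 'e measure) \<Rightarrow> 'e \<Rightarrow>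
    (nat \<Rightarrow> real \<times> real \<times> real \<times> real) \<Rightarrow> real \<Rightarrow> 'e" where
  "jump_process lmax lam G H \<mu> x \<omega> t =
    (if \<exists>n. jump_time lmax \<omega> n \<le> t \<and> t < jump_time lmax \<omega> (Suc n) then
      let n = (THE n. jump_time lmax \<omega> n \<le> t \<and> t < jump_time lmax \<omega> (Suc n));
          y = jump_state lmax lam G H \<mu> x \<omega> n
      in if t = jump_time lmax \<omega> n then y
         else case \<omega> n of (s, u, v, w) \<Rightarrow> H y u (t - jump_time lmax \<omega> n)
     else x)"

text \<open>\<open>R\<^sup>\<mu>\<^bsub>s,t\<^esub>\<close> as a transition kernel: the law of the process driven by the shifted flow,
  so that \<open>R\<^sup>\<mu>\<^bsub>s,t\<^esub> f(x) = E f(X\<^bsub>t-s\<^esub>)\<close> is the integral of \<open>f\<close> against it.\<close>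

definition jump_kernel :: "real \<Rightarrow> ('e::polish_space measure \<Rightarrow> 'e \<Rightarrow> real) \<Rightarrow>
    ('e measure \<Rightarrow> 'e \<Rightarrow> real \<Rightarrow> 'e) \<Rightarrow> ('e \<Rightarrow> real \<Rightarrow> real \<Rightarrow> 'e) \<Rightarrow> (real \<Rightarrow> 'e measure) \<Rightarrow>
    real \<Rightarrow> real \<Rightarrow> 'e \<Rightarrow> 'e measure" where
  "jump_kernel lmax lam G H \<mu> s t x =
    distr noise borel (\<lambda>\<omega>. jump_process lmax lam G H (\<lambda>r. \<mu> (s + r)) x \<omega> (t - s))"

definition mean_field_solution :: "real \<Rightarrow> ('e::polish_space measure \<Rightarrow> 'e \<Rightarrow> real) \<Rightarrow>
    ('e measure \<Rightarrow> 'e \<Rightarrow> real \<Rightarrow> 'e) \<Rightarrow> ('e \<Rightarrow> real \<Rightarrow> real \<Rightarrow> 'e) \<Rightarrow>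
    'e measure \<Rightarrow> (real \<Rightarrow> 'e measure) \<Rightarrow> bool" where
  "mean_field_solution lmax lam G H m\<^sub>0 m \<longleftrightarrow>
    m \<in> prob_flows \<and> m 0 = m\<^sub>0 \<and> (\<forall>t\<ge>0. m\<^sub>0 \<bind> jump_kernel lmax lam G H m 0 t = m t)"

definition mean_field_equilibrium :: "real \<Rightarrow> ('e::polish_space measure \<Rightarrow> 'e \<Rightarrow> real) \<Rightarrow>
    ('e measure \<Rightarrow> 'e \<Rightarrow> real \<Rightarrow> 'e) \<Rightarrow> ('e \<Rightarrow> real \<Rightarrow> real \<Rightarrow> 'e) \<Rightarrow> 'e measure \<Rightarrow> bool" where
  "mean_field_equilibrium lmax lam G H \<nu> \<longleftrightarrow> mean_field_solution lmax lam G H \<nu> (\<lambda>_. \<nu>)"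

end

theory Submission
  imports Defs
begin

text \<open>
  The process rings at rate \<open>lmax\<close>, independently of everything else: between rings it moves by \<open>P\<close>, and
  a ring turns into a jump with probability \<open>lam / lmax\<close>. The kernel \<open>R\<close> of the process is therefore
  the solution of the backward equation
  \<open>R s t f = exp (- l * (t - s)) * P (t - s) f
    + (\<integral>r\<in>{s..t}. l * exp (- l * (r - s)) * P (r - s) (J (\<mu> r) (R r t f)))\<close>, \<open>l = lmax\<close>,
  where \<open>J\<close> is the law of the state after a ring. The expectations over at most \<open>n\<close> rings (\<open>trunc\<close>) are
  its Picard iterates; they increase to \<open>R\<close>. Hence an estimate that is stable under one step
  of the recursion holds for \<open>R\<close>, and everything is done with nonnegative integrals, where no
  integrability has to be discussed. In this way one gets the Chapman--Kolmogorov relation, the growth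
  bound \<open>R V \<le> exp (growth * t) * V\<close>, and the perturbation bound \<open>expect_perturbation\<close>, which compares
  the kernels of two flows.

  Two mechanisms then work together. For a frozen flow with mass \<open>V\<close> at most \<open>M / (1 - \<eta>) + 1\<close>,
  the drift condition and the minorisation (no ring before \<open>t\<^sub>0\<close>, then the Doeblin condition for \<open>P\<close>)
  give Harris' theorem in the form of Hairer and Mattingly: \<open>R\<close> contracts the total variation with
  weight \<open>\<beta> + V\<close> by the factor \<open>\<kappa>\<close> (\<open>harris_contraction\<close>). Replacing the flow of one solution by that of
  another costs at most \<open>C\<close> times their initial distance: the cost at time \<open>t\<close> is an
  integral of earlier distances, which a Gronwall argument bounds (\<open>solution_stability\<close>). So two
  solutions of small mass approach each other by the factor \<open>\<kappa> + C < 1\<close> in each period \<open>t\<^sub>0\<close>.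

  The equilibrium is the limit of \<open>m (n * t\<^sub>0)\<close> for any solution of small mass: the contraction, applied
  to a solution and its own time shifts, makes this a Cauchy sequence and shows that the limit does not
  move. A solution of large mass first has to wait: the drift condition makes its mass decay
  like \<open>exp (- \<rho> * (1 - \<eta>) * t)\<close> (\<open>solution_decay\<close>), a decay at least as fast as the claimed rate, until
  the contraction takes over. The time lost by waiting is paid by the factor \<open>m\<^sub>0(V)\<close>.
\<close>

section \<open>Coordinates of Skorokhod paths\<close>

lemma sets_skorokhod_borel_openin: "openin skorokhod_topology U \<Longrightarrow> U \<in> sets skorokhod_borel"
  by (auto simp: skorokhod_borel_def openin_skorokhod_topology intro!: in_measure_of)

lemma space_skorokhod_borel: "space skorokhod_borel = cadlag_paths"
  by (auto simp: skorokhod_borel_def openin_skorokhod_topology intro!: space_measure_of)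

text \<open>The time changes of a convergent sequence tend to the identity, so an excursion out of a closed
  set inside an open time interval persists along the sequence.\<close>

lemma openin_skorokhod_excursion:
  fixes F :: "'e::polish_space set"
  assumes F: "closed F" and t: "0 \<le> t"
  shows "openin skorokhod_topology {f \<in> cadlag_paths. \<exists>s. t < s \<and> s < u \<and> f s \<notin> F}"
  unfolding openin_skorokhod_topology
proof (safe)
  fix f :: "real \<Rightarrow> 'e" and s and X :: "nat \<Rightarrow> real \<Rightarrow> 'e"
  assume f: "f \<in> cadlag_paths" "t < s" "s < u" "f s \<notin> F"
    and X: "\<forall>n. X n \<in> cadlag_paths" "skorokhod_converges X f"
  then obtain \<tau> where \<tau>: "uniform_limit {0..} \<tau> (\<lambda>t. t) sequentially"
    and lim: "\<And>a. a \<ge> 0 \<Longrightarrow> uniform_limit {0..a} (\<lambda>n t. X n (\<tau> n t)) f sequentially"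
    unfolding skorokhod_converges_def by blast
  have s: "0 \<le> s" using f t by simp
  have "(\<lambda>n. \<tau> n s) \<longlonglongrightarrow> s" using tendsto_uniform_limitI[OF \<tau>, of s] s by simp
  then have 1: "\<forall>\<^sub>F n in sequentially. t < \<tau> n s" "\<forall>\<^sub>F n in sequentially. \<tau> n s < u"
    using f by (auto intro: order_tendstoD)
  have "(\<lambda>n. X n (\<tau> n s)) \<longlonglongrightarrow> f s" using tendsto_uniform_limitI[OF lim[OF s], of s] s by simp
  then have "\<forall>\<^sub>F n in sequentially. X n (\<tau> n s) \<in> - F"
    using f F by (intro topological_tendstoD) (auto simp: open_Compl)
  with 1 show "\<forall>\<^sub>F n in sequentially. X n \<in> {f \<in> cadlag_paths. \<exists>s. t < s \<and> s < u \<and> f s \<notin> F}"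
    by eventually_elim (use X in auto)
qed

text \<open>Evaluation is not continuous for the Skorokhod topology. By right continuity, however, a path
  is in an open set at time \<open>t\<close> iff it stays in one of countably many closed subsets during a whole interval to
  the right of \<open>t\<close>, and staying in a closed set is a closed condition.\<close>

lemma measurable_eval_skorokhod:
  assumes t: "0 \<le> t"
  shows "(\<lambda>f. f t) \<in> skorokhod_borel \<rightarrow>\<^sub>M (borel :: 'e::polish_space measure)"
proof (rule borel_measurableI)
  fix S :: "'e set" assume S: "open S"
  (* an exhaustion of S by closed sets, each in the interior of a later one *)
  define F where "F k = {y. \<forall>z\<in>-S. 1 / real (Suc k) \<le> dist y z}" for k
  define C where "C k j = {f \<in> cadlag_paths. \<forall>s. t < s \<and> s < t + 1 / real (Suc j) \<longrightarrow> f s \<in> F k}"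
    for k j
  have F: "closed (F k)" for k
  proof -
    have "F k = (\<Inter>z\<in>-S. {y. 1 / real (Suc k) \<le> dist y z})" by (auto simp: F_def)
    also have "closed \<dots>" by (intro closed_INT ballI closed_Collect_le continuous_intros)
    finally show ?thesis .
  qed
  have "C k j \<in> sets skorokhod_borel" for k j
  proof -
    have "C k j = space skorokhod_borel -
        {f \<in> cadlag_paths. \<exists>s. t < s \<and> s < t + 1 / real (Suc j) \<and> f s \<notin> F k}"
      by (auto simp: C_def space_skorokhod_borel)
    also have "\<dots> \<in> sets skorokhod_borel"
      using openin_skorokhod_excursion[OF F t] by (intro sets.compl_sets sets_skorokhod_borel_openin)
    finally show ?thesis .
  qed
  then have "(\<Union>k j. C k j) \<in> sets skorokhod_borel" by auto
  also have "(\<Union>k j. C k j) = (\<lambda>f. f t) -` S \<inter> space skorokhod_borel"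
  proof (intro set_eqI iffI)
    fix f assume "f \<in> (\<Union>k j. C k j)"
    then obtain k j where "f \<in> C k j" by blast
    then have fc: "f \<in> cadlag_paths" and fF: "\<And>s. t < s \<Longrightarrow> s < t + 1 / real (Suc j) \<Longrightarrow> f s \<in> F k"
      by (auto simp: C_def)
    have lim: "(f \<longlongrightarrow> f t) (at_right t)" using fc t by (auto simp: cadlag_paths_def)
    have "eventually (\<lambda>s. f s \<in> F k) (at_right t)"
      unfolding eventually_at_right_field
      by (rule exI[of _ "t + 1 / real (Suc j)"]) (use fF in auto)
    then have "f t \<in> F k"
      using Lim_in_closed_set[OF F _ _ lim] by simp
    then have "f t \<in> S" by (force simp: F_def)
    then show "f \<in> (\<lambda>f. f t) -` S \<inter> space skorokhod_borel"
      using fc by (simp add: space_skorokhod_borel)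
  next
    fix f assume "f \<in> (\<lambda>f. f t) -` S \<inter> space skorokhod_borel"
    then have ft: "f t \<in> S" and fc: "f \<in> cadlag_paths" by (auto simp: space_skorokhod_borel)
    obtain e where e: "e > 0" "\<And>z. dist z (f t) < e \<Longrightarrow> z \<in> S"
      using S ft unfolding open_dist by blast
    obtain k where k: "1 / real (Suc k) < e / 2" using nat_approx_posE[of "e/2"] e by auto
    have lim: "(f \<longlongrightarrow> f t) (at_right t)" using fc t by (auto simp: cadlag_paths_def)
    then have "eventually (\<lambda>s. dist (f s) (f t) < e / 2) (at_right t)"
      using e by (intro tendstoD) auto
    then obtain b where b: "b > t" "\<And>s. t < s \<Longrightarrow> s < b \<Longrightarrow> dist (f s) (f t) < e / 2"
      unfolding eventually_at_right_field by blast
    obtain j where j: "1 / real (Suc j) < b - t" using nat_approx_posE[of "b - t"] b by auto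
    have "f s \<in> F k" if s: "t < s" "s < t + 1 / real (Suc j)" for s
      unfolding F_def
    proof safe
      fix z assume "z \<notin> S"
      then have "e \<le> dist z (f t)" using e by force
      also have "\<dots> \<le> dist (f s) z + dist (f s) (f t)" by (metis dist_commute dist_triangle2)
      finally show "1 / real (Suc k) \<le> dist (f s) z" using b(2)[of s] s j k by simp
    qed
    then show "f \<in> (\<Union>k j. C k j)" using fc by (auto simp: C_def)
  qed
  finally show "(\<lambda>f. f t) -` S \<inter> space skorokhod_borel \<in> sets skorokhod_borel" .
qed

text \<open>Right continuity again: a time is approximated from the right by a function with countably many
  values, for which measurability in the path is enough.\<close>

lemma measurable_eval_skorokhod_joint:
  "(\<lambda>(f, r). f (max 0 r)) \<in> skorokhod_borel \<Otimes>\<^sub>M (borel :: real measure) \<rightarrow>\<^sub>M (borel :: 'e::polish_space measure)"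
proof -
  define i where "i n r = nat \<lfloor>real (Suc n) * max 0 r\<rfloor>" for n :: nat and r :: real
  (* strictly larger than max 0 r, so that right continuity applies *)
  define q where "q n r = real (Suc (i n r)) / real (Suc n)" for n and r :: real
  have q: "max 0 r < q n r" "q n r \<le> max 0 r + 1 / real (Suc n)" for n r
  proof -
    have "real (i n r) = of_int \<lfloor>real (Suc n) * max 0 r\<rfloor>" by (simp add: i_def)
    then have "real (i n r) \<le> real (Suc n) * max 0 r" "real (Suc n) * max 0 r < real (i n r) + 1"
      by linarith+
    moreover have "max 0 r + 1 / real (Suc n) = (real (Suc n) * max 0 r + 1) / real (Suc n)"
      by (simp add: add_divide_distrib del: of_nat_Suc)
    ultimately show "max 0 r < q n r" "q n r \<le> max 0 r + 1 / real (Suc n)"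
      unfolding q_def
      by (simp add: pos_less_divide_eq mult.commute add.commute del: max_less_iff_conj,
          simp add: divide_right_mono)
  qed
  have ql: "(\<lambda>n. q n r) \<longlonglongrightarrow> max 0 r" for r
  proof (rule real_tendsto_sandwich)
    show "\<forall>\<^sub>F n in sequentially. max 0 r \<le> q n r" "\<forall>\<^sub>F n in sequentially. q n r \<le> max 0 r + 1 / real (Suc n)"
      by (intro always_eventually allI less_imp_le q) (intro always_eventually allI q)
    show "(\<lambda>n. max 0 r + 1 / real (Suc n)) \<longlonglongrightarrow> max 0 r"
      using tendsto_add[OF tendsto_const LIMSEQ_Suc[OF lim_1_over_n], of "max 0 r"] by simp
  qed simp
  have [measurable]: "i n \<in> borel \<rightarrow>\<^sub>M count_space UNIV" for n
    unfolding i_def by measurable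
  show ?thesis
  proof (rule borel_measurable_LIMSEQ_metric)
    fix n
    have e: "(\<lambda>x. fst x (real (Suc k) / real (Suc n))) \<in> skorokhod_borel \<Otimes>\<^sub>M borel \<rightarrow>\<^sub>M (borel :: 'e measure)" for k
      by (rule measurable_compose[OF measurable_fst measurable_eval_skorokhod]) simp
    have "(\<lambda>x. (\<lambda>k x. fst x (real (Suc k) / real (Suc n))) (i n (snd x)) x)
        \<in> skorokhod_borel \<Otimes>\<^sub>M borel \<rightarrow>\<^sub>M (borel :: 'e measure)"
      by (rule measurable_compose_countable[OF e]) simp
    then show "(\<lambda>(f, r). f (q n r)) \<in> skorokhod_borel \<Otimes>\<^sub>M borel \<rightarrow>\<^sub>M (borel :: 'e measure)"
      by (simp add: q_def split_beta')
  next
    fix x :: "(real \<Rightarrow> 'e) \<times> real" assume x: "x \<in> space (skorokhod_borel \<Otimes>\<^sub>M borel)"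
    obtain f r where [simp]: "x = (f, r)" by (cases x)
    have "f \<in> cadlag_paths" using x by (simp add: space_pair_measure space_skorokhod_borel)
    then have "(f \<longlongrightarrow> f (max 0 r)) (at_right (max 0 r))" by (auto simp: cadlag_paths_def)
    moreover have "filterlim (\<lambda>n. q n r) (at_right (max 0 r)) sequentially"
      unfolding filterlim_at
    proof (intro conjI ql always_eventually allI)
      fix n show "q n r \<in> {max 0 r<..}" "q n r \<noteq> max 0 r" using q(1)[of r n] by auto
    qed
    ultimately show "(\<lambda>n. case x of (f, r) \<Rightarrow> f (q n r)) \<longlonglongrightarrow> (case x of (f, r) \<Rightarrow> f (max 0 r))"
      by (auto intro: filterlim_compose)
  qed
qed

section \<open>Transition kernels of the clocked dynamics\<close>

text \<open>The state after a ring, given the state \<open>y\<close> just before it and the pair of marks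
  \<open>(v, w)\<close> that decides about the jump and its destination.\<close>

definition clock_step :: "real \<Rightarrow> ('e::polish_space measure \<Rightarrow> 'e \<Rightarrow> real) \<Rightarrow>
    ('e measure \<Rightarrow> 'e \<Rightarrow> real \<Rightarrow> 'e) \<Rightarrow> 'e measure \<Rightarrow> 'e \<Rightarrow> real \<times> real \<Rightarrow> 'e" where
  "clock_step lmax lam G \<nu> y = (\<lambda>(v, w). if v \<le> lam \<nu> y / lmax then G \<nu> y w else y)"

lemma space_unif01 [simp]: "space unif01 = {0..1}"
  by (simp add: unif01_def space_restrict_space)

lemma sets_unif01 [measurable_cong]: "sets unif01 = sets (restrict_space borel {0..1})"
  by (auto simp: unif01_def intro!: sets_restrict_space_cong)

lemma measurable_id_unif01 [measurable]: "(\<lambda>x. x) \<in> unif01 \<rightarrow>\<^sub>M borel"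
  by (simp add: unif01_def measurable_restrict_space1)

lemma unif01_in_prob_algebra [simp]: "unif01 \<in> space (prob_algebra unif01)"
  by (simp add: space_prob_algebra prob_space_unif01)

lemma space_prob_algebra_borelD:
  assumes "\<nu> \<in> probs" shows "sets \<nu> = sets borel" "space \<nu> = UNIV" "prob_space \<nu>"
  using assms by (auto simp: space_prob_algebra dest: sets_eq_imp_space_eq)

lemma nn_integral_measurable_prob_algebra2:
  assumes "(\<lambda>(x, y). f x y) \<in> borel_measurable (M \<Otimes>\<^sub>M N)" "L \<in> M \<rightarrow>\<^sub>M prob_algebra N"
  shows "(\<lambda>x. \<integral>\<^sup>+y. f x y \<partial>L x) \<in> borel_measurable M"
  using assms by (intro nn_integral_measurable_subprob_algebra2 measurable_prob_algebraD)

lemma nn_integral_bind_prob: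
  assumes f: "f \<in> borel_measurable B" and M: "M \<in> space (prob_algebra A)" and N: "N \<in> A \<rightarrow>\<^sub>M prob_algebra B"
  shows "(\<integral>\<^sup>+x. f x \<partial>(M \<bind> N)) = (\<integral>\<^sup>+x. \<integral>\<^sup>+y. f y \<partial>N x \<partial>M)"
proof (rule nn_integral_bind[OF f])
  have "sets M = sets A" using M by (simp add: space_prob_algebra)
  then show "N \<in> M \<rightarrow>\<^sub>M subprob_algebra B"
    using measurable_prob_algebraD[OF N] by (simp cong: measurable_cong_sets)
qed

locale clocked_jumps =
  fixes P :: "real \<Rightarrow> 'e::polish_space \<Rightarrow> 'e measure"
    and lam :: "'e measure \<Rightarrow> 'e \<Rightarrow> real"
    and Q :: "'e measure \<Rightarrow> 'e \<Rightarrow> 'e measure"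
    and G :: "'e measure \<Rightarrow> 'e \<Rightarrow> real \<Rightarrow> 'e"
    and H :: "'e \<Rightarrow> real \<Rightarrow> real \<Rightarrow> 'e"
    and lmax :: real
  assumes P_kernel: "\<And>t. 0 \<le> t \<Longrightarrow> P t \<in> borel \<rightarrow>\<^sub>M prob_algebra borel"
    and P_zero: "\<And>x. P 0 x = return borel x"
    and P_add: "\<And>s t x. 0 \<le> s \<Longrightarrow> 0 \<le> t \<Longrightarrow> P (s + t) x = P s x \<bind> P t"
    and H_measurable: "(\<lambda>(x, u). H x u) \<in> borel \<Otimes>\<^sub>M unif01 \<rightarrow>\<^sub>M skorokhod_borel"
    and H_law: "\<And>x t. 0 \<le> t \<Longrightarrow> distr unif01 borel (\<lambda>u. H x u t) = P t x"
    and lam_measurable: "(\<lambda>(\<nu>, x). lam \<nu> x) \<in> borel_measurable (prob_algebra borel \<Otimes>\<^sub>M borel)"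
    and lam_nonneg: "\<And>\<nu> x. \<nu> \<in> probs \<Longrightarrow> 0 \<le> lam \<nu> x"
    and lam_le: "\<And>\<nu> x. \<nu> \<in> probs \<Longrightarrow> lam \<nu> x \<le> lmax"
    and lmax_pos: "0 < lmax"
    and G_measurable: "(\<lambda>(\<nu>, x, u). G \<nu> x u) \<in> prob_algebra borel \<Otimes>\<^sub>M borel \<Otimes>\<^sub>M unif01 \<rightarrow>\<^sub>M borel"
    and G_law: "\<And>\<nu> x. \<nu> \<in> probs \<Longrightarrow> distr unif01 borel (G \<nu> x) = Q \<nu> x"
begin

text \<open>Negative times are sent to 0 to have a kernel that is measurable on the whole real line; the
  same device is used for flows below.\<close>

definition motion :: "real \<Rightarrow> 'e \<Rightarrow> 'e measure" where
  "motion r = P (max 0 r)"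

lemma motion_nonneg: "0 \<le> r \<Longrightarrow> motion r = P r"
  by (simp add: motion_def)

lemma H_joint: "(\<lambda>(x, u, r). H x u (max 0 r)) \<in> borel \<Otimes>\<^sub>M unif01 \<Otimes>\<^sub>M borel \<rightarrow>\<^sub>M borel"
proof -
  have 1: "(\<lambda>p. (case (fst p, fst (snd p)) of (x, u) \<Rightarrow> H x u, snd (snd p)))
      \<in> borel \<Otimes>\<^sub>M unif01 \<Otimes>\<^sub>M borel \<rightarrow>\<^sub>M skorokhod_borel \<Otimes>\<^sub>M borel"
    by (intro measurable_Pair measurable_compose[OF _ H_measurable]) auto
  show ?thesis
    using measurable_compose[OF 1 measurable_eval_skorokhod_joint]
    by (simp add: split_beta')
qed

text \<open>Joint measurability in time and space is inherited from the right-continuous paths \<open>H x u\<close>.\<close>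

lemma motion_measurable [measurable]: "(\<lambda>(r, x). motion r x) \<in> borel \<Otimes>\<^sub>M borel \<rightarrow>\<^sub>M prob_algebra borel"
proof -
  have "(\<lambda>(p, u). (case (snd p, u, fst p) of (x, u, r) \<Rightarrow> H x u (max 0 r)))
      \<in> (borel \<Otimes>\<^sub>M borel) \<Otimes>\<^sub>M unif01 \<rightarrow>\<^sub>M borel"
    unfolding split_beta' using H_joint[unfolded split_beta']
    by (rule measurable_compose[rotated]) auto
  then have "(\<lambda>p. distr unif01 borel (\<lambda>u. H (snd p) u (max 0 (fst p))))
      \<in> borel \<Otimes>\<^sub>M borel \<rightarrow>\<^sub>M prob_algebra borel"
    by (intro measurable_distr_prob_space2[where M=unif01] measurable_const) (auto simp: split_beta')
  then show ?thesis
    by (simp add: split_beta' H_law motion_def)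
qed

lemma motion_in_probs [simp]: "motion r x \<in> probs"
  using measurable_space[OF motion_measurable, of "(r, x)"] by (simp add: space_pair_measure)

lemma motion_add: "0 \<le> r \<Longrightarrow> 0 \<le> s \<Longrightarrow> motion (r + s) x = motion r x \<bind> motion s"
  by (simp add: motion_def P_add)

lemma motion_kernel [measurable]: "motion r \<in> borel \<rightarrow>\<^sub>M prob_algebra borel"
  by (simp add: motion_def P_kernel)

lemma nn_integral_H:
  assumes "f \<in> borel_measurable borel" "0 \<le> r"
  shows "(\<integral>\<^sup>+u. f (H x u r) \<partial>unif01) = (\<integral>\<^sup>+y. f y \<partial>motion r x)"
proof -
  have "(\<lambda>u. (case (x, u, r) of (x, u, r) \<Rightarrow> H x u (max 0 r))) \<in> unif01 \<rightarrow>\<^sub>M borel"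
    by (rule measurable_compose[OF _ H_joint]) auto
  then have [measurable]: "(\<lambda>u. H x u r) \<in> unif01 \<rightarrow>\<^sub>M borel" using assms by simp
  show ?thesis
    using assms by (simp add: motion_nonneg H_law[symmetric] nn_integral_distr)
qed

definition clock_law :: "'e measure \<Rightarrow> 'e \<Rightarrow> 'e measure" where
  "clock_law \<nu> y = distr (unif01 \<Otimes>\<^sub>M unif01) borel (clock_step lmax lam G \<nu> y)"

lemma clock_step_measurable:
  "(\<lambda>(p, q). clock_step lmax lam G (fst p) (snd p) q)
    \<in> (prob_algebra borel \<Otimes>\<^sub>M borel) \<Otimes>\<^sub>M unif01 \<Otimes>\<^sub>M unif01 \<rightarrow>\<^sub>M borel"
proof -
  have 1: "(\<lambda>x. (\<lambda>(\<nu>, x). lam \<nu> x) (fst x)) \<in> borel_measurable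
      ((prob_algebra borel \<Otimes>\<^sub>M borel) \<Otimes>\<^sub>M unif01 \<Otimes>\<^sub>M unif01)"
    by (rule measurable_compose[OF measurable_fst lam_measurable])
  have 2: "(\<lambda>x. (\<lambda>(\<nu>, x, u). G \<nu> x u) (fst (fst x), snd (fst x), snd (snd x)))
      \<in> (prob_algebra borel \<Otimes>\<^sub>M borel) \<Otimes>\<^sub>M unif01 \<Otimes>\<^sub>M unif01 \<rightarrow>\<^sub>M borel"
    by (rule measurable_compose[OF _ G_measurable]) measurable
  have 3: "(\<lambda>x. fst (snd x)) \<in> borel_measurable ((prob_algebra borel \<Otimes>\<^sub>M borel) \<Otimes>\<^sub>M unif01 \<Otimes>\<^sub>M unif01)"
    by (rule measurable_compose[OF measurable_snd, OF measurable_compose[OF measurable_fst measurable_id_unif01]])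
  note [measurable] = 1[unfolded split_beta'] 2[unfolded split_beta' fst_conv snd_conv] 3
  show ?thesis
    unfolding clock_step_def split_beta' by measurable
qed

lemma clock_law_measurable [measurable]:
  "(\<lambda>(\<nu>, y). clock_law \<nu> y) \<in> prob_algebra borel \<Otimes>\<^sub>M borel \<rightarrow>\<^sub>M prob_algebra borel"
proof -
  have "unif01 \<Otimes>\<^sub>M unif01 \<in> space (prob_algebra (unif01 \<Otimes>\<^sub>M unif01))"
    by (simp add: space_prob_algebra prob_space_pair prob_space_unif01)
  then have "(\<lambda>p. distr (unif01 \<Otimes>\<^sub>M unif01) borel (clock_step lmax lam G (fst p) (snd p)))
      \<in> prob_algebra borel \<Otimes>\<^sub>M borel \<rightarrow>\<^sub>M prob_algebra borel"
    by (intro measurable_distr_prob_space2[OF _ clock_step_measurable] measurable_const)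
  then show ?thesis by (simp add: split_beta' clock_law_def)
qed

lemma clock_law_kernel:
  assumes "\<nu> \<in> probs" shows "clock_law \<nu> \<in> borel \<rightarrow>\<^sub>M prob_algebra borel"
proof -
  have "(\<lambda>y. (\<lambda>(\<nu>, y). clock_law \<nu> y) (\<nu>, y)) \<in> borel \<rightarrow>\<^sub>M prob_algebra borel"
    by (rule measurable_compose[OF _ clock_law_measurable]) (use assms in simp)
  then show ?thesis by simp
qed

lemma nn_integral_clock_law:
  assumes f [measurable]: "f \<in> borel_measurable borel" and \<nu>: "\<nu> \<in> probs"
  shows "(\<integral>\<^sup>+z. f z \<partial>clock_law \<nu> y) =
    ennreal (lam \<nu> y / lmax) * (\<integral>\<^sup>+z. f z \<partial>Q \<nu> y) + ennreal (1 - lam \<nu> y / lmax) * f y"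
proof -
  interpret U: prob_space unif01 by (rule prob_space_unif01)
  define p where "p = lam \<nu> y / lmax"
  have p: "0 \<le> p" "p \<le> 1" using lam_nonneg[OF \<nu>] lam_le[OF \<nu>] lmax_pos by (auto simp: p_def)
  have step [measurable]: "clock_step lmax lam G \<nu> y \<in> unif01 \<Otimes>\<^sub>M unif01 \<rightarrow>\<^sub>M borel"
  proof -
    have "(\<lambda>q. (\<lambda>(p, q). clock_step lmax lam G (fst p) (snd p) q) ((\<nu>, y), q)) \<in> unif01 \<Otimes>\<^sub>M unif01 \<rightarrow>\<^sub>M borel"
      by (rule measurable_compose[OF _ clock_step_measurable]) (use \<nu> in simp)
    then show ?thesis by simp
  qed
  have G [measurable]: "G \<nu> y \<in> unif01 \<rightarrow>\<^sub>M borel"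
  proof -
    have "(\<lambda>q. (\<lambda>(\<nu>, x, u). G \<nu> x u) (\<nu>, y, q)) \<in> unif01 \<rightarrow>\<^sub>M borel"
      by (rule measurable_compose[OF _ G_measurable]) (use \<nu> in simp)
    then show ?thesis by simp
  qed
  have e: "emeasure unif01 {0..p} = p" "emeasure unif01 {p<..1} = 1 - p"
    unfolding unif01_def using p by (subst emeasure_restrict_space; force)+
  have s: "{0..p} \<in> sets unif01" "{p<..1} \<in> sets unif01"
    using p by (auto simp: sets_unif01 sets_restrict_space_iff)
  have "(\<integral>\<^sup>+z. f z \<partial>clock_law \<nu> y) = (\<integral>\<^sup>+q. f (clock_step lmax lam G \<nu> y q) \<partial>(unif01 \<Otimes>\<^sub>M unif01))"
    by (simp add: clock_law_def nn_integral_distr)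
  also have "\<dots> = (\<integral>\<^sup>+v. \<integral>\<^sup>+w. f (clock_step lmax lam G \<nu> y (v, w)) \<partial>unif01 \<partial>unif01)"
    by (subst U.nn_integral_fst[symmetric]) auto
  also have "\<dots> = (\<integral>\<^sup>+v. (\<integral>\<^sup>+z. f z \<partial>Q \<nu> y) * indicator {0..p} v + f y * indicator {p<..1} v \<partial>unif01)"
    by (intro nn_integral_cong)
      (auto simp: clock_step_def p_def[symmetric] G_law[OF \<nu>, symmetric] nn_integral_distr U.emeasure_space_1[simplified]
        split: split_indicator)
  also have "\<dots> = (\<integral>\<^sup>+z. f z \<partial>Q \<nu> y) * p + f y * ennreal (1 - p)"
    using s by (subst nn_integral_add) (auto simp: nn_integral_cmult_indicator e)
  finally show ?thesis by (simp add: p_def mult.commute)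
qed

text \<open>The state after a ring at time \<open>r\<close> when there was none since time \<open>s\<close>.\<close>

definition ring_law :: "(real \<Rightarrow> 'e measure) \<Rightarrow> real \<Rightarrow> real \<Rightarrow> 'e \<Rightarrow> 'e measure" where
  "ring_law \<mu> s r x = motion (r - s) x \<bind> clock_law (\<mu> (max 0 r))"

lemma flow_measurable:
  assumes "\<mu> \<in> prob_flows" shows "(\<lambda>r. \<mu> (max 0 r)) \<in> borel \<rightarrow>\<^sub>M prob_algebra borel"
proof (rule measurable_compose[OF _ assms])
  show "max 0 \<in> borel \<rightarrow>\<^sub>M restrict_space (borel :: real measure) {0..}"
    by (rule measurable_restrict_space2) auto
qed

lemma flow_in_probs: "\<mu> \<in> prob_flows \<Longrightarrow> 0 \<le> r \<Longrightarrow> \<mu> r \<in> probs"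
  by (drule measurable_space[of _ _ _ r]) (auto simp: space_restrict_space)

lemma ring_law_measurable:
  assumes \<mu>: "\<mu> \<in> prob_flows"
  shows "(\<lambda>(s, r, x). ring_law \<mu> s r x) \<in> borel \<Otimes>\<^sub>M borel \<Otimes>\<^sub>M borel \<rightarrow>\<^sub>M prob_algebra borel"
proof -
  note [measurable] = flow_measurable[OF \<mu>]
  have 1: "(\<lambda>p. (\<lambda>(r, x). motion r x) (fst (snd p) - fst p, snd (snd p)))
      \<in> borel \<Otimes>\<^sub>M borel \<Otimes>\<^sub>M borel \<rightarrow>\<^sub>M prob_algebra borel"
    by (rule measurable_compose[OF _ motion_measurable]) measurable
  have 2: "(\<lambda>p. (\<lambda>(\<nu>, y). clock_law \<nu> y) (\<mu> (max 0 (fst (snd (fst p)))), snd p))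
      \<in> (borel \<Otimes>\<^sub>M borel \<Otimes>\<^sub>M borel) \<Otimes>\<^sub>M borel \<rightarrow>\<^sub>M prob_algebra borel"
    by (rule measurable_compose[OF _ clock_law_measurable]) measurable
  have "(\<lambda>p. motion (fst (snd p) - fst p) (snd (snd p)) \<bind> clock_law (\<mu> (max 0 (fst (snd p)))))
      \<in> borel \<Otimes>\<^sub>M borel \<Otimes>\<^sub>M borel \<rightarrow>\<^sub>M prob_algebra borel"
    using 1 2 by (intro measurable_bind_prob_space2[where N=borel]) (auto simp: split_beta')
  then show ?thesis by (simp add: split_beta' ring_law_def)
qed

lemma ring_law_in_probs [simp]:
  assumes "\<mu> \<in> prob_flows" shows "ring_law \<mu> s r x \<in> probs"
  using measurable_space[OF ring_law_measurable[OF assms], of "(s, r, x)"] by (simp add: space_pair_measure)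

lemma nn_integral_ring_law:
  assumes f [measurable]: "f \<in> borel_measurable borel" and \<mu>: "\<mu> \<in> prob_flows"
  shows "(\<integral>\<^sup>+z. f z \<partial>ring_law \<mu> s r x) = (\<integral>\<^sup>+y. \<integral>\<^sup>+z. f z \<partial>clock_law (\<mu> (max 0 r)) y \<partial>motion (r - s) x)"
  unfolding ring_law_def
  by (intro nn_integral_bind_prob[OF f motion_in_probs] clock_law_kernel flow_in_probs[OF \<mu>]) simp

lemma nn_integral_clock_law_measurable [measurable]:
  assumes f [measurable]: "f \<in> borel_measurable borel" and \<nu>: "\<nu> \<in> probs"
  shows "(\<lambda>y. \<integral>\<^sup>+z. f z \<partial>clock_law \<nu> y) \<in> borel_measurable borel"
  by (intro nn_integral_measurable_prob_algebra2[OF _ clock_law_kernel[OF \<nu>]]) measurable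

lemma nn_integral_motion_measurable [measurable]:
  assumes f [measurable]: "f \<in> borel_measurable borel"
  shows "(\<lambda>y. \<integral>\<^sup>+z. f z \<partial>motion r y) \<in> borel_measurable borel"
  by (intro nn_integral_measurable_prob_algebra2[OF _ motion_kernel]) measurable

text \<open>A time \<open>r\<close> without ring can be inserted freely: this is the semigroup property of \<open>P\<close>, and the
  memoryless part of the Chapman--Kolmogorov relation.\<close>

lemma ring_law_add:
  assumes \<mu>: "\<mu> \<in> prob_flows" and le: "s \<le> r" "r \<le> q" and f [measurable]: "f \<in> borel_measurable borel"
  shows "(\<integral>\<^sup>+z. \<integral>\<^sup>+y. f y \<partial>ring_law \<mu> r q z \<partial>motion (r - s) x) = (\<integral>\<^sup>+y. f y \<partial>ring_law \<mu> s q x)"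
proof -
  have [measurable]: "\<mu> (max 0 q) \<in> probs" by (rule flow_in_probs[OF \<mu>]) simp
  have "motion (q - s) x = motion (r - s) x \<bind> motion (q - r)"
    using motion_add[of "r - s" "q - r" x] le by simp
  then show ?thesis
    unfolding nn_integral_ring_law[OF f \<mu>]
    by (simp add: nn_integral_bind_prob[OF _ motion_in_probs motion_kernel])
qed

text \<open>The expectation of \<open>f\<close> at time \<open>t\<close> over the event of at most \<open>n\<close> rings after time \<open>s\<close>, by conditioning
  on the first ring. The flow is not shifted, only the initial time moves: this is what makes the joint
  measurability in \<open>s\<close>, \<open>t\<close> and \<open>x\<close> an easy induction.\<close>

primrec trunc :: "nat \<Rightarrow> (real \<Rightarrow> 'e measure) \<Rightarrow> ('e \<Rightarrow> ennreal) \<Rightarrow> real \<Rightarrow> real \<Rightarrow> 'e \<Rightarrow> ennreal" where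
  "trunc 0 \<mu> f s t x = ennreal (exp (- lmax * (t - s))) * (\<integral>\<^sup>+y. f y \<partial>motion (t - s) x)"
| "trunc (Suc n) \<mu> f s t x = ennreal (exp (- lmax * (t - s))) * (\<integral>\<^sup>+y. f y \<partial>motion (t - s) x)
    + (\<integral>\<^sup>+r. ennreal (lmax * exp (- lmax * (r - s))) * (\<integral>\<^sup>+z. trunc n \<mu> f r t z \<partial>ring_law \<mu> s r x)
        * indicator {s..t} r \<partial>lborel)"

lemma trunc_joint_measurable:
  assumes \<mu>: "\<mu> \<in> prob_flows" and f [measurable]: "f \<in> borel_measurable borel"
  shows "(\<lambda>p. trunc n \<mu> f (fst p) (fst (snd p)) (snd (snd p))) \<in> borel_measurable (borel \<Otimes>\<^sub>M borel \<Otimes>\<^sub>M borel)"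
proof (induction n)
  case 0
  have "(\<lambda>p. (\<lambda>(r, x). motion r x) (fst (snd p) - fst p, snd (snd p)))
      \<in> borel \<Otimes>\<^sub>M borel \<Otimes>\<^sub>M borel \<rightarrow>\<^sub>M prob_algebra borel"
    by (rule measurable_compose[OF _ motion_measurable]) measurable
  then have [measurable]: "(\<lambda>p. \<integral>\<^sup>+y. f y \<partial>motion (fst (snd p) - fst p) (snd (snd p)))
     \<in> borel_measurable (borel \<Otimes>\<^sub>M borel \<Otimes>\<^sub>M borel)"
    by (intro nn_integral_measurable_prob_algebra2[where N=borel]) (auto simp: split_beta')
  then show ?case by simp
next
  case (Suc n)
  have "(\<lambda>p. (\<lambda>(r, x). motion r x) (fst (snd p) - fst p, snd (snd p)))
      \<in> borel \<Otimes>\<^sub>M borel \<Otimes>\<^sub>M borel \<rightarrow>\<^sub>M prob_algebra borel"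
    by (rule measurable_compose[OF _ motion_measurable]) measurable
  then have [measurable]: "(\<lambda>p. \<integral>\<^sup>+y. f y \<partial>motion (fst (snd p) - fst p) (snd (snd p)))
     \<in> borel_measurable (borel \<Otimes>\<^sub>M borel \<Otimes>\<^sub>M borel)"
    by (intro nn_integral_measurable_prob_algebra2[where N=borel]) (auto simp: split_beta')
  have 1: "(\<lambda>x. (\<lambda>(s, r, x). ring_law \<mu> s r x) (fst (fst x), snd x, snd (snd (fst x))))
     \<in> (borel \<Otimes>\<^sub>M borel \<Otimes>\<^sub>M borel) \<Otimes>\<^sub>M borel \<rightarrow>\<^sub>M prob_algebra borel"
    by (rule measurable_compose[OF _ ring_law_measurable[OF \<mu>]]) measurable
  have 2: "(\<lambda>x. (\<lambda>p. trunc n \<mu> f (fst p) (fst (snd p)) (snd (snd p)))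
        (snd (fst x), fst (snd (fst (fst x))), snd x))
      \<in> borel_measurable (((borel \<Otimes>\<^sub>M borel \<Otimes>\<^sub>M borel) \<Otimes>\<^sub>M borel) \<Otimes>\<^sub>M borel)"
    by (rule measurable_compose[OF _ Suc]) measurable
  have [measurable]: "(\<lambda>x. \<integral>\<^sup>+z. trunc n \<mu> f (snd x) (fst (snd (fst x))) z
        \<partial>ring_law \<mu> (fst (fst x)) (snd x) (snd (snd (fst x))))
      \<in> borel_measurable ((borel \<Otimes>\<^sub>M borel \<Otimes>\<^sub>M borel) \<Otimes>\<^sub>M borel)"
    using 1 2 by (intro nn_integral_measurable_prob_algebra2[where N=borel]) (auto simp: split_beta')
  have [measurable]: "Measurable.pred ((borel \<Otimes>\<^sub>M borel \<Otimes>\<^sub>M borel) \<Otimes>\<^sub>M borel)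
      (\<lambda>x. snd x \<in> {fst (fst x)..fst (snd (fst x)) :: real})"
    unfolding atLeastAtMost_iff by measurable
  have "(\<lambda>p. \<integral>\<^sup>+r. ennreal (lmax * exp (- lmax * (r - fst p)))
          * (\<integral>\<^sup>+z. trunc n \<mu> f r (fst (snd p)) z \<partial>ring_law \<mu> (fst p) r (snd (snd p)))
          * indicator {fst p..fst (snd p)} r \<partial>lborel)
      \<in> borel_measurable (borel \<Otimes>\<^sub>M borel \<Otimes>\<^sub>M borel)"
    unfolding split_beta'
    by (rule lborel.borel_measurable_nn_integral) (simp add: split_beta', measurable)
  then show ?case by simp
qed

lemma trunc_measurable_times:
  assumes "\<mu> \<in> prob_flows" "f \<in> borel_measurable borel"
    and [measurable]: "a \<in> M \<rightarrow>\<^sub>M borel" "b \<in> M \<rightarrow>\<^sub>M borel" "c \<in> M \<rightarrow>\<^sub>M borel"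
  shows "(\<lambda>z. trunc n \<mu> f (a z) (b z) (c z)) \<in> borel_measurable M"
  using measurable_compose[OF _ trunc_joint_measurable[OF assms(1,2)], of "\<lambda>z. (a z, b z, c z)" M]
  by simp

lemma trunc_le_Suc:
  "trunc n \<mu> f s t x \<le> trunc (Suc n) \<mu> f s t x"
proof (induction n arbitrary: s x)
  case (Suc n)
  show ?case
    unfolding trunc.simps(2)[of "Suc n"] trunc.simps(2)[of n \<mu> f s]
    by (intro add_left_mono nn_integral_mono mult_mono Suc) auto
qed simp

lemma trunc_incseq: "incseq (\<lambda>n. trunc n \<mu> f s t x)"
  by (intro incseq_SucI trunc_le_Suc)

end

section \<open>The noise seen from its first entry\<close>

abbreviation clock_marks :: "(real \<times> real \<times> real \<times> real) measure" where
  "clock_marks \<equiv> exp1 \<Otimes>\<^sub>M unif01 \<Otimes>\<^sub>M unif01 \<Otimes>\<^sub>M unif01"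

lemma space_exp1 [simp]: "space exp1 = {0<..}"
  by (simp add: exp1_def space_restrict_space)

lemma measurable_id_exp1 [measurable]: "(\<lambda>x. x) \<in> exp1 \<rightarrow>\<^sub>M borel"
  by (simp add: exp1_def measurable_restrict_space1)

lemma prob_space_clock_marks: "prob_space clock_marks"
  by (intro prob_space_pair prob_space_exp1 prob_space_unif01)

lemma prob_space_noise: "prob_space noise"
proof -
  interpret sequence_space clock_marks
    by (simp add: sequence_space_def product_prob_space_def product_sigma_finite_def
        product_prob_space_axioms_def prob_space_clock_marks prob_space_imp_sigma_finite)
  show ?thesis unfolding noise_def by (rule P.prob_space_axioms)
qed

lemma noise_pos: "\<omega> \<in> space noise \<Longrightarrow> 0 < fst (\<omega> k)"
  by (auto simp: noise_def space_PiM space_pair_measure PiE_iff dest!: spec[of _ k])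

text \<open>Removing the first entry of an i.i.d. sequence leaves a sequence with the same law.\<close>

lemma nn_integral_noise_first:
  assumes F [measurable]: "F \<in> borel_measurable noise"
  shows "(\<integral>\<^sup>+\<omega>. F \<omega> \<partial>noise) = (\<integral>\<^sup>+s. \<integral>\<^sup>+u. \<integral>\<^sup>+p. \<integral>\<^sup>+\<omega>. F (case_nat (s, u, p) \<omega>)
      \<partial>noise \<partial>(unif01 \<Otimes>\<^sub>M unif01) \<partial>unif01 \<partial>exp1)"
proof -
  interpret S: sequence_space clock_marks
    by (simp add: sequence_space_def product_prob_space_def product_sigma_finite_def
        product_prob_space_axioms_def prob_space_clock_marks prob_space_imp_sigma_finite)
  interpret N: prob_space noise by (rule prob_space_noise)
  interpret U: prob_space unif01 by (rule prob_space_unif01)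
  interpret U2: prob_space "unif01 \<Otimes>\<^sub>M unif01" by (intro prob_space_pair prob_space_unif01)
  interpret U3: prob_space "unif01 \<Otimes>\<^sub>M unif01 \<Otimes>\<^sub>M unif01" by (intro prob_space_pair prob_space_unif01)
  have d: "distr (clock_marks \<Otimes>\<^sub>M noise) noise (\<lambda>(s, \<omega>). case_nat s \<omega>) = noise"
    using S.PiM_iter by (simp add: noise_def)
  have m [measurable]: "(\<lambda>(s, \<omega>). case_nat s \<omega>) \<in> clock_marks \<Otimes>\<^sub>M noise \<rightarrow>\<^sub>M noise"
    unfolding noise_def by measurable
  have [measurable]: "(\<lambda>z. F (case_nat (fst z) (snd z))) \<in> borel_measurable (clock_marks \<Otimes>\<^sub>M noise)"
    using measurable_compose[OF m F] by (simp add: split_beta')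
  have "(\<integral>\<^sup>+\<omega>. F \<omega> \<partial>noise) = (\<integral>\<^sup>+z. F (case_nat (fst z) (snd z)) \<partial>(clock_marks \<Otimes>\<^sub>M noise))"
    by (subst d[symmetric]) (simp add: nn_integral_distr split_beta')
  also have "\<dots> = (\<integral>\<^sup>+z. \<integral>\<^sup>+\<omega>. F (case_nat z \<omega>) \<partial>noise \<partial>clock_marks)"
    by (subst N.nn_integral_fst[symmetric]) auto
  also have "\<dots> = (\<integral>\<^sup>+s. \<integral>\<^sup>+z. \<integral>\<^sup>+\<omega>. F (case_nat (s, z) \<omega>) \<partial>noise \<partial>(unif01 \<Otimes>\<^sub>M unif01 \<Otimes>\<^sub>M unif01) \<partial>exp1)"
    by (subst U3.nn_integral_fst[symmetric]) auto
  also have "\<dots> = (\<integral>\<^sup>+s. \<integral>\<^sup>+u. \<integral>\<^sup>+p. \<integral>\<^sup>+\<omega>. F (case_nat (s, u, p) \<omega>)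
      \<partial>noise \<partial>(unif01 \<Otimes>\<^sub>M unif01) \<partial>unif01 \<partial>exp1)"
  proof (rule nn_integral_cong)
    fix s assume s: "s \<in> space exp1"
    have "(\<lambda>z. (case_nat (s, fst z) (snd z))) \<in> (unif01 \<Otimes>\<^sub>M unif01 \<Otimes>\<^sub>M unif01) \<Otimes>\<^sub>M noise \<rightarrow>\<^sub>M noise"
      using s by (intro measurable_compose[OF _ m[unfolded split_beta'], of "\<lambda>z. ((s, fst z), snd z)", simplified]) auto
    from measurable_compose[OF this F]
    have [measurable]: "(\<lambda>z. F (case_nat (s, fst z) (snd z)))
        \<in> borel_measurable ((unif01 \<Otimes>\<^sub>M unif01 \<Otimes>\<^sub>M unif01) \<Otimes>\<^sub>M noise)" .
    have "(\<lambda>z. \<integral>\<^sup>+\<omega>. F (case_nat (s, z) \<omega>) \<partial>noise) \<in> borel_measurable (unif01 \<Otimes>\<^sub>M unif01 \<Otimes>\<^sub>M unif01)"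
      by (rule N.borel_measurable_nn_integral) (simp add: split_beta')
    then show "(\<integral>\<^sup>+z. \<integral>\<^sup>+\<omega>. F (case_nat (s, z) \<omega>) \<partial>noise \<partial>(unif01 \<Otimes>\<^sub>M unif01 \<Otimes>\<^sub>M unif01)) =
      (\<integral>\<^sup>+u. \<integral>\<^sup>+p. \<integral>\<^sup>+\<omega>. F (case_nat (s, u, p) \<omega>) \<partial>noise \<partial>(unif01 \<Otimes>\<^sub>M unif01) \<partial>unif01)"
      by (subst U2.nn_integral_fst[symmetric]) auto
  qed
  finally show ?thesis .
qed

text \<open>The first ring comes after time \<open>\<tau>\<close>, with probability \<open>exp (- l * \<tau>)\<close>, or it has an exponential
  density on \<open>{0..\<tau>}\<close>.\<close>

lemma nn_integral_exp1_scaled: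
  assumes g [measurable]: "g \<in> borel_measurable borel" and l: "0 < l" and \<tau>: "0 \<le> \<tau>"
  shows "(\<integral>\<^sup>+s. (if \<tau> < s / l then c else g (s / l)) \<partial>exp1) =
    ennreal (exp (- l * \<tau>)) * c + (\<integral>\<^sup>+r. ennreal (l * exp (- l * r)) * g r * indicator {0..\<tau>} r \<partial>lborel)"
proof -
  have "(\<integral>\<^sup>+s. (if \<tau> < s / l then c else g (s / l)) \<partial>exp1) =
     (\<integral>\<^sup>+s. (if \<tau> < s / l then c else g (s / l)) * indicator {0<..} s
        \<partial>density lborel (exponential_density 1))"
    by (simp add: exp1_def nn_integral_restrict_space)
  also have "\<dots> = (\<integral>\<^sup>+s. ennreal (exponential_density 1 s) *
      ((if \<tau> < s / l then c else g (s / l)) * indicator {0<..} s) \<partial>lborel)"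
    by (subst nn_integral_density) auto
  also have "\<dots> = \<bar>l\<bar> * (\<integral>\<^sup>+r. ennreal (exponential_density 1 (0 + l * r)) *
      ((if \<tau> < (0 + l * r) / l then c else g ((0 + l * r) / l)) * indicator {0<..} (0 + l * r)) \<partial>lborel)"
    using l by (subst nn_integral_real_affine[where c=l and t=0]) auto
  also have "\<dots> = \<bar>l\<bar> * (\<integral>\<^sup>+r. c * (ennreal (exp (- l * r)) * indicator {\<tau>..} r) +
       ennreal (exp (- l * r)) * g r * indicator {0..\<tau>} r \<partial>lborel)"
  proof -
    have "AE r in lborel. ennreal (exponential_density 1 (0 + l * r)) *
      ((if \<tau> < (0 + l * r) / l then c else g ((0 + l * r) / l)) * indicator {0<..} (0 + l * r))
      = c * (ennreal (exp (- l * r)) * indicator {\<tau>..} r) +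
       ennreal (exp (- l * r)) * g r * indicator {0..\<tau>} r"
      using AE_lborel_singleton[of "0::real"] AE_lborel_singleton[of \<tau>]
    proof eventually_elim
      case (elim r)
      show ?case
      proof (cases "r < 0")
        case True
        then have "l * r < 0" using l by (simp add: mult_pos_neg)
        then show ?thesis using True \<tau> by (simp add: exponential_density_def)
      next
        case False
        then have lr: "0 < l * r" "0 + l * r \<in> {0<..}" using l elim by simp_all
        then have "exponential_density 1 (0 + l * r) = exp (- l * r)" by (simp add: exponential_density_def)
        with lr show ?thesis using False elim l
          by (cases "\<tau> < r") (simp_all add: ac_simps del: greaterThan_iff)
      qed
    qed
    then show ?thesis by (intro arg_cong2[where f="(*)"] refl nn_integral_cong_AE)
  qed
  also have "\<dots> = \<bar>l\<bar> * (c * (\<integral>\<^sup>+r. ennreal (exp (- l * r)) * indicator {\<tau>..} r \<partial>lborel)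
      + (\<integral>\<^sup>+r. ennreal (exp (- l * r)) * g r * indicator {0..\<tau>} r \<partial>lborel))"
    by (subst nn_integral_add) (auto simp: nn_integral_cmult)
  also have "(\<integral>\<^sup>+r. ennreal (exp (- l * r)) * indicator {\<tau>..} r \<partial>lborel) = ennreal (0 - (- exp (- l * \<tau>) / l))"
  proof (rule nn_integral_FTC_atLeast)
    show "((\<lambda>r. - exp (- l * r) / l) has_real_derivative exp (- l * r)) (at r)" for r
      using l by (auto intro!: derivative_eq_intros)
    have "filterlim (\<lambda>r. - l * r) at_bot at_top"
      using l by (intro filterlim_tendsto_neg_mult_at_bot[OF tendsto_const]) (auto simp: filterlim_ident)
    then have "((\<lambda>r. exp (- l * r)) \<longlongrightarrow> 0) at_top"
      by (rule filterlim_compose[OF exp_at_bot])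
    from tendsto_divide[OF tendsto_minus[OF this] tendsto_const[of l]]
    show "((\<lambda>r. - exp (- l * r) / l) \<longlongrightarrow> 0) at_top" using l by simp
  qed auto
  also have "\<bar>l\<bar> * (c * ennreal (0 - (- exp (- l * \<tau>) / l)) + (\<integral>\<^sup>+r. ennreal (exp (- l * r)) * g r * indicator {0..\<tau>} r \<partial>lborel))
    = ennreal (exp (- l * \<tau>)) * c + (\<integral>\<^sup>+r. ennreal (l * exp (- l * r)) * g r * indicator {0..\<tau>} r \<partial>lborel)"
  proof -
    have "ennreal \<bar>l\<bar> * ennreal (0 - (- exp (- l * \<tau>) / l)) = ennreal (exp (- l * \<tau>))"
      using l by (simp flip: ennreal_mult)
    moreover have "ennreal \<bar>l\<bar> * (\<integral>\<^sup>+r. ennreal (exp (- l * r)) * g r * indicator {0..\<tau>} r \<partial>lborel)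
      = (\<integral>\<^sup>+r. ennreal (l * exp (- l * r)) * g r * indicator {0..\<tau>} r \<partial>lborel)"
      using l by (subst nn_integral_cmult[symmetric])
        (auto intro!: nn_integral_cong simp: ennreal_mult ac_simps)
    ultimately show ?thesis
      by (simp only: distrib_left ac_simps)
  qed
  finally show ?thesis .
qed

section \<open>Pathwise restart at the first ring\<close>

lemma jump_time_strict_mono:
  assumes "\<And>k. 0 < fst (\<omega> k)" "0 < lmax"
  shows "strict_mono (jump_time lmax \<omega>)"
  using assms by (intro strict_mono_Suc_iff[THEN iffD2]) (auto simp: divide_pos_pos)

lemma jump_time_nonneg:
  assumes "\<And>k. 0 < fst (\<omega> k)" "0 < lmax"
  shows "0 \<le> jump_time lmax \<omega> n"
  using strict_mono_less_eq[OF jump_time_strict_mono[OF assms], where x=0 and y=n] by simp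

lemma jump_interval_unique:
  assumes "\<And>k. 0 < fst (\<omega> k)" "0 < lmax"
    and "jump_time lmax \<omega> m \<le> t" "t < jump_time lmax \<omega> (Suc m)"
    and "jump_time lmax \<omega> n \<le> t" "t < jump_time lmax \<omega> (Suc n)"
  shows "m = n"
proof -
  have "jump_time lmax \<omega> m < jump_time lmax \<omega> (Suc n)" "jump_time lmax \<omega> n < jump_time lmax \<omega> (Suc m)"
    using assms by linarith+
  then show ?thesis
    unfolding strict_mono_less[OF jump_time_strict_mono[OF assms(1,2)]] by linarith
qed

lemma jump_interval_exists:
  assumes "0 \<le> t" "t < jump_time lmax \<omega> (Suc n)"
  shows "\<exists>k\<le>n. jump_time lmax \<omega> k \<le> t \<and> t < jump_time lmax \<omega> (Suc k)"
  using assms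
proof (induction n)
  case (Suc n)
  show ?case
  proof (cases "t < jump_time lmax \<omega> (Suc n)")
    case True
    from Suc.IH[OF Suc.prems(1) this] show ?thesis by (meson le_Suc_eq)
  next
    case False
    then show ?thesis using Suc.prems by (intro exI[of _ "Suc n"]) auto
  qed
qed auto

text \<open>The index in the definition of the process is unique as the ring times are strictly increasing.\<close>

lemma jump_process_eq:
  assumes "\<And>k. 0 < fst (\<omega> k)" "0 < lmax"
    and "jump_time lmax \<omega> n \<le> t" "t < jump_time lmax \<omega> (Suc n)"
  shows "jump_process lmax lam G H \<mu> x \<omega> t =
    (if t = jump_time lmax \<omega> n then jump_state lmax lam G H \<mu> x \<omega> n
     else H (jump_state lmax lam G H \<mu> x \<omega> n) (fst (snd (\<omega> n))) (t - jump_time lmax \<omega> n))"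
proof -
  have "(THE n. jump_time lmax \<omega> n \<le> t \<and> t < jump_time lmax \<omega> (Suc n)) = n"
    using assms jump_interval_unique[of \<omega> lmax] by (intro the_equality) auto
  then show ?thesis
    using assms(3,4) unfolding jump_process_def Let_def by (auto simp: split_beta simp del: jump_time.simps)
qed

lemma jump_time_case_nat:
  "jump_time lmax (case_nat z \<omega>) (Suc n) = fst z / lmax + jump_time lmax \<omega> n"
  by (induction n) auto

text \<open>After its first ring the chain of states is the same chain, driven by the remaining noise and
  the shifted flow.\<close>

lemma jump_state_case_nat:
  "jump_state lmax lam G H \<mu> x (case_nat (s, u, p) \<omega>) (Suc n) =
    jump_state lmax lam G H (\<lambda>r. \<mu> (s / lmax + r)) (clock_step lmax lam G (\<mu> (s / lmax)) (H x u (s / lmax)) p) \<omega> n"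
proof (induction n)
  case 0
  show ?case by (simp add: clock_step_def split_beta)
next
  case (Suc n)
  obtain s' u' v' w' where w: "\<omega> n = (s', u', v', w')" by (cases "\<omega> n")
  show ?case
    unfolding jump_state.simps(2)[of _ _ _ _ _ _ _ "Suc n"] jump_state.simps(2)[of _ _ _ _ _ _ \<omega> n]
      nat.case w prod.case Suc jump_time_case_nat fst_conv by (rule refl)
qed

lemma jump_process_before_first:
  assumes "\<And>k. 0 < fst (\<omega> k)" "0 < s" "0 < lmax" "0 \<le> t" "t < s / lmax"
  shows "jump_process lmax lam G H \<mu> x (case_nat (s, u, p) \<omega>) t = (if t = 0 then x else H x u t)"
proof -
  have "\<And>k. 0 < fst (case_nat (s, u, p) \<omega> k)" using assms by (auto split: nat.split)
  then show ?thesis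
    using assms by (subst jump_process_eq[where n=0]) auto
qed

text \<open>The restart property of the whole path. A further ring after \<open>t\<close> is needed: otherwise both
  sides are default values, which are different.\<close>

lemma jump_process_after_first:
  assumes pos: "\<And>k. 0 < fst (\<omega> k)" "0 < s" "0 < lmax" and t: "s / lmax \<le> t" "t - s / lmax < jump_time lmax \<omega> (Suc n)"
  shows "jump_process lmax lam G H \<mu> x (case_nat (s, u, p) \<omega>) t =
    jump_process lmax lam G H (\<lambda>r. \<mu> (s / lmax + r)) (clock_step lmax lam G (\<mu> (s / lmax)) (H x u (s / lmax)) p)
      \<omega> (t - s / lmax)"
proof -
  have pos': "\<And>k. 0 < fst (case_nat (s, u, p) \<omega> k)" using pos by (auto split: nat.split)
  obtain k where k: "jump_time lmax \<omega> k \<le> t - s / lmax" "t - s / lmax < jump_time lmax \<omega> (Suc k)"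
    using jump_interval_exists[OF _ t(2)] t(1) by auto
  have k': "jump_time lmax (case_nat (s, u, p) \<omega>) (Suc k) \<le> t"
      "t < jump_time lmax (case_nat (s, u, p) \<omega>) (Suc (Suc k))"
    using k unfolding jump_time_case_nat by simp_all
  have t_eq: "t = jump_time lmax (case_nat (s, u, p) \<omega>) (Suc k) \<longleftrightarrow> t - s / lmax = jump_time lmax \<omega> k"
    "t - jump_time lmax (case_nat (s, u, p) \<omega>) (Suc k) = t - s / lmax - jump_time lmax \<omega> k"
    unfolding jump_time_case_nat by (auto simp: algebra_simps)
  show ?thesis
    unfolding jump_process_eq[OF pos(1,3) k] jump_process_eq[OF pos' pos(3) k'] t_eq
      jump_state_case_nat by simp
qed

lemma jump_time_measurable [measurable]: "(\<lambda>\<omega>. jump_time lmax \<omega> n) \<in> borel_measurable noise"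
proof (induction n)
  case (Suc n)
  have [measurable]: "(\<lambda>\<omega>. fst (\<omega> n)) \<in> borel_measurable noise"
    by (rule measurable_compose[where N=clock_marks, OF _
          measurable_compose[OF measurable_fst measurable_id_exp1]]) (simp add: noise_def)
  show ?case using Suc by simp
qed simp

section \<open>Law of the process up to finitely many rings\<close>

context clocked_jumps
begin

lemma jump_time_pos_noise:
  "\<omega> \<in> space noise \<Longrightarrow> 0 \<le> jump_time lmax \<omega> n"
  by (intro jump_time_nonneg noise_pos lmax_pos)

lemma jump_state_measurable:
  assumes \<mu>: "\<mu> \<in> prob_flows"
  shows "(\<lambda>\<omega>. jump_state lmax lam G H \<mu> x \<omega> n) \<in> noise \<rightarrow>\<^sub>M borel"
proof (induction n)
  case (Suc n)
  note [measurable] = Suc flow_measurable[OF \<mu>]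
  have [measurable]: "(\<lambda>\<omega>. \<omega> n) \<in> noise \<rightarrow>\<^sub>M clock_marks"
    unfolding noise_def by measurable
  have [measurable]: "(\<lambda>\<omega>. fst (\<omega> n)) \<in> borel_measurable noise"
    by (rule measurable_compose[OF _ measurable_compose[OF measurable_fst measurable_id_exp1]]) measurable
  have [measurable]: "(\<lambda>\<omega>. H (jump_state lmax lam G H \<mu> x \<omega> n) (fst (snd (\<omega> n))) (max 0 (fst (\<omega> n) / lmax)))
      \<in> noise \<rightarrow>\<^sub>M borel"
    using measurable_compose[OF _ H_joint, of "\<lambda>\<omega>. (jump_state lmax lam G H \<mu> x \<omega> n, fst (snd (\<omega> n)), fst (\<omega> n) / lmax)" noise]
    by simp
  have "(\<lambda>\<omega>. clock_step lmax lam G (\<mu> (max 0 (jump_time lmax \<omega> (Suc n))))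
        (H (jump_state lmax lam G H \<mu> x \<omega> n) (fst (snd (\<omega> n))) (max 0 (fst (\<omega> n) / lmax))) (snd (snd (\<omega> n))))
      \<in> noise \<rightarrow>\<^sub>M borel"
    using measurable_compose[OF _ clock_step_measurable, of "\<lambda>\<omega>. ((\<mu> (max 0 (jump_time lmax \<omega> (Suc n))),
        H (jump_state lmax lam G H \<mu> x \<omega> n) (fst (snd (\<omega> n))) (max 0 (fst (\<omega> n) / lmax))), snd (snd (\<omega> n)))" noise]
    by (simp del: jump_time.simps)
  moreover have "jump_state lmax lam G H \<mu> x \<omega> (Suc n) =
      clock_step lmax lam G (\<mu> (max 0 (jump_time lmax \<omega> (Suc n))))
        (H (jump_state lmax lam G H \<mu> x \<omega> n) (fst (snd (\<omega> n))) (max 0 (fst (\<omega> n) / lmax))) (snd (snd (\<omega> n)))"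
    if "\<omega> \<in> space noise" for \<omega>
    using noise_pos[OF that, of n] lmax_pos jump_time_pos_noise[OF that, of "Suc n"]
    by (simp add: clock_step_def split_beta max_def Let_def)
  ultimately show ?case by (simp cong: measurable_cong del: jump_state.simps)
qed simp

text \<open>The path is glued from countably many pieces, selected by the measurable number of rings.\<close>

lemma jump_process_measurable:
  assumes \<mu>: "\<mu> \<in> prob_flows"
  shows "(\<lambda>\<omega>. jump_process lmax lam G H \<mu> x \<omega> t) \<in> noise \<rightarrow>\<^sub>M borel"
proof -
  define A where "A n \<omega> \<longleftrightarrow> jump_time lmax \<omega> n \<le> t \<and> t < jump_time lmax \<omega> (Suc n)" for n \<omega>
  define W where "W n \<omega> = (if t = jump_time lmax \<omega> n then jump_state lmax lam G H \<mu> x \<omega> n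
     else H (jump_state lmax lam G H \<mu> x \<omega> n) (fst (snd (\<omega> n))) (max 0 (t - jump_time lmax \<omega> n)))" for n \<omega>
  note [measurable] = jump_state_measurable[OF \<mu>]
  have A [measurable]: "Measurable.pred noise (A n)" for n
    unfolding A_def by (simp del: jump_time.simps, measurable)
  have W: "W n \<in> noise \<rightarrow>\<^sub>M borel" for n
  proof -
    have [measurable]: "(\<lambda>\<omega>. \<omega> n) \<in> noise \<rightarrow>\<^sub>M clock_marks"
      unfolding noise_def by measurable
    have [measurable]: "(\<lambda>\<omega>. H (jump_state lmax lam G H \<mu> x \<omega> n) (fst (snd (\<omega> n))) (max 0 (t - jump_time lmax \<omega> n)))
        \<in> noise \<rightarrow>\<^sub>M borel"
      using measurable_compose[OF _ H_joint, of "\<lambda>\<omega>. (jump_state lmax lam G H \<mu> x \<omega> n, fst (snd (\<omega> n)), t - jump_time lmax \<omega> n)" noise]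
      by simp
    show ?thesis unfolding W_def by measurable
  qed
  have [measurable]: "(\<lambda>\<omega>. THE n. A n \<omega>) \<in> noise \<rightarrow>\<^sub>M count_space UNIV"
    using A jump_interval_unique[OF noise_pos lmax_pos]
    by (intro measurable_THE[where I=UNIV]) (auto simp: A_def simp del: jump_time.simps)
  have "(\<lambda>\<omega>. W (THE n. A n \<omega>) \<omega>) \<in> noise \<rightarrow>\<^sub>M borel"
    by (rule measurable_compose_countable[OF W]) measurable
  then have "(\<lambda>\<omega>. if \<exists>n. A n \<omega> then W (THE n. A n \<omega>) \<omega> else x) \<in> noise \<rightarrow>\<^sub>M borel"
    by (rule measurable_If) measurable
  moreover have "jump_process lmax lam G H \<mu> x \<omega> t = (if \<exists>n. A n \<omega> then W (THE n. A n \<omega>) \<omega> else x)"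
    if \<omega>: "\<omega> \<in> space noise" for \<omega>
  proof (cases "\<exists>n. A n \<omega>")
    case True
    then obtain n where n: "A n \<omega>" ..
    then have "(THE n. A n \<omega>) = n"
      using jump_interval_unique[OF noise_pos[OF \<omega>] lmax_pos]
      by (intro the_equality) (auto simp: A_def simp del: jump_time.simps)
    moreover have "jump_process lmax lam G H \<mu> x \<omega> t = W n \<omega>"
      using n noise_pos[OF \<omega>] lmax_pos
      by (subst jump_process_eq[where n=n]) (auto simp: A_def W_def max_def simp del: jump_time.simps)
    ultimately show ?thesis using True by simp
  next
    case False
    then show ?thesis unfolding A_def jump_process_def by (auto simp del: jump_time.simps)
  qed
  ultimately show ?thesis by (simp cong: measurable_cong)
qed

lemma flow_shift: "\<mu> \<in> prob_flows \<Longrightarrow> 0 \<le> s \<Longrightarrow> (\<lambda>r. \<mu> (s + r)) \<in> prob_flows"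
  by (rule measurable_compose[where N="restrict_space borel {0..}" and g=\<mu>], rule measurable_restrict_space2)
    (auto intro: measurable_restrict_space1 simp: space_restrict_space)

lemma nn_integral_ring_law_H:
  assumes g [measurable]: "g \<in> borel_measurable borel" and \<mu>: "\<mu> \<in> prob_flows" and r: "0 \<le> s" "s \<le> r"
  shows "(\<integral>\<^sup>+u. \<integral>\<^sup>+p. g (clock_step lmax lam G (\<mu> r) (H x u (r - s)) p) \<partial>(unif01 \<Otimes>\<^sub>M unif01) \<partial>unif01)
    = (\<integral>\<^sup>+z. g z \<partial>ring_law \<mu> s r x)"
proof -
  have \<nu>: "\<mu> r \<in> probs" using flow_in_probs[OF \<mu>] r by simp
  have "clock_step lmax lam G (\<mu> r) y \<in> unif01 \<Otimes>\<^sub>M unif01 \<rightarrow>\<^sub>M borel" for y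
    using measurable_compose[OF _ clock_step_measurable, of "\<lambda>q. ((\<mu> r, y), q)" "unif01 \<Otimes>\<^sub>M unif01"] \<nu> by simp
  then have "(\<integral>\<^sup>+p. g (clock_step lmax lam G (\<mu> r) y p) \<partial>(unif01 \<Otimes>\<^sub>M unif01)) = (\<integral>\<^sup>+z. g z \<partial>clock_law (\<mu> r) y)" for y
    unfolding clock_law_def by (subst nn_integral_distr) auto
  then show ?thesis
    using r by (simp add: nn_integral_ring_law[OF g \<mu>] nn_integral_H[OF nn_integral_clock_law_measurable[OF g \<nu>]])
qed

text \<open>The link between the construction of the process and the recursion: condition on the first
  entry of the noise and restart there. At a ring time the process takes the new state itself and not
  \<open>H\<close> of it at time 0; after the restarts this case only occurs for \<open>t = s\<close>, where \<open>P 0\<close> is the identity.\<close>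

lemma nn_integral_truncated_process:
  assumes \<mu>: "\<mu> \<in> prob_flows" and f [measurable]: "f \<in> borel_measurable borel" and s: "0 \<le> s" "s \<le> t"
  shows "(\<integral>\<^sup>+\<omega>. f (jump_process lmax lam G H (\<lambda>r. \<mu> (s + r)) x \<omega> (t - s))
      * indicator {\<omega>. t - s < jump_time lmax \<omega> (Suc n)} \<omega> \<partial>noise) = trunc n \<mu> f s t x"
  using s
proof (induction n arbitrary: s x)
  (* The conditioning on the first ring, for the base case (n = 0, where g = 0) and the step alike. *)
  have IS: "(\<integral>\<^sup>+\<omega>. f (jump_process lmax lam G H (\<lambda>r. \<mu> (s + r)) x \<omega> (t - s))
      * indicator {\<omega>. t - s < jump_time lmax \<omega> (Suc n)} \<omega> \<partial>noise)
    = ennreal (exp (- lmax * (t - s))) * (\<integral>\<^sup>+y. f y \<partial>motion (t - s) x)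
      + (\<integral>\<^sup>+r. ennreal (lmax * exp (- lmax * (r - s))) * (\<integral>\<^sup>+z. g r z \<partial>ring_law \<mu> s r x)
          * indicator {s..t} r \<partial>lborel)"
    if s: "0 \<le> s" "s \<le> t" and g: "\<And>r. g r \<in> borel_measurable borel"
      and gI: "(\<lambda>r. \<integral>\<^sup>+z. g r z \<partial>ring_law \<mu> s r x) \<in> borel_measurable borel"
      and rec: "\<And>r y. s \<le> r \<Longrightarrow> r \<le> t \<Longrightarrow>
        (\<integral>\<^sup>+\<omega>. f (jump_process lmax lam G H (\<lambda>q. \<mu> (r + q)) y \<omega> (t - r))
          * indicator {\<omega>. t - r < jump_time lmax \<omega> n} \<omega> \<partial>noise) = g r y"
    for s x n g
  proof -
    interpret N: prob_space noise by (rule prob_space_noise)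
    interpret U: prob_space unif01 by (rule prob_space_unif01)
    interpret U2: prob_space "unif01 \<Otimes>\<^sub>M unif01" by (intro prob_space_pair prob_space_unif01)
    let ?\<mu> = "\<lambda>r. \<mu> (s + r)" and ?\<tau> = "t - s"
    let ?X = "\<lambda>\<omega>. jump_process lmax lam G H ?\<mu> x \<omega> ?\<tau>"
    have \<mu>s: "?\<mu> \<in> prob_flows" by (rule flow_shift[OF \<mu> s(1)])
    note [measurable] = jump_process_measurable[OF \<mu>s] gI
    have first: "f (?X (case_nat (z, u, p) \<omega>)) * indicator {\<omega>. ?\<tau> < jump_time lmax \<omega> (Suc n)} (case_nat (z, u, p) \<omega>)
      = (if ?\<tau> < z / lmax then f (if ?\<tau> = 0 then x else H x u ?\<tau>)
         else f (jump_process lmax lam G H (\<lambda>q. \<mu> (s + z / lmax + q))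
               (clock_step lmax lam G (\<mu> (s + z / lmax)) (H x u (z / lmax)) p) \<omega> (t - (s + z / lmax)))
           * indicator {\<omega>. t - (s + z / lmax) < jump_time lmax \<omega> n} \<omega>)"
      if z: "0 < z" and \<omega>: "\<omega> \<in> space noise" for z u p \<omega>
    proof -
      note pos = noise_pos[OF \<omega>]
      have ind: "?\<tau> < jump_time lmax (case_nat (z, u, p) \<omega>) (Suc n) \<longleftrightarrow> ?\<tau> - z / lmax < jump_time lmax \<omega> n"
        unfolding jump_time_case_nat by auto
      show ?thesis
      proof (cases "?\<tau> < z / lmax")
        case True
        then have "?\<tau> - z / lmax < jump_time lmax \<omega> n" using jump_time_pos_noise[OF \<omega>, of n] by simp
        then show ?thesis
          using True ind s by (simp add: jump_process_before_first[OF pos z lmax_pos] del: jump_time.simps)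
      next
        case False
        have eq: "?\<tau> - z / lmax = t - (s + z / lmax)" by simp
        show ?thesis
        proof (cases "?\<tau> - z / lmax < jump_time lmax \<omega> n")
          case True
          then obtain m where m: "n = Suc m" using False by (cases n) auto
          show ?thesis
            using False True ind eq jump_process_after_first[OF pos z lmax_pos _ True[unfolded m], of lam G H ?\<mu> x u p]
            by (simp add: add.assoc diff_diff_eq del: jump_time.simps)
        next
          case no: False
          then show ?thesis using False ind eq by (simp del: jump_time.simps)
        qed
      qed
    qed
    have fm: "(\<lambda>\<omega>. f (?X \<omega>) * indicator {\<omega>. ?\<tau> < jump_time lmax \<omega> (Suc n)} \<omega>) \<in> borel_measurable noise"
      by (simp del: jump_time.simps, measurable)
    have x0: "(\<integral>\<^sup>+u. f (if ?\<tau> = 0 then x else H x u ?\<tau>) \<partial>unif01) = (\<integral>\<^sup>+y. f y \<partial>motion ?\<tau> x)"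
    proof (cases "?\<tau> = 0")
      case True
      then show ?thesis by (simp add: motion_nonneg P_zero nn_integral_return U.emeasure_space_1[simplified])
    next
      case False
      then show ?thesis using s by (simp add: nn_integral_H[OF f])
    qed
    have "(\<integral>\<^sup>+\<omega>. f (?X \<omega>) * indicator {\<omega>. ?\<tau> < jump_time lmax \<omega> (Suc n)} \<omega> \<partial>noise) =
      (\<integral>\<^sup>+z. \<integral>\<^sup>+u. \<integral>\<^sup>+p. \<integral>\<^sup>+\<omega>. f (?X (case_nat (z, u, p) \<omega>))
        * indicator {\<omega>. ?\<tau> < jump_time lmax \<omega> (Suc n)} (case_nat (z, u, p) \<omega>)
        \<partial>noise \<partial>(unif01 \<Otimes>\<^sub>M unif01) \<partial>unif01 \<partial>exp1)"
      by (rule nn_integral_noise_first[OF fm])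
    also have "\<dots> = (\<integral>\<^sup>+z. (if ?\<tau> < z / lmax then (\<integral>\<^sup>+y. f y \<partial>motion ?\<tau> x)
        else (\<lambda>r. \<integral>\<^sup>+y. g (s + r) y \<partial>ring_law \<mu> s (s + r) x) (z / lmax)) \<partial>exp1)"
    proof (rule nn_integral_cong)
      fix z assume "z \<in> space exp1"
      then have z: "0 < z" by simp
      have "(\<integral>\<^sup>+u. \<integral>\<^sup>+p. \<integral>\<^sup>+\<omega>. f (?X (case_nat (z, u, p) \<omega>))
        * indicator {\<omega>. ?\<tau> < jump_time lmax \<omega> (Suc n)} (case_nat (z, u, p) \<omega>)
        \<partial>noise \<partial>(unif01 \<Otimes>\<^sub>M unif01) \<partial>unif01) =
        (\<integral>\<^sup>+u. \<integral>\<^sup>+p. (if ?\<tau> < z / lmax then f (if ?\<tau> = 0 then x else H x u ?\<tau>)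
          else g (s + z / lmax) (clock_step lmax lam G (\<mu> (s + z / lmax)) (H x u (z / lmax)) p))
        \<partial>(unif01 \<Otimes>\<^sub>M unif01) \<partial>unif01)"
      proof (intro nn_integral_cong, goal_cases)
        case (1 u p)
        have "(\<integral>\<^sup>+\<omega>. f (?X (case_nat (z, u, p) \<omega>))
          * indicator {\<omega>. ?\<tau> < jump_time lmax \<omega> (Suc n)} (case_nat (z, u, p) \<omega>) \<partial>noise) =
          (\<integral>\<^sup>+\<omega>. (if ?\<tau> < z / lmax then f (if ?\<tau> = 0 then x else H x u ?\<tau>)
         else f (jump_process lmax lam G H (\<lambda>q. \<mu> (s + z / lmax + q))
               (clock_step lmax lam G (\<mu> (s + z / lmax)) (H x u (z / lmax)) p) \<omega> (t - (s + z / lmax)))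
           * indicator {\<omega>. t - (s + z / lmax) < jump_time lmax \<omega> n} \<omega>) \<partial>noise)"
          by (intro nn_integral_cong first z)
        also have "\<dots> = (if ?\<tau> < z / lmax then f (if ?\<tau> = 0 then x else H x u ?\<tau>)
          else g (s + z / lmax) (clock_step lmax lam G (\<mu> (s + z / lmax)) (H x u (z / lmax)) p))"
        proof (cases "?\<tau> < z / lmax")
          case False
          then show ?thesis using z lmax_pos by (simp add: rec)
        qed (simp add: N.emeasure_space_1)
        finally show ?case .
      qed
      also have "\<dots> = (if ?\<tau> < z / lmax then (\<integral>\<^sup>+y. f y \<partial>motion ?\<tau> x)
          else (\<lambda>r. \<integral>\<^sup>+y. g (s + r) y \<partial>ring_law \<mu> s (s + r) x) (z / lmax))"
      proof (cases "?\<tau> < z / lmax")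
        case True
        then show ?thesis using x0 by (simp add: U2.emeasure_space_1)
      next
        case False
        then show ?thesis
          using nn_integral_ring_law_H[OF g \<mu>, of s "s + z / lmax" "s + z / lmax" x] s z lmax_pos by simp
      qed
      finally show "(\<integral>\<^sup>+u. \<integral>\<^sup>+p. \<integral>\<^sup>+\<omega>. f (?X (case_nat (z, u, p) \<omega>))
        * indicator {\<omega>. ?\<tau> < jump_time lmax \<omega> (Suc n)} (case_nat (z, u, p) \<omega>)
        \<partial>noise \<partial>(unif01 \<Otimes>\<^sub>M unif01) \<partial>unif01) = (if ?\<tau> < z / lmax then (\<integral>\<^sup>+y. f y \<partial>motion ?\<tau> x)
          else (\<lambda>r. \<integral>\<^sup>+y. g (s + r) y \<partial>ring_law \<mu> s (s + r) x) (z / lmax))" .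
    qed
    also have "\<dots> = ennreal (exp (- lmax * ?\<tau>)) * (\<integral>\<^sup>+y. f y \<partial>motion ?\<tau> x)
      + (\<integral>\<^sup>+r. ennreal (lmax * exp (- lmax * r)) * (\<integral>\<^sup>+y. g (s + r) y \<partial>ring_law \<mu> s (s + r) x) * indicator {0..?\<tau>} r \<partial>lborel)"
      using s measurable_compose[OF _ gI, of "\<lambda>r. s + r" borel] by (intro nn_integral_exp1_scaled lmax_pos) auto
    also have "(\<integral>\<^sup>+r. ennreal (lmax * exp (- lmax * r)) * (\<integral>\<^sup>+y. g (s + r) y \<partial>ring_law \<mu> s (s + r) x) * indicator {0..?\<tau>} r \<partial>lborel)
      = (\<integral>\<^sup>+r. ennreal (lmax * exp (- lmax * (r - s))) * (\<integral>\<^sup>+y. g r y \<partial>ring_law \<mu> s r x) * indicator {s..t} r \<partial>lborel)"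
      by (subst nn_integral_real_affine[where c=1 and t=s and f="\<lambda>r. ennreal (lmax * exp (- lmax * (r - s))) * (\<integral>\<^sup>+y. g r y \<partial>ring_law \<mu> s r x) * indicator {s..t} r"])
        (auto intro!: nn_integral_cong split: split_indicator)
    finally show ?thesis .
  qed
  {
    case 0
    have "(\<integral>\<^sup>+\<omega>. f (jump_process lmax lam G H (\<lambda>q. \<mu> (r + q)) y \<omega> (t - r))
          * indicator {\<omega>. t - r < jump_time lmax \<omega> 0} \<omega> \<partial>noise) = 0" if "s \<le> r" "r \<le> t" for r y
      using that by simp
    from IS[OF 0, of "\<lambda>_ _. 0", OF _ _ this] show ?case by simp
  next
    case (Suc n)
    have 1: "(\<lambda>x. (\<lambda>(s, r, x). ring_law \<mu> s r x) (s, x, y)) \<in> borel \<rightarrow>\<^sub>M prob_algebra borel" for s y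
      by (rule measurable_compose[OF _ ring_law_measurable[OF \<mu>]]) measurable
    have m: "(\<lambda>r. \<integral>\<^sup>+z. trunc n \<mu> f r t z \<partial>ring_law \<mu> s r x) \<in> borel_measurable borel" for s x
      using 1[of s x] by (intro nn_integral_measurable_prob_algebra2[where N=borel])
        (auto simp: split_beta' intro!: trunc_measurable_times[OF \<mu> f])
    show ?case
      unfolding trunc.simps(2)
      by (rule IS[OF Suc.prems]) (use Suc.IH Suc.prems m in \<open>auto intro!: trunc_measurable_times[OF \<mu> f] simp del: jump_time.simps\<close>)
  }
qed

end

section \<open>The backward equation and the Chapman--Kolmogorov relation\<close>

lemma nn_integral_exp_Icc:
  fixes l :: real
  assumes "s \<le> t" "0 < l"
  shows "(\<integral>\<^sup>+r. ennreal (l * exp (- l * (r - s))) * indicator {s..t} r \<partial>lborel) = ennreal (1 - exp (- l * (t - s)))"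
proof -
  have "(\<integral>\<^sup>+r. ennreal (l * exp (- l * (r - s))) * indicator {s..t} r \<partial>lborel)
      = ennreal ((- exp (- l * (t - s))) - (- exp (- l * (s - s))))"
    using assms by (intro nn_integral_FTC_Icc) (auto intro!: derivative_eq_intros)
  then show ?thesis by simp
qed

lemma nn_integral_swap_lborel:
  fixes g :: "'e::polish_space \<Rightarrow> real \<Rightarrow> ennreal"
  assumes \<nu>: "\<nu> \<in> probs" and g: "(\<lambda>p. g (fst p) (snd p)) \<in> borel_measurable (borel \<Otimes>\<^sub>M borel)"
  shows "(\<integral>\<^sup>+y. \<integral>\<^sup>+q. g y q \<partial>lborel \<partial>\<nu>) = (\<integral>\<^sup>+q. \<integral>\<^sup>+y. g y q \<partial>\<nu> \<partial>lborel)"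
proof -
  interpret N: prob_space \<nu> using \<nu> by (rule space_prob_algebra_borelD)
  interpret pair_sigma_finite \<nu> lborel by standard
  have [measurable_cong]: "sets \<nu> = sets borel" using \<nu> by (rule space_prob_algebra_borelD)
  have "(\<lambda>p. g (fst p) (snd p)) \<in> borel_measurable (\<nu> \<Otimes>\<^sub>M lborel)"
    using g by (simp cong: measurable_cong_sets)
  from Fubini[OF this] show ?thesis by simp
qed

text \<open>Two probability measures that are comparable are equal, by complements. This turns the
  inequalities obtained from increasing approximations into equalities.\<close>

lemma prob_measure_eqI_le:
  assumes M: "M \<in> probs" and N: "N \<in> probs" and le: "\<And>A. A \<in> sets borel \<Longrightarrow> emeasure M A \<le> emeasure N A"
  shows "M = N"
proof (rule measure_eqI)
  interpret M: prob_space M by (rule space_prob_algebra_borelD[OF M])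
  interpret N: prob_space N by (rule space_prob_algebra_borelD[OF N])
  note [simp] = space_prob_algebra_borelD[OF M] space_prob_algebra_borelD[OF N]
  show "sets M = sets N" by simp
  fix A assume A: "A \<in> sets M"
  then have "M.prob A \<le> N.prob A" "M.prob (space M - A) \<le> N.prob (space M - A)"
    using le[of A] le[of "space M - A"] by (auto simp: M.emeasure_eq_measure N.emeasure_eq_measure)
  then have "M.prob A = N.prob A"
    using A M.prob_compl[of A] N.prob_compl[of A] by simp
  then show "emeasure M A = emeasure N A" by (simp add: M.emeasure_eq_measure N.emeasure_eq_measure)
qed

context clocked_jumps
begin

abbreviation R where "R \<equiv> jump_kernel lmax lam G H"

text \<open>Defined for all times as a limit of the recursion; for \<open>0 \<le> s \<le> t\<close> it is the integral against
  the kernel of the process.\<close>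

definition expect :: "(real \<Rightarrow> 'e measure) \<Rightarrow> ('e \<Rightarrow> ennreal) \<Rightarrow> real \<Rightarrow> real \<Rightarrow> 'e \<Rightarrow> ennreal" where
  "expect \<mu> f s t x = (SUP n. trunc n \<mu> f s t x)"

text \<open>A crude bound for the probability of at most \<open>n\<close> rings: each of the \<open>n + 1\<close> waiting times is
  shorter than \<open>T\<close> with probability \<open>1 - exp (- lmax * T)\<close>.\<close>

lemma trunc_one_ge:
  assumes \<mu>: "\<mu> \<in> prob_flows" and s: "s \<le> t" "t - s \<le> T"
  shows "ennreal (1 - (1 - exp (- lmax * T)) ^ Suc n) \<le> trunc n \<mu> (\<lambda>_. 1) s t x"
  using s
proof (induction n arbitrary: s x)
  case 0
  have "exp (- lmax * T) \<le> exp (- lmax * (t - s))" using 0 lmax_pos by simp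
  then show ?case
    using prob_space.emeasure_space_1[OF space_prob_algebra_borelD(3)[OF motion_in_probs[of "t - s" x]]]
    by simp
next
  case (Suc n)
  interpret T: prob_space "motion (t - s) x" by (rule space_prob_algebra_borelD) simp
  let ?d = "(1 - exp (- lmax * T)) ^ Suc n" and ?e = "exp (- lmax * (t - s))"
  have T: "0 \<le> T" using Suc.prems by simp
  have e: "exp (- lmax * T) \<le> ?e" "?e \<le> 1" "exp (- lmax * T) \<le> 1" using Suc.prems T lmax_pos by auto
  have d: "0 \<le> ?d" "?d \<le> 1" using e by (auto simp del: power_Suc intro!: zero_le_power power_le_one)
  have "1 - (1 - exp (- lmax * T)) ^ Suc (Suc n) = 1 - (1 - exp (- lmax * T)) * ?d" by simp
  also have "\<dots> \<le> 1 - (1 - ?e) * ?d"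
    using e d by (intro diff_left_mono mult_right_mono) auto
  also have "\<dots> = ?e + (1 - ?d) * (1 - ?e)" by (simp add: algebra_simps del: power_Suc)
  finally have "ennreal (1 - (1 - exp (- lmax * T)) ^ Suc (Suc n)) \<le> ennreal (?e + (1 - ?d) * (1 - ?e))"
    by (rule ennreal_leI)
  also have "\<dots> = ennreal ?e + ennreal (1 - ?d) * ennreal (1 - ?e)"
    using d e by (simp add: ennreal_plus ennreal_mult del: power_Suc)
  also have "ennreal (1 - ?e) = (\<integral>\<^sup>+r. ennreal (lmax * exp (- lmax * (r - s))) * indicator {s..t} r \<partial>lborel)"
    using Suc.prems lmax_pos by (intro nn_integral_exp_Icc[symmetric])
  also have "ennreal (1 - ?d) * \<dots> = (\<integral>\<^sup>+r. ennreal (lmax * exp (- lmax * (r - s))) * ennreal (1 - ?d) * indicator {s..t} r \<partial>lborel)"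
    by (subst nn_integral_cmult[symmetric]) (auto simp: ac_simps intro!: nn_integral_cong)
  also have "\<dots> \<le> (\<integral>\<^sup>+r. ennreal (lmax * exp (- lmax * (r - s))) * (\<integral>\<^sup>+z. trunc n \<mu> (\<lambda>_. 1) r t z \<partial>ring_law \<mu> s r x)
        * indicator {s..t} r \<partial>lborel)"
  proof (intro nn_integral_mono)
    fix r
    interpret L: prob_space "ring_law \<mu> s r x" by (rule space_prob_algebra_borelD) (simp add: \<mu>)
    show "ennreal (lmax * exp (- lmax * (r - s))) * ennreal (1 - ?d) * indicator {s..t} r
      \<le> ennreal (lmax * exp (- lmax * (r - s))) * (\<integral>\<^sup>+z. trunc n \<mu> (\<lambda>_. 1) r t z \<partial>ring_law \<mu> s r x) * indicator {s..t} r"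
    proof (cases "r \<in> {s..t}")
      case True
      then have "(\<integral>\<^sup>+z. ennreal (1 - ?d) \<partial>ring_law \<mu> s r x) \<le> (\<integral>\<^sup>+z. trunc n \<mu> (\<lambda>_. 1) r t z \<partial>ring_law \<mu> s r x)"
        using Suc.prems by (intro nn_integral_mono Suc.IH) auto
      then show ?thesis by (auto simp: L.emeasure_space_1 simp del: power_Suc intro!: mult_right_mono mult_left_mono)
    qed simp
  qed
  finally show ?case by (simp add: T.emeasure_space_1 del: power_Suc)
qed

lemma expect_one:
  assumes \<mu>: "\<mu> \<in> prob_flows" and s: "s \<le> t"
  shows "1 \<le> expect \<mu> (\<lambda>_. 1) s t x"
proof (rule LIMSEQ_le_const2)
  have "(\<lambda>n. (1 - exp (- lmax * (t - s))) ^ Suc n) \<longlonglongrightarrow> 0"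
    using s lmax_pos by (intro LIMSEQ_Suc LIMSEQ_power_zero) auto
  then have "(\<lambda>n. 1 - (1 - exp (- lmax * (t - s))) ^ Suc n) \<longlonglongrightarrow> 1 - 0"
    by (intro tendsto_diff tendsto_const)
  then show "(\<lambda>n. ennreal (1 - (1 - exp (- lmax * (t - s))) ^ Suc n)) \<longlonglongrightarrow> 1"
    using tendsto_ennrealI by fastforce
  show "\<exists>N. \<forall>n\<ge>N. ennreal (1 - (1 - exp (- lmax * (t - s))) ^ Suc n) \<le> expect \<mu> (\<lambda>_. 1) s t x"
  proof (intro exI[of _ 0] allI impI)
    fix n
    have "ennreal (1 - (1 - exp (- lmax * (t - s))) ^ Suc n) \<le> trunc n \<mu> (\<lambda>_. 1) s t x"
      by (rule trunc_one_ge[OF \<mu> s]) simp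
    also have "\<dots> \<le> expect \<mu> (\<lambda>_. 1) s t x" unfolding expect_def by (rule SUP_upper) simp
    finally show "ennreal (1 - (1 - exp (- lmax * (t - s))) ^ Suc n) \<le> expect \<mu> (\<lambda>_. 1) s t x" .
  qed
qed

text \<open>The rings do not accumulate. Their times do not depend on the motion, so that any flow and any
  starting point can be used to read the probabilities off from the recursion.\<close>

lemma AE_jump_time_exceeds:
  assumes t: "0 \<le> t"
  shows "AE \<omega> in noise. \<exists>n. t < jump_time lmax \<omega> (Suc n)"
proof -
  interpret N: prob_space noise by (rule prob_space_noise)
  let ?A = "\<lambda>n. {\<omega> \<in> space noise. t < jump_time lmax \<omega> (Suc n)}"
  let ?\<mu> = "\<lambda>_::real. return borel (undefined::'e)"
  have \<mu>: "?\<mu> \<in> prob_flows" by (intro measurable_const) (simp add: space_prob_algebra prob_space_return)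
  have Am [measurable]: "?A n \<in> sets noise" for n
    by (simp del: jump_time.simps)
  have A: "trunc n ?\<mu> (\<lambda>_. 1) 0 t undefined = emeasure noise (?A n)" for n
  proof -
    have "trunc n ?\<mu> (\<lambda>_. 1) 0 t undefined = (\<integral>\<^sup>+\<omega>. indicator {\<omega>. t < jump_time lmax \<omega> (Suc n)} \<omega> \<partial>noise)"
      using t by (subst nn_integral_truncated_process[symmetric, OF \<mu>]) (auto simp del: jump_time.simps)
    also have "\<dots> = (\<integral>\<^sup>+\<omega>. indicator (?A n) \<omega> \<partial>noise)"
      by (intro nn_integral_cong) (auto split: split_indicator)
    finally show ?thesis by (simp del: jump_time.simps)
  qed
  have "1 \<le> (SUP n. emeasure noise (?A n))"
    using expect_one[OF \<mu> t, of undefined] by (simp add: expect_def A del: jump_time.simps)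
  also have "\<dots> \<le> emeasure noise (\<Union>n. ?A n)"
    by (intro SUP_least emeasure_mono sets.countable_UN image_subsetI Am UN_upper UNIV_I)
  finally have "emeasure noise (\<Union>n. ?A n) = 1"
    using N.emeasure_le_1[of "\<Union>n. ?A n"] by (intro antisym) auto
  then have "measure noise (\<Union>n. ?A n) = 1" by (simp only: measure_def) simp
  moreover have "(\<Union>n. ?A n) \<in> sets noise" by (intro sets.countable_UN image_subsetI Am)
  ultimately have "AE \<omega> in noise. \<omega> \<in> (\<Union>n. ?A n)" by (simp only: N.AE_in_set_eq_1)
  then show ?thesis by eventually_elim auto
qed

lemma jump_kernel_in_probs:
  assumes \<mu>: "\<mu> \<in> prob_flows" and s: "0 \<le> s"
  shows "R \<mu> s t x \<in> probs"
  unfolding jump_kernel_def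
  by (auto simp: space_prob_algebra intro!: prob_space.prob_space_distr prob_space_noise
      jump_process_measurable flow_shift \<mu> s)

lemma nn_integral_jump_kernel:
  assumes \<mu>: "\<mu> \<in> prob_flows" and f [measurable]: "f \<in> borel_measurable borel" and s: "0 \<le> s" "s \<le> t"
  shows "(\<integral>\<^sup>+y. f y \<partial>R \<mu> s t x) = expect \<mu> f s t x"
proof -
  let ?X = "\<lambda>\<omega>. jump_process lmax lam G H (\<lambda>r. \<mu> (s + r)) x \<omega> (t - s)"
  let ?A = "\<lambda>n. {\<omega>. t - s < jump_time lmax \<omega> (Suc n)}"
  have [measurable]: "?X \<in> noise \<rightarrow>\<^sub>M borel" by (intro jump_process_measurable flow_shift \<mu> s)
  have "(\<integral>\<^sup>+y. f y \<partial>R \<mu> s t x) = (\<integral>\<^sup>+\<omega>. f (?X \<omega>) \<partial>noise)"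
    by (simp add: jump_kernel_def nn_integral_distr)
  also have "\<dots> = (\<integral>\<^sup>+\<omega>. (SUP n. f (?X \<omega>) * indicator (?A n) \<omega>) \<partial>noise)"
  proof (rule nn_integral_cong_AE)
    have "AE \<omega> in noise. \<exists>n. t - s < jump_time lmax \<omega> (Suc n)"
      by (rule AE_jump_time_exceeds) (use s in simp)
    then show "AE \<omega> in noise. f (?X \<omega>) = (SUP n. f (?X \<omega>) * indicator (?A n) \<omega>)"
    proof eventually_elim
      case (elim \<omega>)
      then obtain n where n: "\<omega> \<in> ?A n" by auto
      show ?case
      proof (intro antisym SUP_least)
        show "f (?X \<omega>) \<le> (SUP n. f (?X \<omega>) * indicator (?A n) \<omega>)"
          using n by (intro SUP_upper2[of n]) (auto simp del: jump_time.simps)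
        show "f (?X \<omega>) * indicator (?A n) \<omega> \<le> f (?X \<omega>)" for n
          by (auto split: split_indicator)
      qed
    qed
  qed
  also have "\<dots> = (SUP n. \<integral>\<^sup>+\<omega>. f (?X \<omega>) * indicator (?A n) \<omega> \<partial>noise)"
  proof (rule nn_integral_monotone_convergence_SUP_AE)
    show "AE \<omega> in noise. f (?X \<omega>) * indicator (?A n) \<omega> \<le> f (?X \<omega>) * indicator (?A (Suc n)) \<omega>" for n
    proof (rule AE_I2)
      fix \<omega> assume \<omega>: "\<omega> \<in> space noise"
      have "jump_time lmax \<omega> (Suc n) \<le> jump_time lmax \<omega> (Suc (Suc n))"
        using noise_pos[OF \<omega>, of "Suc n"] lmax_pos by simp
      then show "f (?X \<omega>) * indicator (?A n) \<omega> \<le> f (?X \<omega>) * indicator (?A (Suc n)) \<omega>"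
        by (auto split: split_indicator simp del: jump_time.simps)
    qed
    show "(\<lambda>\<omega>. f (?X \<omega>) * indicator (?A n) \<omega>) \<in> borel_measurable noise" for n
      by (simp del: jump_time.simps, measurable)
  qed
  also have "\<dots> = expect \<mu> f s t x"
    unfolding expect_def nn_integral_truncated_process[OF \<mu> f s] ..
  finally show ?thesis .
qed

lemma expect_measurable:
  assumes "\<mu> \<in> prob_flows" "f \<in> borel_measurable borel"
    and "a \<in> M \<rightarrow>\<^sub>M borel" "b \<in> M \<rightarrow>\<^sub>M borel" "c \<in> M \<rightarrow>\<^sub>M borel"
  shows "(\<lambda>z. expect \<mu> f (a z) (b z) (c z)) \<in> borel_measurable M"
  unfolding expect_def
  by (intro borel_measurable_SUP trunc_measurable_times assms) auto

lemma jump_kernel_measurable_joint: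
  assumes \<mu>: "\<mu> \<in> prob_flows" and s: "0 \<le> s"
  shows "(\<lambda>p. R \<mu> s (max s (fst p)) (snd p)) \<in> borel \<Otimes>\<^sub>M borel \<rightarrow>\<^sub>M prob_algebra borel"
proof (rule measurable_prob_algebraI)
  show "prob_space (R \<mu> s (max s (fst p)) (snd p))" for p
    by (rule space_prob_algebra_borelD(3)[OF jump_kernel_in_probs[OF \<mu> s]])
  show "(\<lambda>p. R \<mu> s (max s (fst p)) (snd p)) \<in> borel \<Otimes>\<^sub>M borel \<rightarrow>\<^sub>M subprob_algebra borel"
  proof (rule measurable_subprob_algebra)
    fix p :: "real \<times> 'e"
    show "subprob_space (R \<mu> s (max s (fst p)) (snd p))"
      by (intro prob_space_imp_subprob_space space_prob_algebra_borelD(3)[OF jump_kernel_in_probs[OF \<mu> s]])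
    show sets: "sets (R \<mu> s (max s (fst p)) (snd p)) = sets borel" for p :: "real \<times> 'e"
      by (rule space_prob_algebra_borelD(1)[OF jump_kernel_in_probs[OF \<mu> s]])
    fix A :: "'e set" assume A: "A \<in> sets borel"
    have "emeasure (R \<mu> s (max s (fst p)) (snd p)) A = expect \<mu> (indicator A) s (max s (fst p)) (snd p)" for p
      using A s by (subst nn_integral_jump_kernel[OF \<mu>, symmetric]) (auto simp: sets)
    then show "(\<lambda>p. emeasure (R \<mu> s (max s (fst p)) (snd p)) A) \<in> borel_measurable (borel \<Otimes>\<^sub>M borel)"
      using A by (auto intro!: expect_measurable[OF \<mu>])
  qed
qed

lemma jump_kernel_measurable:
  assumes \<mu>: "\<mu> \<in> prob_flows" and s: "0 \<le> s" "s \<le> t"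
  shows "R \<mu> s t \<in> borel \<rightarrow>\<^sub>M prob_algebra borel"
proof -
  have "(\<lambda>x. (\<lambda>p. R \<mu> s (max s (fst p)) (snd p)) (t, x)) \<in> borel \<rightarrow>\<^sub>M prob_algebra borel"
    by (rule measurable_compose[OF _ jump_kernel_measurable_joint[OF \<mu> s(1)]]) measurable
  then show ?thesis using s by (simp add: max_def)
qed

lemma ring_law_measurable_times:
  assumes \<mu>: "\<mu> \<in> prob_flows"
    and [measurable]: "a \<in> M \<rightarrow>\<^sub>M borel" "b \<in> M \<rightarrow>\<^sub>M borel" "c \<in> M \<rightarrow>\<^sub>M borel"
  shows "(\<lambda>z. ring_law \<mu> (a z) (b z) (c z)) \<in> M \<rightarrow>\<^sub>M prob_algebra borel"
  using measurable_compose[OF _ ring_law_measurable[OF \<mu>], of "\<lambda>z. (a z, b z, c z)" M] by simp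

lemma nn_integral_ring_law_measurable:
  assumes \<mu>: "\<mu> \<in> prob_flows"
    and "a \<in> M \<rightarrow>\<^sub>M borel" "b \<in> M \<rightarrow>\<^sub>M borel" "c \<in> M \<rightarrow>\<^sub>M borel"
    and "(\<lambda>p. g (fst p) (snd p)) \<in> borel_measurable (M \<Otimes>\<^sub>M borel)"
  shows "(\<lambda>w. \<integral>\<^sup>+z. g w z \<partial>ring_law \<mu> (a w) (b w) (c w)) \<in> borel_measurable M"
  using assms by (intro nn_integral_measurable_prob_algebra2[where N=borel] ring_law_measurable_times)
    (auto simp: split_beta')

text \<open>Monotone convergence in the recursion: the limit is a fixed point.\<close>

lemma expect_backward:
  assumes \<mu>: "\<mu> \<in> prob_flows" and f [measurable]: "f \<in> borel_measurable borel"
  shows "expect \<mu> f s t x = ennreal (exp (- lmax * (t - s))) * (\<integral>\<^sup>+y. f y \<partial>motion (t - s) x)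
    + (\<integral>\<^sup>+r. ennreal (lmax * exp (- lmax * (r - s))) * (\<integral>\<^sup>+z. expect \<mu> f r t z \<partial>ring_law \<mu> s r x)
        * indicator {s..t} r \<partial>lborel)" (is "_ = ?a + ?b")
proof -
  have m: "(\<lambda>z. trunc n \<mu> f r t z) \<in> borel_measurable borel" for n r
    by (intro trunc_measurable_times[OF \<mu> f]) auto
  have m2: "(\<lambda>r. \<integral>\<^sup>+z. trunc n \<mu> f r t z \<partial>ring_law \<mu> s r x) \<in> borel_measurable borel" for n
    by (intro nn_integral_ring_law_measurable[OF \<mu>] trunc_measurable_times[OF \<mu> f]) auto
  note [measurable] = m m2
  have 1: "(\<integral>\<^sup>+z. expect \<mu> f r t z \<partial>ring_law \<mu> s r x) = (SUP n. \<integral>\<^sup>+z. trunc n \<mu> f r t z \<partial>ring_law \<mu> s r x)" for r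
  proof -
    have [measurable_cong]: "sets (ring_law \<mu> s r x) = sets borel"
      by (rule space_prob_algebra_borelD) (simp add: \<mu>)
    show ?thesis unfolding expect_def
      by (intro nn_integral_monotone_convergence_SUP)
        (auto simp: incseq_def le_fun_def intro!: incseqD[OF trunc_incseq])
  qed
  have "?b = (\<integral>\<^sup>+r. (SUP n. ennreal (lmax * exp (- lmax * (r - s))) * (\<integral>\<^sup>+z. trunc n \<mu> f r t z \<partial>ring_law \<mu> s r x)
        * indicator {s..t} r) \<partial>lborel)"
    unfolding 1 by (simp add: SUP_mult_left_ennreal SUP_mult_right_ennreal)
  also have "\<dots> = (SUP n. \<integral>\<^sup>+r. ennreal (lmax * exp (- lmax * (r - s))) * (\<integral>\<^sup>+z. trunc n \<mu> f r t z \<partial>ring_law \<mu> s r x)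
        * indicator {s..t} r \<partial>lborel)"
    by (intro nn_integral_monotone_convergence_SUP incseq_SucI le_funI mult_mono nn_integral_mono trunc_le_Suc) auto
  finally have "?a + ?b = (SUP n. trunc (Suc n) \<mu> f s t x)"
    by (simp add: ennreal_SUP_add_right)
  also have "\<dots> = expect \<mu> f s t x"
    unfolding expect_def using trunc_incseq
    by (intro antisym SUP_least) (auto intro: SUP_upper2 trunc_le_Suc simp del: trunc.simps)
  finally show ?thesis ..
qed

text \<open>The event without any ring, which provides the minorisation by \<open>P\<close>.\<close>

lemma expect_ge_no_ring:
  "ennreal (exp (- lmax * (t - s))) * (\<integral>\<^sup>+y. f y \<partial>motion (t - s) x) \<le> expect \<mu> f s t x"
  unfolding expect_def by (rule SUP_upper2[of 0]) auto

text \<open>The backward equation from time \<open>r\<close>, transported back to time \<open>s\<close> along paths without ring.\<close>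

lemma backward_from_later:
  assumes \<mu>: "\<mu> \<in> prob_flows" and f [measurable]: "f \<in> borel_measurable borel" and le: "s \<le> r" "r \<le> t"
  shows "ennreal (exp (- lmax * (r - s))) * (\<integral>\<^sup>+y. expect \<mu> f r t y \<partial>motion (r - s) x)
    = ennreal (exp (- lmax * (t - s))) * (\<integral>\<^sup>+y. f y \<partial>motion (t - s) x)
    + (\<integral>\<^sup>+q. ennreal (lmax * exp (- lmax * (q - s))) * (\<integral>\<^sup>+z. expect \<mu> f q t z \<partial>ring_law \<mu> s q x)
        * indicator {r..t} q \<partial>lborel)"
proof -
  let ?T = "motion (r - s) x"
  have [measurable_cong]: "sets ?T = sets borel" by (rule space_prob_algebra_borelD) simp
  have [measurable]: "(\<lambda>z. expect \<mu> f q t z) \<in> borel_measurable borel" for q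
    by (intro expect_measurable[OF \<mu> f]) auto
  have [measurable]: "(\<lambda>p. \<integral>\<^sup>+z. expect \<mu> f (snd p) t z \<partial>ring_law \<mu> r (snd p) (fst p)) \<in> borel_measurable (borel \<Otimes>\<^sub>M borel)"
    by (intro nn_integral_ring_law_measurable[OF \<mu>] expect_measurable[OF \<mu> f]) auto
  have J: "(\<lambda>p. ennreal (lmax * exp (- lmax * (snd p - r))) *
      (\<integral>\<^sup>+z. expect \<mu> f (snd p) t z \<partial>ring_law \<mu> r (snd p) (fst p)) * indicator {r..t} (snd p)) \<in> borel_measurable (borel \<Otimes>\<^sub>M borel)"
    by measurable
  have [measurable]: "(\<lambda>y. \<integral>\<^sup>+q. ennreal (lmax * exp (- lmax * (q - r))) * (\<integral>\<^sup>+z. expect \<mu> f q t z \<partial>ring_law \<mu> r q y)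
        * indicator {r..t} q \<partial>lborel) \<in> borel_measurable borel"
    using J by (intro lborel.borel_measurable_nn_integral) (simp add: split_beta')
  have exp_split: "ennreal (exp (- lmax * (r - s))) * ennreal (c * exp (- lmax * (q - r))) = ennreal (c * exp (- lmax * (q - s)))"
    if "0 \<le> c" for c q
  proof -
    have "exp (- lmax * (r - s)) * exp (- lmax * (q - r)) = exp (- lmax * (q - s))"
      by (simp flip: exp_add add: algebra_simps)
    then show ?thesis using that by (simp flip: ennreal_mult add: ac_simps)
  qed
  have "(\<integral>\<^sup>+y. expect \<mu> f r t y \<partial>?T) = ennreal (exp (- lmax * (t - r))) * (\<integral>\<^sup>+y. \<integral>\<^sup>+z. f z \<partial>motion (t - r) y \<partial>?T)
     + (\<integral>\<^sup>+y. \<integral>\<^sup>+q. ennreal (lmax * exp (- lmax * (q - r))) * (\<integral>\<^sup>+z. expect \<mu> f q t z \<partial>ring_law \<mu> r q y)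
        * indicator {r..t} q \<partial>lborel \<partial>?T)"
    by (subst expect_backward[OF \<mu> f]) (simp add: nn_integral_add nn_integral_cmult)
  also have "(\<integral>\<^sup>+y. \<integral>\<^sup>+z. f z \<partial>motion (t - r) y \<partial>?T) = (\<integral>\<^sup>+z. f z \<partial>motion (t - s) x)"
  proof -
    have "motion (t - s) x = motion (r - s) x \<bind> motion (t - r)"
      using motion_add[of "r - s" "t - r" x] le by simp
    then show ?thesis by (simp add: nn_integral_bind_prob[OF f motion_in_probs motion_kernel])
  qed
  also have "(\<integral>\<^sup>+y. \<integral>\<^sup>+q. ennreal (lmax * exp (- lmax * (q - r))) * (\<integral>\<^sup>+z. expect \<mu> f q t z \<partial>ring_law \<mu> r q y)
        * indicator {r..t} q \<partial>lborel \<partial>?T)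
    = (\<integral>\<^sup>+q. ennreal (lmax * exp (- lmax * (q - r))) * (\<integral>\<^sup>+z. expect \<mu> f q t z \<partial>ring_law \<mu> s q x) * indicator {r..t} q \<partial>lborel)"
  proof (subst nn_integral_swap_lborel[OF motion_in_probs J], intro nn_integral_cong)
    fix q
    have [measurable]: "(\<lambda>y. \<integral>\<^sup>+z. expect \<mu> f q t z \<partial>ring_law \<mu> r q y) \<in> borel_measurable borel"
      by (intro nn_integral_ring_law_measurable[OF \<mu>] expect_measurable[OF \<mu> f]) auto
    show "(\<integral>\<^sup>+y. ennreal (lmax * exp (- lmax * (q - r))) * (\<integral>\<^sup>+z. expect \<mu> f q t z \<partial>ring_law \<mu> r q y) * indicator {r..t} q \<partial>?T)
      = ennreal (lmax * exp (- lmax * (q - r))) * (\<integral>\<^sup>+z. expect \<mu> f q t z \<partial>ring_law \<mu> s q x) * indicator {r..t} q"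
      using ring_law_add[OF \<mu> le(1), of q "\<lambda>z. expect \<mu> f q t z" x]
      by (cases "q \<in> {r..t}") (auto simp: nn_integral_cmult)
  qed
  finally have "ennreal (exp (- lmax * (r - s))) * (\<integral>\<^sup>+y. expect \<mu> f r t y \<partial>?T)
    = ennreal (exp (- lmax * (r - s))) * ennreal (exp (- lmax * (t - r))) * (\<integral>\<^sup>+z. f z \<partial>motion (t - s) x)
      + ennreal (exp (- lmax * (r - s))) * (\<integral>\<^sup>+q. ennreal (lmax * exp (- lmax * (q - r))) * (\<integral>\<^sup>+z. expect \<mu> f q t z \<partial>ring_law \<mu> s q x) * indicator {r..t} q \<partial>lborel)"
    by (simp only: distrib_left mult.assoc)
  also have "\<dots> = ennreal (exp (- lmax * (t - s))) * (\<integral>\<^sup>+y. f y \<partial>motion (t - s) x)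
    + (\<integral>\<^sup>+q. ennreal (lmax * exp (- lmax * (q - s))) * (\<integral>\<^sup>+z. expect \<mu> f q t z \<partial>ring_law \<mu> s q x) * indicator {r..t} q \<partial>lborel)"
  proof -
    have [measurable]: "(\<lambda>q. \<integral>\<^sup>+z. expect \<mu> f q t z \<partial>ring_law \<mu> s q x) \<in> borel_measurable borel"
      by (intro nn_integral_ring_law_measurable[OF \<mu>] expect_measurable[OF \<mu> f]) auto
    show ?thesis
      using exp_split[of 1 t] exp_split[of lmax] lmax_pos
      by (subst nn_integral_cmult[symmetric]) (auto simp: mult.assoc[symmetric] intro!: arg_cong2[where f="(+)"])
  qed
  finally show ?thesis .
qed

text \<open>On \<open>[s, r]\<close> the right-hand side solves the backward equation with terminal value
  \<open>expect \<mu> f r t\<close>, and the left-hand side is the \<open>n\<close>-th iterate towards the smallest nonnegative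
  solution.\<close>

lemma trunc_compose_le:
  assumes \<mu>: "\<mu> \<in> prob_flows" and f [measurable]: "f \<in> borel_measurable borel" and le: "s \<le> r" "r \<le> t"
  shows "trunc n \<mu> (expect \<mu> f r t) s r x \<le> expect \<mu> f s t x"
  using le
proof (induction n arbitrary: s x)
  case 0
  show ?case
    unfolding trunc.simps backward_from_later[OF \<mu> f 0] expect_backward[OF \<mu> f, of s]
    using 0 by (intro add_left_mono nn_integral_mono mult_left_mono) (auto split: split_indicator)
next
  case (Suc n)
  have [measurable]: "(\<lambda>q. \<integral>\<^sup>+z. expect \<mu> f q t z \<partial>ring_law \<mu> s q x) \<in> borel_measurable borel"
    by (intro nn_integral_ring_law_measurable[OF \<mu>] expect_measurable[OF \<mu> f]) auto
  let ?g = "\<lambda>q. ennreal (lmax * exp (- lmax * (q - s))) * (\<integral>\<^sup>+z. expect \<mu> f q t z \<partial>ring_law \<mu> s q x)"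
  have "(\<integral>\<^sup>+q. ennreal (lmax * exp (- lmax * (q - s))) * (\<integral>\<^sup>+z. trunc n \<mu> (expect \<mu> f r t) q r z \<partial>ring_law \<mu> s q x)
        * indicator {s..r} q \<partial>lborel) \<le> (\<integral>\<^sup>+q. ?g q * indicator {s..r} q \<partial>lborel)"
    by (intro nn_integral_mono) (auto split: split_indicator intro!: mult_left_mono nn_integral_mono Suc.IH Suc.prems)
  then have "trunc (Suc n) \<mu> (expect \<mu> f r t) s r x \<le> ennreal (exp (- lmax * (t - s))) * (\<integral>\<^sup>+y. f y \<partial>motion (t - s) x)
    + (\<integral>\<^sup>+q. ?g q * indicator {r..t} q \<partial>lborel) + (\<integral>\<^sup>+q. ?g q * indicator {s..r} q \<partial>lborel)"
    unfolding trunc.simps backward_from_later[OF \<mu> f Suc.prems] by (intro add_left_mono)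
  also have "\<dots> = ennreal (exp (- lmax * (t - s))) * (\<integral>\<^sup>+y. f y \<partial>motion (t - s) x)
    + (\<integral>\<^sup>+q. ?g q * indicator {r..t} q + ?g q * indicator {s..r} q \<partial>lborel)"
    by (subst nn_integral_add) (auto simp: add.assoc)
  also have "(\<integral>\<^sup>+q. ?g q * indicator {r..t} q + ?g q * indicator {s..r} q \<partial>lborel) = (\<integral>\<^sup>+q. ?g q * indicator {s..t} q \<partial>lborel)"
  proof (rule nn_integral_cong_AE)
    show "AE q in lborel. ?g q * indicator {r..t} q + ?g q * indicator {s..r} q = ?g q * indicator {s..t} q"
      using AE_lborel_singleton[of r] by eventually_elim (use Suc.prems in \<open>auto split: split_indicator\<close>)
  qed
  finally show ?case unfolding expect_backward[OF \<mu> f, of s] .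
qed

lemma expect_compose_le:
  assumes "\<mu> \<in> prob_flows" "f \<in> borel_measurable borel" "s \<le> r" "r \<le> t"
  shows "expect \<mu> (expect \<mu> f r t) s r x \<le> expect \<mu> f s t x"
  unfolding expect_def[of \<mu> "expect \<mu> f r t"] by (intro SUP_least trunc_compose_le assms)

text \<open>Only an inequality comes from the iteration; the total masses agree.\<close>

lemma chapman_kolmogorov:
  assumes \<mu>: "\<mu> \<in> prob_flows" and le: "0 \<le> s" "s \<le> r" "r \<le> t"
  shows "R \<mu> s r x \<bind> R \<mu> r t = R \<mu> s t x"
proof (rule prob_measure_eqI_le)
  have k: "R \<mu> s r x \<in> probs" "R \<mu> r t \<in> borel \<rightarrow>\<^sub>M prob_algebra borel"
    using le by (auto intro: jump_kernel_in_probs[OF \<mu>] jump_kernel_measurable[OF \<mu>])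
  show "R \<mu> s t x \<in> probs" using le by (intro jump_kernel_in_probs[OF \<mu>]) auto
  show "R \<mu> s r x \<bind> R \<mu> r t \<in> probs"
    using prob_space_bind'[OF k] sets_bind'[OF k] by (simp add: space_prob_algebra)
  fix A :: "'e set" assume A: "A \<in> sets borel"
  note [simp] = space_prob_algebra_borelD[OF jump_kernel_in_probs[OF \<mu>]]
  have "emeasure (R \<mu> s r x \<bind> R \<mu> r t) A = (\<integral>\<^sup>+y. emeasure (R \<mu> r t y) A \<partial>R \<mu> s r x)"
    by (rule emeasure_bind_prob_algebra[OF k A])
  also have "\<dots> = (\<integral>\<^sup>+y. expect \<mu> (indicator A) r t y \<partial>R \<mu> s r x)"
    using A le by (intro nn_integral_cong) (simp add: nn_integral_jump_kernel[OF \<mu>, symmetric])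
  also have "\<dots> = expect \<mu> (expect \<mu> (indicator A) r t) s r x"
    using A le by (intro nn_integral_jump_kernel[OF \<mu>] expect_measurable[OF \<mu>]) auto
  also have "\<dots> \<le> expect \<mu> (indicator A) s t x"
    using A le by (intro expect_compose_le[OF \<mu>]) auto
  also have "\<dots> = emeasure (R \<mu> s t x) A"
    using A le by (simp add: nn_integral_jump_kernel[OF \<mu>, symmetric])
  finally show "emeasure (R \<mu> s r x \<bind> R \<mu> r t) A \<le> emeasure (R \<mu> s t x) A" .
qed

end

section \<open>Weighted total variation\<close>

text \<open>One of the two halves of the weighted norm. Working with the two halves separately makes it possible to stay within
  nonnegative functions without losing a factor 2.\<close>

abbreviation upper_norm :: "('e::polish_space \<Rightarrow> real) \<Rightarrow> 'e measure \<Rightarrow> 'e measure \<Rightarrow> ennreal" where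
  "upper_norm W \<mu> \<nu> \<equiv> (\<integral>\<^sup>+x. ennreal (W x) \<partial>upper_variation \<mu> \<nu>)"

lemma finite_density_exists:
  assumes D: "prob_space D" "sets D = sets borel" and \<mu>: "\<mu> \<in> probs" and ac: "absolutely_continuous D \<mu>"
  shows "\<exists>a\<in>borel_measurable borel. density D a = \<mu> \<and> (\<forall>x. a x \<noteq> \<top>)"
proof -
  interpret D: prob_space D by (rule D)
  interpret M: prob_space \<mu> by (rule space_prob_algebra_borelD[OF \<mu>])
  note [measurable_cong] = D(2)
  obtain a where a [measurable]: "a \<in> borel_measurable D" "density D a = \<mu>"
    using D.Radon_Nikodym[OF ac] D(2) space_prob_algebra_borelD(1)[OF \<mu>] by auto
  have "(\<integral>\<^sup>+x. a x \<partial>D) = emeasure (density D a) (space D)" by (subst emeasure_density) (auto intro!: nn_integral_cong)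
  also have "\<dots> = 1" using M.emeasure_space_1 a(2) by (metis space_density)
  finally have "AE x in D. a x \<noteq> \<infinity>" by (intro nn_integral_PInf_AE) auto
  then have "density D (\<lambda>x. if a x = \<top> then 0 else a x) = density D a"
    by (intro density_cong) (auto elim: eventually_mono)
  then show ?thesis using a by (intro bexI[of _ "\<lambda>x. if a x = \<top> then 0 else a x"]) auto
qed

text \<open>The average of the two measures dominates both. Finite densities avoid the pitfalls
  of \<open>\<infinity> - \<infinity>\<close> in the truncated subtraction.\<close>

lemma obtain_common_density:
  fixes \<mu> \<nu> :: "'e::polish_space measure"
  assumes \<mu>: "\<mu> \<in> probs" and \<nu>: "\<nu> \<in> probs"
  obtains D and a b :: "'e \<Rightarrow> ennreal" where "sets D = sets borel"
    "a \<in> borel_measurable borel" "b \<in> borel_measurable borel" "density D a = \<mu>" "density D b = \<nu>"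
    "\<And>x. a x \<noteq> \<top>" "\<And>x. b x \<noteq> \<top>"
proof -
  define K where "K c = (if c then \<mu> else \<nu>)" for c
  define D where "D = measure_pmf (bernoulli_pmf (1/2)) \<bind> K"
  have K: "K \<in> measure_pmf (bernoulli_pmf (1/2)) \<rightarrow>\<^sub>M prob_algebra borel"
    using \<mu> \<nu> by (simp add: K_def cong: measurable_cong_sets)
  have B: "measure_pmf (bernoulli_pmf (1/2)) \<in> space (prob_algebra (measure_pmf (bernoulli_pmf (1/2))))"
    by (simp add: space_prob_algebra measure_pmf.prob_space_axioms)
  have D: "sets D = sets borel" "prob_space D"
    unfolding D_def using sets_bind'[OF B K] prob_space_bind'[OF B K] by auto
  interpret D: prob_space D by (rule D)
  have e: "emeasure D A = ennreal (1/2) * emeasure \<mu> A + ennreal (1/2) * emeasure \<nu> A" if "A \<in> sets borel" for A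
    unfolding D_def using emeasure_bind_prob_algebra[OF B K that]
    by (simp add: K_def nn_integral_bernoulli_pmf ac_simps)
  have "absolutely_continuous D \<mu>" "absolutely_continuous D \<nu>"
    unfolding absolutely_continuous_def
    using D space_prob_algebra_borelD[OF \<mu>] space_prob_algebra_borelD[OF \<nu>]
    by (auto simp: null_sets_def e ennreal_mult_eq_top_iff)
  from this[THEN finite_density_exists[OF D(2,1), rotated]] \<mu> \<nu> show thesis
    using D(1) by (metis that)
qed

lemma ennreal_le_add_diff: "(a::ennreal) \<le> b + (a - b)"
proof (cases "a \<le> b")
  case True
  then show ?thesis using add_increasing2[of "a - b" a b] by simp
next
  case False
  then have "b + (a - b) = a" by (intro add_diff_inverse_ennreal) simp
  then show ?thesis by (metis order_refl)
qed

text \<open>The supremum defining the upper variation is attained on the set where the first density is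
  the larger one.\<close>

lemma upper_variation_density:
  fixes \<mu> \<nu> :: "'e::polish_space measure"
  assumes \<mu>: "\<mu> \<in> probs" and \<nu>: "\<nu> \<in> probs" and D: "sets D = sets borel"
    and [measurable]: "a \<in> borel_measurable borel" "b \<in> borel_measurable borel"
    and a: "density D a = \<mu>" and b: "density D b = \<nu>"
    and top: "\<And>x. a x \<noteq> \<top>" "\<And>x. b x \<noteq> \<top>"
  shows "upper_variation \<mu> \<nu> = density D (\<lambda>x. a x - b x)"
proof (rule measure_eqI)
  note [measurable_cong] = D
  note s\<mu> = space_prob_algebra_borelD[OF \<mu>] and s\<nu> = space_prob_algebra_borelD[OF \<nu>]
  interpret M: prob_space \<mu> by (rule s\<mu>)
  interpret N: prob_space \<nu> by (rule s\<nu>)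
  have "sets (upper_variation \<mu> \<nu>) = sets \<mu>"
    unfolding upper_variation_def by (simp add: sets.sets_measure_of_eq)
  then show sets: "sets (upper_variation \<mu> \<nu>) = sets (density D (\<lambda>x. a x - b x))"
    using s\<mu> D by simp
  fix A assume "A \<in> sets (upper_variation \<mu> \<nu>)"
  then have A [measurable]: "A \<in> sets borel" using sets D by simp
  have em: "emeasure \<mu> B = (\<integral>\<^sup>+x. a x * indicator B x \<partial>D)" "emeasure \<nu> B = (\<integral>\<^sup>+x. b x * indicator B x \<partial>D)"
    "emeasure (density D (\<lambda>x. a x - b x)) B = (\<integral>\<^sup>+x. (a x - b x) * indicator B x \<partial>D)" if "B \<in> sets borel" for B
    using that by (auto simp flip: a b simp: emeasure_density D)
  have "emeasure (upper_variation \<mu> \<nu>) A = (SUP B\<in>{B \<in> sets \<mu>. B \<subseteq> A}. emeasure \<mu> B - emeasure \<nu> B)"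
    by (intro emeasure_upper_variation) (use A s\<mu> s\<nu> M.finite_measure_axioms N.finite_measure_axioms in auto)
  also have "\<dots> = emeasure (density D (\<lambda>x. a x - b x)) A"
  proof (intro antisym SUP_least)
    fix B assume "B \<in> {B \<in> sets \<mu>. B \<subseteq> A}"
    then have B [measurable]: "B \<in> sets borel" and BA: "B \<subseteq> A" using s\<mu> by auto
    have "emeasure \<mu> B \<le> (\<integral>\<^sup>+x. b x * indicator B x + (a x - b x) * indicator A x \<partial>D)"
      unfolding em[OF B] using BA
      by (intro nn_integral_mono) (auto split: split_indicator intro: ennreal_le_add_diff)
    also have "\<dots> = emeasure \<nu> B + emeasure (density D (\<lambda>x. a x - b x)) A"
      using A unfolding em[OF B] em[OF A] by (intro nn_integral_add) measurable
    finally show "emeasure \<mu> B - emeasure \<nu> B \<le> emeasure (density D (\<lambda>x. a x - b x)) A"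
      by (simp add: ennreal_minus_le_iff add.commute)
  next
    let ?B = "{x \<in> A. b x < a x}"
    have B [measurable]: "?B \<in> sets borel" using A by measurable
    have fin: "(\<integral>\<^sup>+x. b x * indicator ?B x \<partial>D) \<noteq> \<infinity>"
      unfolding em(2)[OF B, symmetric] by (simp add: N.emeasure_finite)
    have "emeasure (density D (\<lambda>x. a x - b x)) A = (\<integral>\<^sup>+x. a x * indicator ?B x - b x * indicator ?B x \<partial>D)"
      unfolding em[OF A] using top
      by (intro nn_integral_cong) (auto split: split_indicator simp: diff_eq_0_iff_ennreal not_less less_top[symmetric])
    also have "\<dots> = emeasure \<mu> ?B - emeasure \<nu> ?B"
      unfolding em[OF B] using fin
      by (intro nn_integral_diff) (auto split: split_indicator intro!: AE_I2)
    also have "\<dots> \<le> (SUP B\<in>{B \<in> sets \<mu>. B \<subseteq> A}. emeasure \<mu> B - emeasure \<nu> B)"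
      using B s\<mu> by (intro SUP_upper) auto
    finally show "emeasure (density D (\<lambda>x. a x - b x)) A \<le> (SUP B\<in>{B \<in> sets \<mu>. B \<subseteq> A}. emeasure \<mu> B - emeasure \<nu> B)" .
  qed
  finally show "emeasure (upper_variation \<mu> \<nu>) A = emeasure (density D (\<lambda>x. a x - b x)) A" .
qed

lemma sets_upper_variation:
  "\<mu> \<in> probs \<Longrightarrow> sets (upper_variation \<mu> \<nu>) = sets borel"
  using sets.sets_measure_of_eq[of \<mu>] unfolding upper_variation_def by (simp only: space_prob_algebra_borelD(1))

text \<open>The identity \<open>\<mu> - \<nu> = (\<mu> - \<nu>)\<^sup>+ - (\<mu> - \<nu>)\<^sup>-\<close>, written without subtraction.\<close>

lemma jordan_decomposition:
  fixes \<mu> \<nu> :: "'e::polish_space measure"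
  assumes \<mu>: "\<mu> \<in> probs" and \<nu>: "\<nu> \<in> probs" and f [measurable]: "f \<in> borel_measurable borel"
  shows "(\<integral>\<^sup>+x. f x \<partial>\<mu>) + (\<integral>\<^sup>+x. f x \<partial>upper_variation \<nu> \<mu>) = (\<integral>\<^sup>+x. f x \<partial>\<nu>) + (\<integral>\<^sup>+x. f x \<partial>upper_variation \<mu> \<nu>)"
proof -
  obtain D a b where D [measurable_cong]: "sets D = sets borel"
    and [measurable]: "a \<in> borel_measurable borel" "b \<in> borel_measurable borel"
    and a: "density D a = \<mu>" and b: "density D b = \<nu>"
    and top: "\<And>x. a x \<noteq> \<top>" "\<And>x. b x \<noteq> \<top>" by (rule obtain_common_density[OF \<mu> \<nu>]) blast
  have I: "(\<integral>\<^sup>+x. f x \<partial>\<mu>) = (\<integral>\<^sup>+x. a x * f x \<partial>D)" "(\<integral>\<^sup>+x. f x \<partial>\<nu>) = (\<integral>\<^sup>+x. b x * f x \<partial>D)"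
    "(\<integral>\<^sup>+x. f x \<partial>upper_variation \<mu> \<nu>) = (\<integral>\<^sup>+x. (a x - b x) * f x \<partial>D)"
    "(\<integral>\<^sup>+x. f x \<partial>upper_variation \<nu> \<mu>) = (\<integral>\<^sup>+x. (b x - a x) * f x \<partial>D)"
    unfolding upper_variation_density[OF \<mu> \<nu> D _ _ a b top, simplified] upper_variation_density[OF \<nu> \<mu> D _ _ b a top(2,1), simplified]
    by (auto simp flip: a b simp: nn_integral_density)
  have swap: "a x + (b x - a x) = b x + (a x - b x)" for x
    using top[of x] by (cases "a x \<le> b x")
      (auto simp: add_diff_inverse_ennreal diff_eq_0_iff_ennreal less_top[symmetric])
  have "(\<integral>\<^sup>+x. f x \<partial>\<mu>) + (\<integral>\<^sup>+x. f x \<partial>upper_variation \<nu> \<mu>) = (\<integral>\<^sup>+x. (a x + (b x - a x)) * f x \<partial>D)"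
    unfolding I by (subst nn_integral_add[symmetric]) (auto simp: distrib_right)
  also have "\<dots> = (\<integral>\<^sup>+x. f x \<partial>\<nu>) + (\<integral>\<^sup>+x. f x \<partial>upper_variation \<mu> \<nu>)"
    unfolding I swap by (subst nn_integral_add[symmetric]) (auto simp: distrib_right)
  finally show ?thesis .
qed

text \<open>One half of the dual description of the norm: it bounds the difference of integrals. The other
  half is \<open>upper_norm_least\<close>.\<close>

lemma nn_integral_le_upper_norm:
  assumes \<mu>: "\<mu> \<in> probs" and \<nu>: "\<nu> \<in> probs" and W: "W \<in> borel_measurable borel"
    and f: "f \<in> borel_measurable borel" and le: "\<And>x. f x \<le> c * ennreal (W x)"
  shows "(\<integral>\<^sup>+x. f x \<partial>\<mu>) \<le> (\<integral>\<^sup>+x. f x \<partial>\<nu>) + c * upper_norm W \<mu> \<nu>"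
proof -
  have [measurable_cong]: "sets (upper_variation \<mu> \<nu>) = sets borel" by (rule sets_upper_variation[OF \<mu>])
  note [measurable] = W f
  have "(\<integral>\<^sup>+x. f x \<partial>\<mu>) \<le> (\<integral>\<^sup>+x. f x \<partial>\<mu>) + (\<integral>\<^sup>+x. f x \<partial>upper_variation \<nu> \<mu>)" by simp
  also have "\<dots> = (\<integral>\<^sup>+x. f x \<partial>\<nu>) + (\<integral>\<^sup>+x. f x \<partial>upper_variation \<mu> \<nu>)"
    by (rule jordan_decomposition[OF \<mu> \<nu> f])
  also have "(\<integral>\<^sup>+x. f x \<partial>upper_variation \<mu> \<nu>) \<le> (\<integral>\<^sup>+x. c * ennreal (W x) \<partial>upper_variation \<mu> \<nu>)"
    by (intro nn_integral_mono le)
  also have "\<dots> = c * upper_norm W \<mu> \<nu>" by (intro nn_integral_cmult) measurable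
  finally show ?thesis by (simp add: add_left_mono)
qed

text \<open>A Hahn decomposition that serves all weights at once.\<close>

lemma obtain_positive_set:
  fixes \<mu> \<nu> :: "'e::polish_space measure"
  assumes \<mu>: "\<mu> \<in> probs" and \<nu>: "\<nu> \<in> probs"
  obtains Y where "Y \<in> sets borel"
    "\<And>W. W \<in> borel_measurable borel \<Longrightarrow> (\<integral>\<^sup>+x. ennreal (W x) \<partial>\<nu>) < \<infinity> \<Longrightarrow>
       upper_norm W \<mu> \<nu> = (\<integral>\<^sup>+x. ennreal (W x) * indicator Y x \<partial>\<mu>) - (\<integral>\<^sup>+x. ennreal (W x) * indicator Y x \<partial>\<nu>)"
    "\<And>W. W \<in> borel_measurable borel \<Longrightarrow> (\<integral>\<^sup>+x. ennreal (W x) \<partial>\<mu>) < \<infinity> \<Longrightarrow>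
       upper_norm W \<nu> \<mu> = (\<integral>\<^sup>+x. ennreal (W x) * indicator (-Y) x \<partial>\<nu>) - (\<integral>\<^sup>+x. ennreal (W x) * indicator (-Y) x \<partial>\<mu>)"
    "\<And>W. W \<in> borel_measurable borel \<Longrightarrow> (\<integral>\<^sup>+x. ennreal (W x) * indicator Y x \<partial>\<nu>) \<le> (\<integral>\<^sup>+x. ennreal (W x) * indicator Y x \<partial>\<mu>)"
    "\<And>W. W \<in> borel_measurable borel \<Longrightarrow> (\<integral>\<^sup>+x. ennreal (W x) * indicator (-Y) x \<partial>\<mu>) \<le> (\<integral>\<^sup>+x. ennreal (W x) * indicator (-Y) x \<partial>\<nu>)"
proof -
  obtain D a b where D [measurable_cong]: "sets D = sets borel"
    and [measurable]: "a \<in> borel_measurable borel" "b \<in> borel_measurable borel"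
    and a: "density D a = \<mu>" and b: "density D b = \<nu>"
    and top: "\<And>x. a x \<noteq> \<top>" "\<And>x. b x \<noteq> \<top>" by (rule obtain_common_density[OF \<mu> \<nu>]) blast
  have int: "(\<integral>\<^sup>+x. f x \<partial>\<mu>) = (\<integral>\<^sup>+x. a x * f x \<partial>D)" "(\<integral>\<^sup>+x. f x \<partial>\<nu>) = (\<integral>\<^sup>+x. b x * f x \<partial>D)"
    if [measurable]: "f \<in> borel_measurable borel" for f
    by (auto simp flip: a b simp: nn_integral_density)
  define Y where "Y = {x. b x < a x}"
  have Y [measurable]: "Y \<in> sets borel" unfolding Y_def by measurable
  show thesis
  proof (rule that[OF Y])
    fix W :: "'e \<Rightarrow> real" assume W [measurable]: "W \<in> borel_measurable borel" and fin: "(\<integral>\<^sup>+x. ennreal (W x) \<partial>\<nu>) < \<infinity>"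
    have "(\<integral>\<^sup>+x. b x * (ennreal (W x) * indicator Y x) \<partial>D) \<le> (\<integral>\<^sup>+x. ennreal (W x) \<partial>\<nu>)"
      unfolding b[symmetric] by (subst nn_integral_density) (auto intro!: nn_integral_mono split: split_indicator)
    then have fin': "(\<integral>\<^sup>+x. b x * (ennreal (W x) * indicator Y x) \<partial>D) \<noteq> \<infinity>" using fin by (auto simp: top_unique)
    have "upper_norm W \<mu> \<nu> = (\<integral>\<^sup>+x. a x * (ennreal (W x) * indicator Y x) - b x * (ennreal (W x) * indicator Y x) \<partial>D)"
      unfolding upper_variation_density[OF \<mu> \<nu> D _ _ a b top, simplified]
      by (subst nn_integral_density; auto intro!: nn_integral_cong simp: Y_def ennreal_right_diff_distrib mult.commute diff_eq_0_iff_ennreal not_less top less_top[symmetric] ennreal_mult_eq_top_iff intro!: mult_right_mono split: split_indicator)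
    also have "\<dots> = (\<integral>\<^sup>+x. a x * (ennreal (W x) * indicator Y x) \<partial>D) - (\<integral>\<^sup>+x. b x * (ennreal (W x) * indicator Y x) \<partial>D)"
      using fin' by (intro nn_integral_diff) (auto intro!: AE_I2 mult_right_mono simp: Y_def less_imp_le split: split_indicator)
    finally show "upper_norm W \<mu> \<nu> = (\<integral>\<^sup>+x. ennreal (W x) * indicator Y x \<partial>\<mu>) - (\<integral>\<^sup>+x. ennreal (W x) * indicator Y x \<partial>\<nu>)"
      by (simp add: int)
  next
    fix W :: "'e \<Rightarrow> real" assume W [measurable]: "W \<in> borel_measurable borel" and fin: "(\<integral>\<^sup>+x. ennreal (W x) \<partial>\<mu>) < \<infinity>"
    have "(\<integral>\<^sup>+x. a x * (ennreal (W x) * indicator (-Y) x) \<partial>D) \<le> (\<integral>\<^sup>+x. ennreal (W x) \<partial>\<mu>)"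
      unfolding a[symmetric] by (subst nn_integral_density) (auto intro!: nn_integral_mono split: split_indicator)
    then have fin': "(\<integral>\<^sup>+x. a x * (ennreal (W x) * indicator (-Y) x) \<partial>D) \<noteq> \<infinity>" using fin by (auto simp: top_unique)
    have "upper_norm W \<nu> \<mu> = (\<integral>\<^sup>+x. b x * (ennreal (W x) * indicator (-Y) x) - a x * (ennreal (W x) * indicator (-Y) x) \<partial>D)"
      unfolding upper_variation_density[OF \<nu> \<mu> D _ _ b a top(2,1), simplified]
      by (subst nn_integral_density; auto intro!: nn_integral_cong simp: Y_def ennreal_right_diff_distrib mult.commute diff_eq_0_iff_ennreal not_less top less_top[symmetric] ennreal_mult_eq_top_iff intro!: mult_right_mono split: split_indicator)
    also have "\<dots> = (\<integral>\<^sup>+x. b x * (ennreal (W x) * indicator (-Y) x) \<partial>D) - (\<integral>\<^sup>+x. a x * (ennreal (W x) * indicator (-Y) x) \<partial>D)"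
      using fin' by (intro nn_integral_diff) (auto intro!: AE_I2 mult_right_mono simp: Y_def not_less less_imp_le split: split_indicator)
    finally show "upper_norm W \<nu> \<mu> = (\<integral>\<^sup>+x. ennreal (W x) * indicator (-Y) x \<partial>\<nu>) - (\<integral>\<^sup>+x. ennreal (W x) * indicator (-Y) x \<partial>\<mu>)"
      by (simp add: int)
  next
    fix W :: "'e \<Rightarrow> real" assume W [measurable]: "W \<in> borel_measurable borel"
    show "(\<integral>\<^sup>+x. ennreal (W x) * indicator Y x \<partial>\<nu>) \<le> (\<integral>\<^sup>+x. ennreal (W x) * indicator Y x \<partial>\<mu>)"
      by (simp add: int) (rule nn_integral_mono, auto intro: mult_right_mono simp: Y_def less_imp_le split: split_indicator)
    show "(\<integral>\<^sup>+x. ennreal (W x) * indicator (-Y) x \<partial>\<mu>) \<le> (\<integral>\<^sup>+x. ennreal (W x) * indicator (-Y) x \<partial>\<nu>)"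
      by (simp add: int) (rule nn_integral_mono, auto intro: mult_right_mono simp: Y_def not_less split: split_indicator)
  qed
qed

definition positive_set_for :: "('e::polish_space \<Rightarrow> real) \<Rightarrow> 'e measure \<Rightarrow> 'e measure \<Rightarrow> 'e set \<Rightarrow> bool" where
  "positive_set_for W \<mu> \<nu> Y \<longleftrightarrow>
    ((\<integral>\<^sup>+x. ennreal (W x) \<partial>\<nu>) < \<infinity> \<longrightarrow> upper_norm W \<mu> \<nu> =
      (\<integral>\<^sup>+x. ennreal (W x) * indicator Y x \<partial>\<mu>) - (\<integral>\<^sup>+x. ennreal (W x) * indicator Y x \<partial>\<nu>)) \<and>
    ((\<integral>\<^sup>+x. ennreal (W x) \<partial>\<mu>) < \<infinity> \<longrightarrow> upper_norm W \<nu> \<mu> =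
      (\<integral>\<^sup>+x. ennreal (W x) * indicator (-Y) x \<partial>\<nu>) - (\<integral>\<^sup>+x. ennreal (W x) * indicator (-Y) x \<partial>\<mu>)) \<and>
    (\<integral>\<^sup>+x. ennreal (W x) * indicator Y x \<partial>\<nu>) \<le> (\<integral>\<^sup>+x. ennreal (W x) * indicator Y x \<partial>\<mu>) \<and>
    (\<integral>\<^sup>+x. ennreal (W x) * indicator (-Y) x \<partial>\<mu>) \<le> (\<integral>\<^sup>+x. ennreal (W x) * indicator (-Y) x \<partial>\<nu>)"

lemma positive_set_exists:
  fixes \<mu> \<nu> :: "'e::polish_space measure"
  assumes "\<mu> \<in> probs" "\<nu> \<in> probs"
  shows "\<exists>Y\<in>sets borel. \<forall>W\<in>borel_measurable borel. positive_set_for W \<mu> \<nu> Y"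
  unfolding positive_set_for_def
  by (rule obtain_positive_set[OF assms], rule bexI) auto

lemma upper_norm_least:
  assumes \<mu>: "\<mu> \<in> probs" and \<nu>: "\<nu> \<in> probs" and W: "W \<in> borel_measurable borel"
    and fin: "(\<integral>\<^sup>+x. ennreal (W x) \<partial>\<nu>) < \<infinity>"
    and le: "\<And>f. f \<in> borel_measurable borel \<Longrightarrow> (\<And>x. f x \<le> ennreal (W x)) \<Longrightarrow>
      (\<integral>\<^sup>+x. f x \<partial>\<mu>) \<le> (\<integral>\<^sup>+x. f x \<partial>\<nu>) + c"
  shows "upper_norm W \<mu> \<nu> \<le> c"
proof -
  obtain Y where Y [measurable]: "Y \<in> sets borel"
    and eq: "upper_norm W \<mu> \<nu> = (\<integral>\<^sup>+x. ennreal (W x) * indicator Y x \<partial>\<mu>) - (\<integral>\<^sup>+x. ennreal (W x) * indicator Y x \<partial>\<nu>)"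
    using obtain_positive_set[OF \<mu> \<nu>] W fin by metis
  note [measurable] = W
  have "(\<integral>\<^sup>+x. ennreal (W x) * indicator Y x \<partial>\<mu>) \<le> (\<integral>\<^sup>+x. ennreal (W x) * indicator Y x \<partial>\<nu>) + c"
    by (rule le) (auto split: split_indicator)
  moreover have "(\<integral>\<^sup>+x. ennreal (W x) * indicator Y x \<partial>\<nu>) \<le> (\<integral>\<^sup>+x. ennreal (W x) \<partial>\<nu>)"
    by (intro nn_integral_mono) (auto split: split_indicator)
  ultimately show ?thesis unfolding eq using fin by (auto simp: ennreal_minus_le_iff add.commute top_unique)
qed

lemma upper_norm_le: 
  assumes \<mu>: "\<mu> \<in> probs" and \<nu>: "\<nu> \<in> probs" and W: "W \<in> borel_measurable borel"
    and fin: "(\<integral>\<^sup>+x. ennreal (W x) \<partial>\<nu>) < \<infinity>"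
  shows "upper_norm W \<mu> \<nu> \<le> (\<integral>\<^sup>+x. ennreal (W x) \<partial>\<mu>)"
  by (rule upper_norm_least[OF assms]) (auto intro!: add_increasing nn_integral_mono)

lemma upper_norm_mono:
  "(\<And>x. W x \<le> W' x) \<Longrightarrow> upper_norm W \<mu> \<nu> \<le> upper_norm W' \<mu> \<nu>"
  by (intro nn_integral_mono ennreal_leI)

lemma upper_norm_triangle:
  assumes \<mu>: "\<mu> \<in> probs" and \<nu>: "\<nu> \<in> probs" and \<sigma>: "\<sigma> \<in> probs" and W: "W \<in> borel_measurable borel"
    and fin: "(\<integral>\<^sup>+x. ennreal (W x) \<partial>\<sigma>) < \<infinity>"
  shows "upper_norm W \<mu> \<sigma> \<le> upper_norm W \<mu> \<nu> + upper_norm W \<nu> \<sigma>"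
proof (rule upper_norm_least[OF \<mu> \<sigma> W fin])
  fix f :: "'a \<Rightarrow> ennreal" assume f: "f \<in> borel_measurable borel" "\<And>x. f x \<le> ennreal (W x)"
  have "(\<integral>\<^sup>+x. f x \<partial>\<mu>) \<le> (\<integral>\<^sup>+x. f x \<partial>\<nu>) + upper_norm W \<mu> \<nu>"
    using nn_integral_le_upper_norm[OF \<mu> \<nu> W f(1), of 1] f(2) by simp
  also have "(\<integral>\<^sup>+x. f x \<partial>\<nu>) \<le> (\<integral>\<^sup>+x. f x \<partial>\<sigma>) + upper_norm W \<nu> \<sigma>"
    using nn_integral_le_upper_norm[OF \<nu> \<sigma> W f(1), of 1] f(2) by simp
  finally show "(\<integral>\<^sup>+x. f x \<partial>\<mu>) \<le> (\<integral>\<^sup>+x. f x \<partial>\<sigma>) + (upper_norm W \<mu> \<nu> + upper_norm W \<nu> \<sigma>)"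
    by (simp add: ac_simps add_left_mono)
qed

lemma V_norm_commute: "V_norm W \<mu> \<nu> = V_norm W \<nu> \<mu>"
  by (simp add: V_norm_def add.commute)

lemma V_norm_mono: "(\<And>x. W x \<le> W' x) \<Longrightarrow> V_norm W \<mu> \<nu> \<le> V_norm W' \<mu> \<nu>"
  unfolding V_norm_def by (intro add_mono upper_norm_mono)

lemma probs_V_iff: "\<nu> \<in> probs_V W \<longleftrightarrow> \<nu> \<in> probs \<and> (\<integral>\<^sup>+x. ennreal (W x) \<partial>\<nu>) < \<infinity>"
  by (simp add: probs_V_def)

lemma V_norm_triangle:
  assumes "\<mu> \<in> probs_V W" "\<nu> \<in> probs" "\<sigma> \<in> probs_V W" "W \<in> borel_measurable borel"
  shows "V_norm W \<mu> \<sigma> \<le> V_norm W \<mu> \<nu> + V_norm W \<nu> \<sigma>"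
proof -
  have "V_norm W \<mu> \<sigma> \<le> (upper_norm W \<mu> \<nu> + upper_norm W \<nu> \<sigma>) + (upper_norm W \<sigma> \<nu> + upper_norm W \<nu> \<mu>)"
    unfolding V_norm_def using assms by (intro add_mono upper_norm_triangle) (auto simp: probs_V_iff)
  then show ?thesis by (simp add: V_norm_def ac_simps)
qed

lemma V_norm_le_sum:
  assumes "\<mu> \<in> probs_V W" "\<nu> \<in> probs_V W" "W \<in> borel_measurable borel"
  shows "V_norm W \<mu> \<nu> \<le> (\<integral>\<^sup>+x. ennreal (W x) \<partial>\<mu>) + (\<integral>\<^sup>+x. ennreal (W x) \<partial>\<nu>)"
  unfolding V_norm_def using assms by (intro add_mono upper_norm_le) (auto simp: probs_V_iff)

lemma V_norm_finite:
  assumes "\<mu> \<in> probs_V W" "\<nu> \<in> probs_V W" "W \<in> borel_measurable borel"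
  shows "V_norm W \<mu> \<nu> < \<infinity>"
  using assms by (intro le_less_trans[OF V_norm_le_sum[OF assms]]) (auto simp: probs_V_iff)

lemma V_norm_self:
  assumes "\<mu> \<in> probs_V W" "W \<in> borel_measurable borel" shows "V_norm W \<mu> \<mu> = 0"
proof -
  have "upper_norm W \<mu> \<mu> \<le> 0" using assms by (intro upper_norm_least) (auto simp: probs_V_iff)
  then show ?thesis by (simp add: V_norm_def)
qed

lemma one_le_ennrealI: "1 \<le> w \<Longrightarrow> 1 \<le> ennreal w"
  by (metis ennreal_1 ennreal_leI)

lemma V_norm_eq_0D:
  assumes \<mu>: "\<mu> \<in> probs" and \<nu>: "\<nu> \<in> probs" and W: "W \<in> borel_measurable borel" "\<And>x. 1 \<le> W x"
    and 0: "V_norm W \<mu> \<nu> = 0"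
  shows "\<mu> = \<nu>"
proof (rule prob_measure_eqI_le[OF \<mu> \<nu>])
  fix A :: "'a set" assume A: "A \<in> sets borel"
  have "(\<integral>\<^sup>+x. indicator A x \<partial>\<mu>) \<le> (\<integral>\<^sup>+x. indicator A x \<partial>\<nu>) + 1 * upper_norm W \<mu> \<nu>"
    using A W(2) by (intro nn_integral_le_upper_norm[OF \<mu> \<nu> W(1)]) (auto split: split_indicator intro: one_le_ennrealI)
  then show "emeasure \<mu> A \<le> emeasure \<nu> A"
    using A 0 by (simp add: V_norm_def space_prob_algebra_borelD[OF \<mu>] space_prob_algebra_borelD[OF \<nu>])
qed

lemma measure_diff_le_V_norm:
  assumes \<mu>: "\<mu> \<in> probs" and \<nu>: "\<nu> \<in> probs" and W: "W \<in> borel_measurable borel" "\<And>x. 1 \<le> W x"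
    and le: "V_norm W \<mu> \<nu> \<le> ennreal e" "0 \<le> e" and A: "A \<in> sets borel"
  shows "\<bar>measure \<mu> A - measure \<nu> A\<bar> \<le> e"
proof -
  have *: "measure \<mu> A \<le> measure \<nu> A + e" if \<mu>: "\<mu> \<in> probs" and \<nu>: "\<nu> \<in> probs" and le: "upper_norm W \<mu> \<nu> \<le> ennreal e" for \<mu> \<nu>
  proof -
    interpret M: prob_space \<mu> by (rule space_prob_algebra_borelD[OF \<mu>])
    interpret N: prob_space \<nu> by (rule space_prob_algebra_borelD[OF \<nu>])
    have "(\<integral>\<^sup>+x. indicator A x \<partial>\<mu>) \<le> (\<integral>\<^sup>+x. indicator A x \<partial>\<nu>) + 1 * upper_norm W \<mu> \<nu>"
      using A W(2) by (intro nn_integral_le_upper_norm[OF \<mu> \<nu> W(1)]) (auto split: split_indicator intro: one_le_ennrealI)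
    also have "\<dots> \<le> (\<integral>\<^sup>+x. indicator A x \<partial>\<nu>) + ennreal e" using le by (intro add_left_mono) simp
    finally have "ennreal (measure \<mu> A) \<le> ennreal (measure \<nu> A + e)"
      using A \<open>0 \<le> e\<close> by (simp add: space_prob_algebra_borelD[OF \<mu>] space_prob_algebra_borelD[OF \<nu>]
        M.emeasure_eq_measure N.emeasure_eq_measure ennreal_plus)
    then show ?thesis using \<open>0 \<le> e\<close> by (subst (asm) ennreal_le_iff) auto
  qed
  have "upper_norm W \<mu> \<nu> \<le> ennreal e" "upper_norm W \<nu> \<mu> \<le> ennreal e"
    using le(1) unfolding V_norm_def by (auto elim: order_trans[rotated])
  then show ?thesis using *[OF \<mu> \<nu>] *[OF \<nu> \<mu>] by linarith
qed

section \<open>Completeness of the weighted total variation\<close>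

text \<open>Setwise convergence passes to integrals of simple functions; more general functions are reached by
  monotone approximation, one inequality at a time.\<close>

lemma simple_integral_setwise_limit:
  fixes h :: "'e::polish_space \<Rightarrow> ennreal"
  assumes \<nu>: "\<nu> \<in> probs" and \<sigma>: "\<And>n. \<sigma> n \<in> probs"
    and lim: "\<And>A. A \<in> sets borel \<Longrightarrow> (\<lambda>n. emeasure (\<sigma> n) A) \<longlonglongrightarrow> emeasure \<nu> A"
    and h: "simple_function borel h" "\<And>x. h x < \<top>"
  shows "(\<lambda>n. \<integral>\<^sup>+x. h x \<partial>\<sigma> n) \<longlonglongrightarrow> (\<integral>\<^sup>+x. h x \<partial>\<nu>)"
proof -
  have eq: "(\<integral>\<^sup>+x. h x \<partial>\<tau>) = (\<Sum>y\<in>range h. y * emeasure \<tau> (h -` {y}))" if \<tau>: "\<tau> \<in> probs" for \<tau>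
  proof -
    note s = space_prob_algebra_borelD[OF \<tau>]
    have "simple_function \<tau> h" using h(1) s by (simp add: simple_function_def)
    then have "(\<integral>\<^sup>+x. h x \<partial>\<tau>) = integral\<^sup>S \<tau> h" by (rule nn_integral_eq_simple_integral)
    then show ?thesis by (simp add: simple_integral_def s)
  qed
  have "h -` {y} \<in> sets borel" for y
    using borel_measurable_simple_function[OF h(1)] by (simp add: measurable_sets_borel)
  then show ?thesis
    unfolding eq[OF \<nu>] eq[OF \<sigma>] using h(2)
    by (intro tendsto_sum ennreal_tendsto_cmult lim) (auto)
qed

lemma nn_integral_le_simple:
  fixes f :: "'e::polish_space \<Rightarrow> ennreal"
  assumes \<tau>: "\<tau> \<in> probs"
    and le: "\<And>h. simple_function borel h \<Longrightarrow> h \<le> f \<Longrightarrow> (\<And>x. h x < \<top>) \<Longrightarrow> (\<integral>\<^sup>+x. h x \<partial>\<tau>) \<le> c"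
  shows "(\<integral>\<^sup>+x. f x \<partial>\<tau>) \<le> c"
  unfolding nn_integral_def_finite
proof (intro SUP_least)
  fix h assume "h \<in> {g. simple_function \<tau> g \<and> g \<le> f \<and> (\<forall>x. g x < \<top>)}"
  then have h: "simple_function \<tau> h" "h \<le> f" "\<And>x. h x < \<top>" by auto
  note s = space_prob_algebra_borelD[OF \<tau>]
  have "simple_function borel h" using h(1) s by (simp add: simple_function_def)
  then show "integral\<^sup>S \<tau> h \<le> c" using le[OF _ h(2,3)] nn_integral_eq_simple_integral[OF h(1)] by simp
qed

text \<open>Uniformity in the set gives continuity at the empty set, hence countable additivity of the limit.\<close>

lemma setwise_limit_measure:
  fixes \<sigma> :: "nat \<Rightarrow> 'e::polish_space measure"
  assumes \<sigma>: "\<And>n. \<sigma> n \<in> probs" and e: "e \<longlonglongrightarrow> 0"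
    and cauchy: "\<And>n m A. n \<le> m \<Longrightarrow> A \<in> sets borel \<Longrightarrow> \<bar>measure (\<sigma> n) A - measure (\<sigma> m) A\<bar> \<le> e n"
  obtains \<nu> where "\<nu> \<in> probs" "\<And>A. A \<in> sets borel \<Longrightarrow> (\<lambda>n. emeasure (\<sigma> n) A) \<longlonglongrightarrow> emeasure \<nu> A"
proof -
  note s = space_prob_algebra_borelD[OF \<sigma>]
  have p: "prob_space (\<sigma> n)" for n by (rule s)
  define L where "L A = lim (\<lambda>n. measure (\<sigma> n) A)" for A
  have L: "(\<lambda>n. measure (\<sigma> n) A) \<longlonglongrightarrow> L A" if A: "A \<in> sets borel" for A
  proof -
    have "Cauchy (\<lambda>n. measure (\<sigma> n) A)"
    proof (rule metric_CauchyI)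
      fix d :: real assume "0 < d"
      then obtain N where N: "\<And>n. n \<ge> N \<Longrightarrow> \<bar>e n\<bar> < d"
        using LIMSEQ_D[OF e] by auto
      have N': "dist (measure (\<sigma> m) A) (measure (\<sigma> n) A) < d" if "m \<ge> N" "m \<le> n" for m n
        using cauchy[OF that(2) A] N[OF that(1)] by (simp add: dist_real_def)
      show "\<exists>M. \<forall>m\<ge>M. \<forall>n\<ge>M. dist (measure (\<sigma> m) A) (measure (\<sigma> n) A) < d"
        by (metis N' dist_commute nle_le)
    qed
    then show ?thesis unfolding L_def by (simp add: Cauchy_convergent convergent_LIMSEQ_iff[symmetric])
  qed
  have L0: "0 \<le> L A" if "A \<in> sets borel" for A
    using L[OF that] by (rule LIMSEQ_le_const) auto
  have Le: "\<bar>measure (\<sigma> n) A - L A\<bar> \<le> e n" if A: "A \<in> sets borel" for n A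
  proof (rule LIMSEQ_le_const2)
    show "(\<lambda>m. \<bar>measure (\<sigma> n) A - measure (\<sigma> m) A\<bar>) \<longlonglongrightarrow> \<bar>measure (\<sigma> n) A - L A\<bar>"
      by (intro tendsto_intros L A)
    show "\<exists>N. \<forall>m\<ge>N. \<bar>measure (\<sigma> n) A - measure (\<sigma> m) A\<bar> \<le> e n" using cauchy[OF _ A] by blast
  qed
  define \<nu> where "\<nu> = measure_of UNIV (sets borel) (\<lambda>A::'e set. ennreal (L A))"
  have s\<nu>: "sets \<nu> = sets borel" "space \<nu> = UNIV"
    unfolding \<nu>_def using sets.sets_measure_of_eq[of "borel :: 'e measure"] by (simp_all add: space_measure_of_conv)
  have pos: "positive (sets borel) (\<lambda>A::'e set. ennreal (L A))"
    by (simp add: positive_def L_def)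
  have add: "additive (sets borel) (\<lambda>A::'e set. ennreal (L A))"
    unfolding additive_def
  proof (intro ballI impI)
    fix A B :: "'e set" assume AB: "A \<in> sets borel" "B \<in> sets borel" "A \<inter> B = {}"
    have "measure (\<sigma> n) (A \<union> B) = measure (\<sigma> n) A + measure (\<sigma> n) B" for n
      using AB s by (intro finite_measure.finite_measure_Union prob_space.finite_measure p) auto
    then have "(\<lambda>n. measure (\<sigma> n) (A \<union> B)) \<longlonglongrightarrow> L A + L B"
      using tendsto_add[OF L[OF AB(1)] L[OF AB(2)]] by simp
    then have "L (A \<union> B) = L A + L B" using L[of "A \<union> B"] AB by (intro LIMSEQ_unique) auto
    then show "ennreal (L (A \<union> B)) = ennreal (L A) + ennreal (L B)" using L0 AB by simp
  qed
  have ca: "countably_additive (sets borel) (\<lambda>A::'e set. ennreal (L A))"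
  proof (rule sets.empty_continuous_imp_countably_additive[OF pos add])
    fix A :: "nat \<Rightarrow> 'e set" assume A: "range A \<subseteq> sets borel" "decseq A" "(\<Inter>i. A i) = {}"
    have "(\<lambda>i. L (A i)) \<longlonglongrightarrow> 0"
    proof (rule LIMSEQ_I)
      fix d :: real assume d: "0 < d"
      then obtain N where "\<bar>e N\<bar> < d / 2" using LIMSEQ_D[OF e, of "d/2"] by auto
      moreover have "(\<lambda>i. measure (\<sigma> N) (A i)) \<longlonglongrightarrow> measure (\<sigma> N) (\<Inter>i. A i)"
        using A s by (intro finite_measure.finite_Lim_measure_decseq prob_space.finite_measure p) auto
      then obtain I where "\<And>i. i \<ge> I \<Longrightarrow> measure (\<sigma> N) (A i) < d / 2"
        using A(3) LIMSEQ_D[of _ 0 "d/2"] d by fastforce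
      ultimately show "\<exists>no. \<forall>i\<ge>no. norm (L (A i) - 0) < d"
      proof (intro exI[of _ I] allI impI)
        fix i assume "I \<le> i"
        have "A i \<in> sets borel" using A(1) by auto
        from Le[OF this, of N] L0[OF this] \<open>\<bar>e N\<bar> < d / 2\<close> \<open>I \<le> i\<close> \<open>\<And>i. i \<ge> I \<Longrightarrow> measure (\<sigma> N) (A i) < d / 2\<close>[of i]
        show "norm (L (A i) - 0) < d" by simp
      qed
    qed
    then show "(\<lambda>i. ennreal (L (A i))) \<longlonglongrightarrow> 0" using tendsto_ennrealI by fastforce
  qed auto
  have em: "emeasure \<nu> A = ennreal (L A)" if A: "A \<in> sets borel" for A
    using pos ca A sets.sigma_algebra_axioms[of "borel :: 'e measure"] unfolding \<nu>_def
    by (subst emeasure_measure_of_sigma) auto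
  have "L UNIV = 1"
  proof (rule LIMSEQ_unique[OF L])
    have "measure (\<sigma> n) UNIV = 1" for n using prob_space.prob_space[OF p[of n]] s by simp
    then show "(\<lambda>n. measure (\<sigma> n) UNIV) \<longlonglongrightarrow> 1" by simp
  qed simp
  then have "\<nu> \<in> probs" using s\<nu> by (auto simp: space_prob_algebra em intro!: prob_spaceI)
  moreover have "(\<lambda>n. emeasure (\<sigma> n) A) \<longlonglongrightarrow> emeasure \<nu> A" if A: "A \<in> sets borel" for A
  proof -
    have "emeasure (\<sigma> n) A = ennreal (measure (\<sigma> n) A)" for n
      by (intro finite_measure.emeasure_eq_measure prob_space.finite_measure p)
    then show ?thesis using L[OF A] by (simp add: em[OF A] tendsto_ennrealI)
  qed
  ultimately show thesis by (rule that)
qed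

text \<open>The limit is constructed setwise. The bounds for the norm pass to the limit because they are
  inequalities between integrals of simple functions.\<close>

lemma V_norm_complete:
  fixes \<sigma> :: "nat \<Rightarrow> 'e::polish_space measure"
  assumes W: "W \<in> borel_measurable borel" "\<And>x. 1 \<le> W x" and \<sigma>: "\<And>n. \<sigma> n \<in> probs_V W"
    and e: "e \<longlonglongrightarrow> 0" "\<And>n. 0 \<le> e n"
    and cauchy: "\<And>n m. n \<le> m \<Longrightarrow> V_norm W (\<sigma> n) (\<sigma> m) \<le> ennreal (e n)"
  obtains \<nu> where "\<nu> \<in> probs_V W" "\<And>n. V_norm W (\<sigma> n) \<nu> \<le> ennreal (2 * e n)"
    "\<And>A. A \<in> sets borel \<Longrightarrow> (\<lambda>n. emeasure (\<sigma> n) A) \<longlonglongrightarrow> emeasure \<nu> A"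
proof -
  have \<sigma>p: "\<sigma> n \<in> probs" for n using \<sigma> by (simp add: probs_V_iff)
  obtain \<nu> where \<nu>: "\<nu> \<in> probs" and lim: "\<And>A. A \<in> sets borel \<Longrightarrow> (\<lambda>n. emeasure (\<sigma> n) A) \<longlonglongrightarrow> emeasure \<nu> A"
    using setwise_limit_measure[of \<sigma> e, OF \<sigma>p e(1) measure_diff_le_V_norm[OF \<sigma>p \<sigma>p W cauchy e(2)]] by blast
  have up: "upper_norm W (\<sigma> n) (\<sigma> m) \<le> ennreal (e n)" "upper_norm W (\<sigma> m) (\<sigma> n) \<le> ennreal (e n)" if "n \<le> m" for n m
    using cauchy[OF that] unfolding V_norm_def by (auto elim: order_trans[rotated])
  have 1: "(\<integral>\<^sup>+x. f x \<partial>\<nu>) \<le> (\<integral>\<^sup>+x. f x \<partial>\<sigma> n) + ennreal (e n)"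
    if f: "f \<in> borel_measurable borel" "\<And>x. f x \<le> ennreal (W x)" for f n
  proof (rule nn_integral_le_simple[OF \<nu>])
    fix h assume h: "simple_function borel h" "h \<le> f" "\<And>x. h x < \<top>"
    have hW: "h x \<le> 1 * ennreal (W x)" for x using h(2) f(2) by (auto simp: le_fun_def intro: order_trans)
    show "(\<integral>\<^sup>+x. h x \<partial>\<nu>) \<le> (\<integral>\<^sup>+x. f x \<partial>\<sigma> n) + ennreal (e n)"
    proof (rule LIMSEQ_le_const2[OF simple_integral_setwise_limit[OF \<nu> \<sigma>p lim h(1,3)]], simp, intro exI allI impI)
      fix m assume "n \<le> m"
      have "(\<integral>\<^sup>+x. h x \<partial>\<sigma> m) \<le> (\<integral>\<^sup>+x. h x \<partial>\<sigma> n) + 1 * upper_norm W (\<sigma> m) (\<sigma> n)"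
        by (rule nn_integral_le_upper_norm[OF \<sigma>p \<sigma>p W(1) borel_measurable_simple_function[OF h(1)] hW])
      also have "\<dots> \<le> (\<integral>\<^sup>+x. f x \<partial>\<sigma> n) + ennreal (e n)"
        using up[OF \<open>n \<le> m\<close>] h(2) by (intro add_mono nn_integral_mono) (auto simp: le_fun_def)
      finally show "(\<integral>\<^sup>+x. h x \<partial>\<sigma> m) \<le> (\<integral>\<^sup>+x. f x \<partial>\<sigma> n) + ennreal (e n)" .
    qed
  qed
  have 2: "(\<integral>\<^sup>+x. f x \<partial>\<sigma> n) \<le> (\<integral>\<^sup>+x. f x \<partial>\<nu>) + ennreal (e n)"
    if f: "f \<in> borel_measurable borel" "\<And>x. f x \<le> ennreal (W x)" for f n
  proof (rule nn_integral_le_simple[OF \<sigma>p])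
    fix h assume h: "simple_function borel h" "h \<le> f" "\<And>x. h x < \<top>"
    have hW: "h x \<le> 1 * ennreal (W x)" for x using h(2) f(2) by (auto simp: le_fun_def intro: order_trans)
    have "(\<integral>\<^sup>+x. h x \<partial>\<sigma> n) \<le> (\<integral>\<^sup>+x. h x \<partial>\<nu>) + ennreal (e n)"
    proof (rule LIMSEQ_le_const[OF tendsto_add[OF simple_integral_setwise_limit[OF \<nu> \<sigma>p lim h(1,3)] tendsto_const]], simp, intro exI allI impI)
      fix m assume "n \<le> m"
      have "(\<integral>\<^sup>+x. h x \<partial>\<sigma> n) \<le> (\<integral>\<^sup>+x. h x \<partial>\<sigma> m) + 1 * upper_norm W (\<sigma> n) (\<sigma> m)"
        by (rule nn_integral_le_upper_norm[OF \<sigma>p \<sigma>p W(1) borel_measurable_simple_function[OF h(1)] hW])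
      also have "\<dots> \<le> (\<integral>\<^sup>+x. h x \<partial>\<sigma> m) + ennreal (e n)"
        using up[OF \<open>n \<le> m\<close>] by (intro add_mono) auto
      finally show "(\<integral>\<^sup>+x. h x \<partial>\<sigma> n) \<le> (\<integral>\<^sup>+x. h x \<partial>\<sigma> m) + ennreal (e n)" .
    qed
    also have "\<dots> \<le> (\<integral>\<^sup>+x. f x \<partial>\<nu>) + ennreal (e n)"
      using h(2) by (intro add_right_mono nn_integral_mono) (auto simp: le_fun_def)
    finally show "(\<integral>\<^sup>+x. h x \<partial>\<sigma> n) \<le> (\<integral>\<^sup>+x. f x \<partial>\<nu>) + ennreal (e n)" .
  qed
  have fin: "(\<integral>\<^sup>+x. ennreal (W x) \<partial>\<sigma> n) < \<infinity>" for n using \<sigma> by (simp add: probs_V_iff)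
  have "(\<integral>\<^sup>+x. ennreal (W x) \<partial>\<nu>) \<le> (\<integral>\<^sup>+x. ennreal (W x) \<partial>\<sigma> 0) + ennreal (e 0)" using W(1) by (intro 1) auto
  then have fin\<nu>: "(\<integral>\<^sup>+x. ennreal (W x) \<partial>\<nu>) < \<infinity>" using fin[of 0] by (auto intro: le_less_trans)
  show thesis
  proof (rule that[OF _ _ lim])
    show "\<nu> \<in> probs_V W" using \<nu> fin\<nu> by (simp add: probs_V_iff)
    fix n
    have "upper_norm W (\<sigma> n) \<nu> \<le> ennreal (e n)" by (rule upper_norm_least[OF \<sigma>p \<nu> W(1) fin\<nu> 2])
    moreover have "upper_norm W \<nu> (\<sigma> n) \<le> ennreal (e n)" by (rule upper_norm_least[OF \<nu> \<sigma>p W(1) fin 1])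
    ultimately have "V_norm W (\<sigma> n) \<nu> \<le> ennreal (e n) + ennreal (e n)" unfolding V_norm_def by (rule add_mono)
    then show "V_norm W (\<sigma> n) \<nu> \<le> ennreal (2 * e n)" using e(2)[of n] by (simp flip: ennreal_plus)
  qed
qed

section \<open>Growth of the Lyapunov function and Lipschitz clock kernels\<close>

locale lyapunov_jumps = clocked_jumps P lam Q G H lmax
  for P :: "real \<Rightarrow> 'e::polish_space \<Rightarrow> 'e measure" and lam Q G H lmax +
  fixes V :: "'e \<Rightarrow> real" and \<theta> \<rho> \<rho>max \<eta> M \<gamma>max :: real
  assumes V_measurable [measurable]: "V \<in> borel_measurable borel"
    and V_ge_1: "\<And>x. 1 \<le> V x"
    and \<theta>: "0 \<le> \<theta>" and \<rho>: "0 < \<rho>" and \<eta>: "0 \<le> \<eta>" "\<eta> < 1" and M: "1 \<le> M" and \<gamma>max: "1 \<le> \<gamma>max"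
    and drift_R: "\<And>\<mu> x t. \<mu> \<in> prob_flows \<Longrightarrow> 0 \<le> t \<Longrightarrow>
      (\<integral>\<^sup>+y. ennreal (V y) \<partial>jump_kernel lmax lam G H \<mu> 0 t x)
      \<le> ennreal (exp (- \<rho> * t)) * ennreal (V x)
        + ennreal \<rho> * (\<integral>\<^sup>+s\<in>{0..t}. ennreal (exp (\<rho> * (s - t)))
            * (ennreal \<eta> * (\<integral>\<^sup>+y. ennreal (V y) \<partial>\<mu> s) + ennreal M) \<partial>lborel)"
    and drift_P: "\<And>x t. 0 \<le> t \<Longrightarrow>
      (\<integral>\<^sup>+y. ennreal (V y) \<partial>P t x) \<le> ennreal (exp (\<rho>max * t) * V x)"
    and V_jump: "\<And>\<nu> x. \<nu> \<in> probs \<Longrightarrow> AE u in unif01. V (G \<nu> x u) \<le> \<gamma>max * V x"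
    and lipschitz: "\<And>\<nu>\<^sub>1 \<nu>\<^sub>2 f x. \<nu>\<^sub>1 \<in> probs_V V \<Longrightarrow> \<nu>\<^sub>2 \<in> probs_V V \<Longrightarrow>
      f \<in> borel_measurable borel \<Longrightarrow> (\<And>x. \<bar>f x\<bar> \<le> 1) \<Longrightarrow>
      ennreal \<bar>lam \<nu>\<^sub>1 x * ((\<integral>y. f y \<partial>Q \<nu>\<^sub>1 x) - f x) - lam \<nu>\<^sub>2 x * ((\<integral>y. f y \<partial>Q \<nu>\<^sub>2 x) - f x)\<bar>
      \<le> ennreal \<theta> * V_norm V \<nu>\<^sub>1 \<nu>\<^sub>2"
begin

text \<open>The exponential rate \<open>\<rho>\<^sub>* + \<lambda>\<^sub>* (\<gamma>\<^sub>* - 1)\<close>: the motion multiplies \<open>V\<close> at rate \<open>\<rho>\<^sub>*\<close>, and each of the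
  rings, which come at rate \<open>\<lambda>\<^sub>*\<close>, at most by \<open>\<gamma>\<^sub>*\<close>.\<close>

definition growth :: real where "growth = \<rho>max + lmax * (\<gamma>max - 1)"

lemma V_pos: "0 < V x" "0 \<le> V x"
  using V_ge_1[of x] by linarith+

lemma G_kernel: "\<nu> \<in> probs \<Longrightarrow> G \<nu> y \<in> unif01 \<rightarrow>\<^sub>M borel"
  using measurable_compose[OF _ G_measurable, of "\<lambda>u. (\<nu>, y, u)" unif01] by simp

lemma Q_in_probs: "\<nu> \<in> probs \<Longrightarrow> Q \<nu> y \<in> probs"
  unfolding G_law[symmetric] using G_kernel
  by (auto simp: space_prob_algebra intro!: prob_space.prob_space_distr prob_space_unif01)

lemma Q_V_le:
  assumes "\<nu> \<in> probs" shows "AE z in Q \<nu> y. V z \<le> \<gamma>max * V y"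
  unfolding G_law[OF assms, symmetric]
  using V_jump[OF assms] by (subst AE_distr_iff[OF G_kernel[OF assms]]) auto

lemma jump_prob_bounds:
  assumes "\<nu> \<in> probs" shows "0 \<le> lam \<nu> y / lmax" "lam \<nu> y / lmax \<le> 1"
  using lam_nonneg[OF assms, of y] lam_le[OF assms, of y] lmax_pos by auto

lemma nn_integral_clock_law_V:
  assumes \<nu>: "\<nu> \<in> probs"
  shows "(\<integral>\<^sup>+z. ennreal (V z) \<partial>clock_law \<nu> y) \<le> ennreal (\<gamma>max * V y)"
proof -
  interpret Q: prob_space "Q \<nu> y" by (rule space_prob_algebra_borelD[OF Q_in_probs[OF \<nu>]])
  define p where "p = lam \<nu> y / lmax"
  have p: "0 \<le> p" "p \<le> 1" using jump_prob_bounds[OF \<nu>] by (auto simp: p_def)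
  have "(\<integral>\<^sup>+z. ennreal (V z) \<partial>Q \<nu> y) \<le> (\<integral>\<^sup>+z. ennreal (\<gamma>max * V y) \<partial>Q \<nu> y)"
    using Q_V_le[OF \<nu>, of y] by (intro nn_integral_mono_AE) (auto elim!: eventually_mono intro: ennreal_leI)
  then have "(\<integral>\<^sup>+z. ennreal (V z) \<partial>Q \<nu> y) \<le> ennreal (\<gamma>max * V y)" by (simp add: Q.emeasure_space_1)
  moreover have "ennreal (V y) \<le> ennreal (\<gamma>max * V y)"
    using \<gamma>max V_pos(2)[of y] mult_right_mono[of 1 \<gamma>max "V y"] by (intro ennreal_leI) simp
  ultimately have "(\<integral>\<^sup>+z. ennreal (V z) \<partial>clock_law \<nu> y) \<le> ennreal p * ennreal (\<gamma>max * V y) + ennreal (1 - p) * ennreal (\<gamma>max * V y)"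
    unfolding nn_integral_clock_law[OF measurable_compose[OF V_measurable measurable_ennreal] \<nu>] p_def[symmetric]
    by (intro add_mono mult_left_mono) auto
  also have "\<dots> = ennreal (\<gamma>max * V y)"
    using p by (simp flip: distrib_right ennreal_plus)
  finally show ?thesis .
qed

lemma nn_integral_motion_V:
  assumes "0 \<le> r" shows "(\<integral>\<^sup>+z. ennreal (V z) \<partial>motion r x) \<le> ennreal (exp (\<rho>max * r) * V x)"
  using drift_P[OF assms] by (simp add: motion_nonneg[OF assms])

lemma nn_integral_ring_law_V:
  assumes \<mu>: "\<mu> \<in> prob_flows" and "s \<le> r"
  shows "(\<integral>\<^sup>+z. ennreal (V z) \<partial>ring_law \<mu> s r x) \<le> ennreal (\<gamma>max * (exp (\<rho>max * (r - s)) * V x))"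
proof -
  have [measurable_cong]: "sets (motion (r - s) x) = sets borel" by (rule space_prob_algebra_borelD) simp
  have "(\<integral>\<^sup>+z. ennreal (V z) \<partial>ring_law \<mu> s r x) \<le> (\<integral>\<^sup>+y. ennreal \<gamma>max * ennreal (V y) \<partial>motion (r - s) x)"
    unfolding nn_integral_ring_law[OF measurable_compose[OF V_measurable measurable_ennreal] \<mu>]
    using nn_integral_clock_law_V[OF flow_in_probs[OF \<mu>], of "max 0 r"] \<gamma>max V_pos
    by (intro nn_integral_mono) (simp add: ennreal_mult)
  also have "\<dots> = ennreal \<gamma>max * (\<integral>\<^sup>+y. ennreal (V y) \<partial>motion (r - s) x)" by (intro nn_integral_cmult) measurable
  also have "\<dots> \<le> ennreal \<gamma>max * ennreal (exp (\<rho>max * (r - s)) * V x)"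
    using assms by (intro mult_left_mono nn_integral_motion_V) auto
  finally show ?thesis using \<gamma>max V_pos(2)[of x] by (simp add: ennreal_mult)
qed

text \<open>The relation between the exponents that makes \<open>exp (growth * t)\<close> a fixed point of the recursion.\<close>

lemma growth_exp:
  "exp (- lmax * u) * exp (\<rho>max * u) * exp (growth * w) = exp (growth * (u + w)) * exp (- (lmax * \<gamma>max) * u)"
  by (simp add: growth_def algebra_simps flip: exp_add)

text \<open>The claimed bound reproduces itself in the recursion: the part without ring and the
  part with a ring carry the weights \<open>exp (- \<lambda>\<^sub>* \<gamma>\<^sub>* t)\<close> and \<open>1 - exp (- \<lambda>\<^sub>* \<gamma>\<^sub>* t)\<close>.\<close>

lemma trunc_V_le:
  assumes \<mu>: "\<mu> \<in> prob_flows" and "s \<le> t"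
  shows "trunc n \<mu> (\<lambda>y. ennreal (V y)) s t x \<le> ennreal (exp (growth * (t - s)) * V x)"
  using assms(2)
proof (induction n arbitrary: s x)
  have base: "ennreal (exp (- lmax * (t - s))) * (\<integral>\<^sup>+y. ennreal (V y) \<partial>motion (t - s) x)
      \<le> ennreal (exp (growth * (t - s)) * exp (- (lmax * \<gamma>max) * (t - s)) * V x)" if "s \<le> t" for s x
  proof -
    have "ennreal (exp (- lmax * (t - s))) * (\<integral>\<^sup>+y. ennreal (V y) \<partial>motion (t - s) x)
      \<le> ennreal (exp (- lmax * (t - s))) * ennreal (exp (\<rho>max * (t - s)) * V x)"
      using that by (intro mult_left_mono nn_integral_motion_V) auto
    also have "\<dots> = ennreal (exp (growth * (t - s)) * exp (- (lmax * \<gamma>max) * (t - s)) * V x)"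
      using growth_exp[of "t - s" 0] by (simp flip: ennreal_mult' mult.assoc)
    finally show ?thesis .
  qed
  {
    case 0
    have "exp (growth * (t - s)) * exp (- (lmax * \<gamma>max) * (t - s)) * V x \<le> exp (growth * (t - s)) * 1 * V x"
      using 0 V_pos(2) \<gamma>max lmax_pos by (intro mult_right_mono mult_left_mono) auto
    then have "exp (growth * (t - s)) * exp (- (lmax * \<gamma>max) * (t - s)) * V x \<le> exp (growth * (t - s)) * V x" by simp
    from order_trans[OF base[OF 0, of x] ennreal_leI[OF this]] show ?case by simp
  next
    case (Suc n)
    let ?l = "lmax * \<gamma>max" and ?W = "exp (growth * (t - s)) * V x"
    have l: "0 < ?l" using lmax_pos \<gamma>max by simp
    have "(\<integral>\<^sup>+r. ennreal (lmax * exp (- lmax * (r - s))) * (\<integral>\<^sup>+z. trunc n \<mu> (\<lambda>y. ennreal (V y)) r t z \<partial>ring_law \<mu> s r x)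
        * indicator {s..t} r \<partial>lborel)
      \<le> (\<integral>\<^sup>+r. ennreal ?W * (ennreal (?l * exp (- ?l * (r - s))) * indicator {s..t} r) \<partial>lborel)"
    proof (intro nn_integral_mono)
      fix r
      show "ennreal (lmax * exp (- lmax * (r - s))) * (\<integral>\<^sup>+z. trunc n \<mu> (\<lambda>y. ennreal (V y)) r t z \<partial>ring_law \<mu> s r x)
        * indicator {s..t} r \<le> ennreal ?W * (ennreal (?l * exp (- ?l * (r - s))) * indicator {s..t} r)"
      proof (cases "r \<in> {s..t}")
        case True
        have [measurable_cong]: "sets (ring_law \<mu> s r x) = sets borel"
          by (rule space_prob_algebra_borelD) (simp add: \<mu>)
        have "(\<integral>\<^sup>+z. trunc n \<mu> (\<lambda>y. ennreal (V y)) r t z \<partial>ring_law \<mu> s r x)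
          \<le> (\<integral>\<^sup>+z. ennreal (exp (growth * (t - r))) * ennreal (V z) \<partial>ring_law \<mu> s r x)"
          using Suc.IH[of r] True by (intro nn_integral_mono) (simp add: ennreal_mult')
        also have "\<dots> = ennreal (exp (growth * (t - r))) * (\<integral>\<^sup>+z. ennreal (V z) \<partial>ring_law \<mu> s r x)"
          by (intro nn_integral_cmult) measurable
        also have "\<dots> \<le> ennreal (exp (growth * (t - r))) * ennreal (\<gamma>max * (exp (\<rho>max * (r - s)) * V x))"
          using True by (intro mult_left_mono nn_integral_ring_law_V[OF \<mu>]) auto
        finally have "ennreal (lmax * exp (- lmax * (r - s))) * (\<integral>\<^sup>+z. trunc n \<mu> (\<lambda>y. ennreal (V y)) r t z \<partial>ring_law \<mu> s r x)
          \<le> ennreal (lmax * exp (- lmax * (r - s))) * (ennreal (exp (growth * (t - r))) * ennreal (\<gamma>max * (exp (\<rho>max * (r - s)) * V x)))"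
          by (intro mult_left_mono) auto
        also have "\<dots> = ennreal (?l * (exp (- lmax * (r - s)) * exp (\<rho>max * (r - s)) * exp (growth * (t - r))) * V x)"
          using lmax_pos \<gamma>max V_pos(2)[of x] by (simp add: ac_simps flip: ennreal_mult)
        also have "\<dots> = ennreal (?W * (?l * exp (- ?l * (r - s))))"
          unfolding growth_exp by (simp add: ac_simps)
        also have "\<dots> = ennreal ?W * ennreal (?l * exp (- ?l * (r - s)))"
          using l V_pos(2)[of x] by (intro ennreal_mult) auto
        finally show ?thesis using True by simp
      qed simp
    qed
    also have "\<dots> = ennreal ?W * (\<integral>\<^sup>+r. ennreal (?l * exp (- ?l * (r - s))) * indicator {s..t} r \<partial>lborel)"
      by (intro nn_integral_cmult) auto
    also have "(\<integral>\<^sup>+r. ennreal (?l * exp (- ?l * (r - s))) * indicator {s..t} r \<partial>lborel) = ennreal (1 - exp (- ?l * (t - s)))"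
      using Suc.prems l by (intro nn_integral_exp_Icc)
    finally have "trunc (Suc n) \<mu> (\<lambda>y. ennreal (V y)) s t x \<le>
        ennreal (exp (growth * (t - s)) * exp (- ?l * (t - s)) * V x) + ennreal ?W * ennreal (1 - exp (- ?l * (t - s)))"
      unfolding trunc.simps using base[OF Suc.prems] by (rule add_mono[rotated])
    also have "\<dots> = ennreal (exp (growth * (t - s)) * exp (- ?l * (t - s)) * V x + ?W * (1 - exp (- ?l * (t - s))))"
      using V_pos(2)[of x] l Suc.prems by (simp add: ennreal_plus ennreal_mult)
    also have "exp (growth * (t - s)) * exp (- ?l * (t - s)) * V x + ?W * (1 - exp (- ?l * (t - s))) = ?W"
      by (simp add: algebra_simps)
    finally show ?case .
  }
qed

lemma expect_V_le:
  assumes "\<mu> \<in> prob_flows" "s \<le> t"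
  shows "expect \<mu> (\<lambda>y. ennreal (V y)) s t x \<le> ennreal (exp (growth * (t - s)) * V x)"
  unfolding expect_def by (intro SUP_least trunc_V_le assms)

lemma trunc_mono:
  assumes "\<And>y. f y \<le> g y" shows "trunc n \<mu> f s t x \<le> trunc n \<mu> g s t x"
proof (induction n arbitrary: s x)
  case (Suc n)
  show ?case unfolding trunc.simps
    by (intro add_mono mult_left_mono mult_right_mono nn_integral_mono assms Suc) auto
qed (auto intro!: mult_left_mono nn_integral_mono assms)

lemma expect_mono:
  assumes "\<And>y. f y \<le> g y" shows "expect \<mu> f s t x \<le> expect \<mu> g s t x"
  unfolding expect_def by (rule SUP_mono, rule bexI, rule trunc_mono, rule assms, simp)

text \<open>The Lipschitz hypothesis only concerns bounded functions. It extends to functions below \<open>c * V\<close> since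
  a jump from \<open>y\<close> stays in the region where \<open>V\<close> is at most \<open>\<gamma>max * V y\<close>, so that \<open>f\<close> may be cut
  at the level \<open>b = c * \<gamma>max * V y\<close>. The generator of the jumps vanishes on constants; recentring a function
  with values in \<open>[0, b]\<close> to \<open>[-b/2, b/2]\<close> gains the factor 1/2 that the splitting of the norm in two halves
  costs.\<close>

lemma clock_law_lipschitz:
  assumes \<nu>: "\<nu>\<^sub>1 \<in> probs_V V" "\<nu>\<^sub>2 \<in> probs_V V" and f [measurable]: "f \<in> borel_measurable borel"
    and le: "\<And>z. f z \<le> ennreal (c * V z)" and c: "0 \<le> c"
    and D: "V_norm V \<nu>\<^sub>1 \<nu>\<^sub>2 \<le> ennreal D" "0 \<le> D"
  shows "(\<integral>\<^sup>+z. f z \<partial>clock_law \<nu>\<^sub>1 y) \<le> (\<integral>\<^sup>+z. f z \<partial>clock_law \<nu>\<^sub>2 y) + ennreal (c * (\<theta> * \<gamma>max * D / (2 * lmax)) * V y)"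
proof (cases "c = 0")
  case True
  then have f0: "f z = 0" for z using le[of z] by simp
  show ?thesis by (simp add: f0)
next
  case False
  define b where "b = c * \<gamma>max * V y"
  have b: "0 < b" using False c \<gamma>max V_pos(1)[of y] by (simp add: b_def)
  have \<nu>p: "\<nu>\<^sub>1 \<in> probs" "\<nu>\<^sub>2 \<in> probs" using \<nu> by (auto simp: probs_V_iff)
  define g where "g z = enn2real (min (f z) (ennreal b))" for z
  have [measurable]: "g \<in> borel_measurable borel" unfolding g_def by measurable
  have g: "0 \<le> g z" "g z \<le> b" for z
    using b by (auto simp: g_def enn2real_leI)
  have fg: "f z = ennreal (g z)" if "V z \<le> \<gamma>max * V y" for z
  proof -
    have "c * V z \<le> b" using that c mult_left_mono[OF that c] by (simp add: b_def mult.assoc)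
    from order_trans[OF le[of z] ennreal_leI[OF this]] have fb: "f z \<le> ennreal b" .
    then have "f z < \<top>" by (rule le_less_trans) simp
    then show ?thesis using fb by (simp add: g_def min_def)
  qed
  (* recentred: the constant does not contribute to the generator of the jumps *)
  define h where "h z = 2 * g z / b - 1" for z
  have [measurable]: "h \<in> borel_measurable borel" unfolding h_def by measurable
  have h: "\<bar>h z\<bar> \<le> 1" for z
    using g[of z] b by (auto simp: h_def abs_le_iff field_simps)
  have law: "(\<integral>\<^sup>+z. f z \<partial>clock_law \<nu> y) = ennreal (g y + (lam \<nu> y / lmax) * ((\<integral>z. g z \<partial>Q \<nu> y) - g y))"
    and gen: "lam \<nu> y * ((\<integral>z. h z \<partial>Q \<nu> y) - h y) = 2 * lmax / b * ((lam \<nu> y / lmax) * ((\<integral>z. g z \<partial>Q \<nu> y) - g y))"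
    if \<nu>: "\<nu> \<in> probs" for \<nu>
  proof -
    interpret Q: prob_space "Q \<nu> y" by (rule space_prob_algebra_borelD[OF Q_in_probs[OF \<nu>]])
    have [measurable_cong]: "sets (Q \<nu> y) = sets borel" by (rule space_prob_algebra_borelD[OF Q_in_probs[OF \<nu>]])
    define p where "p = lam \<nu> y / lmax"
    have p: "0 \<le> p" "p \<le> 1" using jump_prob_bounds[OF \<nu>] by (auto simp: p_def)
    have int: "integrable (Q \<nu> y) g"
      using g by (intro Q.integrable_const_bound[of _ b]) auto
    have "(\<integral>\<^sup>+z. f z \<partial>Q \<nu> y) = (\<integral>\<^sup>+z. ennreal (g z) \<partial>Q \<nu> y)"
      using Q_V_le[OF \<nu>, of y] fg by (intro nn_integral_cong_AE) (auto elim!: eventually_mono)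
    also have "\<dots> = ennreal (\<integral>z. g z \<partial>Q \<nu> y)"
      using g int by (intro nn_integral_eq_integral) auto
    finally have 1: "(\<integral>\<^sup>+z. f z \<partial>Q \<nu> y) = ennreal (\<integral>z. g z \<partial>Q \<nu> y)" .
    have "V y \<le> \<gamma>max * V y" using \<gamma>max V_pos(2)[of y] mult_right_mono[of 1 \<gamma>max "V y"] by simp
    then have 2: "f y = ennreal (g y)" by (rule fg)
    have 3: "0 \<le> (\<integral>z. g z \<partial>Q \<nu> y)" using g by simp
    show "(\<integral>\<^sup>+z. f z \<partial>clock_law \<nu> y) = ennreal (g y + (lam \<nu> y / lmax) * ((\<integral>z. g z \<partial>Q \<nu> y) - g y))"
      unfolding nn_integral_clock_law[OF f \<nu>] 1 2 p_def[symmetric] using p 3 g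
      by (simp flip: ennreal_mult ennreal_plus) (simp add: algebra_simps)
    have "(\<integral>z. h z \<partial>Q \<nu> y) = 2 / b * (\<integral>z. g z \<partial>Q \<nu> y) - 1"
      unfolding h_def using int by (simp add: Q.prob_space)
    then show "lam \<nu> y * ((\<integral>z. h z \<partial>Q \<nu> y) - h y) = 2 * lmax / b * ((lam \<nu> y / lmax) * ((\<integral>z. g z \<partial>Q \<nu> y) - g y))"
      using lmax_pos b by (simp add: h_def field_simps)
  qed
  define a where "a \<nu> = (lam \<nu> y / lmax) * ((\<integral>z. g z \<partial>Q \<nu> y) - g y)" for \<nu>
  have "ennreal \<bar>2 * lmax / b * a \<nu>\<^sub>1 - 2 * lmax / b * a \<nu>\<^sub>2\<bar> \<le> ennreal \<theta> * V_norm V \<nu>\<^sub>1 \<nu>\<^sub>2"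
    using lipschitz[OF \<nu>, of h y] h unfolding gen[OF \<nu>p(1)] gen[OF \<nu>p(2)] a_def[symmetric] by simp
  also have "\<dots> \<le> ennreal \<theta> * ennreal D" using D by (intro mult_left_mono) auto
  finally have "ennreal \<bar>2 * lmax / b * a \<nu>\<^sub>1 - 2 * lmax / b * a \<nu>\<^sub>2\<bar> \<le> ennreal \<theta> * ennreal D" .
  then have "2 * lmax / b * (a \<nu>\<^sub>1 - a \<nu>\<^sub>2) \<le> \<theta> * D"
    using \<theta> D by (simp add: right_diff_distrib flip: ennreal_mult)
  then have "a \<nu>\<^sub>1 \<le> a \<nu>\<^sub>2 + b * \<theta> * D / (2 * lmax)"
    using b lmax_pos by (simp add: field_simps)
  then have le: "g y + a \<nu>\<^sub>1 \<le> (g y + a \<nu>\<^sub>2) + c * (\<theta> * \<gamma>max * D / (2 * lmax)) * V y"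
    by (simp add: b_def ac_simps)
  have pos: "0 \<le> g y + a \<nu>\<^sub>2"
  proof -
    have "g y + a \<nu>\<^sub>2 = (1 - lam \<nu>\<^sub>2 y / lmax) * g y + lam \<nu>\<^sub>2 y / lmax * (\<integral>z. g z \<partial>Q \<nu>\<^sub>2 y)"
      by (simp add: a_def algebra_simps)
    also have "0 \<le> \<dots>" using jump_prob_bounds[OF \<nu>p(2)] g
      by (intro add_nonneg_nonneg mult_nonneg_nonneg integral_nonneg) auto
    finally show ?thesis .
  qed
  have nn: "0 \<le> c * (\<theta> * \<gamma>max * D / (2 * lmax)) * V y"
    using c \<theta> \<gamma>max D lmax_pos V_pos(2)[of y] by simp
  from ennreal_leI[OF le] show ?thesis
    unfolding law[OF \<nu>p(1)] law[OF \<nu>p(2)] a_def[symmetric] ennreal_plus[OF pos nn] .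
qed

end

section \<open>Perturbation of the driving flow\<close>

context lyapunov_jumps
begin

lemma expect_V_measurable2:
  assumes \<mu>: "\<mu> \<in> prob_flows" and [measurable]: "a \<in> N \<rightarrow>\<^sub>M borel" "b \<in> N \<rightarrow>\<^sub>M borel" "c \<in> N \<rightarrow>\<^sub>M borel"
  shows "(\<lambda>z. expect \<mu> (\<lambda>y. ennreal (V y)) (a z) (b z) (c z)) \<in> borel_measurable N"
  by (intro expect_measurable[OF \<mu>]) measurable

text \<open>The backward equation, integrated in the final time with weight \<open>h\<close>; apart from it only Tonelli's
  theorem is used.\<close>

lemma weighted_expect_backward:
  assumes \<mu>: "\<mu> \<in> prob_flows" and h [measurable]: "h \<in> borel_measurable borel" and h0: "\<And>r. 0 \<le> h r"
    and st: "s \<le> t"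
  shows "(\<integral>\<^sup>+q. ennreal (h q) * expect \<mu> (\<lambda>y. ennreal (V y)) s q x * indicator {s..t} q \<partial>lborel)
    = (\<integral>\<^sup>+q. ennreal (h q * exp (- lmax * (q - s))) * (\<integral>\<^sup>+y. ennreal (V y) \<partial>motion (q - s) x) * indicator {s..t} q \<partial>lborel)
    + (\<integral>\<^sup>+r. ennreal (lmax * exp (- lmax * (r - s))) *
        (\<integral>\<^sup>+z. (\<integral>\<^sup>+q. ennreal (h q) * expect \<mu> (\<lambda>y. ennreal (V y)) r q z * indicator {r..t} q \<partial>lborel) \<partial>ring_law \<mu> s r x)
        * indicator {s..t} r \<partial>lborel)"
proof -
  let ?E = "expect \<mu> (\<lambda>y. ennreal (V y))"
  let ?k = "\<lambda>r. ennreal (lmax * exp (- lmax * (r - s)))"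
  let ?D = "{p. s \<le> fst p \<and> fst p \<le> snd p \<and> snd p \<le> t}"
  have [measurable]: "(\<lambda>p. \<integral>\<^sup>+z. ?E (fst p) (snd p) z \<partial>ring_law \<mu> s (fst p) x) \<in> borel_measurable (borel \<Otimes>\<^sub>M borel)"
    by (intro nn_integral_ring_law_measurable[OF \<mu>] expect_V_measurable2[OF \<mu>]) auto
  have "Measurable.pred (borel \<Otimes>\<^sub>M (borel :: real measure)) (\<lambda>p. s \<le> fst p \<and> fst p \<le> snd p \<and> snd p \<le> t)"
    by measurable
  then have D [measurable]: "?D \<in> sets (borel \<Otimes>\<^sub>M (borel :: real measure))"
    by (simp add: pred_def space_pair_measure)
  have Dind: "(\<lambda>p. indicator ?D p :: ennreal) \<in> borel_measurable (borel \<Otimes>\<^sub>M (borel :: real measure))"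
    using D by (rule borel_measurable_indicator)
  let ?J = "\<lambda>r q. ?k r * ennreal (h q) * (\<integral>\<^sup>+z. ?E r q z \<partial>ring_law \<mu> s r x) * indicator ?D (r, q)"
  have J: "(\<lambda>p. ?J (fst p) (snd p)) \<in> borel_measurable (borel \<Otimes>\<^sub>M borel)"
    using Dind by simp
  have tr: "(\<lambda>q. \<integral>\<^sup>+y. ennreal (V y) \<partial>motion (q - s) x) \<in> borel_measurable borel"
  proof (rule nn_integral_measurable_prob_algebra2[where N=borel])
    show "(\<lambda>q. motion (q - s) x) \<in> borel \<rightarrow>\<^sub>M prob_algebra borel"
      using measurable_compose[OF _ motion_measurable, of "\<lambda>q. (q - s, x)" borel] by simp
  qed measurable
  have Jsec: "(\<lambda>q. \<integral>\<^sup>+r. ?J r q \<partial>lborel) \<in> borel_measurable borel"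
    by (rule lborel.borel_measurable_nn_integral)
      (use measurable_compose[OF measurable_pair_swap'[of borel borel] J] in \<open>simp add: split_beta'\<close>)
  have "(\<integral>\<^sup>+q. ennreal (h q) * ?E s q x * indicator {s..t} q \<partial>lborel)
    = (\<integral>\<^sup>+q. ennreal (h q * exp (- lmax * (q - s))) * (\<integral>\<^sup>+y. ennreal (V y) \<partial>motion (q - s) x) * indicator {s..t} q
      + (\<integral>\<^sup>+r. ?J r q \<partial>lborel) \<partial>lborel)"
  proof (intro nn_integral_cong)
    fix q
    have [measurable]: "(\<lambda>r. \<integral>\<^sup>+z. ?E r q z \<partial>ring_law \<mu> s r x) \<in> borel_measurable borel"
      by (intro nn_integral_ring_law_measurable[OF \<mu>] expect_V_measurable2[OF \<mu>]) auto
    show "ennreal (h q) * ?E s q x * indicator {s..t} q =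
      ennreal (h q * exp (- lmax * (q - s))) * (\<integral>\<^sup>+y. ennreal (V y) \<partial>motion (q - s) x) * indicator {s..t} q
      + (\<integral>\<^sup>+r. ?J r q \<partial>lborel)"
    proof (cases "q \<in> {s..t}")
      case True
      have "(\<integral>\<^sup>+r. ?J r q \<partial>lborel) = (\<integral>\<^sup>+r. ennreal (h q) * (?k r * (\<integral>\<^sup>+z. ?E r q z \<partial>ring_law \<mu> s r x) * indicator {s..q} r) \<partial>lborel)"
        using True by (intro nn_integral_cong) (auto split: split_indicator simp: ac_simps)
      also have "\<dots> = ennreal (h q) * (\<integral>\<^sup>+r. ?k r * (\<integral>\<^sup>+z. ?E r q z \<partial>ring_law \<mu> s r x) * indicator {s..q} r \<partial>lborel)"
        by (intro nn_integral_cmult) auto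
      finally show ?thesis
        using True by (subst expect_backward[OF \<mu>]) (auto simp: distrib_left ennreal_mult h0 mult.assoc)
    next
      case False
      then have "?J r q = 0" for r by auto
      then show ?thesis using False by simp
    qed
  qed
  also have "\<dots> = (\<integral>\<^sup>+q. ennreal (h q * exp (- lmax * (q - s))) * (\<integral>\<^sup>+y. ennreal (V y) \<partial>motion (q - s) x) * indicator {s..t} q \<partial>lborel)
      + (\<integral>\<^sup>+q. \<integral>\<^sup>+r. ?J r q \<partial>lborel \<partial>lborel)"
    using tr Jsec by (intro nn_integral_add) auto
  also have "(\<integral>\<^sup>+q. \<integral>\<^sup>+r. ?J r q \<partial>lborel \<partial>lborel) = (\<integral>\<^sup>+r. \<integral>\<^sup>+q. ?J r q \<partial>lborel \<partial>lborel)"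
  proof -
    have "(\<lambda>p. ?J (fst p) (snd p)) \<in> borel_measurable (lborel \<Otimes>\<^sub>M lborel)" using J by simp
    from lborel_pair.Fubini[OF this] show ?thesis by simp
  qed
  also have "\<dots> = (\<integral>\<^sup>+r. ?k r * (\<integral>\<^sup>+z. (\<integral>\<^sup>+q. ennreal (h q) * ?E r q z * indicator {r..t} q \<partial>lborel) \<partial>ring_law \<mu> s r x)
        * indicator {s..t} r \<partial>lborel)"
  proof (intro nn_integral_cong)
    fix r
    have rp: "ring_law \<mu> s r x \<in> probs" by (simp add: \<mu>)
    have [measurable_cong]: "sets (ring_law \<mu> s r x) = sets borel" by (rule space_prob_algebra_borelD[OF rp])
    have [measurable]: "(\<lambda>q. \<integral>\<^sup>+z. ?E r q z \<partial>ring_law \<mu> s r x) \<in> borel_measurable borel"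
      by (intro nn_integral_ring_law_measurable[OF \<mu>] expect_V_measurable2[OF \<mu>]) auto
    have [measurable]: "(\<lambda>z. ?E r q z) \<in> borel_measurable borel" for q
      by (intro expect_V_measurable2[OF \<mu>]) auto
    show "(\<integral>\<^sup>+q. ?J r q \<partial>lborel) = ?k r * (\<integral>\<^sup>+z. (\<integral>\<^sup>+q. ennreal (h q) * ?E r q z * indicator {r..t} q \<partial>lborel) \<partial>ring_law \<mu> s r x) * indicator {s..t} r"
    proof (cases "r \<in> {s..t}")
      case True
      have "(\<integral>\<^sup>+z. (\<integral>\<^sup>+q. ennreal (h q) * ?E r q z * indicator {r..t} q \<partial>lborel) \<partial>ring_law \<mu> s r x)
        = (\<integral>\<^sup>+q. \<integral>\<^sup>+z. ennreal (h q) * ?E r q z * indicator {r..t} q \<partial>ring_law \<mu> s r x \<partial>lborel)"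
      proof (rule nn_integral_swap_lborel[OF rp])
        have [measurable]: "(\<lambda>p. ?E r (snd p) (fst p)) \<in> borel_measurable (borel \<Otimes>\<^sub>M borel)"
          by (intro expect_V_measurable2[OF \<mu>]) auto
        show "(\<lambda>p. ennreal (h (snd p)) * ?E r (snd p) (fst p) * indicator {r..t} (snd p)) \<in> borel_measurable (borel \<Otimes>\<^sub>M borel)"
          by measurable
      qed
      also have "\<dots> = (\<integral>\<^sup>+q. ennreal (h q) * (\<integral>\<^sup>+z. ?E r q z \<partial>ring_law \<mu> s r x) * indicator {r..t} q \<partial>lborel)"
        by (simp add: nn_integral_cmult nn_integral_multc)
      finally have "?k r * (\<integral>\<^sup>+z. (\<integral>\<^sup>+q. ennreal (h q) * ?E r q z * indicator {r..t} q \<partial>lborel) \<partial>ring_law \<mu> s r x)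
        = (\<integral>\<^sup>+q. ?k r * (ennreal (h q) * (\<integral>\<^sup>+z. ?E r q z \<partial>ring_law \<mu> s r x) * indicator {r..t} q) \<partial>lborel)"
        by (simp add: nn_integral_cmult)
      also have "\<dots> = (\<integral>\<^sup>+q. ?J r q \<partial>lborel)"
        using True by (intro nn_integral_cong) (auto split: split_indicator simp: ac_simps)
      finally show ?thesis using True by simp
    next
      case False
      then have "(\<integral>\<^sup>+q. ?J r q \<partial>lborel) = (\<integral>\<^sup>+q. 0 \<partial>(lborel :: real measure))"
        by (intro nn_integral_cong) (auto split: split_indicator)
      then show ?thesis using False by simp
    qed
  qed
  finally show ?thesis .
qed

text \<open>A Duhamel formula as an inequality. Along a trajectory of the second flow, exchanging the clock
  kernels at time \<open>q\<close> costs \<open>\<theta> * \<gamma>max / 2 * F q\<close> times the current value of \<open>V\<close> (\<open>clock_law_lipschitz\<close>), and the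
  remaining evolution with the first flow amplifies this by \<open>exp (growth * (t - q))\<close>. It is essential to
  keep \<open>V\<close> under the expectation instead of bounding it pointwise: against the initial law it
  gives the mass at time \<open>q\<close>, for which there are bounds that are uniform in time.\<close>

lemma expect_perturbation:
  assumes \<mu>: "\<mu> \<in> prob_flows" and \<mu>': "\<mu>' \<in> prob_flows"
    and F [measurable]: "F \<in> borel_measurable borel" and F0: "\<And>r. 0 \<le> F r"
    and close: "\<And>r. 0 \<le> r \<Longrightarrow> r \<le> t \<Longrightarrow> \<mu> r \<in> probs_V V \<and> \<mu>' r \<in> probs_V V \<and> V_norm V (\<mu> r) (\<mu>' r) \<le> ennreal (F r)"
    and f [measurable]: "f \<in> borel_measurable borel" and le: "\<And>y. f y \<le> ennreal (V y)"
    and s: "0 \<le> s" "s \<le> t"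
  shows "expect \<mu> f s t x \<le> expect \<mu>' f s t x +
    (\<integral>\<^sup>+q. ennreal (\<theta> * \<gamma>max / 2 * F q * exp (growth * (t - q))) * expect \<mu>' (\<lambda>y. ennreal (V y)) s q x * indicator {s..t} q \<partial>lborel)"
proof -
  define h where "h q = \<theta> * \<gamma>max / 2 * F q * exp (growth * (t - q))" for q
  have [measurable]: "h \<in> borel_measurable borel" unfolding h_def by measurable
  have h0: "0 \<le> h q" for q using F0 \<theta> \<gamma>max by (simp add: h_def)
  let ?k = "\<lambda>s r. ennreal (lmax * exp (- lmax * (r - s)))"
  define \<Gamma> where "\<Gamma> s x = (\<integral>\<^sup>+q. ennreal (h q) * expect \<mu>' (\<lambda>y. ennreal (V y)) s q x * indicator {s..t} q \<partial>lborel)" for s x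
  have \<Gamma>m [measurable]: "(\<lambda>p. \<Gamma> (fst p) (snd p)) \<in> borel_measurable (borel \<Otimes>\<^sub>M borel)"
  proof -
    have [measurable]: "(\<lambda>p. expect \<mu>' (\<lambda>y. ennreal (V y)) (fst (fst p)) (snd p) (snd (fst p))) \<in> borel_measurable ((borel \<Otimes>\<^sub>M borel) \<Otimes>\<^sub>M borel)"
      by (intro expect_V_measurable2[OF \<mu>']) auto
    have [measurable]: "Measurable.pred ((borel \<Otimes>\<^sub>M borel) \<Otimes>\<^sub>M borel) (\<lambda>x::(real \<times> 'e) \<times> real. snd x \<in> {fst (fst x)..t})"
      unfolding atLeastAtMost_iff by measurable
    show ?thesis unfolding \<Gamma>_def
      by (rule lborel.borel_measurable_nn_integral) (simp add: split_beta', measurable)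
  qed
  have main: "trunc n \<mu> f s t x \<le> trunc n \<mu>' f s t x + \<Gamma> s x" if "0 \<le> s" "s \<le> t" for n s x
    using that
  proof (induction n arbitrary: s x)
    case (Suc n)
    have s: "0 \<le> s" "s \<le> t" by fact+
    have [measurable]: "(\<lambda>z. trunc n \<mu> f r t z) \<in> borel_measurable borel" for r
      by (intro trunc_measurable_times[OF \<mu> f]) auto
    have [measurable]: "(\<lambda>z. trunc n \<mu>' f r t z) \<in> borel_measurable borel" for r
      by (intro trunc_measurable_times[OF \<mu>' f]) auto
    have [measurable]: "\<Gamma> r \<in> borel_measurable borel" for r
      using measurable_compose[OF _ \<Gamma>m, of "\<lambda>z. (r, z)" borel] by simp
    have ring: "(\<integral>\<^sup>+z. trunc n \<mu> f r t z \<partial>ring_law \<mu> s r x) \<le> (\<integral>\<^sup>+z. trunc n \<mu>' f r t z \<partial>ring_law \<mu>' s r x)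
        + (\<integral>\<^sup>+z. \<Gamma> r z \<partial>ring_law \<mu>' s r x) + ennreal (h r / lmax) * (\<integral>\<^sup>+y. ennreal (V y) \<partial>motion (r - s) x)"
      if r: "r \<in> {s..t}" for r
    proof -
      have [measurable_cong]: "sets (motion (r - s) x) = sets borel" by (rule space_prob_algebra_borelD) simp
      have [measurable_cong]: "sets (ring_law \<mu>' s r x) = sets borel" by (rule space_prob_algebra_borelD) (simp add: \<mu>')
      have \<nu>: "\<mu> r \<in> probs_V V" "\<mu>' r \<in> probs_V V" "V_norm V (\<mu> r) (\<mu>' r) \<le> ennreal (F r)"
        using close[of r] r s by auto
      have \<nu>p [measurable]: "\<mu>' r \<in> probs" using \<nu> by (simp add: probs_V_iff)
      have tb: "trunc n \<mu> f r t z \<le> ennreal (exp (growth * (t - r)) * V z)" for z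
        using order_trans[OF trunc_mono trunc_V_le[OF \<mu>], OF le] r by auto
      have "(\<integral>\<^sup>+z. trunc n \<mu> f r t z \<partial>ring_law \<mu> s r x) = (\<integral>\<^sup>+y. \<integral>\<^sup>+z. trunc n \<mu> f r t z \<partial>clock_law (\<mu> r) y \<partial>motion (r - s) x)"
        using r s by (subst nn_integral_ring_law[OF _ \<mu>]) (auto simp: max_def)
      also have "\<dots> \<le> (\<integral>\<^sup>+y. (\<integral>\<^sup>+z. trunc n \<mu> f r t z \<partial>clock_law (\<mu>' r) y) + ennreal (h r / lmax) * ennreal (V y) \<partial>motion (r - s) x)"
      proof (intro nn_integral_mono)
        fix y
        have "(\<integral>\<^sup>+z. trunc n \<mu> f r t z \<partial>clock_law (\<mu> r) y) \<le> (\<integral>\<^sup>+z. trunc n \<mu> f r t z \<partial>clock_law (\<mu>' r) y)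
          + ennreal (exp (growth * (t - r)) * (\<theta> * \<gamma>max * F r / (2 * lmax)) * V y)"
          by (rule clock_law_lipschitz[OF \<nu>(1,2) _ tb _ \<nu>(3) F0]) auto
        also have "exp (growth * (t - r)) * (\<theta> * \<gamma>max * F r / (2 * lmax)) * V y = h r / lmax * V y"
          by (simp add: h_def)
        finally show "(\<integral>\<^sup>+z. trunc n \<mu> f r t z \<partial>clock_law (\<mu> r) y) \<le> (\<integral>\<^sup>+z. trunc n \<mu> f r t z \<partial>clock_law (\<mu>' r) y)
          + ennreal (h r / lmax) * ennreal (V y)"
          using h0[of r] lmax_pos V_pos(2)[of y] by (simp add: ennreal_mult[symmetric])
      qed
      also have "\<dots> = (\<integral>\<^sup>+y. (\<integral>\<^sup>+z. trunc n \<mu> f r t z \<partial>clock_law (\<mu>' r) y) \<partial>motion (r - s) x)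
          + ennreal (h r / lmax) * (\<integral>\<^sup>+y. ennreal (V y) \<partial>motion (r - s) x)"
        by (subst nn_integral_add) (auto simp: nn_integral_cmult)
      also have "(\<integral>\<^sup>+y. (\<integral>\<^sup>+z. trunc n \<mu> f r t z \<partial>clock_law (\<mu>' r) y) \<partial>motion (r - s) x) = (\<integral>\<^sup>+z. trunc n \<mu> f r t z \<partial>ring_law \<mu>' s r x)"
        using r s by (subst nn_integral_ring_law[OF _ \<mu>']) (auto simp: max_def)
      also have "\<dots> \<le> (\<integral>\<^sup>+z. trunc n \<mu>' f r t z + \<Gamma> r z \<partial>ring_law \<mu>' s r x)"
        using r s by (intro nn_integral_mono Suc.IH) auto
      also have "\<dots> = (\<integral>\<^sup>+z. trunc n \<mu>' f r t z \<partial>ring_law \<mu>' s r x) + (\<integral>\<^sup>+z. \<Gamma> r z \<partial>ring_law \<mu>' s r x)"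
        by (intro nn_integral_add) measurable
      finally show ?thesis by (simp add: add_right_mono)
    qed
    have [measurable]: "(\<lambda>r. \<integral>\<^sup>+z. trunc n \<mu>' f r t z \<partial>ring_law \<mu>' s r x) \<in> borel_measurable borel"
      by (intro nn_integral_ring_law_measurable[OF \<mu>'] trunc_measurable_times[OF \<mu>' f]) auto
    have [measurable]: "(\<lambda>r. \<integral>\<^sup>+z. \<Gamma> r z \<partial>ring_law \<mu>' s r x) \<in> borel_measurable borel"
      by (intro nn_integral_ring_law_measurable[OF \<mu>'] \<Gamma>m) auto
    have [measurable]: "(\<lambda>q. \<integral>\<^sup>+y. ennreal (V y) \<partial>motion (q - s) x) \<in> borel_measurable borel"
    proof (rule nn_integral_measurable_prob_algebra2[where N=borel])
      show "(\<lambda>q. motion (q - s) x) \<in> borel \<rightarrow>\<^sub>M prob_algebra borel"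
        using measurable_compose[OF _ motion_measurable, of "\<lambda>q. (q - s, x)" borel] by simp
    qed measurable
    have "(\<integral>\<^sup>+r. ?k s r * (\<integral>\<^sup>+z. trunc n \<mu> f r t z \<partial>ring_law \<mu> s r x) * indicator {s..t} r \<partial>lborel)
      \<le> (\<integral>\<^sup>+r. ?k s r * (\<integral>\<^sup>+z. trunc n \<mu>' f r t z \<partial>ring_law \<mu>' s r x) * indicator {s..t} r
        + (ennreal (h r * exp (- lmax * (r - s))) * (\<integral>\<^sup>+y. ennreal (V y) \<partial>motion (r - s) x) * indicator {s..t} r
        + ?k s r * (\<integral>\<^sup>+z. \<Gamma> r z \<partial>ring_law \<mu>' s r x) * indicator {s..t} r) \<partial>lborel)"
    proof (intro nn_integral_mono)
      fix r
      have k: "?k s r * ennreal (h r / lmax) = ennreal (h r * exp (- lmax * (r - s)))"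
        using h0[of r] lmax_pos by (simp flip: ennreal_mult)
      show "?k s r * (\<integral>\<^sup>+z. trunc n \<mu> f r t z \<partial>ring_law \<mu> s r x) * indicator {s..t} r
      \<le> ?k s r * (\<integral>\<^sup>+z. trunc n \<mu>' f r t z \<partial>ring_law \<mu>' s r x) * indicator {s..t} r
        + (ennreal (h r * exp (- lmax * (r - s))) * (\<integral>\<^sup>+y. ennreal (V y) \<partial>motion (r - s) x) * indicator {s..t} r
        + ?k s r * (\<integral>\<^sup>+z. \<Gamma> r z \<partial>ring_law \<mu>' s r x) * indicator {s..t} r)"
      proof (cases "r \<in> {s..t}")
        case True
        have eq: "K * (B + C + X * Y) = K * B + ((K * X) * Y + K * C)" for K B C X Y :: ennreal
          by (simp add: distrib_left ac_simps)
        have "?k s r * (\<integral>\<^sup>+z. trunc n \<mu> f r t z \<partial>ring_law \<mu> s r x)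
          \<le> ?k s r * ((\<integral>\<^sup>+z. trunc n \<mu>' f r t z \<partial>ring_law \<mu>' s r x)
            + (\<integral>\<^sup>+z. \<Gamma> r z \<partial>ring_law \<mu>' s r x) + ennreal (h r / lmax) * (\<integral>\<^sup>+y. ennreal (V y) \<partial>motion (r - s) x))"
          by (rule mult_left_mono[OF ring[OF True]]) simp
        then show ?thesis unfolding eq k using True by simp
      qed simp
    qed
    also have "\<dots> = (\<integral>\<^sup>+r. ?k s r * (\<integral>\<^sup>+z. trunc n \<mu>' f r t z \<partial>ring_law \<mu>' s r x) * indicator {s..t} r \<partial>lborel)
        + ((\<integral>\<^sup>+r. ennreal (h r * exp (- lmax * (r - s))) * (\<integral>\<^sup>+y. ennreal (V y) \<partial>motion (r - s) x) * indicator {s..t} r \<partial>lborel)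
        + (\<integral>\<^sup>+r. ?k s r * (\<integral>\<^sup>+z. \<Gamma> r z \<partial>ring_law \<mu>' s r x) * indicator {s..t} r \<partial>lborel))"
      by (subst nn_integral_add; simp?) (subst nn_integral_add; simp?)
    also have "(\<integral>\<^sup>+r. ennreal (h r * exp (- lmax * (r - s))) * (\<integral>\<^sup>+y. ennreal (V y) \<partial>motion (r - s) x) * indicator {s..t} r \<partial>lborel)
        + (\<integral>\<^sup>+r. ?k s r * (\<integral>\<^sup>+z. \<Gamma> r z \<partial>ring_law \<mu>' s r x) * indicator {s..t} r \<partial>lborel) = \<Gamma> s x"
      unfolding \<Gamma>_def using h0 s by (intro weighted_expect_backward[OF \<mu>', symmetric]) auto
    finally show ?case unfolding trunc.simps add.assoc by (rule add_left_mono)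
  qed simp
  show ?thesis
    unfolding expect_def[of \<mu>] h_def[symmetric] \<Gamma>_def[symmetric]
  proof (rule SUP_least)
    fix n
    have "trunc n \<mu> f s t x \<le> trunc n \<mu>' f s t x + \<Gamma> s x" by (rule main[OF s])
    also have "\<dots> \<le> expect \<mu>' f s t x + \<Gamma> s x"
      unfolding expect_def by (intro add_right_mono SUP_upper) simp
    finally show "trunc n \<mu> f s t x \<le> expect \<mu>' f s t x + \<Gamma> s x" .
  qed
qed

end

section \<open>Evolution of measures and decay of the Lyapunov mass\<close>

context lyapunov_jumps
begin

abbreviation mass_V :: "'e measure \<Rightarrow> ennreal" where
  "mass_V \<nu> \<equiv> (\<integral>\<^sup>+x. ennreal (V x) \<partial>\<nu>)"

text \<open>The law at time \<open>t\<close> of the process driven by the flow \<open>\<mu>\<close> and started from \<open>m\<^sub>0\<close>; a solution is a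
  fixed point of \<open>evolve m\<^sub>0\<close>.\<close>

definition evolve :: "'e measure \<Rightarrow> (real \<Rightarrow> 'e measure) \<Rightarrow> real \<Rightarrow> 'e measure" where
  "evolve m\<^sub>0 \<mu> t = m\<^sub>0 \<bind> R \<mu> 0 t"

lemma evolve_in_probs:
  assumes "m\<^sub>0 \<in> probs" "\<mu> \<in> prob_flows" "0 \<le> t" shows "evolve m\<^sub>0 \<mu> t \<in> probs"
  using prob_space_bind'[OF assms(1) jump_kernel_measurable[OF assms(2) order_refl assms(3)]]
    sets_bind'[OF assms(1) jump_kernel_measurable[OF assms(2) order_refl assms(3)]]
  by (simp add: evolve_def space_prob_algebra)

lemma nn_integral_evolve:
  assumes "m\<^sub>0 \<in> probs" "\<mu> \<in> prob_flows" "0 \<le> t" "f \<in> borel_measurable borel"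
  shows "(\<integral>\<^sup>+y. f y \<partial>evolve m\<^sub>0 \<mu> t) = (\<integral>\<^sup>+x. expect \<mu> f 0 t x \<partial>m\<^sub>0)"
  unfolding evolve_def nn_integral_bind_prob[OF assms(4,1) jump_kernel_measurable[OF assms(2) order_refl assms(3)]]
  using assms by (simp add: nn_integral_jump_kernel)

lemma evolve_flow:
  assumes "m\<^sub>0 \<in> probs" "\<mu> \<in> prob_flows" shows "evolve m\<^sub>0 \<mu> \<in> prob_flows"
proof -
  have "(\<lambda>t. m\<^sub>0 \<bind> (\<lambda>x. R \<mu> 0 (max 0 t) x)) \<in> borel \<rightarrow>\<^sub>M prob_algebra borel"
    using jump_kernel_measurable_joint[OF assms(2) order_refl] assms(1)
    by (intro measurable_bind_prob_space2[where N=borel] measurable_const) (auto simp: split_beta')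
  then have "(\<lambda>t. m\<^sub>0 \<bind> (\<lambda>x. R \<mu> 0 (max 0 t) x)) \<in> prob_flows" by (rule measurable_restrict_space1)
  then show ?thesis
    by (rule measurable_cong[THEN iffD1, rotated]) (simp add: space_restrict_space evolve_def)
qed

lemma expect_eval_measurable:
  assumes "\<mu> \<in> prob_flows" "f \<in> borel_measurable borel" "m\<^sub>0 \<in> probs"
  shows "expect \<mu> f s t \<in> borel_measurable m\<^sub>0"
proof -
  have "expect \<mu> f s t \<in> borel_measurable borel" using assms by (intro expect_measurable) auto
  then show ?thesis using assms(3) by (simp add: space_prob_algebra_borelD cong: measurable_cong_sets)
qed

lemma evolve_V_growth:
  assumes m: "m\<^sub>0 \<in> probs" and \<mu>: "\<mu> \<in> prob_flows" and t: "0 \<le> t"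
  shows "mass_V (evolve m\<^sub>0 \<mu> t) \<le> ennreal (exp (growth * t)) * mass_V m\<^sub>0"
proof -
  have [measurable_cong]: "sets m\<^sub>0 = sets borel" by (rule space_prob_algebra_borelD[OF m])
  have "mass_V (evolve m\<^sub>0 \<mu> t) = (\<integral>\<^sup>+x. expect \<mu> (\<lambda>y. ennreal (V y)) 0 t x \<partial>m\<^sub>0)"
    by (rule nn_integral_evolve[OF m \<mu> t]) measurable
  also have "\<dots> \<le> (\<integral>\<^sup>+x. ennreal (exp (growth * t)) * ennreal (V x) \<partial>m\<^sub>0)"
    using expect_V_le[OF \<mu> t] V_pos by (intro nn_integral_mono) (simp add: ennreal_mult)
  finally show ?thesis by (simp add: nn_integral_cmult)
qed

lemma evolve_V_drift:
  assumes m: "m\<^sub>0 \<in> probs" and \<mu>: "\<mu> \<in> prob_flows" and t: "0 \<le> t"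
  shows "mass_V (evolve m\<^sub>0 \<mu> t) \<le> ennreal (exp (- \<rho> * t)) * mass_V m\<^sub>0
    + ennreal \<rho> * (\<integral>\<^sup>+s\<in>{0..t}. ennreal (exp (\<rho> * (s - t))) * (ennreal \<eta> * mass_V (\<mu> s) + ennreal M) \<partial>lborel)"
    (is "_ \<le> _ + ?c")
proof -
  interpret M: prob_space m\<^sub>0 by (rule space_prob_algebra_borelD[OF m])
  have [measurable_cong]: "sets m\<^sub>0 = sets borel" by (rule space_prob_algebra_borelD[OF m])
  have "mass_V (evolve m\<^sub>0 \<mu> t) = (\<integral>\<^sup>+x. (\<integral>\<^sup>+y. ennreal (V y) \<partial>R \<mu> 0 t x) \<partial>m\<^sub>0)"
    unfolding evolve_def by (intro nn_integral_bind_prob[OF _ m jump_kernel_measurable[OF \<mu> order_refl t]]) measurable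
  also have "\<dots> \<le> (\<integral>\<^sup>+x. ennreal (exp (- \<rho> * t)) * ennreal (V x) + ?c \<partial>m\<^sub>0)"
    by (intro nn_integral_mono drift_R[OF \<mu> t])
  also have "\<dots> = ennreal (exp (- \<rho> * t)) * mass_V m\<^sub>0 + ?c"
    by (subst nn_integral_add) (auto simp: nn_integral_cmult M.emeasure_space_1)
  finally show ?thesis .
qed

lemma drift_weight_integral:
  assumes "0 \<le> t" "0 \<le> c"
  shows "ennreal \<rho> * (\<integral>\<^sup>+s\<in>{0..t}. ennreal (exp (\<rho> * (s - t))) * ennreal c \<partial>lborel) = ennreal ((1 - exp (- \<rho> * t)) * c)"
proof -
  have "ennreal \<rho> * (\<integral>\<^sup>+s\<in>{0..t}. ennreal (exp (\<rho> * (s - t))) * ennreal c \<partial>lborel)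
    = (\<integral>\<^sup>+s. ennreal (\<rho> * exp (\<rho> * (s - t)) * c) * indicator {0..t} s \<partial>lborel)"
    using \<rho> assms by (subst nn_integral_cmult[symmetric]) (auto intro!: nn_integral_cong simp: ennreal_mult mult.assoc)
  also have "\<dots> = ennreal (exp (\<rho> * (t - t)) * c - exp (\<rho> * (0 - t)) * c)"
    using assms \<rho> by (intro nn_integral_FTC_Icc[where F="\<lambda>s. exp (\<rho> * (s - t)) * c"]) (auto intro!: derivative_eq_intros)
  finally show ?thesis by (simp add: left_diff_distrib)
qed

text \<open>The fixed point of the bound for the mass in the drift condition, \<open>A = \<eta> * A + M\<close>.\<close>

definition equilibrium_mass :: real ("A\<^sub>M") where "A\<^sub>M = M / (1 - \<eta>)"

lemma equilibrium_mass: "1 \<le> A\<^sub>M" "\<eta> * A\<^sub>M + M = A\<^sub>M" "\<rho> * (1 - \<eta>) * A\<^sub>M = \<rho> * M"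
  using \<eta> M by (auto simp: equilibrium_mass_def field_simps)

lemma drift_const_bound:
  assumes t: "0 \<le> t" and \<mu>: "\<And>s. 0 \<le> s \<Longrightarrow> s \<le> t \<Longrightarrow> mass_V (\<mu> s) \<le> ennreal B" and B: "0 \<le> B"
  shows "ennreal \<rho> * (\<integral>\<^sup>+s\<in>{0..t}. ennreal (exp (\<rho> * (s - t))) * (ennreal \<eta> * mass_V (\<mu> s) + ennreal M) \<partial>lborel)
    \<le> ennreal ((1 - exp (- \<rho> * t)) * (\<eta> * B + M))"
proof -
  have "ennreal \<eta> * mass_V (\<mu> s) + ennreal M \<le> ennreal (\<eta> * B + M)" if "s \<in> {0..t}" for s
  proof -
    have "ennreal \<eta> * mass_V (\<mu> s) + ennreal M \<le> ennreal \<eta> * ennreal B + ennreal M"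
      using \<mu>[of s] that by (intro add_right_mono mult_left_mono) auto
    then show ?thesis using \<eta> M B by (simp add: ennreal_mult ennreal_plus)
  qed
  then have "ennreal \<rho> * (\<integral>\<^sup>+s\<in>{0..t}. ennreal (exp (\<rho> * (s - t))) * (ennreal \<eta> * mass_V (\<mu> s) + ennreal M) \<partial>lborel)
    \<le> ennreal \<rho> * (\<integral>\<^sup>+s\<in>{0..t}. ennreal (exp (\<rho> * (s - t))) * ennreal (\<eta> * B + M) \<partial>lborel)"
    by (intro mult_left_mono nn_integral_mono) (auto split: split_indicator intro!: mult_left_mono)
  also have "\<dots> = ennreal ((1 - exp (- \<rho> * t)) * (\<eta> * B + M))"
    using t \<eta> B M by (intro drift_weight_integral) auto
  finally show ?thesis .
qed

text \<open>Flows with mass at most \<open>B\<close> are mapped to flows of the same kind. Unlike the growth bound this is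
  uniform in time, which is what the fixed point argument and the Gronwall estimate need.\<close>

lemma evolve_V_invariant:
  assumes m: "m\<^sub>0 \<in> probs" "mass_V m\<^sub>0 \<le> ennreal B" and \<mu>: "\<mu> \<in> prob_flows" and t: "0 \<le> t"
    and B: "A\<^sub>M \<le> B" and \<mu>B: "\<And>s. 0 \<le> s \<Longrightarrow> s \<le> t \<Longrightarrow> mass_V (\<mu> s) \<le> ennreal B"
  shows "mass_V (evolve m\<^sub>0 \<mu> t) \<le> ennreal B"
proof -
  let ?e = "exp (- \<rho> * t)"
  have B0: "0 \<le> B" using B equilibrium_mass(1) by simp
  have e: "0 \<le> ?e" "?e \<le> 1" using t \<rho> by auto
  have "(1 - \<eta>) * A\<^sub>M \<le> (1 - \<eta>) * B" using B \<eta> by (intro mult_left_mono) auto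
  then have le: "\<eta> * B + M \<le> B" using equilibrium_mass(2) by (simp add: algebra_simps)
  have "mass_V (evolve m\<^sub>0 \<mu> t) \<le> ennreal ?e * ennreal B + ennreal ((1 - ?e) * (\<eta> * B + M))"
    by (rule order_trans[OF evolve_V_drift[OF m(1) \<mu> t]])
      (intro add_mono mult_left_mono m drift_const_bound[OF t \<mu>B B0]; simp)
  also have "\<dots> = ennreal (?e * B + (1 - ?e) * (\<eta> * B + M))"
    using e B0 \<eta> M by (simp add: ennreal_plus ennreal_mult)
  also have "\<dots> \<le> ennreal B"
    using mult_left_mono[OF le, of "1 - ?e"] e by (intro ennreal_leI) (simp add: algebra_simps)
  finally show ?thesis .
qed

lemma evolve_upper_perturbation:
  assumes m: "m\<^sub>0 \<in> probs_V V" and \<mu>: "\<mu> \<in> prob_flows" and \<mu>': "\<mu>' \<in> prob_flows" and t: "0 \<le> t"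
    and F [measurable]: "F \<in> borel_measurable borel" and F0: "\<And>r. 0 \<le> F r"
    and close: "\<And>r. 0 \<le> r \<Longrightarrow> r \<le> t \<Longrightarrow> \<mu> r \<in> probs_V V \<and> \<mu>' r \<in> probs_V V \<and> V_norm V (\<mu> r) (\<mu>' r) \<le> ennreal (F r)"
    and B: "0 \<le> B" "\<And>r. 0 \<le> r \<Longrightarrow> r \<le> t \<Longrightarrow> mass_V (evolve m\<^sub>0 \<mu>' r) \<le> ennreal B"
  shows "upper_norm V (evolve m\<^sub>0 \<mu> t) (evolve m\<^sub>0 \<mu>' t)
    \<le> ennreal (\<theta> * \<gamma>max * B / 2) * (\<integral>\<^sup>+q. ennreal (F q * exp (growth * (t - q))) * indicator {0..t} q \<partial>lborel)"
proof -
  have mp: "m\<^sub>0 \<in> probs" using m by (simp add: probs_V_iff)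
  have [measurable_cong]: "sets m\<^sub>0 = sets borel" by (rule space_prob_algebra_borelD[OF mp])
  let ?E = "expect \<mu>' (\<lambda>y. ennreal (V y))"
  let ?h = "\<lambda>q. ennreal (\<theta> * \<gamma>max / 2 * F q * exp (growth * (t - q)))"
  have E2: "(\<lambda>p. ?h (snd p) * ?E 0 (snd p) (fst p) * indicator {0..t} (snd p)) \<in> borel_measurable (borel \<Otimes>\<^sub>M borel)"
  proof -
    have [measurable]: "(\<lambda>p. ?E 0 (snd p) (fst p)) \<in> borel_measurable (borel \<Otimes>\<^sub>M borel)"
      by (intro expect_V_measurable2[OF \<mu>']) auto
    show ?thesis by measurable
  qed
  have [measurable]: "(\<lambda>x. \<integral>\<^sup>+q. ?h q * ?E 0 q x * indicator {0..t} q \<partial>lborel) \<in> borel_measurable borel"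
    using E2 by (intro lborel.borel_measurable_nn_integral) (simp add: split_beta')
  have [measurable]: "?E 0 q \<in> borel_measurable borel" for q
    by (intro expect_V_measurable2[OF \<mu>']) auto
  have total: "(\<integral>\<^sup>+x. \<integral>\<^sup>+q. ?h q * ?E 0 q x * indicator {0..t} q \<partial>lborel \<partial>m\<^sub>0) \<le>
    ennreal (\<theta> * \<gamma>max * B / 2) * (\<integral>\<^sup>+q. ennreal (F q * exp (growth * (t - q))) * indicator {0..t} q \<partial>lborel)"
  proof -
    have "(\<integral>\<^sup>+x. \<integral>\<^sup>+q. ?h q * ?E 0 q x * indicator {0..t} q \<partial>lborel \<partial>m\<^sub>0)
      = (\<integral>\<^sup>+q. \<integral>\<^sup>+x. ?h q * ?E 0 q x * indicator {0..t} q \<partial>m\<^sub>0 \<partial>lborel)"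
      by (rule nn_integral_swap_lborel[OF mp E2])
    also have "\<dots> \<le> (\<integral>\<^sup>+q. ennreal (\<theta> * \<gamma>max * B / 2) * (ennreal (F q * exp (growth * (t - q))) * indicator {0..t} q) \<partial>lborel)"
    proof (intro nn_integral_mono)
      fix q
      have "(\<integral>\<^sup>+x. ?h q * ?E 0 q x * indicator {0..t} q \<partial>m\<^sub>0) = ?h q * (\<integral>\<^sup>+x. ?E 0 q x \<partial>m\<^sub>0) * indicator {0..t} q"
        by (simp add: nn_integral_cmult nn_integral_multc)
      also have "\<dots> \<le> ?h q * ennreal B * indicator {0..t} q"
      proof (cases "q \<in> {0..t}")
        case True
        then have "(\<integral>\<^sup>+x. ?E 0 q x \<partial>m\<^sub>0) = mass_V (evolve m\<^sub>0 \<mu>' q)"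
          by (intro nn_integral_evolve[OF mp \<mu>', symmetric]) auto
        also have "\<dots> \<le> ennreal B" using B(2)[of q] True by auto
        finally show ?thesis by (intro mult_right_mono mult_left_mono) auto
      qed simp
      also have "?h q * ennreal B = ennreal (\<theta> * \<gamma>max * B / 2) * ennreal (F q * exp (growth * (t - q)))"
        using \<theta> \<gamma>max B F0[of q] by (simp flip: ennreal_mult add: ac_simps)
      finally show "(\<integral>\<^sup>+x. ?h q * ?E 0 q x * indicator {0..t} q \<partial>m\<^sub>0)
        \<le> ennreal (\<theta> * \<gamma>max * B / 2) * (ennreal (F q * exp (growth * (t - q))) * indicator {0..t} q)"
        by (simp add: mult.assoc)
    qed
    finally show ?thesis by (simp add: nn_integral_cmult)
  qed
  show ?thesis
  proof (rule upper_norm_least)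
    show "evolve m\<^sub>0 \<mu> t \<in> probs" "evolve m\<^sub>0 \<mu>' t \<in> probs" by (intro evolve_in_probs mp \<mu> \<mu>' t)+
    show "mass_V (evolve m\<^sub>0 \<mu>' t) < \<infinity>" using B(2)[OF t] by (auto intro: le_less_trans)
    fix f assume f [measurable]: "f \<in> borel_measurable borel" and le: "\<And>x. f x \<le> ennreal (V x)"
    note [measurable] = expect_eval_measurable[OF \<mu>' f mp]
    have "(\<integral>\<^sup>+x. f x \<partial>evolve m\<^sub>0 \<mu> t) = (\<integral>\<^sup>+x. expect \<mu> f 0 t x \<partial>m\<^sub>0)"
      by (rule nn_integral_evolve[OF mp \<mu> t f])
    also have "\<dots> \<le> (\<integral>\<^sup>+x. expect \<mu>' f 0 t x + (\<integral>\<^sup>+q. ?h q * ?E 0 q x * indicator {0..t} q \<partial>lborel) \<partial>m\<^sub>0)"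
      by (intro nn_integral_mono expect_perturbation[OF \<mu> \<mu>' F F0 close f le order_refl t])
    also have "\<dots> = (\<integral>\<^sup>+x. expect \<mu>' f 0 t x \<partial>m\<^sub>0) + (\<integral>\<^sup>+x. \<integral>\<^sup>+q. ?h q * ?E 0 q x * indicator {0..t} q \<partial>lborel \<partial>m\<^sub>0)"
      by (intro nn_integral_add) measurable
    also have "(\<integral>\<^sup>+x. expect \<mu>' f 0 t x \<partial>m\<^sub>0) = (\<integral>\<^sup>+x. f x \<partial>evolve m\<^sub>0 \<mu>' t)"
      by (rule nn_integral_evolve[OF mp \<mu>' t f, symmetric])
    finally show "(\<integral>\<^sup>+x. f x \<partial>evolve m\<^sub>0 \<mu> t) \<le> (\<integral>\<^sup>+x. f x \<partial>evolve m\<^sub>0 \<mu>' t) +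
      ennreal (\<theta> * \<gamma>max * B / 2) * (\<integral>\<^sup>+q. ennreal (F q * exp (growth * (t - q))) * indicator {0..t} q \<partial>lborel)"
      using total by (auto intro: order_trans add_left_mono)
  qed simp
qed

text \<open>The two halves of the norm add up, and so the factor 1/2 disappears.\<close>

lemma evolve_perturbation:
  assumes m: "m\<^sub>0 \<in> probs_V V" and \<mu>: "\<mu> \<in> prob_flows" and \<mu>': "\<mu>' \<in> prob_flows" and t: "0 \<le> t"
    and F: "F \<in> borel_measurable borel" "\<And>r. 0 \<le> F r"
    and close: "\<And>r. 0 \<le> r \<Longrightarrow> r \<le> t \<Longrightarrow> \<mu> r \<in> probs_V V \<and> \<mu>' r \<in> probs_V V \<and> V_norm V (\<mu> r) (\<mu>' r) \<le> ennreal (F r)"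
    and B: "0 \<le> B" "\<And>r. 0 \<le> r \<Longrightarrow> r \<le> t \<Longrightarrow> mass_V (evolve m\<^sub>0 \<mu> r) \<le> ennreal B"
      "\<And>r. 0 \<le> r \<Longrightarrow> r \<le> t \<Longrightarrow> mass_V (evolve m\<^sub>0 \<mu>' r) \<le> ennreal B"
  shows "V_norm V (evolve m\<^sub>0 \<mu> t) (evolve m\<^sub>0 \<mu>' t)
    \<le> ennreal (\<theta> * \<gamma>max * B) * (\<integral>\<^sup>+q. ennreal (F q * exp (growth * (t - q))) * indicator {0..t} q \<partial>lborel)" (is "_ \<le> _ * ?I")
proof -
  have "V_norm V (evolve m\<^sub>0 \<mu> t) (evolve m\<^sub>0 \<mu>' t) \<le> ennreal (\<theta> * \<gamma>max * B / 2) * ?I + ennreal (\<theta> * \<gamma>max * B / 2) * ?I"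
    unfolding V_norm_def
  proof (intro add_mono)
    show "upper_norm V (evolve m\<^sub>0 \<mu> t) (evolve m\<^sub>0 \<mu>' t) \<le> ennreal (\<theta> * \<gamma>max * B / 2) * ?I"
      by (rule evolve_upper_perturbation[OF m \<mu> \<mu>' t F close B(1,3)])
    have "\<mu>' r \<in> probs_V V \<and> \<mu> r \<in> probs_V V \<and> V_norm V (\<mu>' r) (\<mu> r) \<le> ennreal (F r)"
      if "0 \<le> r" "r \<le> t" for r using close[OF that] V_norm_commute[of V "\<mu> r"] by simp
    from evolve_upper_perturbation[OF m \<mu>' \<mu> t F this B(1,2)]
    show "upper_norm V (evolve m\<^sub>0 \<mu>' t) (evolve m\<^sub>0 \<mu> t) \<le> ennreal (\<theta> * \<gamma>max * B / 2) * ?I" by simp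
  qed
  also have "\<dots> = (ennreal (\<theta> * \<gamma>max * B / 2) + ennreal (\<theta> * \<gamma>max * B / 2)) * ?I" by (simp add: distrib_right)
  also have "ennreal (\<theta> * \<gamma>max * B / 2) + ennreal (\<theta> * \<gamma>max * B / 2) = ennreal (\<theta> * \<gamma>max * B)"
    using \<theta> \<gamma>max B(1) by (simp flip: ennreal_plus)
  finally show ?thesis .
qed

lemma evolve_V_norm_growth:
  assumes m: "m\<^sub>0 \<in> probs_V V" "m\<^sub>0' \<in> probs_V V" and \<mu>: "\<mu> \<in> prob_flows" and t: "0 \<le> t"
  shows "V_norm V (evolve m\<^sub>0 \<mu> t) (evolve m\<^sub>0' \<mu> t) \<le> ennreal (exp (growth * t)) * V_norm V m\<^sub>0 m\<^sub>0'"
proof -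
  have "upper_norm V (evolve m\<^sub>0 \<mu> t) (evolve m\<^sub>0' \<mu> t) \<le> ennreal (exp (growth * t)) * upper_norm V m\<^sub>0 m\<^sub>0'"
    if m: "m\<^sub>0 \<in> probs_V V" "m\<^sub>0' \<in> probs_V V" for m\<^sub>0 m\<^sub>0'
  proof (rule upper_norm_least)
    have mp: "m\<^sub>0 \<in> probs" "m\<^sub>0' \<in> probs" using m by (auto simp: probs_V_iff)
    then show "evolve m\<^sub>0 \<mu> t \<in> probs" "evolve m\<^sub>0' \<mu> t \<in> probs" by (auto intro: evolve_in_probs \<mu> t)
    have "mass_V (evolve m\<^sub>0' \<mu> t) \<le> ennreal (exp (growth * t)) * mass_V m\<^sub>0'" by (rule evolve_V_growth[OF mp(2) \<mu> t])
    also have "\<dots> < \<infinity>" using m by (auto simp: probs_V_iff ennreal_mult_less_top)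
    finally show "mass_V (evolve m\<^sub>0' \<mu> t) < \<infinity>" .
    fix f assume f: "f \<in> borel_measurable borel" and le: "\<And>x. f x \<le> ennreal (V x)"
    have "expect \<mu> f 0 t x \<le> ennreal (exp (growth * t)) * ennreal (V x)" for x
      using order_trans[OF expect_mono[OF le, where \<mu>=\<mu> and s=0 and t=t and x=x] expect_V_le[OF \<mu> t]] V_pos(2)[of x] by (simp add: ennreal_mult)
    then have "(\<integral>\<^sup>+x. expect \<mu> f 0 t x \<partial>m\<^sub>0) \<le> (\<integral>\<^sup>+x. expect \<mu> f 0 t x \<partial>m\<^sub>0') + ennreal (exp (growth * t)) * upper_norm V m\<^sub>0 m\<^sub>0'"
      using mp f by (intro nn_integral_le_upper_norm expect_measurable[OF \<mu>]) auto
    then show "(\<integral>\<^sup>+x. f x \<partial>evolve m\<^sub>0 \<mu> t) \<le> (\<integral>\<^sup>+x. f x \<partial>evolve m\<^sub>0' \<mu> t) + ennreal (exp (growth * t)) * upper_norm V m\<^sub>0 m\<^sub>0'"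
      using nn_integral_evolve[OF mp(1) \<mu> t f] nn_integral_evolve[OF mp(2) \<mu> t f] by simp
  qed simp
  from add_mono[OF this[OF m] this[OF m(2,1)]] show ?thesis
    unfolding V_norm_def by (simp add: distrib_left)
qed

abbreviation solution :: "'e measure \<Rightarrow> (real \<Rightarrow> 'e measure) \<Rightarrow> bool" where
  "solution \<equiv> mean_field_solution lmax lam G H"

lemma solution_iff: "solution m\<^sub>0 m \<longleftrightarrow> m \<in> prob_flows \<and> m 0 = m\<^sub>0 \<and> (\<forall>t\<ge>0. evolve m\<^sub>0 m t = m t)"
  by (simp add: mean_field_solution_def evolve_def)

lemma solutionD:
  assumes "solution m\<^sub>0 m"
  shows "m \<in> prob_flows" "m 0 = m\<^sub>0" "\<And>t. 0 \<le> t \<Longrightarrow> evolve m\<^sub>0 m t = m t" "m\<^sub>0 \<in> probs"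
    "\<And>t. 0 \<le> t \<Longrightarrow> m t \<in> probs"
  using assms flow_in_probs[of m] by (auto simp: solution_iff)

text \<open>The equation is autonomous: this is the Chapman--Kolmogorov relation.\<close>

lemma solution_shift:
  assumes sol: "solution m\<^sub>0 m" and s: "0 \<le> s"
  shows "solution (m s) (\<lambda>r. m (s + r))"
proof -
  note m = solutionD[OF sol]
  have "evolve (m s) (\<lambda>r. m (s + r)) t = m (s + t)" if t: "0 \<le> t" for t
  proof -
    have eq: "R (\<lambda>r. m (s + r)) 0 t = R m s (s + t)" by (simp add: jump_kernel_def fun_eq_iff)
    have mk: "R m 0 s \<in> m\<^sub>0 \<rightarrow>\<^sub>M subprob_algebra borel" "R m s (s + t) \<in> borel \<rightarrow>\<^sub>M subprob_algebra borel"
      using jump_kernel_measurable[OF m(1) order_refl s] jump_kernel_measurable[OF m(1) s, of "s + t"] t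
        space_prob_algebra_borelD(1)[OF m(4)]
      by (auto intro!: measurable_prob_algebraD cong: measurable_cong_sets)
    have "evolve (m s) (\<lambda>r. m (s + r)) t = (m\<^sub>0 \<bind> R m 0 s) \<bind> R m s (s + t)"
      using m(3)[OF s] by (simp add: evolve_def eq)
    also have "\<dots> = m\<^sub>0 \<bind> (\<lambda>x. R m 0 s x \<bind> R m s (s + t))" by (rule bind_assoc[OF mk])
    also have "\<dots> = m\<^sub>0 \<bind> R m 0 (s + t)"
      using s t by (simp add: chapman_kolmogorov[OF m(1)])
    also have "\<dots> = m (s + t)" using m(3)[of "s + t"] s t by (simp add: evolve_def)
    finally show ?thesis .
  qed
  then show ?thesis using flow_shift[OF m(1) s] by (simp add: solution_iff)
qed

lemma solution_in_probs_V:
  assumes sol: "solution m\<^sub>0 m" and m0: "m\<^sub>0 \<in> probs_V V" and t: "0 \<le> t"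
  shows "m t \<in> probs_V V"
proof -
  note m = solutionD[OF sol]
  have "mass_V (m t) \<le> ennreal (exp (growth * t)) * mass_V m\<^sub>0"
    using evolve_V_growth[OF m(4,1) t] m(3)[OF t] by simp
  also have "\<dots> < \<infinity>" using m0 by (auto simp: probs_V_iff ennreal_mult_less_top)
  finally show ?thesis using m(5)[OF t] by (simp add: probs_V_iff)
qed

text \<open>The right-hand side \<open>y\<close> solves the equality in the drift inequality. If the mass exceeds \<open>y\<close> by at most
  \<open>b\<close> on an interval, then the drift inequality improves this to \<open>\<eta> * b\<close>; iterate. A first \<open>b\<close> is provided by the
  growth bound.\<close>

lemma solution_decay:
  assumes sol: "solution m\<^sub>0 m" and v0: "mass_V m\<^sub>0 = ennreal v" "0 \<le> v" and t: "0 \<le> t"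
  shows "mass_V (m t) \<le> ennreal (A\<^sub>M + exp (- \<rho> * (1 - \<eta>) * t) * (v - A\<^sub>M))"
proof -
  note m = solutionD[OF sol]
  define y where "y s = A\<^sub>M + exp (- \<rho> * (1 - \<eta>) * s) * (v - A\<^sub>M)" for s
  define S where "S = exp (\<bar>growth\<bar> * t) * v"
  have S0: "0 \<le> S" using v0 by (simp add: S_def)
  have y0: "0 \<le> y s" if "0 \<le> s" for s
  proof -
    have "exp (- \<rho> * (1 - \<eta>) * s) \<le> 1" using that \<rho> \<eta> by (simp add: mult_nonneg_nonneg mult_nonpos_nonneg)
    then have "0 \<le> (1 - exp (- \<rho> * (1 - \<eta>) * s)) * A\<^sub>M + exp (- \<rho> * (1 - \<eta>) * s) * v"
      using equilibrium_mass(1) v0 by (intro add_nonneg_nonneg mult_nonneg_nonneg) auto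
    then show ?thesis by (simp add: y_def algebra_simps)
  qed
  have step: "mass_V (m s) \<le> ennreal (y s + \<eta> * b)"
    if s: "0 \<le> s" "s \<le> t" and b: "0 \<le> b" and IH: "\<And>r. 0 \<le> r \<Longrightarrow> r \<le> t \<Longrightarrow> mass_V (m r) \<le> ennreal (y r + b)" for s b
  proof -
    (* an antiderivative of the integrand of the drift inequality with y + b in place of the mass *)
    let ?\<Phi> = "\<lambda>r. exp (\<rho> * (r - s)) * (y r + \<eta> * b)"
    have "ennreal \<rho> * (\<integral>\<^sup>+r\<in>{0..s}. ennreal (exp (\<rho> * (r - s))) * (ennreal \<eta> * mass_V (m r) + ennreal M) \<partial>lborel)
      \<le> ennreal \<rho> * (\<integral>\<^sup>+r\<in>{0..s}. ennreal (exp (\<rho> * (r - s)) * (\<eta> * (y r + b) + M)) \<partial>lborel)"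
    proof (intro mult_left_mono nn_integral_mono)
      fix r
      show "ennreal (exp (\<rho> * (r - s))) * (ennreal \<eta> * mass_V (m r) + ennreal M) * indicator {0..s} r
        \<le> ennreal (exp (\<rho> * (r - s)) * (\<eta> * (y r + b) + M)) * indicator {0..s} r"
      proof (cases "r \<in> {0..s}")
        case True
        then have "ennreal \<eta> * mass_V (m r) + ennreal M \<le> ennreal \<eta> * ennreal (y r + b) + ennreal M"
          using IH[of r] s by (intro add_right_mono mult_left_mono) auto
        also have "\<dots> = ennreal (\<eta> * (y r + b) + M)"
          using \<eta> M b y0[of r] True by (simp add: ennreal_mult ennreal_plus)
        finally have "ennreal (exp (\<rho> * (r - s))) * (ennreal \<eta> * mass_V (m r) + ennreal M)
          \<le> ennreal (exp (\<rho> * (r - s))) * ennreal (\<eta> * (y r + b) + M)" by (intro mult_left_mono) auto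
        also have "\<dots> = ennreal (exp (\<rho> * (r - s)) * (\<eta> * (y r + b) + M))" by (simp add: ennreal_mult')
        finally show ?thesis using True by simp
      qed simp
    qed simp
    also have "\<dots> = (\<integral>\<^sup>+r. ennreal (\<rho> * (exp (\<rho> * (r - s)) * (\<eta> * (y r + b) + M))) * indicator {0..s} r \<partial>lborel)"
    proof -
      have [measurable]: "y \<in> borel_measurable borel" unfolding y_def by measurable
      show ?thesis using \<rho> by (subst nn_integral_cmult[symmetric]) (auto intro!: nn_integral_cong simp: ennreal_mult' mult.assoc)
    qed
    also have "\<dots> = ennreal (?\<Phi> s - ?\<Phi> 0)"
    proof (rule nn_integral_FTC_Icc)
      fix r assume r: "r \<in> {0..s}"
      have "(?\<Phi> has_real_derivative \<rho> * exp (\<rho> * (r - s)) * (y r + \<eta> * b)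
          + exp (\<rho> * (r - s)) * (- (\<rho> * (1 - \<eta>)) * (y r - A\<^sub>M))) (at r)"
        unfolding y_def by (auto intro!: derivative_eq_intros simp: algebra_simps)
      also have "\<rho> * exp (\<rho> * (r - s)) * (y r + \<eta> * b) + exp (\<rho> * (r - s)) * (- (\<rho> * (1 - \<eta>)) * (y r - A\<^sub>M))
        = \<rho> * (exp (\<rho> * (r - s)) * (\<eta> * (y r + b) + M))"
      proof -
        have "\<rho> * (y r + \<eta> * b) - \<rho> * (1 - \<eta>) * (y r - A\<^sub>M) = \<rho> * (\<eta> * (y r + b) + M)"
          using equilibrium_mass(3) by (simp add: algebra_simps)
        then have "exp (\<rho> * (r - s)) * (\<rho> * (y r + \<eta> * b) - \<rho> * (1 - \<eta>) * (y r - A\<^sub>M)) = exp (\<rho> * (r - s)) * (\<rho> * (\<eta> * (y r + b) + M))"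
          by (rule arg_cong)
        then show ?thesis by (simp add: right_diff_distrib ac_simps)
      qed
      finally show "(?\<Phi> has_real_derivative \<rho> * (exp (\<rho> * (r - s)) * (\<eta> * (y r + b) + M))) (at r)" .
      show "0 \<le> \<rho> * (exp (\<rho> * (r - s)) * (\<eta> * (y r + b) + M))" using \<rho> \<eta> M b y0[of r] r by simp
    qed (use s in \<open>auto simp: y_def\<close>)
    finally have "mass_V (m s) \<le> ennreal (exp (- \<rho> * s)) * ennreal v + ennreal (?\<Phi> s - ?\<Phi> 0)"
      using evolve_V_drift[OF m(4,1) s(1)] m(3)[OF s(1)] v0 by (auto intro: order_trans add_left_mono)
    moreover have "0 \<le> ?\<Phi> s - ?\<Phi> 0"
    proof -
      have "?\<Phi> s - ?\<Phi> 0 = y s + \<eta> * b - exp (- \<rho> * s) * (v + \<eta> * b)" by (simp add: y_def)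
      moreover have "exp (- \<rho> * s) * v \<le> exp (- \<rho> * (1 - \<eta>) * s) * v"
        using \<rho> \<eta> s v0 by (intro mult_right_mono) (auto simp: algebra_simps)
      moreover have "exp (- \<rho> * (1 - \<eta>) * s) * v \<le> y s"
      proof -
        have "exp (- \<rho> * (1 - \<eta>) * s) \<le> 1" using s \<rho> \<eta> by (simp add: mult_nonneg_nonneg mult_nonpos_nonneg)
        then have "0 \<le> (1 - exp (- \<rho> * (1 - \<eta>) * s)) * A\<^sub>M" using equilibrium_mass(1) by (intro mult_nonneg_nonneg) auto
        then show ?thesis by (simp add: y_def algebra_simps)
      qed
      moreover have "exp (- \<rho> * s) * (\<eta> * b) \<le> 1 * (\<eta> * b)" using \<rho> s \<eta> b by (intro mult_right_mono) auto
      ultimately show ?thesis by (simp add: distrib_left)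
    qed
    ultimately have "mass_V (m s) \<le> ennreal (exp (- \<rho> * s) * v + (?\<Phi> s - ?\<Phi> 0))"
      using v0 by (simp add: ennreal_mult ennreal_plus)
    also have "exp (- \<rho> * s) * v + (?\<Phi> s - ?\<Phi> 0) = y s + \<eta> * b - exp (- \<rho> * s) * (\<eta> * b)"
      by (simp add: y_def algebra_simps)
    also have "\<dots> \<le> y s + \<eta> * b" using \<eta> b by simp
    finally show ?thesis by (simp add: ennreal_leI)
  qed
  have iter: "mass_V (m s) \<le> ennreal (y s + \<eta> ^ n * S)" if "0 \<le> s" "s \<le> t" for s n
    using that
  proof (induction n arbitrary: s)
    case 0
    have "growth * s \<le> \<bar>growth\<bar> * t" using 0 by (intro order_trans[OF mult_right_mono[OF abs_ge_self] mult_left_mono]) auto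
    then have "exp (growth * s) * v \<le> S" using v0 by (simp add: S_def mult_right_mono)
    moreover have "mass_V (m s) \<le> ennreal (exp (growth * s)) * ennreal v"
      using evolve_V_growth[OF m(4,1) 0(1)] m(3)[OF 0(1)] v0 by simp
    ultimately have "mass_V (m s) \<le> ennreal S" by (auto simp flip: ennreal_mult' intro: order_trans ennreal_leI)
    also have "\<dots> \<le> ennreal (y s + \<eta> ^ 0 * S)" using y0[OF 0(1)] by (intro ennreal_leI) simp
    finally show ?case .
  next
    case (Suc n)
    then show ?case using step[OF Suc.prems, of "\<eta> ^ n * S"] \<eta> S0 by (simp add: mult.assoc)
  qed
  have "(\<lambda>n. ennreal (y t + \<eta> ^ n * S)) \<longlonglongrightarrow> ennreal (y t + 0 * S)"
    using \<eta> by (intro tendsto_ennrealI tendsto_intros LIMSEQ_power_zero) auto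
  then have "mass_V (m t) \<le> ennreal (y t + 0 * S)"
    by (rule LIMSEQ_le_const) (use iter[OF t order_refl] in auto)
  then show ?thesis by (simp add: y_def)
qed

end

section \<open>Stability and existence of solutions\<close>

context lyapunov_jumps
begin

text \<open>Exponential bounds are reproduced by the integral in the perturbation bound. The factor \<open>k\<close> is kept on
  the left in order to include \<open>k = 0\<close>.\<close>

lemma exp_convolution:
  assumes "0 \<le> k" "0 \<le> D" "0 \<le> t"
  shows "ennreal k * (\<integral>\<^sup>+q. ennreal (D * exp ((g + k) * q) * exp (g * (t - q))) * indicator {0..t} q \<partial>lborel)
    = ennreal (D * exp (g * t) * (exp (k * t) - 1))"
proof -
  have eq: "exp ((g + k) * q) * exp (g * (t - q)) = exp (g * t) * exp (k * q)" for q :: real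
    by (simp add: algebra_simps flip: exp_add)
  have "ennreal k * (\<integral>\<^sup>+q. ennreal (D * exp ((g + k) * q) * exp (g * (t - q))) * indicator {0..t} q \<partial>lborel)
    = (\<integral>\<^sup>+q. ennreal (D * exp (g * t) * (k * exp (k * q))) * indicator {0..t} q \<partial>lborel)"
    unfolding mult.assoc[of D] eq using assms
    by (subst nn_integral_cmult[symmetric]) (auto intro!: nn_integral_cong simp: ac_simps simp flip: ennreal_mult split: split_indicator)
  also have "\<dots> = ennreal (D * exp (g * t) * exp (k * t) - D * exp (g * t) * exp (k * 0))"
    using assms by (intro nn_integral_FTC_Icc[where F="\<lambda>q. D * exp (g * t) * exp (k * q)"]) (auto intro!: derivative_eq_intros)
  finally show ?thesis by (simp add: right_diff_distrib)
qed

lemma mass_V_in_probs_V: "\<nu> \<in> probs \<Longrightarrow> mass_V \<nu> \<le> ennreal B \<Longrightarrow> \<nu> \<in> probs_V V"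
  by (auto simp: probs_V_iff intro: le_less_trans)

lemma V_norm_le_2B:
  assumes "\<mu> \<in> probs" "\<nu> \<in> probs" "mass_V \<mu> \<le> ennreal B" "mass_V \<nu> \<le> ennreal B" "0 \<le> B"
  shows "V_norm V \<mu> \<nu> \<le> ennreal (2 * B)"
proof -
  have "V_norm V \<mu> \<nu> \<le> mass_V \<mu> + mass_V \<nu>"
    using assms by (intro V_norm_le_sum mass_V_in_probs_V V_measurable)
  also have "\<dots> \<le> ennreal B + ennreal B" using assms by (intro add_mono)
  finally show ?thesis using assms by (simp flip: ennreal_plus)
qed

text \<open>Exchanging the driving flow of the second solution for that of the first one. The mass stays bounded
  by \<open>B\<close> for the mixed evolution as well.\<close>

lemma solution_distance_integral:
  assumes sol: "solution m\<^sub>0 m" "solution m\<^sub>0' m'" and t: "0 \<le> t" and B: "A\<^sub>M \<le> B"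
    and mB: "\<And>s. 0 \<le> s \<Longrightarrow> mass_V (m s) \<le> ennreal B" "\<And>s. 0 \<le> s \<Longrightarrow> mass_V (m' s) \<le> ennreal B"
    and F: "F \<in> borel_measurable borel" "\<And>r. 0 \<le> F r" "\<And>r. 0 \<le> r \<Longrightarrow> r \<le> t \<Longrightarrow> V_norm V (m r) (m' r) \<le> ennreal (F r)"
  shows "V_norm V (evolve m\<^sub>0' m t) (m' t)
    \<le> ennreal (\<theta> * \<gamma>max * B) * (\<integral>\<^sup>+q. ennreal (F q * exp (growth * (t - q))) * indicator {0..t} q \<partial>lborel)"
proof -
  note m = solutionD[OF sol(1)] and m' = solutionD[OF sol(2)]
  have B0: "0 \<le> B" using B equilibrium_mass(1) by simp
  have init: "m\<^sub>0' \<in> probs_V V" using mass_V_in_probs_V[OF m'(5) mB(2), of 0] m'(2) by simp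
  have "V_norm V (evolve m\<^sub>0' m t) (evolve m\<^sub>0' m' t) \<le>
    ennreal (\<theta> * \<gamma>max * B) * (\<integral>\<^sup>+q. ennreal (F q * exp (growth * (t - q))) * indicator {0..t} q \<partial>lborel)"
  proof (rule evolve_perturbation[OF init m(1) m'(1) t F(1,2) _ B0])
    fix r assume r: "0 \<le> r" "r \<le> t"
    show "m r \<in> probs_V V \<and> m' r \<in> probs_V V \<and> V_norm V (m r) (m' r) \<le> ennreal (F r)"
      using mass_V_in_probs_V[OF m(5) mB(1)] mass_V_in_probs_V[OF m'(5) mB(2)] F(3) r by simp
    show "mass_V (evolve m\<^sub>0' m r) \<le> ennreal B"
      using mB(2)[of 0] m'(2) by (intro evolve_V_invariant[OF m'(4) _ m(1) r(1) B] mB) auto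
    show "mass_V (evolve m\<^sub>0' m' r) \<le> ennreal B" using mB(2) m'(3) r by simp
  qed
  then show ?thesis using m'(3)[OF t] by simp
qed

text \<open>Gronwall's lemma, with explicit exponentials in place of integrals of the distance itself. A bound \<open>D n * exp (L * s)\<close> for the distance, \<open>L = growth + c\<close>, is improved by one
  application of the perturbation bound to \<open>D n - exp (- c * t) * (D n - d)\<close>, whence \<open>D n\<close>
  decreases to \<open>d\<close>.\<close>

lemma solution_stability:
  assumes sol: "solution m\<^sub>0 m" "solution m\<^sub>0' m'" and t: "0 \<le> t" and B: "A\<^sub>M \<le> B"
    and mB: "\<And>s. 0 \<le> s \<Longrightarrow> mass_V (m s) \<le> ennreal B" "\<And>s. 0 \<le> s \<Longrightarrow> mass_V (m' s) \<le> ennreal B"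
    and d: "V_norm V m\<^sub>0 m\<^sub>0' = ennreal d" "0 \<le> d"
  shows "V_norm V (m t) (m' t) \<le> ennreal (d * exp ((growth + \<theta> * \<gamma>max * B) * t))"
proof -
  note m = solutionD[OF sol(1)] and m' = solutionD[OF sol(2)]
  define c where "c = \<theta> * \<gamma>max * B"
  have B0: "0 \<le> B" using B equilibrium_mass(1) by simp
  have c0: "0 \<le> c" using \<theta> \<gamma>max B0 by (simp add: c_def)
  have mV: "m s \<in> probs_V V" "m' s \<in> probs_V V" if "0 \<le> s" for s
    using mass_V_in_probs_V[OF m(5) mB(1)] mass_V_in_probs_V[OF m'(5) mB(2)] that by simp_all
  have init: "m\<^sub>0 \<in> probs_V V" "m\<^sub>0' \<in> probs_V V" using mV[of 0] m(2) m'(2) by auto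
  (* the distance never exceeds 2 * B *)
  define D\<^sub>0 where "D\<^sub>0 = max d (2 * B * exp (\<bar>growth + c\<bar> * t))"
  define q where "q = 1 - exp (- c * t)"
  have q: "0 \<le> q" "q < 1" using c0 t by (auto simp: q_def)
  define D where "D n = d + q ^ n * (D\<^sub>0 - d)" for n
  have D: "d \<le> D n" "D n * q + (1 - q) * d = D (Suc n)" for n
  proof -
    have "0 \<le> q ^ n * (D\<^sub>0 - d)" using q by (intro mult_nonneg_nonneg) (auto simp: D\<^sub>0_def)
    then show "d \<le> D n" by (simp add: D_def)
    show "D n * q + (1 - q) * d = D (Suc n)" by (simp add: D_def algebra_simps)
  qed
  have bound: "V_norm V (m s) (m' s) \<le> ennreal (D n * exp ((growth + c) * s))" if "0 \<le> s" "s \<le> t" for n s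
    using that
  proof (induction n arbitrary: s)
    case 0
    have "- (growth + c) * s \<le> \<bar>growth + c\<bar> * t"
      using 0 by (intro order_trans[OF mult_right_mono[of _ "\<bar>growth + c\<bar>"] mult_left_mono]) auto
    then have "exp (- (growth + c) * s) \<le> exp (\<bar>growth + c\<bar> * t)" by simp
    then have "2 * B * exp (- (growth + c) * s) \<le> D\<^sub>0"
      unfolding D\<^sub>0_def using B0 by (intro max.coboundedI2 mult_left_mono) auto
    then have a: "2 * B * exp (- (growth + c) * s) * exp ((growth + c) * s) \<le> D\<^sub>0 * exp ((growth + c) * s)"
      by (intro mult_right_mono) auto
    have b: "exp (- (growth + c) * s) * exp ((growth + c) * s) = 1"
      unfolding exp_add[symmetric] by (simp add: algebra_simps)
    have "2 * B = 2 * B * exp (- (growth + c) * s) * exp ((growth + c) * s)"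
      unfolding mult.assoc b by simp
    also note a
    finally have "2 * B \<le> D 0 * exp ((growth + c) * s)" by (simp add: D_def)
    moreover have "V_norm V (m s) (m' s) \<le> ennreal (2 * B)"
      using 0 by (intro V_norm_le_2B m m' mB B0)
    ultimately show ?case by (auto intro: order_trans ennreal_leI)
  next
    case (Suc n)
    have s: "0 \<le> s" "s \<le> t" by fact+
    have D0: "0 \<le> D n" using D(1)[of n] d by simp
    have E: "evolve m\<^sub>0' m s \<in> probs" by (rule evolve_in_probs[OF m'(4) m(1) s(1)])
    have "V_norm V (m s) (m' s) \<le> V_norm V (m s) (evolve m\<^sub>0' m s) + V_norm V (evolve m\<^sub>0' m s) (m' s)"
      using mV[OF s(1)] E by (intro V_norm_triangle) auto
    also have "V_norm V (m s) (evolve m\<^sub>0' m s) \<le> ennreal (exp (growth * s)) * ennreal d"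
      using evolve_V_norm_growth[OF init m(1) s(1)] m(3)[OF s(1)] d by simp
    also have "V_norm V (evolve m\<^sub>0' m s) (m' s) \<le> ennreal c *
        (\<integral>\<^sup>+q. ennreal (D n * exp ((growth + c) * q) * exp (growth * (s - q))) * indicator {0..s} q \<partial>lborel)"
      unfolding c_def
      by (rule solution_distance_integral[OF sol s(1) B mB])
        (use Suc.IH s D0 in \<open>auto simp: c_def[symmetric]\<close>)
    also have "\<dots> = ennreal (D n * exp (growth * s) * (exp (c * s) - 1))"
      by (rule exp_convolution[OF c0 D0 s(1)])
    finally have "V_norm V (m s) (m' s) \<le> ennreal (exp (growth * s)) * ennreal d + ennreal (D n * exp (growth * s) * (exp (c * s) - 1))"
      by (simp add: add_mono)
    also have "\<dots> = ennreal (exp (growth * s) * d + D n * exp (growth * s) * (exp (c * s) - 1))"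
      using D0 d c0 s by (simp add: ennreal_mult ennreal_plus)
    also have "exp (growth * s) * d + D n * exp (growth * s) * (exp (c * s) - 1)
      = exp ((growth + c) * s) * (D n - exp (- c * s) * (D n - d))"
      by (simp add: algebra_simps exp_add exp_minus field_simps)
    also have "\<dots> \<le> exp ((growth + c) * s) * (D n - exp (- c * t) * (D n - d))"
      using s c0 D(1)[of n] by (intro mult_left_mono diff_left_mono mult_right_mono) (auto simp: mult_left_mono)
    also have "D n - exp (- c * t) * (D n - d) = D (Suc n)"
      unfolding D(2)[symmetric] by (simp add: q_def algebra_simps)
    finally show ?case by (simp add: mult.commute ennreal_leI)
  qed
  have "(\<lambda>n. ennreal (D n * exp ((growth + c) * t))) \<longlonglongrightarrow> ennreal ((d + 0 * (D\<^sub>0 - d)) * exp ((growth + c) * t))"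
    unfolding D_def using q by (intro tendsto_ennrealI tendsto_intros LIMSEQ_power_zero) auto
  then have "V_norm V (m t) (m' t) \<le> ennreal ((d + 0 * (D\<^sub>0 - d)) * exp ((growth + c) * t))"
    by (rule LIMSEQ_le_const) (use bound[OF t order_refl] in auto)
  then show ?thesis by (simp add: c_def)
qed

text \<open>Comparable by \<open>expect_ge_no_ring\<close>, hence equal.\<close>

lemma evolve_zero:
  assumes m: "m\<^sub>0 \<in> probs" and \<mu>: "\<mu> \<in> prob_flows" shows "evolve m\<^sub>0 \<mu> 0 = m\<^sub>0"
proof -
  have "R \<mu> 0 0 x = return borel x" for x
  proof (rule prob_measure_eqI_le[symmetric])
    show "return borel x \<in> probs" by (simp add: space_prob_algebra prob_space_return)
    show "R \<mu> 0 0 x \<in> probs" by (rule jump_kernel_in_probs[OF \<mu> order_refl])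
    fix A :: "'e set" assume A: "A \<in> sets borel"
    have "emeasure (return borel x) A = (\<integral>\<^sup>+y. indicator A y \<partial>motion 0 x)"
      using A by (simp add: motion_nonneg P_zero)
    also have "\<dots> \<le> expect \<mu> (indicator A) 0 0 x"
      using expect_ge_no_ring[where s=0 and t=0 and f="indicator A" and x=x and \<mu>=\<mu>] by simp
    also have "\<dots> = emeasure (R \<mu> 0 0 x) A"
      using A by (simp add: nn_integral_jump_kernel[OF \<mu>, symmetric] space_prob_algebra_borelD[OF jump_kernel_in_probs[OF \<mu>]])
    finally show "emeasure (return borel x) A \<le> emeasure (R \<mu> 0 0 x) A" .
  qed
  then have "R \<mu> 0 0 = return borel" by (rule ext)
  then show ?thesis
    unfolding evolve_def by (simp add: bind_return'' space_prob_algebra_borelD[OF m])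
qed

lemma ennreal_eq_0_geometric:
  assumes "\<And>n. a \<le> ennreal (K * (1/2) ^ n)" shows "a = 0"
proof -
  have "(\<lambda>n. ennreal (K * (1/2) ^ n)) \<longlonglongrightarrow> ennreal (K * 0)"
    by (intro tendsto_ennrealI tendsto_intros LIMSEQ_power_zero) auto
  then have "a \<le> ennreal (K * 0)" by (rule LIMSEQ_le_const) (use assms in auto)
  then show ?thesis by simp
qed

text \<open>Picard iteration on the flows of mass at most \<open>B\<close>. In the norm with weight \<open>exp (- (growth + k) * t)\<close> in
  time, \<open>evolve m\<^sub>0\<close> is a contraction by 1/2 on the whole half-line as soon as \<open>k \<ge> 2 * c\<close>.\<close>

lemma solution_exists:
  assumes m0: "m\<^sub>0 \<in> probs_V V"
  shows "\<exists>m. solution m\<^sub>0 m"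
proof -
  have m0p: "m\<^sub>0 \<in> probs" using m0 by (simp add: probs_V_iff)
  obtain v where v: "mass_V m\<^sub>0 = ennreal v" "0 \<le> v"
    using m0 by (cases "mass_V m\<^sub>0") (auto simp: probs_V_iff)
  define B where "B = max v A\<^sub>M"
  have B: "A\<^sub>M \<le> B" "0 \<le> B" "mass_V m\<^sub>0 \<le> ennreal B"
    using v equilibrium_mass(1) by (auto simp: B_def intro: ennreal_leI)
  define c where "c = \<theta> * \<gamma>max * B"
  have c0: "0 \<le> c" using \<theta> \<gamma>max B by (simp add: c_def)
  (* k >= 2 * c for the contraction; growth + k >= 0 lets the weight dominate 1 *)
  define k where "k = 2 * c + 1 + \<bar>growth\<bar>"
  have k: "0 \<le> k" "c \<le> k / 2" "0 \<le> growth + k" using c0 by (auto simp: k_def)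
  define X where "X = rec_nat (\<lambda>_::real. m\<^sub>0) (\<lambda>_. evolve m\<^sub>0)"
  have X0: "X 0 = (\<lambda>_. m\<^sub>0)" and XS: "X (Suc n) = evolve m\<^sub>0 (X n)" for n by (simp_all add: X_def)
  have Xflow: "X n \<in> prob_flows" for n
    by (induction n) (auto simp: X0 XS m0p intro: evolve_flow)
  have XB: "mass_V (X n s) \<le> ennreal B" if "0 \<le> s" for n s
    using that
  proof (induction n arbitrary: s)
    case (Suc n)
    then show ?case unfolding XS by (intro evolve_V_invariant[OF m0p B(3) Xflow _ B(1)]) auto
  qed (simp add: X0 B)
  have Xp: "X n s \<in> probs" if "0 \<le> s" for n s using flow_in_probs[OF Xflow that] .
  have XV: "X n s \<in> probs_V V" if "0 \<le> s" for n s by (rule mass_V_in_probs_V[OF Xp[OF that] XB[OF that]])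
  have contract: "V_norm V (evolve m\<^sub>0 \<mu> t) (evolve m\<^sub>0 \<mu>' t) \<le> ennreal (K / 2 * exp ((growth + k) * t))"
    if \<mu>: "\<mu> \<in> prob_flows" "\<mu>' \<in> prob_flows" and \<mu>B: "\<And>s. 0 \<le> s \<Longrightarrow> mass_V (\<mu> s) \<le> ennreal B" "\<And>s. 0 \<le> s \<Longrightarrow> mass_V (\<mu>' s) \<le> ennreal B"
      and d: "\<And>s. 0 \<le> s \<Longrightarrow> V_norm V (\<mu> s) (\<mu>' s) \<le> ennreal (K * exp ((growth + k) * s))" and K: "0 \<le> K" and t: "0 \<le> t"
    for \<mu> \<mu>' K t
  proof -
    let ?I = "\<integral>\<^sup>+q. ennreal (K * exp ((growth + k) * q) * exp (growth * (t - q))) * indicator {0..t} q \<partial>lborel"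
    have "V_norm V (evolve m\<^sub>0 \<mu> t) (evolve m\<^sub>0 \<mu>' t) \<le> ennreal (\<theta> * \<gamma>max * B) * ?I"
    proof (rule evolve_perturbation[OF m0 \<mu> t _ _ _ B(2)])
      fix r assume r: "0 \<le> r" "r \<le> t"
      show "\<mu> r \<in> probs_V V \<and> \<mu>' r \<in> probs_V V \<and> V_norm V (\<mu> r) (\<mu>' r) \<le> ennreal (K * exp ((growth + k) * r))"
        using mass_V_in_probs_V[OF flow_in_probs[OF \<mu>(1)] \<mu>B(1)] mass_V_in_probs_V[OF flow_in_probs[OF \<mu>(2)] \<mu>B(2)] r d by simp
      show "mass_V (evolve m\<^sub>0 \<mu> r) \<le> ennreal B" by (rule evolve_V_invariant[OF m0p B(3) \<mu>(1) r(1) B(1) \<mu>B(1)])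
      show "mass_V (evolve m\<^sub>0 \<mu>' r) \<le> ennreal B" by (rule evolve_V_invariant[OF m0p B(3) \<mu>(2) r(1) B(1) \<mu>B(2)])
    qed (use K in auto)
    also have "\<dots> \<le> ennreal (1/2 * k) * ?I"
      using k by (intro mult_right_mono ennreal_leI) (auto simp: c_def)
    also have "\<dots> = ennreal (1/2) * (ennreal k * ?I)" using k by (subst ennreal_mult) (auto simp: mult.assoc)
    also have "ennreal k * ?I = ennreal (K * exp (growth * t) * (exp (k * t) - 1))"
      by (rule exp_convolution[OF k(1) K t])
    also have "\<dots> \<le> ennreal (K * exp (growth * t) * exp (k * t))"
      using K by (intro ennreal_leI mult_left_mono) auto
    finally have "V_norm V (evolve m\<^sub>0 \<mu> t) (evolve m\<^sub>0 \<mu>' t) \<le> ennreal (1/2) * ennreal (K * exp (growth * t) * exp (k * t))"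
      by (simp add: mult_left_mono)
    also have "\<dots> = ennreal (1/2 * (K * exp (growth * t) * exp (k * t)))" by (rule ennreal_mult[symmetric]) (use K in auto)
    also have "1/2 * (K * exp (growth * t) * exp (k * t)) = K / 2 * exp ((growth + k) * t)"
      by (simp add: distrib_right exp_add)
    finally show ?thesis .
  qed
  have dist: "V_norm V (X n s) (X (Suc n) s) \<le> ennreal (2 * B * (1/2) ^ n * exp ((growth + k) * s))" if "0 \<le> s" for n s
    using that
  proof (induction n arbitrary: s)
    case 0
    have "V_norm V (X 0 s) (X (Suc 0) s) \<le> ennreal (2 * B)"
      using 0 by (intro V_norm_le_2B Xp XB B)
    also have "\<dots> \<le> ennreal (2 * B * (1/2) ^ 0 * exp ((growth + k) * s))"
      using 0 k(3) B(2) mult_left_mono[of 1 "exp ((growth + k) * s)" "2 * B"] by (intro ennreal_leI) simp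
    finally show ?case .
  next
    case (Suc n)
    from contract[OF Xflow Xflow XB XB Suc.IH _ Suc.prems] show ?case
      unfolding XS[of n, symmetric] XS[of "Suc n", symmetric] using B(2) by simp
  qed
  have cauchy: "V_norm V (X n s) (X l s) \<le> ennreal (4 * B * exp ((growth + k) * s) * (1/2) ^ n)"
    if s: "0 \<le> s" and "n \<le> l" for n l s
  proof -
    let ?K = "4 * B * exp ((growth + k) * s)"
    have "V_norm V (X n s) (X l s) \<le> ennreal (?K * ((1/2) ^ n - (1/2) ^ l))"
      using \<open>n \<le> l\<close>
    proof (induction l rule: dec_induct)
      case base
      then show ?case using V_norm_self[OF XV[OF s] V_measurable] by simp
    next
      case (step l)
      have "V_norm V (X n s) (X (Suc l) s) \<le> V_norm V (X n s) (X l s) + V_norm V (X l s) (X (Suc l) s)"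
        using XV[OF s] Xp[OF s] by (intro V_norm_triangle) auto
      also have "\<dots> \<le> ennreal (?K * ((1/2) ^ n - (1/2) ^ l)) + ennreal (2 * B * (1/2) ^ l * exp ((growth + k) * s))"
        by (intro add_mono step.IH dist[OF s])
      also have "\<dots> = ennreal (?K * ((1/2) ^ n - (1/2) ^ l) + 2 * B * (1/2) ^ l * exp ((growth + k) * s))"
        using B(2) step.hyps power_decreasing[OF step.hyps(1), of "1/2::real"] by (intro ennreal_plus[symmetric]) auto
      also have "?K * ((1/2) ^ n - (1/2) ^ l) + 2 * B * (1/2) ^ l * exp ((growth + k) * s) = ?K * ((1/2) ^ n - (1/2) ^ Suc l)"
        by (simp add: algebra_simps)
      finally show ?case .
    qed
    also have "\<dots> \<le> ennreal (?K * (1/2) ^ n)" using B(2) by (intro ennreal_leI mult_left_mono) auto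
    finally show ?thesis .
  qed
  have "\<exists>Y. 0 \<le> s \<longrightarrow> Y \<in> probs_V V \<and> (\<forall>n. V_norm V (X n s) Y \<le> ennreal (2 * (4 * B * exp ((growth + k) * s) * (1/2) ^ n)))
      \<and> (\<forall>A\<in>sets borel. (\<lambda>n. emeasure (X n s) A) \<longlonglongrightarrow> emeasure Y A)" for s
  proof (cases "0 \<le> s")
    case True
    have "(\<lambda>n. 4 * B * exp ((growth + k) * s) * (1/2) ^ n) \<longlonglongrightarrow> 4 * B * exp ((growth + k) * s) * 0"
      by (intro tendsto_intros LIMSEQ_power_zero) auto
    then have "(\<lambda>n. 4 * B * exp ((growth + k) * s) * (1/2) ^ n) \<longlonglongrightarrow> 0" by simp
    from V_norm_complete[OF V_measurable V_ge_1 XV[OF True] this _ cauchy[OF True]] B(2)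
    show ?thesis by (smt (verit, best) mult_nonneg_nonneg exp_ge_zero zero_le_power divide_nonneg_nonneg)
  qed auto
  then obtain m where m: "\<And>s. 0 \<le> s \<Longrightarrow> m s \<in> probs_V V"
      "\<And>s n. 0 \<le> s \<Longrightarrow> V_norm V (X n s) (m s) \<le> ennreal (8 * B * (1/2) ^ n * exp ((growth + k) * s))"
      "\<And>s A. 0 \<le> s \<Longrightarrow> A \<in> sets borel \<Longrightarrow> (\<lambda>n. emeasure (X n s) A) \<longlonglongrightarrow> emeasure (m s) A"
    by (simp add: ac_simps) metis
  have mp: "m s \<in> probs" if "0 \<le> s" for s using m(1)[OF that] by (simp add: probs_V_iff)
  have mflow: "m \<in> prob_flows"
  proof (rule measurable_prob_algebraI)
    show "prob_space (m s)" if "s \<in> space (restrict_space borel {0..})" for s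
      using that by (auto simp: space_restrict_space intro: space_prob_algebra_borelD(3)[OF mp])
    show "m \<in> restrict_space borel {0..} \<rightarrow>\<^sub>M subprob_algebra borel"
    proof (rule measurable_subprob_algebra)
      fix s :: real assume "s \<in> space (restrict_space borel {0..})"
      then have "0 \<le> s" by (simp add: space_restrict_space)
      then show "subprob_space (m s)" "sets (m s) = sets borel"
        using space_prob_algebra_borelD[OF mp] by (auto intro: prob_space_imp_subprob_space)
    next
      fix A :: "'e set" assume A: "A \<in> sets borel"
      show "(\<lambda>s. emeasure (m s) A) \<in> borel_measurable (restrict_space borel {0..})"
      proof (rule borel_measurable_LIMSEQ_order)
        show "(\<lambda>n. emeasure (X n s) A) \<longlonglongrightarrow> emeasure (m s) A" if "s \<in> space (restrict_space borel {0..})" for s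
          using that m(3)[OF _ A] by (simp add: space_restrict_space)
        show "(\<lambda>s. emeasure (X n s) A) \<in> borel_measurable (restrict_space borel {0..})" for n
          using measurable_emeasure_subprob_algebra[OF A]
          by (rule measurable_compose[OF measurable_prob_algebraD[OF Xflow]])
      qed
    qed
  qed
  have mB: "mass_V (m s) \<le> ennreal B" if s: "0 \<le> s" for s
  proof -
    have "mass_V (m s) \<le> ennreal (B + 8 * B * (1/2) ^ n * exp ((growth + k) * s))" for n
    proof -
      have "mass_V (m s) \<le> mass_V (X n s) + 1 * upper_norm V (m s) (X n s)"
        by (rule nn_integral_le_upper_norm[OF mp[OF s] Xp[OF s]]) auto
      also have "\<dots> \<le> ennreal B + ennreal (8 * B * (1/2) ^ n * exp ((growth + k) * s))"
        using m(2)[OF s, of n] unfolding V_norm_def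
        by (intro add_mono XB[OF s]) (auto elim: order_trans[rotated])
      finally show ?thesis using B(2) by (simp add: ennreal_plus)
    qed
    moreover have "(\<lambda>n. ennreal (B + 8 * B * (1/2) ^ n * exp ((growth + k) * s))) \<longlonglongrightarrow> ennreal (B + 8 * B * 0 * exp ((growth + k) * s))"
      by (intro tendsto_ennrealI tendsto_intros LIMSEQ_power_zero) auto
    ultimately have "mass_V (m s) \<le> ennreal (B + 8 * B * 0 * exp ((growth + k) * s))"
      by (intro LIMSEQ_le_const) auto
    then show ?thesis by simp
  qed
  have fixed: "evolve m\<^sub>0 m t = m t" if t: "0 \<le> t" for t
  proof (rule V_norm_eq_0D[OF _ mp[OF t] V_measurable V_ge_1])
    show ep: "evolve m\<^sub>0 m t \<in> probs" by (rule evolve_in_probs[OF m0p mflow t])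
    have eV: "evolve m\<^sub>0 m t \<in> probs_V V"
      by (rule mass_V_in_probs_V[OF ep evolve_V_invariant[OF m0p B(3) mflow t B(1) mB]])
    show "V_norm V (evolve m\<^sub>0 m t) (m t) = 0"
    proof (rule ennreal_eq_0_geometric)
      fix n
      have "V_norm V (evolve m\<^sub>0 m t) (m t) \<le> V_norm V (evolve m\<^sub>0 m t) (X (Suc n) t) + V_norm V (X (Suc n) t) (m t)"
        using eV m(1)[OF t] Xp[OF t] by (intro V_norm_triangle) auto
      also have "V_norm V (evolve m\<^sub>0 m t) (X (Suc n) t) \<le> ennreal (8 * B * (1/2) ^ n / 2 * exp ((growth + k) * t))"
        unfolding XS
        using contract[OF mflow Xflow[of n] mB XB[of _ n], where K="8 * B * (1/2) ^ n" and t=t] m(2)[of _ n] B(2) t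
        by (simp add: V_norm_commute[of V "m _"])
      also have "V_norm V (X (Suc n) t) (m t) \<le> ennreal (8 * B * (1/2) ^ Suc n * exp ((growth + k) * t))" by (rule m(2)[OF t])
      finally have "V_norm V (evolve m\<^sub>0 m t) (m t) \<le> ennreal (8 * B * (1/2) ^ n / 2 * exp ((growth + k) * t))
        + ennreal (8 * B * (1/2) ^ Suc n * exp ((growth + k) * t))" by (simp add: add_mono)
      also have "\<dots> = ennreal (8 * B * exp ((growth + k) * t) * (1/2) ^ n)"
        using B(2) by (subst ennreal_plus[symmetric]) (auto simp: algebra_simps)
      finally show "V_norm V (evolve m\<^sub>0 m t) (m t) \<le> ennreal (8 * B * exp ((growth + k) * t) * (1/2) ^ n)" .
    qed
  qed
  have "m 0 = m\<^sub>0" using fixed[of 0] evolve_zero[OF m0p mflow] by simp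
  then show ?thesis using mflow fixed by (auto simp: solution_iff)
qed

end

section \<open>Harris contraction for a frozen flow\<close>

text \<open>Test with \<open>1\<^sub>A - 1\<^sub>B\<close>, where \<open>B\<close> is the complement of \<open>A\<close>: the norm is normalised to be at most 2.\<close>

lemma tv_norm_measure_diff:
  assumes p: "p \<in> probs" and q: "q \<in> probs" and tv: "tv_norm p q \<le> ennreal (2 * c)" "0 \<le> c" and A: "A \<in> sets borel"
  shows "measure p A \<le> measure q A + c"
proof -
  let ?f = "\<lambda>x. 2 * indicator A x - 1 :: real"
  have int: "(\<integral>x. ?f x \<partial>r) = 2 * measure r A - 1" if r: "r \<in> probs" for r
  proof -
    interpret r: prob_space r by (rule space_prob_algebra_borelD[OF r])
    have "A \<in> sets r" using A by (simp add: space_prob_algebra_borelD[OF r])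
    then have "integrable r (indicator A :: 'a \<Rightarrow> real)" by (intro integrable_real_indicator) (auto simp: r.emeasure_finite less_top[symmetric])
    then show ?thesis using \<open>A \<in> sets r\<close> by (simp add: r.prob_space)
  qed
  have "ennreal \<bar>(\<integral>x. ?f x \<partial>p) - (\<integral>x. ?f x \<partial>q)\<bar> \<le> tv_norm p q"
    unfolding tv_norm_def using A by (intro SUP_upper) (auto split: split_indicator)
  also have "\<dots> \<le> ennreal (2 * c)" by (rule tv)
  finally have "\<bar>(2 * measure p A - 1) - (2 * measure q A - 1)\<bar> \<le> 2 * c"
    using tv(2) by (simp add: int[OF p] int[OF q])
  then show ?thesis by linarith
qed

text \<open>The arithmetic of the contraction for starting points of small \<open>V\<close>: the overlap \<open>a\<close> of the
  kernels gains \<open>2 * b * a\<close> on the bounded part of the weight. By the choice of the weight \<open>b\<close> one half of it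
  compensates the constant in the drift.\<close>

lemma harris_real_small:
  fixes b \<Delta> u S K e a k :: real
  assumes "0 \<le> b" "\<Delta> \<le> 1 - a" "u \<le> e * S + 2 * (1 - e) * K" "b * a = 2 * (1 - e) * K" "1 - a / 2 \<le> k" "e \<le> k" "0 \<le> S"
  shows "2 * b * \<Delta> + u \<le> k * (2 * b + S)"
proof -
  have "2 * b * \<Delta> \<le> 2 * b * (1 - a)" using assms by (intro mult_left_mono) auto
  also have "2 * b * (1 - a) = (1 - a / 2) * (2 * b) - b * a" by (simp add: algebra_simps)
  also have "\<dots> \<le> k * (2 * b) - b * a" using assms by (intro diff_right_mono mult_right_mono) auto
  finally have 1: "2 * b * \<Delta> \<le> k * (2 * b) - b * a" .
  have 2: "e * S \<le> k * S" using assms by (intro mult_right_mono) auto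
  have "2 * b * \<Delta> + u \<le> (k * (2 * b) - b * a) + (k * S + b * a)"
    using 1 2 assms(3,4) by (intro add_mono) linarith+
  then show ?thesis by (simp add: distrib_left)
qed

text \<open>For starting points of large \<open>V\<close> the kernels may be mutually singular, but the drift
  lowers \<open>S\<close> by more than its constant term.\<close>

lemma harris_real_large:
  fixes b \<Delta> u S K e a k :: real
  assumes "0 \<le> b" "\<Delta> \<le> 1" "u \<le> e * S + 2 * (1 - e) * K" "b * a = 2 * (1 - e) * K" "1 - a / 2 \<le> k" "(1 + e) / 2 \<le> k"
    "8 * K \<le> S" "0 \<le> K" "e \<le> 1"
  shows "2 * b * \<Delta> + u \<le> k * (2 * b + S)"
proof -
  have 1: "2 * b * \<Delta> \<le> 2 * b * 1" using assms by (intro mult_left_mono) auto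
  have "(1 - k) * (2 * b) \<le> a / 2 * (2 * b)" using assms by (intro mult_right_mono) auto
  then have 2: "2 * b \<le> k * (2 * b) + b * a" by (simp add: algebra_simps)
  have "(1 - e) / 2 * (8 * K) \<le> (k - e) * S" using assms by (intro mult_mono) (auto simp: field_simps)
  moreover have "(1 - e) / 2 * (8 * K) = 4 * ((1 - e) * K)" by simp
  ultimately have 3: "e * S + 4 * ((1 - e) * K) \<le> k * S" by (simp add: left_diff_distrib)
  have "u + b * a \<le> e * S + 4 * ((1 - e) * K)" using assms(3,4) by (simp add: algebra_simps)
  then have "2 * b * \<Delta> + u \<le> k * (2 * b) + k * S" using 1 2 3 by simp
  then show ?thesis by (simp add: distrib_left)
qed

locale harris_jumps = lyapunov_jumps P lam Q G H lmax V \<theta> \<rho> \<rho>max \<eta> M \<gamma>max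
  for P :: "real \<Rightarrow> 'e::polish_space \<Rightarrow> 'e measure" and lam Q G H lmax V \<theta> \<rho> \<rho>max \<eta> M \<gamma>max +
  fixes t\<^sub>0 \<alpha> :: real
  assumes t0: "0 < t\<^sub>0" and \<alpha>: "0 < \<alpha>" "\<alpha> \<le> 1"
    and doeblin: "\<And>x y. V x + V y \<le> 8 * (1 + M / (1 - \<eta>)) \<Longrightarrow>
      tv_norm (P t\<^sub>0 x) (P t\<^sub>0 y) \<le> ennreal (2 * (1 - \<alpha>))"
begin

text \<open>The weight for which the Doeblin gain \<open>beta * \<alpha> * exp (- lmax * t\<^sub>0)\<close> equals the constant
  \<open>2 * (1 - exp (- \<rho> * t\<^sub>0)) * (A\<^sub>M + 1)\<close> of the drift for a pair of points.\<close>

definition beta :: real where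
  "beta = 2 * (1 - exp (- \<rho> * t\<^sub>0)) * exp (lmax * t\<^sub>0) / \<alpha> * (A\<^sub>M + 1)"

definition kappa :: real where
  "kappa = max ((1 + exp (- \<rho> * t\<^sub>0)) / 2) (1 - \<alpha> * exp (- lmax * t\<^sub>0) / 2)"

abbreviation W :: "'e \<Rightarrow> real" where "W x \<equiv> beta + V x"

lemma beta_nonneg: "0 \<le> beta"
  using \<rho> t0 \<alpha> equilibrium_mass(1) by (simp add: beta_def)

lemma kappa_pos: "0 < kappa"
  by (simp add: kappa_def less_max_iff_disj add_pos_pos)

lemma W_measurable [measurable]: "W \<in> borel_measurable borel" by measurable

lemma V_le_W: "V x \<le> W x" using beta_nonneg by simp

lemma W_le_V: "W x \<le> (1 + beta) * V x"
  using mult_left_mono[OF V_ge_1[of x] beta_nonneg] by (simp add: algebra_simps)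

lemma W_le_V_ennreal: "ennreal (W x) \<le> ennreal (1 + beta) * ennreal (V x)"
proof -
  have "ennreal (W x) \<le> ennreal ((1 + beta) * V x)" by (rule ennreal_leI[OF W_le_V])
  also have "\<dots> = ennreal (1 + beta) * ennreal (V x)" using beta_nonneg V_pos(2) by (intro ennreal_mult) auto
  finally show ?thesis .
qed

lemma W_norm_le:
  assumes "\<mu> \<in> probs" "\<nu> \<in> probs"
  shows "V_norm W \<mu> \<nu> \<le> ennreal (1 + beta) * V_norm V \<mu> \<nu>"
proof -
  have "upper_norm W \<mu> \<nu> \<le> ennreal (1 + beta) * upper_norm V \<mu> \<nu>" if "\<mu> \<in> probs" for \<mu> \<nu>
  proof -
    have [measurable_cong]: "sets (upper_variation \<mu> \<nu>) = sets borel" by (rule sets_upper_variation[OF that])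
    have "upper_norm W \<mu> \<nu> \<le> (\<integral>\<^sup>+x. ennreal (1 + beta) * ennreal (V x) \<partial>upper_variation \<mu> \<nu>)"
      by (intro nn_integral_mono W_le_V_ennreal)
    also have "\<dots> = ennreal (1 + beta) * upper_norm V \<mu> \<nu>" by (intro nn_integral_cmult) measurable
    finally show ?thesis .
  qed
  from add_mono[OF this[OF assms(1), of \<nu>] this[OF assms(2), of \<mu>]] show ?thesis
    unfolding V_norm_def by (simp add: distrib_left)
qed

text \<open>Without ring, which has probability \<open>exp (- lmax * t\<^sub>0)\<close>, the two processes move by \<open>P\<close>, and the
  Doeblin condition applies.\<close>

lemma jump_kernel_overlap:
  assumes \<mu>: "\<mu> \<in> prob_flows" and Y: "Y \<in> sets borel"
    and tv: "tv_norm (P t\<^sub>0 x) (P t\<^sub>0 y) \<le> ennreal (2 * (1 - \<alpha>))"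
  shows "measure (R \<mu> 0 t\<^sub>0 x) Y \<le> measure (R \<mu> 0 t\<^sub>0 y) Y + (1 - \<alpha> * exp (- lmax * t\<^sub>0))"
proof -
  let ?e = "exp (- lmax * t\<^sub>0)"
  have ge: "?e * measure (P t\<^sub>0 z) A \<le> measure (R \<mu> 0 t\<^sub>0 z) A" if A: "A \<in> sets borel" for A z
  proof -
    have Pp: "P t\<^sub>0 z \<in> probs" using motion_in_probs[of t\<^sub>0 z] t0 by (simp add: motion_nonneg)
    have Rp: "R \<mu> 0 t\<^sub>0 z \<in> probs" by (rule jump_kernel_in_probs[OF \<mu> order_refl])
    interpret P: prob_space "P t\<^sub>0 z" by (rule space_prob_algebra_borelD[OF Pp])
    interpret R: prob_space "R \<mu> 0 t\<^sub>0 z" by (rule space_prob_algebra_borelD[OF Rp])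
    have "ennreal ?e * (\<integral>\<^sup>+y. indicator A y \<partial>P t\<^sub>0 z) \<le> (\<integral>\<^sup>+y. indicator A y \<partial>R \<mu> 0 t\<^sub>0 z)"
      using expect_ge_no_ring[where s=0 and t=t\<^sub>0 and f="indicator A" and x=z and \<mu>=\<mu>] t0 A
      by (simp add: nn_integral_jump_kernel[OF \<mu>] motion_nonneg)
    then have "ennreal (?e * P.prob A) \<le> ennreal (R.prob A)"
      using A by (simp add: space_prob_algebra_borelD[OF Pp] space_prob_algebra_borelD[OF Rp]
          P.emeasure_eq_measure R.emeasure_eq_measure ennreal_mult)
    then show ?thesis by simp
  qed
  have Pp: "P t\<^sub>0 z \<in> probs" for z using motion_in_probs[of t\<^sub>0 z] t0 by (simp add: motion_nonneg)
  have compl: "measure r (-Y) = 1 - measure r Y" if r: "r \<in> probs" for r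
    using prob_space.prob_compl[OF space_prob_algebra_borelD(3)[OF r], of Y] Y
    by (simp add: space_prob_algebra_borelD[OF r] Compl_eq_Diff_UNIV)
  have "measure (P t\<^sub>0 x) Y \<le> measure (P t\<^sub>0 y) Y + (1 - \<alpha>)"
    using \<alpha> by (intro tv_norm_measure_diff[OF Pp Pp tv _ Y]) auto
  then have "?e * measure (P t\<^sub>0 x) Y \<le> ?e * (measure (P t\<^sub>0 y) Y + (1 - \<alpha>))" by (intro mult_left_mono) auto
  moreover have "?e * (1 - measure (P t\<^sub>0 x) Y) \<le> 1 - measure (R \<mu> 0 t\<^sub>0 x) Y"
    using ge[of "-Y" x] Y compl[OF Pp] compl[OF jump_kernel_in_probs[OF \<mu> order_refl]] by simp
  ultimately show ?thesis using ge[OF Y, of y] by (simp add: algebra_simps)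
qed

text \<open>The contraction for Dirac masses, with the total variation of \<open>R(x) - R(y)\<close> tested by the
  weight on \<open>Y\<close> minus the weight on its complement.\<close>

lemma harris_pointwise:
  assumes \<mu>: "\<mu> \<in> prob_flows" and \<mu>B: "\<And>s. 0 \<le> s \<Longrightarrow> s \<le> t\<^sub>0 \<Longrightarrow> mass_V (\<mu> s) \<le> ennreal (A\<^sub>M + 1)"
    and Y [measurable]: "Y \<in> sets borel"
  defines "E \<equiv> \<lambda>A. expect \<mu> (\<lambda>z. ennreal (W z) * indicator A z) 0 t\<^sub>0"
  shows "E Y x + E (-Y) y \<le> E Y y + E (-Y) x + ennreal kappa * (ennreal (W x) + ennreal (W y))"
proof -
  let ?R = "R \<mu> 0 t\<^sub>0"
  define e where "e = exp (- \<rho> * t\<^sub>0)"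
  define a' where "a' = \<alpha> * exp (- lmax * t\<^sub>0)"
  have e: "0 < e" "e < 1" using \<rho> t0 by (auto simp: e_def)
  have a': "0 < a'" using \<alpha> by (simp add: a'_def)
  have bb: "beta * a' = 2 * (1 - e) * (A\<^sub>M + 1)"
    using \<alpha> by (simp add: beta_def a'_def e_def exp_minus field_simps)
  have Rp: "?R z \<in> probs" for z by (rule jump_kernel_in_probs[OF \<mu> order_refl])
  have drift: "(\<integral>\<^sup>+w. ennreal (V w) \<partial>?R z) \<le> ennreal (e * V z + (1 - e) * (A\<^sub>M + 1))" for z
  proof -
    have A0: "0 \<le> A\<^sub>M + 1" using equilibrium_mass(1) by simp
    have "(\<integral>\<^sup>+w. ennreal (V w) \<partial>?R z) \<le> ennreal e * ennreal (V z) + ennreal ((1 - e) * (\<eta> * (A\<^sub>M + 1) + M))"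
      using drift_R[OF \<mu>, of t\<^sub>0 z] drift_const_bound[OF _ \<mu>B A0] t0
      by (auto simp: e_def intro: order_trans add_left_mono)
    also have "\<dots> = ennreal (e * V z + (1 - e) * (\<eta> * (A\<^sub>M + 1) + M))"
      using e V_pos(2)[of z] \<eta> M A0 by (simp add: ennreal_mult ennreal_plus)
    also have "\<dots> \<le> ennreal (e * V z + (1 - e) * (A\<^sub>M + 1))"
      using e \<eta> equilibrium_mass(2) by (intro ennreal_leI add_left_mono mult_left_mono) (auto simp: algebra_simps)
    finally show ?thesis .
  qed
  define v where "v A z = enn2real (\<integral>\<^sup>+w. ennreal (V w) * indicator A w \<partial>?R z)" for A z
  have vfin: "(\<integral>\<^sup>+w. ennreal (V w) * indicator A w \<partial>?R z) = ennreal (v A z)" for A z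
  proof -
    have "(\<integral>\<^sup>+w. ennreal (V w) * indicator A w \<partial>?R z) \<le> (\<integral>\<^sup>+w. ennreal (V w) \<partial>?R z)"
      by (intro nn_integral_mono) (auto split: split_indicator)
    also have "\<dots> < \<top>" using drift[of z] by (rule le_less_trans) simp
    finally show ?thesis by (simp add: v_def)
  qed
  have v0: "0 \<le> v A z" for A z by (simp add: v_def)
  have vle: "v A z \<le> e * V z + (1 - e) * (A\<^sub>M + 1)" for A z
  proof -
    have "ennreal (v A z) \<le> (\<integral>\<^sup>+w. ennreal (V w) \<partial>?R z)"
      unfolding vfin[symmetric] by (intro nn_integral_mono) (auto split: split_indicator)
    also note drift
    finally show ?thesis using e V_pos(2)[of z] equilibrium_mass(1) by (subst (asm) ennreal_le_iff) auto
  qed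
  have E: "E A z = ennreal (beta * measure (?R z) A + v A z)" if A [measurable]: "A \<in> sets borel" for A z
  proof -
    interpret R: prob_space "?R z" by (rule space_prob_algebra_borelD[OF Rp])
    have [measurable_cong]: "sets (?R z) = sets borel" by (rule space_prob_algebra_borelD[OF Rp])
    have "E A z = (\<integral>\<^sup>+w. ennreal (W w) * indicator A w \<partial>?R z)"
      unfolding E_def using t0 by (intro nn_integral_jump_kernel[OF \<mu>, symmetric]) auto
    also have "\<dots> = (\<integral>\<^sup>+w. ennreal beta * indicator A w + ennreal (V w) * indicator A w \<partial>?R z)"
      using beta_nonneg V_pos by (intro nn_integral_cong) (auto split: split_indicator simp: ennreal_plus)
    also have "\<dots> = ennreal beta * emeasure (?R z) A + ennreal (v A z)"
      by (subst nn_integral_add) (auto simp: nn_integral_cmult_indicator vfin)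
    finally show ?thesis using beta_nonneg v0 by (simp add: R.emeasure_eq_measure ennreal_mult ennreal_plus)
  qed
  have compl: "measure (?R z) (-Y) = 1 - measure (?R z) Y" for z
    using prob_space.prob_compl[OF space_prob_algebra_borelD(3)[OF Rp], of Y] Y
    by (simp add: space_prob_algebra_borelD[OF Rp] Compl_eq_Diff_UNIV)
  have k: "1 - a' / 2 \<le> kappa" "(1 + e) / 2 \<le> kappa" by (auto simp: kappa_def a'_def e_def)
  have v_sum: "v Y x + v (-Y) y \<le> e * (V x + V y) + 2 * (1 - e) * (A\<^sub>M + 1)"
    using vle[of Y x] vle[of "-Y" y] by (simp add: algebra_simps)
  have real: "2 * beta * (measure (?R x) Y - measure (?R y) Y) + (v Y x + v (-Y) y)
    \<le> kappa * (2 * beta + (V x + V y))"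
  proof (cases "V x + V y \<le> 8 * (A\<^sub>M + 1)")
    case True
    then have "V x + V y \<le> 8 * (1 + M / (1 - \<eta>))" by (simp add: equilibrium_mass_def add.commute)
    then have "measure (?R x) Y - measure (?R y) Y \<le> 1 - a'"
      using jump_kernel_overlap[OF \<mu> Y doeblin, of x y] by (simp add: a'_def)
    moreover have "0 \<le> V x + V y" using V_pos(2)[of x] V_pos(2)[of y] by simp
    ultimately show ?thesis using k e v_sum bb beta_nonneg by (intro harris_real_small[where a=a' and e=e and K="A\<^sub>M + 1"]) auto
  next
    case False
    have "measure (?R x) Y - measure (?R y) Y \<le> 1"
      using prob_space.prob_le_1[OF space_prob_algebra_borelD(3)[OF Rp[of x]], of Y] measure_nonneg[of "?R y" Y] by linarith
    then show ?thesis using k e v_sum bb beta_nonneg False equilibrium_mass(1)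
      by (intro harris_real_large[where a=a' and e=e and K="A\<^sub>M + 1"]) auto
  qed
  have nn: "0 \<le> beta * measure (?R z) A + v A z" for A z using beta_nonneg v0 by simp
  have "2 * beta * (p - q) + (v1 + v2) \<le> k * (2 * beta + (V x + V y)) \<Longrightarrow> 0 \<le> v3 \<Longrightarrow> 0 \<le> v4 \<Longrightarrow>
    beta * p + v1 + (beta * (1 - q) + v2) \<le> beta * q + v3 + (beta * (1 - p) + v4) + k * (W x + W y)" for p q k v1 v2 v3 v4
    by (simp add: algebra_simps)
  from this[OF real v0[of Y y] v0[of "-Y" x]]
  have "beta * measure (?R x) Y + v Y x + (beta * measure (?R y) (-Y) + v (-Y) y)
    \<le> beta * measure (?R y) Y + v Y y + (beta * measure (?R x) (-Y) + v (-Y) x) + kappa * (W x + W y)"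
    unfolding compl .
  moreover have "E Y x + E (-Y) y = ennreal (beta * measure (?R x) Y + v Y x + (beta * measure (?R y) (-Y) + v (-Y) y))"
    using nn by (simp add: E ennreal_plus[symmetric] del: ennreal_plus)
  moreover have "E Y y + E (-Y) x + ennreal kappa * (ennreal (W x) + ennreal (W y)) =
    ennreal (beta * measure (?R y) Y + v Y y + (beta * measure (?R x) (-Y) + v (-Y) x) + kappa * (W x + W y))"
  proof -
    have W0: "0 \<le> W x" "0 \<le> W y" using beta_nonneg V_pos by auto
    have "ennreal kappa * (ennreal (W x) + ennreal (W y)) = ennreal (kappa * (W x + W y))"
      using W0 kappa_pos by (simp only: ennreal_plus[OF W0, symmetric]) (simp add: ennreal_mult[symmetric])
    moreover have "0 \<le> kappa * (W x + W y)" using W0 kappa_pos by simp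
    ultimately show ?thesis using nn[of y Y] nn[of x "-Y"]
      by (simp add: E ennreal_plus[symmetric] del: ennreal_plus)
  qed
  ultimately show ?thesis by (simp add: ennreal_leI)
qed

text \<open>The positive and the negative part of \<open>m\<^sub>0 - m\<^sub>0'\<close> have the same mass \<open>a\<close>. Their product, divided by \<open>a\<close>, is a
  way to transport one to the other, along which the pointwise contraction is integrated. The norm of
  the image is computed on a Hahn set \<open>Y\<close>.\<close>

lemma harris_contraction:
  assumes m: "m\<^sub>0 \<in> probs_V V" "m\<^sub>0' \<in> probs_V V" and \<mu>: "\<mu> \<in> prob_flows"
    and \<mu>B: "\<And>s. 0 \<le> s \<Longrightarrow> s \<le> t\<^sub>0 \<Longrightarrow> mass_V (\<mu> s) \<le> ennreal (A\<^sub>M + 1)"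
  shows "V_norm W (evolve m\<^sub>0 \<mu> t\<^sub>0) (evolve m\<^sub>0' \<mu> t\<^sub>0) \<le> ennreal kappa * V_norm W m\<^sub>0 m\<^sub>0'"
proof -
  have mp: "m\<^sub>0 \<in> probs" "m\<^sub>0' \<in> probs" using m by (auto simp: probs_V_iff)
  have t: "0 \<le> t\<^sub>0" using t0 by simp
  let ?\<epsilon> = "evolve m\<^sub>0 \<mu> t\<^sub>0" and ?\<epsilon>' = "evolve m\<^sub>0' \<mu> t\<^sub>0"
  have ep: "?\<epsilon> \<in> probs" "?\<epsilon>' \<in> probs" using mp by (auto intro: evolve_in_probs \<mu> t)
  define K where "K = (1 + beta) * exp (growth * t\<^sub>0)"
  have K: "0 \<le> K" using beta_nonneg by (simp add: K_def)
  have EW: "expect \<mu> f 0 t\<^sub>0 x \<le> ennreal K * ennreal (V x)" if le: "\<And>z. f z \<le> ennreal (W z)" for f x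
  proof -
    have "expect \<mu> f 0 t\<^sub>0 x \<le> (\<integral>\<^sup>+z. ennreal (1 + beta) * ennreal (V z) \<partial>R \<mu> 0 t\<^sub>0 x)"
    proof -
      have "f z \<le> ennreal (1 + beta) * ennreal (V z)" for z
        by (rule order_trans[OF le W_le_V_ennreal])
      then have "expect \<mu> f 0 t\<^sub>0 x \<le> expect \<mu> (\<lambda>z. ennreal (1 + beta) * ennreal (V z)) 0 t\<^sub>0 x" by (rule expect_mono)
      then show ?thesis using t by (simp add: nn_integral_jump_kernel[OF \<mu>])
    qed
    also have "\<dots> = ennreal (1 + beta) * (\<integral>\<^sup>+z. ennreal (V z) \<partial>R \<mu> 0 t\<^sub>0 x)"
    proof -
      have [measurable_cong]: "sets (R \<mu> 0 t\<^sub>0 x) = sets borel" by (rule space_prob_algebra_borelD[OF jump_kernel_in_probs[OF \<mu> order_refl]])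
      show ?thesis by (intro nn_integral_cmult) measurable
    qed
    also have "\<dots> \<le> ennreal (1 + beta) * ennreal (exp (growth * t\<^sub>0) * V x)"
      using expect_V_le[OF \<mu> t, of x] t by (intro mult_left_mono) (auto simp: nn_integral_jump_kernel[OF \<mu>])
    also have "\<dots> = ennreal K * ennreal (V x)"
      using beta_nonneg V_pos(2)[of x] by (simp add: K_def ennreal_mult mult.assoc)
    finally show ?thesis .
  qed
  have Wfin: "(\<integral>\<^sup>+x. ennreal (W x) \<partial>\<nu>) < \<infinity>" if "\<nu> \<in> probs_V V" for \<nu>
  proof -
    have [measurable_cong]: "sets \<nu> = sets borel" using that by (auto simp: probs_V_iff dest: space_prob_algebra_borelD)
    have "(\<integral>\<^sup>+x. ennreal (W x) \<partial>\<nu>) \<le> (\<integral>\<^sup>+x. ennreal (1 + beta) * ennreal (V x) \<partial>\<nu>)"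
      by (intro nn_integral_mono W_le_V_ennreal)
    also have "\<dots> = ennreal (1 + beta) * mass_V \<nu>" by (intro nn_integral_cmult) measurable
    also have "\<dots> < \<infinity>" using that by (auto simp: probs_V_iff ennreal_mult_less_top)
    finally show ?thesis .
  qed
  have eV: "?\<epsilon> \<in> probs_V V" "?\<epsilon>' \<in> probs_V V"
    using evolve_V_growth[OF mp(1) \<mu> t] evolve_V_growth[OF mp(2) \<mu> t] m ep
    by (auto simp: probs_V_iff ennreal_mult_less_top intro: le_less_trans)
  from positive_set_exists[OF ep] obtain Y where Y [measurable]: "Y \<in> sets borel"
    and pos: "\<forall>W\<in>borel_measurable borel. positive_set_for W ?\<epsilon> ?\<epsilon>' Y" by blast
  from bspec[OF pos W_measurable] Wfin[OF eV(1)] Wfin[OF eV(2)]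
  have up: "upper_norm W ?\<epsilon> ?\<epsilon>' = (\<integral>\<^sup>+x. ennreal (W x) * indicator Y x \<partial>?\<epsilon>) - (\<integral>\<^sup>+x. ennreal (W x) * indicator Y x \<partial>?\<epsilon>')"
      "upper_norm W ?\<epsilon>' ?\<epsilon> = (\<integral>\<^sup>+x. ennreal (W x) * indicator (-Y) x \<partial>?\<epsilon>') - (\<integral>\<^sup>+x. ennreal (W x) * indicator (-Y) x \<partial>?\<epsilon>)"
    and ord: "(\<integral>\<^sup>+x. ennreal (W x) * indicator Y x \<partial>?\<epsilon>') \<le> (\<integral>\<^sup>+x. ennreal (W x) * indicator Y x \<partial>?\<epsilon>)"
      "(\<integral>\<^sup>+x. ennreal (W x) * indicator (-Y) x \<partial>?\<epsilon>) \<le> (\<integral>\<^sup>+x. ennreal (W x) * indicator (-Y) x \<partial>?\<epsilon>')"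
    by (simp_all add: positive_set_for_def)
  define E where "E A = expect \<mu> (\<lambda>z. ennreal (W z) * indicator A z) 0 t\<^sub>0" for A
  have Em [measurable]: "E A \<in> borel_measurable borel" if [measurable]: "A \<in> sets borel" for A
    unfolding E_def by (intro expect_measurable[OF \<mu>]) auto
  have EK: "E A x \<le> ennreal K * ennreal (V x)" for A x
    unfolding E_def by (rule EW) (auto split: split_indicator)
  define p where "p = upper_variation m\<^sub>0 m\<^sub>0'"
  define n where "n = upper_variation m\<^sub>0' m\<^sub>0"
  have [measurable_cong]: "sets p = sets borel" "sets n = sets borel"
    by (auto simp: p_def n_def sets_upper_variation mp)
  have EKfin: "(\<integral>\<^sup>+x. E A x \<partial>\<nu>) < \<top>" if "(\<integral>\<^sup>+x. ennreal (V x) \<partial>\<nu>) < \<top>" "sets \<nu> = sets borel" for A \<nu>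
  proof -
    note [measurable_cong] = that(2)
    have "(\<integral>\<^sup>+x. E A x \<partial>\<nu>) \<le> (\<integral>\<^sup>+x. ennreal K * ennreal (V x) \<partial>\<nu>)" by (intro nn_integral_mono EK)
    also have "\<dots> = ennreal K * (\<integral>\<^sup>+x. ennreal (V x) \<partial>\<nu>)" by (intro nn_integral_cmult) measurable
    also have "\<dots> < \<top>" using that by (simp add: ennreal_mult_less_top)
    finally show ?thesis .
  qed
  have pV: "(\<integral>\<^sup>+x. ennreal (V x) \<partial>p) < \<top>" "(\<integral>\<^sup>+x. ennreal (V x) \<partial>n) < \<top>"
    using upper_norm_le[OF mp V_measurable] upper_norm_le[OF mp(2,1) V_measurable] m
    by (auto simp: p_def n_def probs_V_iff intro: le_less_trans)
  have X: "(\<integral>\<^sup>+x. ennreal (W x) * indicator A x \<partial>evolve \<nu> \<mu> t\<^sub>0) = (\<integral>\<^sup>+x. E A x \<partial>\<nu>)"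
    if "\<nu> \<in> probs" and [measurable]: "A \<in> sets borel" for \<nu> A
    unfolding E_def by (rule nn_integral_evolve[OF that(1) \<mu> t]) measurable
  have sets0: "sets m\<^sub>0 = sets borel" "sets m\<^sub>0' = sets borel" using mp by (auto dest: space_prob_algebra_borelD)
  have mfin: "mass_V m\<^sub>0 < \<top>" "mass_V m\<^sub>0' < \<top>" using m by (auto simp: probs_V_iff)
  define r where "r \<nu> A = enn2real (\<integral>\<^sup>+x. E A x \<partial>\<nu>)" for \<nu> A
  have r: "(\<integral>\<^sup>+x. E A x \<partial>m\<^sub>0) = ennreal (r m\<^sub>0 A)" "(\<integral>\<^sup>+x. E A x \<partial>m\<^sub>0') = ennreal (r m\<^sub>0' A)"
    "(\<integral>\<^sup>+x. E A x \<partial>p) = ennreal (r p A)" "(\<integral>\<^sup>+x. E A x \<partial>n) = ennreal (r n A)" for A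
    using EKfin[OF mfin(1) sets0(1)] EKfin[OF mfin(2) sets0(2)] EKfin[OF pV(1)] EKfin[OF pV(2)] \<open>sets p = sets borel\<close> \<open>sets n = sets borel\<close>
    by (auto simp: r_def)
  have r0: "0 \<le> r \<nu> A" for \<nu> A by (simp add: r_def)
  have jd: "r m\<^sub>0 A + r n A = r m\<^sub>0' A + r p A" if A: "A \<in> sets borel" for A
  proof -
    have "ennreal (r m\<^sub>0 A) + ennreal (r n A) = ennreal (r m\<^sub>0' A) + ennreal (r p A)"
      unfolding r[symmetric] using jordan_decomposition[OF mp Em[OF A]] by (simp add: p_def n_def)
    then show ?thesis using r0 by (simp flip: ennreal_plus)
  qed
  obtain w where w: "V_norm W m\<^sub>0 m\<^sub>0' = ennreal w" "0 \<le> w"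
  proof -
    have "V_norm W m\<^sub>0 m\<^sub>0' < \<infinity>" using Wfin[OF m(1)] Wfin[OF m(2)] mp by (intro V_norm_finite) (auto simp: probs_V_iff)
    then show thesis by (cases "V_norm W m\<^sub>0 m\<^sub>0'") (auto intro: that)
  qed
  have pn: "emeasure p UNIV = emeasure n UNIV" "emeasure p UNIV \<noteq> \<top>"
  proof -
    have one: "emeasure m\<^sub>0 UNIV = 1" "emeasure m\<^sub>0' UNIV = 1"
      using prob_space.emeasure_space_1[OF space_prob_algebra_borelD(3)[OF mp(1)]]
        prob_space.emeasure_space_1[OF space_prob_algebra_borelD(3)[OF mp(2)]]
      by (auto simp: space_prob_algebra_borelD[OF mp(1)] space_prob_algebra_borelD[OF mp(2)])
    have sp: "space p = UNIV" "space n = UNIV" "space m\<^sub>0 = UNIV" "space m\<^sub>0' = UNIV"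
      using \<open>sets p = sets borel\<close> \<open>sets n = sets borel\<close> sets0 by (auto dest: sets_eq_imp_space_eq)
    have "1 + emeasure n UNIV = 1 + emeasure p UNIV"
      using jordan_decomposition[OF mp, of "\<lambda>_. 1"] sp one by (simp add: p_def n_def)
    then show "emeasure p UNIV = emeasure n UNIV" by (simp add: ennreal_add_left_cancel)
    have "(\<integral>\<^sup>+x. 1 \<partial>p) \<le> (\<integral>\<^sup>+x. ennreal (V x) \<partial>p)" by (intro nn_integral_mono one_le_ennrealI V_ge_1)
    then show "emeasure p UNIV \<noteq> \<top>" using pV(1) sp by (auto simp: top_unique)
  qed
  have main: "r p Y + r n (-Y) \<le> r n Y + r p (-Y) + kappa * w"
  proof -
    obtain a where a: "emeasure p UNIV = ennreal a" "0 \<le> a" using pn(2) by (cases "emeasure p UNIV") auto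
    have sp: "space p = UNIV" "space n = UNIV"
      using \<open>sets p = sets borel\<close> \<open>sets n = sets borel\<close> by (auto dest: sets_eq_imp_space_eq)
    have an: "emeasure n UNIV = ennreal a" using pn(1) a by simp
    (* for a = 0 the two initial laws agree; otherwise the factor a cancels *)
    show ?thesis
    proof (cases "a = 0")
      case True
      have "AE x in \<nu>. P x" if "\<nu> = p \<or> \<nu> = n" for \<nu> P
        using that True a an sp \<open>sets p = sets borel\<close> \<open>sets n = sets borel\<close>
        by (intro AE_I'[of "UNIV"]) (auto simp: null_sets_def)
      then have "(\<integral>\<^sup>+x. E A x \<partial>\<nu>) = (\<integral>\<^sup>+x. 0 \<partial>\<nu>)" if "\<nu> = p \<or> \<nu> = n" for \<nu> A
        using that by (intro nn_integral_cong_AE) blast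
      then have "r p A = 0" "r n A = 0" for A by (auto simp: r_def)
      then show ?thesis using w kappa_pos by simp
    next
      case False
      have W_split: "(\<integral>\<^sup>+x. ennreal (W x) \<partial>p) + (\<integral>\<^sup>+y. ennreal (W y) \<partial>n) = ennreal w"
        using w by (simp add: V_norm_def p_def n_def)
      have dbl: "(\<integral>\<^sup>+x. \<integral>\<^sup>+y. f x + g y \<partial>n \<partial>p) = ennreal a * (\<integral>\<^sup>+x. f x \<partial>p) + ennreal a * (\<integral>\<^sup>+y. g y \<partial>n)"
        if [measurable]: "f \<in> borel_measurable borel" "g \<in> borel_measurable borel" for f g :: "'e \<Rightarrow> ennreal"
      proof -
        have "(\<integral>\<^sup>+x. \<integral>\<^sup>+y. f x + g y \<partial>n \<partial>p) = (\<integral>\<^sup>+x. f x * ennreal a + (\<integral>\<^sup>+y. g y \<partial>n) \<partial>p)"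
          by (intro nn_integral_cong) (subst nn_integral_add; simp add: sp an)
        also have "\<dots> = (\<integral>\<^sup>+x. f x \<partial>p) * ennreal a + (\<integral>\<^sup>+y. g y \<partial>n) * ennreal a"
          by (subst nn_integral_add) (auto simp: nn_integral_multc sp a)
        finally show ?thesis by (simp add: mult.commute)
      qed
      have "(\<integral>\<^sup>+x. \<integral>\<^sup>+y. E Y x + E (-Y) y \<partial>n \<partial>p)
        \<le> (\<integral>\<^sup>+x. \<integral>\<^sup>+y. E Y y + E (-Y) x + ennreal kappa * (ennreal (W x) + ennreal (W y)) \<partial>n \<partial>p)"
        unfolding E_def by (intro nn_integral_mono harris_pointwise[OF \<mu> \<mu>B Y])
      also have "(\<integral>\<^sup>+x. \<integral>\<^sup>+y. E Y x + E (-Y) y \<partial>n \<partial>p) = ennreal a * ennreal (r p Y) + ennreal a * ennreal (r n (-Y))"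
        unfolding r[symmetric] using Y by (intro dbl) auto
      also have "(\<integral>\<^sup>+x. \<integral>\<^sup>+y. E Y y + E (-Y) x + ennreal kappa * (ennreal (W x) + ennreal (W y)) \<partial>n \<partial>p)
        = (\<integral>\<^sup>+x. \<integral>\<^sup>+y. (E (-Y) x + ennreal kappa * ennreal (W x)) + (E Y y + ennreal kappa * ennreal (W y)) \<partial>n \<partial>p)"
        by (intro nn_integral_cong) (simp only: distrib_left ac_simps)
      also have "\<dots> = ennreal a * (\<integral>\<^sup>+x. E (-Y) x + ennreal kappa * ennreal (W x) \<partial>p)
          + ennreal a * (\<integral>\<^sup>+y. E Y y + ennreal kappa * ennreal (W y) \<partial>n)"
        using Y by (intro dbl) auto
      also have "(\<integral>\<^sup>+x. E (-Y) x + ennreal kappa * ennreal (W x) \<partial>p) = ennreal (r p (-Y)) + ennreal kappa * (\<integral>\<^sup>+x. ennreal (W x) \<partial>p)"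
        unfolding r[symmetric] using Y by (subst nn_integral_add) (auto intro!: arg_cong2[where f="(+)"] nn_integral_cmult)
      also have "(\<integral>\<^sup>+x. E Y x + ennreal kappa * ennreal (W x) \<partial>n) = ennreal (r n Y) + ennreal kappa * (\<integral>\<^sup>+x. ennreal (W x) \<partial>n)"
        unfolding r[symmetric] using Y by (subst nn_integral_add) (auto intro!: arg_cong2[where f="(+)"] nn_integral_cmult)
      also have "ennreal a * (ennreal (r p (-Y)) + ennreal kappa * (\<integral>\<^sup>+x. ennreal (W x) \<partial>p))
          + ennreal a * (ennreal (r n Y) + ennreal kappa * (\<integral>\<^sup>+x. ennreal (W x) \<partial>n))
        = ennreal a * ennreal (r n Y) + ennreal a * ennreal (r p (-Y))
          + ennreal kappa * (ennreal a * ((\<integral>\<^sup>+x. ennreal (W x) \<partial>p) + (\<integral>\<^sup>+y. ennreal (W y) \<partial>n)))"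
        by (simp only: distrib_left ac_simps)
      finally have "ennreal a * ennreal (r p Y) + ennreal a * ennreal (r n (-Y)) \<le>
        ennreal a * ennreal (r n Y) + ennreal a * ennreal (r p (-Y)) + ennreal kappa * (ennreal a * ennreal w)"
        unfolding W_split .
      then have "ennreal (a * r p Y + a * r n (-Y)) \<le> ennreal (a * r n Y + a * r p (-Y) + kappa * (a * w))"
        using a(2) r0 w(2) kappa_pos by (simp add: ennreal_mult ennreal_plus)
      then have "a * (r p Y + r n (-Y)) \<le> a * (r n Y + r p (-Y) + kappa * w)"
        using a(2) r0 w(2) kappa_pos by (subst (asm) ennreal_le_iff) (auto simp: algebra_simps)
      then show ?thesis using False a(2) by simp
    qed
  qed
  have "V_norm W ?\<epsilon> ?\<epsilon>' = (ennreal (r m\<^sub>0 Y) - ennreal (r m\<^sub>0' Y)) + (ennreal (r m\<^sub>0' (-Y)) - ennreal (r m\<^sub>0 (-Y)))"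
    unfolding V_norm_def up X[OF mp(1) Y] X[OF mp(2) Y] using Y by (simp add: X[OF mp(1)] X[OF mp(2)] r)
  also have "\<dots> = ennreal (r m\<^sub>0 Y - r m\<^sub>0' Y) + ennreal (r m\<^sub>0' (-Y) - r m\<^sub>0 (-Y))"
    using r0 by (simp add: ennreal_minus)
  also have "\<dots> \<le> ennreal (kappa * w)"
  proof -
    have a1: "r m\<^sub>0 Y - r m\<^sub>0' Y = r p Y - r n Y" and a2: "r m\<^sub>0' (-Y) - r m\<^sub>0 (-Y) = r n (-Y) - r p (-Y)"
      using jd[of Y] jd[of "-Y"] Y by auto
    have "ennreal (r m\<^sub>0' Y) \<le> ennreal (r m\<^sub>0 Y)" "ennreal (r m\<^sub>0 (-Y)) \<le> ennreal (r m\<^sub>0' (-Y))"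
      using ord Y by (simp_all add: X[OF mp(1)] X[OF mp(2)] r)
    then have pos: "0 \<le> r m\<^sub>0 Y - r m\<^sub>0' Y" "0 \<le> r m\<^sub>0' (-Y) - r m\<^sub>0 (-Y)"
      using r0 by (simp_all add: ennreal_le_iff)
    show ?thesis unfolding ennreal_plus[OF pos, symmetric] using main a1 a2 by (intro ennreal_leI) linarith
  qed
  also have "\<dots> = ennreal kappa * V_norm W m\<^sub>0 m\<^sub>0'" using w kappa_pos by (simp add: ennreal_mult)
  finally show ?thesis .
qed

end

section \<open>The equilibrium and the rate of convergence\<close>

context harris_jumps
begin

text \<open>The price per period \<open>t\<^sub>0\<close> for the dependence of the dynamics on the flow.\<close>

definition C_star :: real where
  "C_star = \<theta> * (2 * (1 + beta) * \<gamma>max * (A\<^sub>M + 1) / ((\<rho> + \<theta> * \<gamma>max) * (A\<^sub>M + 1)))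
      * exp (growth * t\<^sub>0) * (exp ((\<rho> + \<theta> * \<gamma>max) * (A\<^sub>M + 1) * t\<^sub>0) - 1)"

definition rate :: real where
  "rate = max (exp (- \<rho> * (1 - \<eta>) * t\<^sub>0)) (kappa + C_star)"

lemma rate_pos: "0 < rate"
  by (simp add: rate_def less_max_iff_disj)

lemma mass_V_ge_1:
  assumes "\<nu> \<in> probs" shows "1 \<le> mass_V \<nu>"
proof -
  have "1 = (\<integral>\<^sup>+x. 1 \<partial>\<nu>)" using prob_space.emeasure_space_1[OF space_prob_algebra_borelD(3)[OF assms]] by simp
  also have "\<dots> \<le> mass_V \<nu>" by (intro nn_integral_mono one_le_ennrealI V_ge_1)
  finally show ?thesis .
qed

lemma solution_mass_bound:
  assumes sol: "solution m\<^sub>0 m" and B: "mass_V m\<^sub>0 \<le> ennreal B" "A\<^sub>M \<le> B" and t: "0 \<le> t"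
  shows "mass_V (m t) \<le> ennreal B"
proof -
  have B0: "0 \<le> B" using B(2) equilibrium_mass(1) by simp
  obtain v where v: "mass_V m\<^sub>0 = ennreal v" "0 \<le> v"
    using B(1) by (cases "mass_V m\<^sub>0") (auto simp: top_unique)
  have vB: "v \<le> B" using B(1) B0 v by simp
  let ?e = "exp (- \<rho> * (1 - \<eta>) * t)"
  have e: "?e \<le> 1" using \<rho> \<eta> t by (simp add: mult_nonneg_nonneg mult_nonpos_nonneg)
  have "A\<^sub>M + ?e * (v - A\<^sub>M) = (1 - ?e) * A\<^sub>M + ?e * v" by (simp add: algebra_simps)
  also have "\<dots> \<le> (1 - ?e) * B + ?e * B"
    using e B vB by (intro add_mono mult_left_mono) auto
  also have "\<dots> = B" by (simp add: algebra_simps)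
  finally show ?thesis using solution_decay[OF sol v t] by (auto intro: order_trans ennreal_leI)
qed

text \<open>Convexity of the exponential: the slope of the chord from 0 increases.\<close>

lemma exp_minus_1_ratio:
  fixes a b t :: real
  assumes "0 \<le> a" "a \<le> b" "0 < b" "0 \<le> t"
  shows "exp (a * t) - 1 \<le> a / b * (exp (b * t) - 1)"
proof -
  have "exp ((1 - a / b) *\<^sub>R 0 + (a / b) *\<^sub>R (b * t)) \<le> (1 - a / b) * exp 0 + (a / b) * exp (b * t)"
    using assms by (intro convex_onD[OF exp_convex]) auto
  then have "exp (a * t) \<le> (1 - a / b) + (a / b) * exp (b * t)" using assms by simp
  then show ?thesis by (simp add: algebra_simps)
qed

text \<open>The left-hand side is the cost computed from \<open>solution_stability\<close> and \<open>exp_convolution\<close>. As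
  \<open>(exp (c * t) - 1) / c\<close> increases with \<open>c\<close>, it is at most one half of \<open>C_star\<close>.\<close>

lemma C_star_ge:
  "(1 + beta) * (exp (growth * t\<^sub>0) * (exp (\<theta> * \<gamma>max * (A\<^sub>M + 1) * t\<^sub>0) - 1)) \<le> C_star"
proof -
  let ?a = "\<theta> * \<gamma>max * (A\<^sub>M + 1)" and ?b = "(\<rho> + \<theta> * \<gamma>max) * (A\<^sub>M + 1)"
  have A: "0 < A\<^sub>M + 1" using equilibrium_mass(1) by simp
  have "0 \<le> \<theta> * \<gamma>max" using \<theta> \<gamma>max by simp
  then have b: "0 < ?b" "?a \<le> ?b" using \<rho> A by (auto intro!: mult_pos_pos mult_right_mono)
  have a: "0 \<le> ?a" using \<theta> \<gamma>max A by simp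
  have e: "0 \<le> exp (?b * t\<^sub>0) - 1" using b t0 by simp
  have "(1 + beta) * (exp (growth * t\<^sub>0) * (exp (?a * t\<^sub>0) - 1)) \<le>
      (1 + beta) * (exp (growth * t\<^sub>0) * (?a / ?b * (exp (?b * t\<^sub>0) - 1)))"
    using exp_minus_1_ratio[OF a b(2,1), of t\<^sub>0] t0 beta_nonneg by (intro mult_left_mono) auto
  also have "\<dots> \<le> 2 * ((1 + beta) * (exp (growth * t\<^sub>0) * (?a / ?b * (exp (?b * t\<^sub>0) - 1))))"
  proof -
    have "0 \<le> (1 + beta) * (exp (growth * t\<^sub>0) * (?a / ?b * (exp (?b * t\<^sub>0) - 1)))"
      using beta_nonneg mult_nonneg_nonneg[OF divide_nonneg_pos[OF a b(1)] e] by (simp only: mult_nonneg_nonneg add_nonneg_nonneg zero_le_one exp_ge_zero)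
    moreover have "x \<le> 2 * x" if "0 \<le> x" for x :: real using that by simp
    ultimately show ?thesis by blast
  qed
  also have "\<dots> = C_star" by (simp add: C_star_def)
  finally show ?thesis .
qed

lemma W_probs_V: assumes "\<nu> \<in> probs" "mass_V \<nu> \<le> ennreal B" "0 \<le> B"
  shows "\<nu> \<in> probs_V W" "(\<integral>\<^sup>+x. ennreal (W x) \<partial>\<nu>) \<le> ennreal (beta + B)"
proof -
  interpret prob_space \<nu> by (rule space_prob_algebra_borelD[OF assms(1)])
  have [measurable_cong]: "sets \<nu> = sets borel" by (rule space_prob_algebra_borelD[OF assms(1)])
  have "(\<integral>\<^sup>+x. ennreal (W x) \<partial>\<nu>) = (\<integral>\<^sup>+x. ennreal beta + ennreal (V x) \<partial>\<nu>)"
    using beta_nonneg V_pos by (intro nn_integral_cong) (simp add: ennreal_plus)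
  also have "\<dots> = ennreal beta + mass_V \<nu>" by (subst nn_integral_add) (auto simp: emeasure_space_1)
  also have "\<dots> \<le> ennreal beta + ennreal B" using assms by (intro add_left_mono)
  finally show 1: "(\<integral>\<^sup>+x. ennreal (W x) \<partial>\<nu>) \<le> ennreal (beta + B)" using beta_nonneg assms by (simp add: ennreal_plus)
  then show "\<nu> \<in> probs_V W" using assms(1) by (auto simp: probs_V_iff intro: le_less_trans)
qed

lemma W_norm_bound:
  assumes "\<mu> \<in> probs" "\<nu> \<in> probs" "mass_V \<mu> \<le> ennreal B" "mass_V \<nu> \<le> ennreal B'" "0 \<le> B" "0 \<le> B'"
  shows "V_norm W \<mu> \<nu> \<le> ennreal (2 * beta + B + B')"
proof -
  have "V_norm W \<mu> \<nu> \<le> (\<integral>\<^sup>+x. ennreal (W x) \<partial>\<mu>) + (\<integral>\<^sup>+x. ennreal (W x) \<partial>\<nu>)"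
    using assms by (intro V_norm_le_sum W_probs_V W_measurable) 
  also have "\<dots> \<le> ennreal (beta + B) + ennreal (beta + B')" using assms by (intro add_mono W_probs_V)
  also have "\<dots> = ennreal (2 * beta + B + B')"
    using beta_nonneg assms by (subst ennreal_plus[symmetric]) (auto simp: algebra_simps)
  finally show ?thesis .
qed

text \<open>Pass from one solution to the other through the mixed evolution: first change the initial
  law with a frozen flow (Harris), then change the flow with a fixed initial law (perturbation).\<close>

lemma solution_contraction_step:
  assumes sol: "solution m\<^sub>0 m" "solution m\<^sub>0' m'"
    and mass: "mass_V m\<^sub>0 \<le> ennreal (A\<^sub>M + 1)" "mass_V m\<^sub>0' \<le> ennreal (A\<^sub>M + 1)"
  shows "V_norm W (m t\<^sub>0) (m' t\<^sub>0) \<le> ennreal rate * V_norm W m\<^sub>0 m\<^sub>0'"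
proof -
  note m = solutionD[OF sol(1)] and m' = solutionD[OF sol(2)]
  have t: "0 \<le> t\<^sub>0" using t0 by simp
  have A: "0 \<le> A\<^sub>M + 1" "A\<^sub>M \<le> A\<^sub>M + 1" using equilibrium_mass(1) by auto
  have mB: "mass_V (m s) \<le> ennreal (A\<^sub>M + 1)" "mass_V (m' s) \<le> ennreal (A\<^sub>M + 1)" if "0 \<le> s" for s
    using solution_mass_bound[OF sol(1) mass(1) A(2) that] solution_mass_bound[OF sol(2) mass(2) A(2) that] by auto
  have init: "m\<^sub>0 \<in> probs_V V" "m\<^sub>0' \<in> probs_V V"
    using mass_V_in_probs_V[OF m(4) mass(1)] mass_V_in_probs_V[OF m'(4) mass(2)] by auto
  obtain d where d: "V_norm V m\<^sub>0 m\<^sub>0' = ennreal d" "0 \<le> d"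
    using V_norm_finite[OF init V_measurable] by (cases "V_norm V m\<^sub>0 m\<^sub>0'") auto
  let ?c = "\<theta> * \<gamma>max * (A\<^sub>M + 1)"
  let ?E = "evolve m\<^sub>0' m t\<^sub>0"
  have c0: "0 \<le> ?c" using \<theta> \<gamma>max A by simp
  have Ep: "?E \<in> probs" by (rule evolve_in_probs[OF m'(4) m(1) t])
  have EB: "mass_V ?E \<le> ennreal (A\<^sub>M + 1)"
    by (rule evolve_V_invariant[OF m'(4) mass(2) m(1) t A(2) mB(1)])
  have "V_norm V ?E (m' t\<^sub>0) \<le> ennreal ?c *
      (\<integral>\<^sup>+q. ennreal (d * exp ((growth + ?c) * q) * exp (growth * (t\<^sub>0 - q))) * indicator {0..t\<^sub>0} q \<partial>lborel)"
    by (rule solution_distance_integral[OF sol t A(2) mB])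
      (use d solution_stability[OF sol _ A(2) mB d] in auto)
  also have "\<dots> = ennreal (d * exp (growth * t\<^sub>0) * (exp (?c * t\<^sub>0) - 1))"
    by (rule exp_convolution[OF c0 d(2) t])
  finally have V: "V_norm V ?E (m' t\<^sub>0) \<le> ennreal (d * exp (growth * t\<^sub>0) * (exp (?c * t\<^sub>0) - 1))" .
  have "V_norm W (m t\<^sub>0) (m' t\<^sub>0) \<le> V_norm W (m t\<^sub>0) ?E + V_norm W ?E (m' t\<^sub>0)"
    using W_probs_V(1)[OF m(5)[OF t] mB(1)[OF t] A(1)] W_probs_V(1)[OF m'(5)[OF t] mB(2)[OF t] A(1)] Ep
    by (intro V_norm_triangle W_measurable)
  also have "V_norm W (m t\<^sub>0) ?E \<le> ennreal kappa * V_norm W m\<^sub>0 m\<^sub>0'"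
    using harris_contraction[OF init m(1) mB(1)] m(3)[OF t] by simp
  also have "V_norm W ?E (m' t\<^sub>0) \<le> ennreal C_star * V_norm W m\<^sub>0 m\<^sub>0'"
  proof -
    have "V_norm W ?E (m' t\<^sub>0) \<le> ennreal (1 + beta) * V_norm V ?E (m' t\<^sub>0)" by (rule W_norm_le[OF Ep m'(5)[OF t]])
    also have "\<dots> \<le> ennreal (1 + beta) * ennreal (d * exp (growth * t\<^sub>0) * (exp (?c * t\<^sub>0) - 1))"
      by (intro mult_left_mono V) auto
    also have "\<dots> = ennreal ((1 + beta) * (d * exp (growth * t\<^sub>0) * (exp (?c * t\<^sub>0) - 1)))"
      using beta_nonneg d c0 t by (intro ennreal_mult[symmetric]) auto
    also have "\<dots> = ennreal ((1 + beta) * (exp (growth * t\<^sub>0) * (exp (?c * t\<^sub>0) - 1)) * d)" by (simp add: ac_simps)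
    also have "\<dots> \<le> ennreal (C_star * d)" using C_star_ge d by (intro ennreal_leI mult_right_mono)
    also have "\<dots> = ennreal C_star * ennreal d" using d(2) by (rule ennreal_mult'')
    also have "\<dots> \<le> ennreal C_star * V_norm W m\<^sub>0 m\<^sub>0'"
      unfolding d(1)[symmetric] by (intro mult_left_mono V_norm_mono V_le_W) auto
    finally show ?thesis .
  qed
  finally have "V_norm W (m t\<^sub>0) (m' t\<^sub>0) \<le> (ennreal kappa + ennreal C_star) * V_norm W m\<^sub>0 m\<^sub>0'"
    by (simp add: distrib_right add_left_mono add_right_mono)
  also have "ennreal kappa + ennreal C_star = ennreal (kappa + C_star)"
  proof -
    have "0 \<le> (1 + beta) * (exp (growth * t\<^sub>0) * (exp (?c * t\<^sub>0) - 1))"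
      using beta_nonneg c0 t by (intro mult_nonneg_nonneg) auto
    then show ?thesis using C_star_ge kappa_pos by (intro ennreal_plus[symmetric]) auto
  qed
  also have "\<dots> * V_norm W m\<^sub>0 m\<^sub>0' \<le> ennreal rate * V_norm W m\<^sub>0 m\<^sub>0'"
    by (intro mult_right_mono ennreal_leI) (auto simp: rate_def)
  finally show ?thesis .
qed

lemma solution_contraction:
  assumes sol: "solution m\<^sub>0 m" "solution m\<^sub>0' m'"
    and mass: "mass_V m\<^sub>0 \<le> ennreal (A\<^sub>M + 1)" "mass_V m\<^sub>0' \<le> ennreal (A\<^sub>M + 1)"
  shows "V_norm W (m (real n * t\<^sub>0)) (m' (real n * t\<^sub>0)) \<le> ennreal (rate ^ n) * V_norm W m\<^sub>0 m\<^sub>0'"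
proof (induction n)
  case 0
  then show ?case using solutionD(2)[OF sol(1)] solutionD(2)[OF sol(2)] by simp
next
  case (Suc n)
  let ?s = "real n * t\<^sub>0"
  have s: "0 \<le> ?s" using t0 by simp
  have A: "A\<^sub>M \<le> A\<^sub>M + 1" by simp
  have "V_norm W (m (?s + t\<^sub>0)) (m' (?s + t\<^sub>0)) \<le> ennreal rate * V_norm W (m ?s) (m' ?s)"
    using solution_contraction_step[OF solution_shift[OF sol(1) s] solution_shift[OF sol(2) s]
      solution_mass_bound[OF sol(1) mass(1) A s] solution_mass_bound[OF sol(2) mass(2) A s]] .
  also have "\<dots> \<le> ennreal rate * (ennreal (rate ^ n) * V_norm W m\<^sub>0 m\<^sub>0')" by (intro mult_left_mono Suc) auto
  also have "\<dots> = ennreal (rate ^ Suc n) * V_norm W m\<^sub>0 m\<^sub>0'"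
    using rate_pos by (simp add: ennreal_mult mult.assoc)
  finally show ?case by (simp add: distrib_right add.commute)
qed

lemma ennreal_le_geometric_limit:
  assumes r: "0 \<le> r" "r < 1" and le: "\<And>n. a \<le> ennreal (b + K * r ^ n)"
  shows "a \<le> ennreal b"
proof -
  have "(\<lambda>n. ennreal (b + K * r ^ n)) \<longlonglongrightarrow> ennreal (b + K * 0)"
    using r by (intro tendsto_ennrealI tendsto_intros LIMSEQ_power_zero) auto
  then have "a \<le> ennreal (b + K * 0)" by (rule LIMSEQ_le_const) (use le in auto)
  then show ?thesis by simp
qed

abbreviation equilibrium :: "'e measure \<Rightarrow> bool" where
  "equilibrium \<equiv> mean_field_equilibrium lmax lam G H"

text \<open>The mass of an equilibrium is constant and decays towards \<open>A\<^sub>M\<close>.\<close>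

lemma equilibrium_mass_le:
  assumes \<nu>: "\<nu> \<in> probs_V V" "equilibrium \<nu>"
  shows "mass_V \<nu> \<le> ennreal A\<^sub>M"
proof -
  obtain v where v: "mass_V \<nu> = ennreal v" "0 \<le> v" using \<nu> by (cases "mass_V \<nu>") (auto simp: probs_V_iff)
  have sol: "solution \<nu> (\<lambda>_. \<nu>)" using \<nu> by (simp add: mean_field_equilibrium_def)
  let ?r = "exp (- \<rho> * (1 - \<eta>))"
  have r: "0 \<le> ?r" "?r < 1" using \<rho> \<eta> by (auto simp: mult_pos_pos mult_neg_pos)
  show ?thesis
  proof (rule ennreal_le_geometric_limit[OF r, where K="v - A\<^sub>M"])
    fix n
    have "exp (- \<rho> * (1 - \<eta>) * real n) = ?r ^ n" by (metis exp_of_nat_mult mult.commute)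
    then show "mass_V \<nu> \<le> ennreal (A\<^sub>M + (v - A\<^sub>M) * ?r ^ n)"
      using solution_decay[OF sol v, of "real n"] by (simp add: mult.commute)
  qed
qed

lemma equilibrium_unique:
  assumes "rate < 1" "\<nu> \<in> probs_V V" "equilibrium \<nu>" "\<nu>' \<in> probs_V V" "equilibrium \<nu>'"
  shows "\<nu> = \<nu>'"
proof -
  have sol: "solution \<nu> (\<lambda>_. \<nu>)" "solution \<nu>' (\<lambda>_. \<nu>')" using assms by (auto simp: mean_field_equilibrium_def)
  have p: "\<nu> \<in> probs" "\<nu>' \<in> probs" using assms by (auto simp: probs_V_iff)
  have A: "0 \<le> A\<^sub>M + 1" using equilibrium_mass(1) by simp
  have mass: "mass_V \<nu> \<le> ennreal (A\<^sub>M + 1)" "mass_V \<nu>' \<le> ennreal (A\<^sub>M + 1)"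
    by (rule order_trans[OF equilibrium_mass_le[OF assms(2,3)] ennreal_leI]; simp)
      (rule order_trans[OF equilibrium_mass_le[OF assms(4,5)] ennreal_leI]; simp)
  let ?K = "2 * beta + (A\<^sub>M + 1) + (A\<^sub>M + 1)"
  have "V_norm W \<nu> \<nu>' \<le> ennreal 0"
  proof (rule ennreal_le_geometric_limit[where r=rate and K="?K"])
    fix n
    have "V_norm W \<nu> \<nu>' \<le> ennreal (rate ^ n) * V_norm W \<nu> \<nu>'" using solution_contraction[OF sol mass] by simp
    also have "\<dots> \<le> ennreal (rate ^ n) * ennreal ?K" by (intro mult_left_mono W_norm_bound p mass A) auto
    also have "\<dots> = ennreal (0 + ?K * rate ^ n)" using rate_pos by (subst ennreal_mult'[symmetric]) (auto simp: mult.commute)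
    finally show "V_norm W \<nu> \<nu>' \<le> ennreal (0 + ?K * rate ^ n)" .
  qed (use rate_pos assms(1) in auto)
  then have "V_norm W \<nu> \<nu>' = 0" by simp
  then show ?thesis by (intro V_norm_eq_0D[OF p W_measurable order_trans[OF V_ge_1 V_le_W]])
qed

text \<open>Flows that agree on \<open>[0, \<infinity>)\<close> have distance 0 there, and the perturbation bound identifies their
  evolutions. This replaces a solution that does not move by a constant flow.\<close>

lemma evolve_flow_cong:
  assumes m: "m\<^sub>0 \<in> probs" "mass_V m\<^sub>0 \<le> ennreal (A\<^sub>M + 1)" and \<mu>: "\<mu> \<in> prob_flows" "\<mu>' \<in> prob_flows"
    and eq: "\<And>s. 0 \<le> s \<Longrightarrow> \<mu> s = \<mu>' s" and B: "\<And>s. 0 \<le> s \<Longrightarrow> mass_V (\<mu> s) \<le> ennreal (A\<^sub>M + 1)" and t: "0 \<le> t"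
  shows "evolve m\<^sub>0 \<mu> t = evolve m\<^sub>0 \<mu>' t"
proof (rule V_norm_eq_0D[OF _ _ V_measurable V_ge_1])
  show "evolve m\<^sub>0 \<mu> t \<in> probs" "evolve m\<^sub>0 \<mu>' t \<in> probs" by (intro evolve_in_probs m \<mu> t)+
  have A: "0 \<le> A\<^sub>M + 1" "A\<^sub>M \<le> A\<^sub>M + 1" using equilibrium_mass(1) by auto
  have "V_norm V (evolve m\<^sub>0 \<mu> t) (evolve m\<^sub>0 \<mu>' t) \<le> ennreal (\<theta> * \<gamma>max * (A\<^sub>M + 1)) *
      (\<integral>\<^sup>+q. ennreal (0 * exp (growth * (t - q))) * indicator {0..t} q \<partial>lborel)"
  proof (rule evolve_perturbation[OF mass_V_in_probs_V[OF m] \<mu> t _ _ _ A(1)])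
    fix r assume r: "0 \<le> r" "r \<le> t"
    have "\<mu> r \<in> probs_V V" by (rule mass_V_in_probs_V[OF flow_in_probs[OF \<mu>(1) r(1)] B[OF r(1)]])
    then show "\<mu> r \<in> probs_V V \<and> \<mu>' r \<in> probs_V V \<and> V_norm V (\<mu> r) (\<mu>' r) \<le> ennreal 0"
      using eq[OF r(1)] V_norm_self[OF _ V_measurable, of "\<mu> r"] by simp
    show "mass_V (evolve m\<^sub>0 \<mu> r) \<le> ennreal (A\<^sub>M + 1)" by (rule evolve_V_invariant[OF m \<mu>(1) r(1) A(2) B])
    show "mass_V (evolve m\<^sub>0 \<mu>' r) \<le> ennreal (A\<^sub>M + 1)"
      by (rule evolve_V_invariant[OF m \<mu>(2) r(1) A(2)]) (use B eq in auto)
  qed auto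
  then show "V_norm V (evolve m\<^sub>0 \<mu> t) (evolve m\<^sub>0 \<mu>' t) = 0" by simp
qed

lemma mass_enters_level:
  assumes sol: "solution m\<^sub>0 m" and v: "mass_V m\<^sub>0 = ennreal v" "0 \<le> v" and s: "0 \<le> s"
    and enter: "exp (- \<rho> * (1 - \<eta>) * s) * (v - A\<^sub>M) \<le> 1"
  shows "mass_V (m s) \<le> ennreal (A\<^sub>M + 1)"
  by (rule order_trans[OF solution_decay[OF sol v s] ennreal_leI]) (use enter in simp)

text \<open>Start from a Dirac mass and wait until the mass is small; call the solution \<open>m\<^sub>1\<close> from then on.
  Contraction between \<open>m\<^sub>1\<close> and its shift by \<open>s\<close> brings \<open>m\<^sub>1 (s + n * t\<^sub>0)\<close> close to \<open>m\<^sub>1 (n * t\<^sub>0)\<close> for every \<open>s\<close>, not only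
  for multiples of \<open>t\<^sub>0\<close>. Hence the limit along \<open>n * t\<^sub>0\<close> exists and, by stability, is not moved by the equation.\<close>

lemma equilibrium_exists:
  assumes rate: "rate < 1"
  shows "\<exists>\<nu>\<in>probs_V V. equilibrium \<nu>"
proof -
  let ?B = "A\<^sub>M + 1"
  have A: "0 \<le> ?B" "A\<^sub>M \<le> ?B" using equilibrium_mass(1) by auto
  obtain m\<^sub>1 \<mu>\<^sub>1 where sol: "solution \<mu>\<^sub>1 m\<^sub>1" and mass1: "mass_V \<mu>\<^sub>1 \<le> ennreal ?B"
  proof -
    fix x :: 'e
    define v where "v = V x"
    have v: "mass_V (return borel x) = ennreal v" "0 \<le> v" "1 \<le> v"
      using V_ge_1[of x] by (auto simp: v_def nn_integral_return)
    have "return borel x \<in> probs_V V" by (auto simp: probs_V_iff v space_prob_algebra prob_space_return)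
    then obtain m where sol: "solution (return borel x) m" using solution_exists by blast
    (* the time at which a mass v has decayed to an excess of at most 1 *)
    define T where "T = ln v / (\<rho> * (1 - \<eta>))"
    have pos: "0 < \<rho> * (1 - \<eta>)" using \<rho> \<eta> by simp
    have T: "0 \<le> T" using v pos by (simp add: T_def)
    have "- \<rho> * (1 - \<eta>) * T = - ln v" using pos \<eta> \<rho> by (simp add: T_def)
    then have "exp (- \<rho> * (1 - \<eta>) * T) = inverse v" using v by (simp only: exp_minus exp_ln)
    then have "exp (- \<rho> * (1 - \<eta>) * T) * (v - A\<^sub>M) = (v - A\<^sub>M) / v" by (simp only: divide_inverse mult.commute)
    also have "\<dots> \<le> 1" using v equilibrium_mass(1) by (simp add: field_simps)
    finally have "mass_V (m T) \<le> ennreal ?B" by (intro mass_enters_level[OF sol v(1,2) T])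
    with solution_shift[OF sol T] show thesis by (rule that)
  qed
  have m1: "mass_V (m\<^sub>1 s) \<le> ennreal ?B" "m\<^sub>1 s \<in> probs" if "0 \<le> s" for s
    using solution_mass_bound[OF sol mass1 A(2) that] solutionD(5)[OF sol that] by auto
  let ?K = "2 * beta + ?B + ?B"
  have K: "0 \<le> ?K" using beta_nonneg A by simp
  define \<sigma> where "\<sigma> n = m\<^sub>1 (real n * t\<^sub>0)" for n
  have nt: "0 \<le> real n * t\<^sub>0" for n using t0 by simp
  have close: "V_norm V (m\<^sub>1 (s + real n * t\<^sub>0)) (\<sigma> n) \<le> ennreal (?K * rate ^ n)" if s: "0 \<le> s" for s n
  proof -
    have "V_norm V (m\<^sub>1 (s + real n * t\<^sub>0)) (\<sigma> n) \<le> V_norm W (m\<^sub>1 (s + real n * t\<^sub>0)) (\<sigma> n)"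
      by (intro V_norm_mono V_le_W)
    also have "\<dots> \<le> ennreal (rate ^ n) * V_norm W (m\<^sub>1 s) \<mu>\<^sub>1"
      unfolding \<sigma>_def by (rule solution_contraction[OF solution_shift[OF sol s] sol m1(1)[OF s] mass1])
    also have "\<dots> \<le> ennreal (rate ^ n) * ennreal ?K"
      using m1[OF s] mass1 solutionD(4)[OF sol] A by (intro mult_left_mono W_norm_bound) auto
    also have "\<dots> = ennreal (?K * rate ^ n)" using rate_pos K by (subst ennreal_mult[symmetric]) (auto simp: mult.commute)
    finally show ?thesis .
  qed
  have \<sigma>p: "\<sigma> n \<in> probs" "mass_V (\<sigma> n) \<le> ennreal ?B" for n using m1[OF nt] by (auto simp: \<sigma>_def)
  have \<sigma>V: "\<sigma> n \<in> probs_V V" for n by (rule mass_V_in_probs_V[OF \<sigma>p])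
  have lim: "(\<lambda>n. ?K * rate ^ n) \<longlonglongrightarrow> 0"
    using tendsto_mult[OF tendsto_const LIMSEQ_power_zero, of rate ?K] rate rate_pos by simp
  have cauchy: "V_norm V (\<sigma> n) (\<sigma> l) \<le> ennreal (?K * rate ^ n)" if "n \<le> l" for n l
  proof -
    have "real (l - n) * t\<^sub>0 + real n * t\<^sub>0 = real l * t\<^sub>0" using that by (simp add: distrib_right[symmetric])
    then show ?thesis using close[OF nt, of "l - n" n] V_norm_commute[of V "\<sigma> n"] by (simp add: \<sigma>_def)
  qed
  obtain \<nu> where \<nu>: "\<nu> \<in> probs_V V" and \<nu>lim: "\<And>n. V_norm V (\<sigma> n) \<nu> \<le> ennreal (2 * (?K * rate ^ n))"
  proof (rule V_norm_complete[OF V_measurable V_ge_1 \<sigma>V lim _ cauchy])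
    show "0 \<le> ?K * rate ^ n" for n using K rate_pos by (intro mult_nonneg_nonneg) auto
    fix \<nu> assume "\<nu> \<in> probs_V V" "\<And>n. V_norm V (\<sigma> n) \<nu> \<le> ennreal (2 * (?K * rate ^ n))"
    then show thesis by (rule that)
  qed
  have \<nu>p: "\<nu> \<in> probs" using \<nu> by (simp add: probs_V_iff)
  have \<nu>B: "mass_V \<nu> \<le> ennreal ?B"
  proof (rule ennreal_le_geometric_limit[where r=rate and K="2 * ?K"])
    fix n
    have "mass_V \<nu> \<le> mass_V (\<sigma> n) + 1 * upper_norm V \<nu> (\<sigma> n)"
      by (rule nn_integral_le_upper_norm[OF \<nu>p \<sigma>p(1)]) auto
    also have "\<dots> \<le> ennreal ?B + ennreal (2 * (?K * rate ^ n))"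
      using \<nu>lim[of n] unfolding V_norm_def by (intro add_mono \<sigma>p) (auto elim: order_trans[rotated])
    also have "\<dots> = ennreal (?B + 2 * ?K * rate ^ n)" using A K rate_pos by (subst ennreal_plus[symmetric]) (auto simp: mult.assoc)
    finally show "mass_V \<nu> \<le> ennreal (?B + 2 * ?K * rate ^ n)" .
  qed (use rate rate_pos in auto)
  obtain m where m: "solution \<nu> m" using solution_exists[OF \<nu>] by blast
  have mB: "mass_V (m s) \<le> ennreal ?B" if "0 \<le> s" for s by (rule solution_mass_bound[OF m \<nu>B A(2) that])
  have mp: "m s \<in> probs" if "0 \<le> s" for s by (rule solutionD(5)[OF m that])
  have stationary: "m s = \<nu>" if s: "0 \<le> s" for s
  proof (rule V_norm_eq_0D[OF mp[OF s] \<nu>p V_measurable V_ge_1])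
    let ?L = "exp ((growth + \<theta> * \<gamma>max * ?B) * s)"
    have "V_norm V (m s) \<nu> \<le> ennreal 0"
    proof (rule ennreal_le_geometric_limit[where r=rate and K="2 * ?K * ?L + ?K + 2 * ?K"])
      fix n
      let ?x = "m\<^sub>1 (s + real n * t\<^sub>0)"
      have xp: "?x \<in> probs" using m1(2)[of "s + real n * t\<^sub>0"] s nt[of n] by simp
      have mV: "m s \<in> probs_V V" "\<sigma> n \<in> probs_V V" using mass_V_in_probs_V[OF mp[OF s] mB[OF s]] \<sigma>V by auto
      have "V_norm V (m s) \<nu> \<le> V_norm V (m s) (\<sigma> n) + V_norm V (\<sigma> n) \<nu>"
        by (rule V_norm_triangle[OF mV(1) \<sigma>p(1) \<nu> V_measurable])
      also have "V_norm V (m s) (\<sigma> n) \<le> V_norm V (m s) ?x + V_norm V ?x (\<sigma> n)"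
        by (rule V_norm_triangle[OF mV(1) xp mV(2) V_measurable])
      also have "V_norm V (m s) ?x \<le> ennreal (2 * (?K * rate ^ n) * ?L)"
      proof -
        obtain d where d: "V_norm V \<nu> (\<sigma> n) = ennreal d" "0 \<le> d"
          using V_norm_finite[OF \<nu> \<sigma>V V_measurable, of n] by (cases "V_norm V \<nu> (\<sigma> n)") auto
        have sh: "solution (\<sigma> n) (\<lambda>r. m\<^sub>1 (real n * t\<^sub>0 + r))" unfolding \<sigma>_def by (rule solution_shift[OF sol nt])
        have "V_norm V (m s) (m\<^sub>1 (real n * t\<^sub>0 + s)) \<le> ennreal (d * ?L)"
          by (rule solution_stability[OF m sh s A(2) mB _ d]) (use m1(1) nt in auto)
        also have "\<dots> \<le> ennreal (2 * (?K * rate ^ n) * ?L)"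
        proof -
          have "ennreal d \<le> ennreal (2 * (?K * rate ^ n))" using \<nu>lim[of n] d V_norm_commute[of V \<nu>] by simp
          then have "d \<le> 2 * (?K * rate ^ n)" using K rate_pos by (subst (asm) ennreal_le_iff) auto
          then show ?thesis by (intro ennreal_leI mult_right_mono) auto
        qed
        finally show ?thesis by (simp add: add.commute)
      qed
      also have "V_norm V ?x (\<sigma> n) \<le> ennreal (?K * rate ^ n)" by (rule close[OF s])
      also have "V_norm V (\<sigma> n) \<nu> \<le> ennreal (2 * (?K * rate ^ n))" by (rule \<nu>lim)
      finally have "V_norm V (m s) \<nu> \<le> ennreal (2 * (?K * rate ^ n) * ?L) + ennreal (?K * rate ^ n) + ennreal (2 * (?K * rate ^ n))"
        by (simp add: add_right_mono)
      also have "\<dots> = ennreal (2 * (?K * rate ^ n) * ?L + ?K * rate ^ n + 2 * (?K * rate ^ n))"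
      proof -
        have "ennreal (2 * x * l) + ennreal x + ennreal (2 * x) = ennreal (2 * x * l + x + 2 * x)" if "0 \<le> x" "0 \<le> l" for x l :: real
          using that by (simp only: ennreal_plus mult_nonneg_nonneg add_nonneg_nonneg zero_le_numeral)
        then show ?thesis using K rate_pos by simp
      qed
      also have "2 * (?K * rate ^ n) * ?L + ?K * rate ^ n + 2 * (?K * rate ^ n) = 0 + (2 * ?K * ?L + ?K + 2 * ?K) * rate ^ n"
        by (simp add: algebra_simps)
      finally show "V_norm V (m s) \<nu> \<le> ennreal (0 + (2 * ?K * ?L + ?K + 2 * ?K) * rate ^ n)" .
    qed (use rate rate_pos in auto)
    then show "V_norm V (m s) \<nu> = 0" by simp
  qed
  have "solution \<nu> (\<lambda>_. \<nu>)"
    unfolding solution_iff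
  proof (intro conjI allI impI)
    show c: "(\<lambda>_. \<nu>) \<in> prob_flows" using \<nu>p by simp
    fix t :: real assume t: "0 \<le> t"
    have "evolve \<nu> m t = evolve \<nu> (\<lambda>_. \<nu>) t"
      by (rule evolve_flow_cong[OF \<nu>p \<nu>B solutionD(1)[OF m] c stationary mB t])
    then show "evolve \<nu> (\<lambda>_. \<nu>) t = \<nu>" using solutionD(3)[OF m t] stationary[OF t] by simp
  qed simp
  then show ?thesis using \<nu> by (auto simp: mean_field_equilibrium_def)
qed

lemma powr_rate_ge_exp:
  assumes "0 \<le> t" shows "exp (- \<rho> * (1 - \<eta>) * t) \<le> rate powr (t / t\<^sub>0)"
proof -
  have "exp (- \<rho> * (1 - \<eta>) * t) = exp (- \<rho> * (1 - \<eta>) * t\<^sub>0) powr (t / t\<^sub>0)"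
    using t0 by (simp add: powr_def)
  also have "\<dots> \<le> rate powr (t / t\<^sub>0)"
    using assms t0 by (intro powr_mono2) (auto simp: rate_def)
  finally show ?thesis .
qed

text \<open>Until the time \<open>t\<^sub>1\<close>, at which the excess of mass has decayed to 1, the sum of the masses already
  gives the bound. Afterwards the contraction is used for the number \<open>n\<close> of full periods since \<open>t\<^sub>1\<close>. The factor
  lost during the waiting is \<open>rate powr (- t\<^sub>1 / t\<^sub>0)\<close>; it is at most \<open>exp (\<rho> * (1 - \<eta>) * t\<^sub>1)\<close>, which
  is at most the initial mass.\<close>

lemma convergence_to_equilibrium:
  assumes rate: "rate < 1" and \<nu>: "\<nu> \<in> probs_V V" "equilibrium \<nu>"
    and m0: "m\<^sub>0 \<in> probs_V V" and sol: "solution m\<^sub>0 m" and t: "0 \<le> t"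
  shows "V_norm V (m t) \<nu> \<le> ennreal (2 * rate powr (t / t\<^sub>0 - 1) * (beta + 1 + A\<^sub>M)) * mass_V m\<^sub>0"
proof -
  have p: "\<nu> \<in> probs" "m\<^sub>0 \<in> probs" using \<nu> m0 by (auto simp: probs_V_iff)
  have sol\<nu>: "solution \<nu> (\<lambda>_. \<nu>)" using \<nu> by (simp add: mean_field_equilibrium_def)
  obtain v where v: "mass_V m\<^sub>0 = ennreal v" "0 \<le> v" using m0 by (cases "mass_V m\<^sub>0") (auto simp: probs_V_iff)
  have v1: "1 \<le> v" using mass_V_ge_1[OF p(2)] v by simp
  have A0: "0 \<le> A\<^sub>M" "1 \<le> A\<^sub>M" using equilibrium_mass(1) by auto
  have mass\<nu>: "mass_V \<nu> \<le> ennreal A\<^sub>M" by (rule equilibrium_mass_le[OF \<nu>])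
  define \<delta> where "\<delta> = \<rho> * (1 - \<eta>)"
  have \<delta>: "0 < \<delta>" "- \<rho> * (1 - \<eta>) = - \<delta>" using \<rho> \<eta> by (auto simp: \<delta>_def)
  define q where "q = rate powr (t / t\<^sub>0 - 1)"
  have q0: "0 \<le> q" by (simp add: q_def)
  define w where "w = max 1 (v - A\<^sub>M)"
  have w: "1 \<le> w" "v - A\<^sub>M \<le> w" "w \<le> v" using v1 A0 by (auto simp: w_def)
  define t\<^sub>1 where "t\<^sub>1 = ln w / \<delta>"
  have t1: "0 \<le> t\<^sub>1" "exp (\<delta> * t\<^sub>1) = w" using w \<delta> by (auto simp: t\<^sub>1_def)
  have qt: "rate powr (t / t\<^sub>0) \<le> q" unfolding q_def using rate rate_pos by (intro powr_mono') auto
  have "V_norm V (m t) \<nu> \<le> ennreal (2 * q * (beta + 1 + A\<^sub>M) * v)"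
  proof (cases "t < t\<^sub>1")
    case True
    then have "1 < w" using \<delta> w t by (cases "w = 1") (auto simp: t\<^sub>1_def)
    then have wv: "w = v - A\<^sub>M" by (auto simp: w_def max_def split: if_splits)
    let ?e = "exp (- \<delta> * t)"
    have "exp (\<delta> * t) \<le> w" unfolding t1(2)[symmetric] using True \<delta> by simp
    then have ew: "1 \<le> ?e * w" by (simp add: exp_minus field_simps)
    have "V_norm V (m t) \<nu> \<le> mass_V (m t) + mass_V \<nu>"
      using solution_in_probs_V[OF sol m0 t] \<nu> by (intro V_norm_le_sum V_measurable)
    also have "\<dots> \<le> ennreal (A\<^sub>M + ?e * w) + ennreal A\<^sub>M"
      using solution_decay[OF sol v t] unfolding \<delta>(2) wv by (intro add_mono mass\<nu>)
    also have "\<dots> = ennreal (A\<^sub>M + ?e * w + A\<^sub>M)" using A0 w by (intro ennreal_plus[symmetric]) auto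
    also have "\<dots> \<le> ennreal (2 * q * (beta + 1 + A\<^sub>M) * v)"
    proof (rule ennreal_leI)
      have "A\<^sub>M + ?e * w + A\<^sub>M \<le> ?e * w * (2 * A\<^sub>M + 1)"
        using mult_right_mono[OF ew, of "2 * A\<^sub>M"] A0 by (simp add: algebra_simps)
      also have "\<dots> \<le> (q * v) * (2 * (beta + 1 + A\<^sub>M))"
      proof (intro mult_mono)
        show "?e \<le> q" using powr_rate_ge_exp[OF t] qt \<delta>(2) by simp
      qed (use w v A0 beta_nonneg q0 in auto)
      finally show "A\<^sub>M + ?e * w + A\<^sub>M \<le> 2 * q * (beta + 1 + A\<^sub>M) * v" by (simp add: ac_simps)
    qed
    finally show ?thesis .
  next
    case False
    (* n full periods after t1; the remaining time s is at least t1 *)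
    define n where "n = nat \<lfloor>(t - t\<^sub>1) / t\<^sub>0\<rfloor>"
    have "0 \<le> (t - t\<^sub>1) / t\<^sub>0" using False t0 by simp
    then have n: "real n \<le> (t - t\<^sub>1) / t\<^sub>0" "(t - t\<^sub>1) / t\<^sub>0 - 1 \<le> real n"
      unfolding n_def by linarith+
    define s where "s = t - real n * t\<^sub>0"
    have s1: "t\<^sub>1 \<le> s" using n(1) t0 by (simp add: s_def field_simps)
    then have s: "0 \<le> s" "s + real n * t\<^sub>0 = t" using t1(1) by (auto simp: s_def)
    have "exp (- \<delta> * s) * (v - A\<^sub>M) \<le> exp (- \<delta> * s) * w" using w by (intro mult_left_mono) auto
    also have "\<dots> \<le> exp (- \<delta> * t\<^sub>1) * w" using s1 \<delta> w by (intro mult_right_mono) auto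
    also have "\<dots> = 1" unfolding t1(2)[symmetric] by (simp flip: exp_add)
    finally have mass_s: "mass_V (m s) \<le> ennreal (A\<^sub>M + 1)"
      by (intro mass_enters_level[OF sol v s(1)]) (simp add: \<delta>(2)[symmetric] del: mult_minus_left)
    have sp: "m s \<in> probs" by (rule solutionD(5)[OF sol s(1)])
    have "mass_V \<nu> \<le> ennreal (A\<^sub>M + 1)" by (rule order_trans[OF mass\<nu> ennreal_leI]) simp
    then have "V_norm W (m (s + real n * t\<^sub>0)) \<nu> \<le> ennreal (rate ^ n) * V_norm W (m s) \<nu>"
      by (rule solution_contraction[OF solution_shift[OF sol s(1)] sol\<nu> mass_s])
    also have "\<dots> \<le> ennreal (rate ^ n) * ennreal (2 * beta + (A\<^sub>M + 1) + A\<^sub>M)"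
      using A0 by (intro mult_left_mono W_norm_bound sp p mass_s mass\<nu>) auto
    also have "\<dots> = ennreal (rate ^ n * (2 * beta + (A\<^sub>M + 1) + A\<^sub>M))"
      using rate_pos beta_nonneg A0 by (intro ennreal_mult[symmetric]) auto
    also have "\<dots> \<le> ennreal (2 * q * (beta + 1 + A\<^sub>M) * v)"
    proof (rule ennreal_leI)
      have "rate ^ n = rate powr (real n)" using rate_pos by (simp add: powr_realpow)
      also have "\<dots> \<le> rate powr ((t - t\<^sub>1) / t\<^sub>0 - 1)" using n rate rate_pos by (intro powr_mono') auto
      also have "\<dots> = q * rate powr (- (t\<^sub>1 / t\<^sub>0))"
      proof -
        have "(t - t\<^sub>1) / t\<^sub>0 - 1 = (t / t\<^sub>0 - 1) + - (t\<^sub>1 / t\<^sub>0)" by (simp add: diff_divide_distrib)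
        then show ?thesis unfolding q_def by (simp only: powr_add)
      qed
      also have "\<dots> \<le> q * v"
      proof (intro mult_left_mono q0)
        have "exp (- \<delta> * t\<^sub>1) \<le> rate powr (t\<^sub>1 / t\<^sub>0)" using powr_rate_ge_exp[OF t1(1)] \<delta>(2) by simp
        then have "inverse (rate powr (t\<^sub>1 / t\<^sub>0)) \<le> inverse (exp (- \<delta> * t\<^sub>1))" by (intro le_imp_inverse_le) auto
        also have "\<dots> = w" unfolding t1(2)[symmetric] by (simp add: exp_minus)
        finally show "rate powr (- (t\<^sub>1 / t\<^sub>0)) \<le> v" using w by (simp add: powr_minus)
      qed
      finally have "rate ^ n * (2 * beta + (A\<^sub>M + 1) + A\<^sub>M) \<le> (q * v) * (2 * (beta + 1 + A\<^sub>M))"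
        using beta_nonneg A0 q0 v by (intro mult_mono) auto
      then show "rate ^ n * (2 * beta + (A\<^sub>M + 1) + A\<^sub>M) \<le> 2 * q * (beta + 1 + A\<^sub>M) * v" by (simp add: ac_simps)
    qed
    finally have "V_norm W (m t) \<nu> \<le> ennreal (2 * q * (beta + 1 + A\<^sub>M) * v)" unfolding s(2) .
    then show ?thesis by (rule order_trans[OF V_norm_mono[OF V_le_W]])
  qed
  also have "\<dots> = ennreal (2 * q * (beta + 1 + A\<^sub>M)) * mass_V m\<^sub>0"
    using v q0 beta_nonneg A0 by (simp add: ennreal_mult)
  finally show ?thesis unfolding q_def .
qed

end

section \<open>Long-time convergence of the mean-field equation\<close>

theorem theorem3:
  fixes P :: "real \<Rightarrow> 'e::polish_space \<Rightarrow> 'e measure"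
    and N :: "'e \<Rightarrow> 'w measure" and Z :: "'e \<Rightarrow> 'w \<Rightarrow> real \<Rightarrow> 'e"
    and lam :: "'e measure \<Rightarrow> 'e \<Rightarrow> real"
    and Q :: "'e measure \<Rightarrow> 'e \<Rightarrow> 'e measure"
    and G :: "'e measure \<Rightarrow> 'e \<Rightarrow> real \<Rightarrow> 'e"
    and H :: "'e \<Rightarrow> real \<Rightarrow> real \<Rightarrow> 'e"
    and V :: "'e \<Rightarrow> real"
    and lmax \<theta> \<rho> t\<^sub>0 \<rho>max \<alpha> \<eta> M \<gamma>max \<beta> C \<kappa> \<kappa>' :: real
  assumes feller: "feller_semigroup P"
    and process: "\<And>x. strong_markov_process P x (N x) (Z x)"
    and lam_measurable: "(\<lambda>(\<nu>, x). lam \<nu> x) \<in> borel_measurable (prob_algebra borel \<Otimes>\<^sub>M borel)"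
    and lam_nonneg: "\<And>\<nu> x. \<nu> \<in> probs \<Longrightarrow> 0 \<le> lam \<nu> x"
    and Q_kernel: "\<And>\<nu>. \<nu> \<in> probs \<Longrightarrow> Q \<nu> \<in> borel \<rightarrow>\<^sub>M prob_algebra borel"
    and G_measurable: "(\<lambda>(\<nu>, x, u). G \<nu> x u) \<in> prob_algebra borel \<Otimes>\<^sub>M borel \<Otimes>\<^sub>M unif01 \<rightarrow>\<^sub>M borel"
    and G_represents: "\<And>\<nu> x. \<nu> \<in> probs \<Longrightarrow> distr unif01 borel (G \<nu> x) = Q \<nu> x"
    and H_measurable: "(\<lambda>(x, u). H x u) \<in> borel \<Otimes>\<^sub>M unif01 \<rightarrow>\<^sub>M skorokhod_borel"
    and H_represents: "\<And>x. distr unif01 skorokhod_borel (H x) = distr (N x) skorokhod_borel (Z x)"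
    and lmax: "0 < lmax" "\<And>\<nu> x. \<nu> \<in> probs \<Longrightarrow> lam \<nu> x \<le> lmax"
    and V: "V \<in> borel_measurable borel" "\<And>x. 1 \<le> V x"
    and params: "0 \<le> \<theta>" "0 < \<rho>" "0 < t\<^sub>0" "0 \<le> \<alpha>" "\<alpha> \<le> 1" "0 \<le> \<eta>" "\<eta> < 1" "1 \<le> M" "1 \<le> \<gamma>max"
    and drift_R: "\<And>\<mu> x t. \<mu> \<in> prob_flows \<Longrightarrow> 0 \<le> t \<Longrightarrow>
      (\<integral>\<^sup>+y. ennreal (V y) \<partial>jump_kernel lmax lam G H \<mu> 0 t x)
      \<le> ennreal (exp (- \<rho> * t)) * ennreal (V x)
        + ennreal \<rho> * (\<integral>\<^sup>+s\<in>{0..t}. ennreal (exp (\<rho> * (s - t)))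
            * (ennreal \<eta> * (\<integral>\<^sup>+y. ennreal (V y) \<partial>\<mu> s) + ennreal M) \<partial>lborel)"
    and drift_P: "\<And>x t. 0 \<le> t \<Longrightarrow>
      (\<integral>\<^sup>+y. ennreal (V y) \<partial>P t x) \<le> ennreal (exp (\<rho>max * t) * V x)"
    and V_jump: "\<And>\<mu> x t. \<mu> \<in> prob_flows \<Longrightarrow> 0 \<le> t \<Longrightarrow>
      AE u in unif01. V (G (\<mu> t) x u) \<le> \<gamma>max * V x"
    and lipschitz: "\<And>\<nu>\<^sub>1 \<nu>\<^sub>2. \<nu>\<^sub>1 \<in> probs_V V \<Longrightarrow> \<nu>\<^sub>2 \<in> probs_V V \<Longrightarrow>
      (SUP f\<in>{f \<in> borel_measurable borel. \<forall>x. \<bar>f x\<bar> \<le> 1}. SUP x.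
        ennreal \<bar>lam \<nu>\<^sub>1 x * ((\<integral>y. f y \<partial>Q \<nu>\<^sub>1 x) - f x) - lam \<nu>\<^sub>2 x * ((\<integral>y. f y \<partial>Q \<nu>\<^sub>2 x) - f x)\<bar>)
      \<le> ennreal \<theta> * V_norm V \<nu>\<^sub>1 \<nu>\<^sub>2"
    and doeblin: "\<And>x y. V x + V y \<le> 8 * (1 + M / (1 - \<eta>)) \<Longrightarrow>
      tv_norm (P t\<^sub>0 x) (P t\<^sub>0 y) \<le> ennreal (2 * (1 - \<alpha>))"
    and \<alpha>_pos: "0 < \<alpha>"
    and \<beta>: "\<beta> = 2 * (1 - exp (- \<rho> * t\<^sub>0)) * exp (lmax * t\<^sub>0) / \<alpha> * (M / (1 - \<eta>) + 1)"
    and C: "C = \<theta> * (2 * (1 + \<beta>) * \<gamma>max * (M / (1 - \<eta>) + 1) / ((\<rho> + \<theta> * \<gamma>max) * (M / (1 - \<eta>) + 1)))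
      * exp ((\<rho>max + lmax * (\<gamma>max - 1)) * t\<^sub>0)
      * (exp ((\<rho> + \<theta> * \<gamma>max) * (M / (1 - \<eta>) + 1) * t\<^sub>0) - 1)"
    and \<kappa>: "\<kappa> = max ((1 + exp (- \<rho> * t\<^sub>0)) / 2) (1 - \<alpha> * exp (- lmax * t\<^sub>0) / 2)"
    and \<kappa>': "\<kappa>' = max (exp (- \<rho> * (1 - \<eta>) * t\<^sub>0)) (\<kappa> + C)"
    and \<kappa>'_less: "\<kappa>' < 1"
  shows "\<exists>\<mu>inf\<in>probs_V V.
    mean_field_equilibrium lmax lam G H \<mu>inf \<and>
    (\<forall>\<nu>\<in>probs_V V. mean_field_equilibrium lmax lam G H \<nu> \<longrightarrow> \<nu> = \<mu>inf) \<and>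
    (\<integral>\<^sup>+x. ennreal (V x) \<partial>\<mu>inf) \<le> ennreal (M / (1 - \<eta>)) \<and>
    (\<forall>m\<^sub>0\<in>probs_V V.
      (\<exists>m. mean_field_solution lmax lam G H m\<^sub>0 m) \<and>
      (\<forall>m. mean_field_solution lmax lam G H m\<^sub>0 m \<longrightarrow>
        (\<forall>t\<ge>0. V_norm V (m t) \<mu>inf
          \<le> ennreal (2 * \<kappa>' powr (t / t\<^sub>0 - 1) * (\<beta> + 1 + M / (1 - \<eta>)))
            * (\<integral>\<^sup>+x. ennreal (V x) \<partial>m\<^sub>0))))"
proof -
  have eval_law: "distr unif01 borel (\<lambda>u. H x u t) = P t x" if t: "0 \<le> t" for x t
  proof -
    have Hx: "H x \<in> unif01 \<rightarrow>\<^sub>M skorokhod_borel"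
      using measurable_compose[OF _ H_measurable, of "\<lambda>u. (x, u)" unif01] by simp
    have Zx: "Z x \<in> N x \<rightarrow>\<^sub>M skorokhod_borel" and law: "distr (N x) borel (\<lambda>\<omega>. Z x \<omega> t) = P t x"
      using process[of x] t by (auto simp: strong_markov_process_def)
    note ev = measurable_eval_skorokhod[OF t]
    have "distr unif01 borel (\<lambda>u. H x u t) = distr (distr unif01 skorokhod_borel (H x)) borel (\<lambda>f. f t)"
      by (simp add: distr_distr[OF ev Hx] comp_def)
    also have "\<dots> = distr (N x) borel (\<lambda>\<omega>. Z x \<omega> t)"
      unfolding H_represents by (simp add: distr_distr[OF ev Zx] comp_def)
    finally show ?thesis using law by simp
  qed
  interpret harris_jumps P lam Q G H lmax V \<theta> \<rho> \<rho>max \<eta> M \<gamma>max t\<^sub>0 \<alpha>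
  proof unfold_locales
    fix t :: real and s :: real and x
    show "0 \<le> t \<Longrightarrow> P t \<in> borel \<rightarrow>\<^sub>M prob_algebra borel" "P 0 x = return borel x"
      "0 \<le> s \<Longrightarrow> 0 \<le> t \<Longrightarrow> P (s + t) x = P s x \<bind> P t"
      using feller unfolding feller_semigroup_def by blast+
    show "0 \<le> t \<Longrightarrow> distr unif01 borel (\<lambda>u. H x u t) = P t x" by (rule eval_law)
  next
    fix \<nu> :: "'e measure" and x assume \<nu>: "\<nu> \<in> probs"
    then have "(\<lambda>_. \<nu>) \<in> prob_flows" by simp
    from V_jump[OF this order_refl, of x] show "AE u in unif01. V (G \<nu> x u) \<le> \<gamma>max * V x" .
  next
    fix \<nu>\<^sub>1 \<nu>\<^sub>2 and f :: "'e \<Rightarrow> real" and x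
    assume \<nu>: "\<nu>\<^sub>1 \<in> probs_V V" "\<nu>\<^sub>2 \<in> probs_V V" and f: "f \<in> borel_measurable borel" "\<And>x. \<bar>f x\<bar> \<le> 1"
    show "ennreal \<bar>lam \<nu>\<^sub>1 x * ((\<integral>y. f y \<partial>Q \<nu>\<^sub>1 x) - f x) - lam \<nu>\<^sub>2 x * ((\<integral>y. f y \<partial>Q \<nu>\<^sub>2 x) - f x)\<bar>
      \<le> ennreal \<theta> * V_norm V \<nu>\<^sub>1 \<nu>\<^sub>2"
      by (rule order_trans[OF _ lipschitz[OF \<nu>]], rule SUP_upper2[of f], use f in simp, rule SUP_upper2[of x]) auto
  qed (fact H_measurable lam_measurable lam_nonneg lmax G_measurable G_represents V params drift_R drift_P \<alpha>_pos doeblin)+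
  have const_eqs: "A\<^sub>M = M / (1 - \<eta>)" "\<beta> = beta" "C = C_star" "\<kappa> = kappa" "\<kappa>' = rate"
    by (simp_all add: equilibrium_mass_def \<beta> beta_def C C_star_def growth_def \<kappa> kappa_def \<kappa>' rate_def)
  have rate: "rate < 1" using \<kappa>'_less const_eqs by simp
  obtain \<mu>inf where \<mu>inf: "\<mu>inf \<in> probs_V V" "equilibrium \<mu>inf" using equilibrium_exists[OF rate] by blast
  show ?thesis
  proof (intro bexI[OF _ \<mu>inf(1)] conjI ballI impI allI)
    show "equilibrium \<mu>inf" by fact
    show "\<nu> = \<mu>inf" if "\<nu> \<in> probs_V V" "equilibrium \<nu>" for \<nu>
      by (rule equilibrium_unique[OF rate that \<mu>inf])
    show "(\<integral>\<^sup>+x. ennreal (V x) \<partial>\<mu>inf) \<le> ennreal (M / (1 - \<eta>))"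
      using equilibrium_mass_le[OF \<mu>inf] by (simp add: const_eqs)
    show "\<exists>m. mean_field_solution lmax lam G H m\<^sub>0 m" if "m\<^sub>0 \<in> probs_V V" for m\<^sub>0
      by (rule solution_exists[OF that])
    fix m\<^sub>0 m and t :: real
    assume "m\<^sub>0 \<in> probs_V V" "mean_field_solution lmax lam G H m\<^sub>0 m" "0 \<le> t"
    from convergence_to_equilibrium[OF rate \<mu>inf this]
    show "V_norm V (m t) \<mu>inf \<le> ennreal (2 * \<kappa>' powr (t / t\<^sub>0 - 1) * (\<beta> + 1 + M / (1 - \<eta>))) * (\<integral>\<^sup>+x. ennreal (V x) \<partial>m\<^sub>0)"
      by (simp add: const_eqs)
  qed
qed

end
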